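(* Let $\alpha\in(\frac12,1)$. (i) Let $0\le s\le T$ and $x\in\mathbb{R}^N$. If $B_0\in C_b^{0,1}([0,T]\times\mathbb{R}^N;\mathbb{R}^N)$ and $\phi\in C_b^2(\mathbb{R}^N)$, then the function $t\mapsto P_{s,t}\phi(x)$ is continuously differentiable in $[s,T]$ and satisfies the Kolmogorov forward equation $$\partial_tP_{s,t}\phi(x)=P_{s,t}A(t)\phi(x).$$ (ii) Let $0\le t\le T$ and $x\in\mathbb{R}^N$. If $B_0\in C_b^{0,3}([0,T]\times\mathbb{R}^N;\mathbb{R}^N)$ and $\phi\in C_b^3(\mathbb{R}^N)$, then the function $s\mapsto P_{s,t}\phi(x)$ is continuously differentiable in $[0,t]$ and satisfies the Kolmogorov backward equation $$\partial_sP_{s,t}\phi(x)=-A(s)P_{s,t}\phi(x).$$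
   Context: Fix $N\in\mathbb{N}$, $T>0$ and a complete probability space $(\Omega,\mathcal{F},\mathbb{P})$. $W=(\beta^1,\dots,\beta^N)^\top$ is a standard $N$-dimensional Brownian motion and $L=(L_t)_{t\ge0}$ is a strictly $\alpha$-stable subordinator (increasing Lévy process) independent of $W$, with $\mathbb{E}[e^{iuL_1}]=\exp\{-\bar\gamma^\alpha|u|^\alpha(1-i\tan\frac{\pi\alpha}{2}\,\mathrm{sign}\,u)\}$, $u\in\mathbb{R}$, for some $\bar\gamma>0$. $W_L=(W_{L_t})_{t\ge0}$ is the subordinated Brownian motion, a rotation-invariant $2\alpha$-stable Lévy process; $\nu$ denotes its Lévy measure, which is of the form $\nu(dz)=c|z|^{-(N+2\alpha)}dz$ for a constant $c>0$. $A=-\mathrm{diag}[\lambda_1,\dots,\lambda_N]$ with $0<\lambda_1\le\dots\le\lambda_N$, $Q=\mathrm{diag}[\sigma_1^2,\dots,\sigma_N^2]$ with $\sigma_n^2>0$. For $0\le s\le T$, $x\in\mathbb{R}^N$, $X^{s,x}=(X^{s,x}_t)_{t\in[s,T]}$ is the unique solution of $dX_t^{s,x}=(AX_t^{s,x}+B_0(t,X_t^{s,x}))dt+\sqrt{Q}\,dW_{L_t}$, $X_s^{s,x}=x$, and $P_{s,t}\phi(x)=\mathbb{E}[\phi(X_t^{s,x})]$ for $0\le s\le t\le T$ whenever the expectation is well defined (in particular for bounded Borel $\phi$, and for functions of linear growth when $\alpha>\frac12$). Let $D=\{z\in\mathbb{R}^N:|z|\le1\}$. For $s\in[0,T]$ the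 integro-differential operator $A(s)$ is defined on $\psi\in C_b^2(\mathbb{R}^N)$ by $$A(s)\psi(x)=\langle Ax+B_0(s,x),\nabla^\top\psi(x)\rangle+\int_{\mathbb{R}^N}\big[\psi(x+\sqrt{Q}z)-\psi(x)-1_D(z)\nabla\psi(x)\sqrt{Q}z\big]\nu(dz),\quad x\in\mathbb{R}^N,$$ where $\nabla\psi$ is a row vector; $P_{s,t}A(t)\phi$ means $P_{s,t}$ applied to the function $A(t)\phi$, and $A(s)P_{s,t}\phi$ means $A(s)$ applied to the function $P_{s,t}\phi$. $C_b^{k}(\mathbb{R}^N)$ is the space of bounded real functions that are continuously differentiable up to order $k$ with bounded derivatives. $C_b^{0,n}([0,T]\times\mathbb{R}^N;\mathbb{R}^N)$ is the space of bounded continuous maps whose partial derivatives in the space variable up to order $n$ exist, are continuous and bounded on $[0,T]\times\mathbb{R}^N$. *)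

theory Defs
  imports "HOL-Probability.Probability"
begin

section \<open>Function spaces and differential operators\<close>

text \<open>Derivatives are iterated partial derivatives along the coordinate axes; every partial
  derivative of order at most \<open>k\<close>, including order 0, is required to be continuous and bounded.\<close>

primrec C_b :: "nat \<Rightarrow> (real^'n \<Rightarrow> real) set" where
  "C_b 0 = {f. continuous_on UNIV f \<and> bounded (range f)}"
| "C_b (Suc k) = {f. continuous_on UNIV f \<and> bounded (range f) \<and>
     (\<forall>i. \<exists>g\<in>C_b k. \<forall>x. ((\<lambda>h. f (x + h *\<^sub>R axis i 1)) has_real_derivative g x) (at 0))}"

text \<open>Time-dependent version: derivatives are in the space variable only, and nothing is required
  outside \<open>{0..T}\<close>.\<close>

primrec C_b0 :: "real \<Rightarrow> nat \<Rightarrow> (real \<Rightarrow> real^'n \<Rightarrow> real^'n) set" where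
  "C_b0 T 0 = {f. continuous_on ({0..T} \<times> UNIV) (\<lambda>(t, x). f t x) \<and>
     bounded ((\<lambda>(t, x). f t x) ` ({0..T} \<times> UNIV))}"
| "C_b0 T (Suc k) = {f. continuous_on ({0..T} \<times> UNIV) (\<lambda>(t, x). f t x) \<and>
     bounded ((\<lambda>(t, x). f t x) ` ({0..T} \<times> UNIV)) \<and>
     (\<forall>i. \<exists>g\<in>C_b0 T k. \<forall>t\<in>{0..T}. \<forall>x.
        ((\<lambda>h. f t (x + h *\<^sub>R axis i 1)) has_vector_derivative g t x) (at 0))}"

definition grad :: "(real^'n \<Rightarrow> real) \<Rightarrow> real^'n \<Rightarrow> real^'n" where
  "grad f x = (THE D. GDERIV f x :> D)"

definition diag_mat :: "('n \<Rightarrow> real) \<Rightarrow> real^'n^'n" where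
  "diag_mat d = (\<chi> i j. if i = j then d i else 0)"

text \<open>Here \<open>A\<close> is the linear part of the drift, \<open>B\<close> the nonlinear part, \<open>R\<close> the noise coefficient
  (the square root of \<open>Q\<close>), and \<open>\<nu>\<close> the Levy measure of the noise.\<close>

definition generator ::
  "real^'n^'n \<Rightarrow> (real \<Rightarrow> real^'n \<Rightarrow> real^'n) \<Rightarrow> real^'n^'n \<Rightarrow> (real^'n) measure \<Rightarrow>
   real \<Rightarrow> (real^'n \<Rightarrow> real) \<Rightarrow> real^'n \<Rightarrow> real" where
  "generator A B R \<nu> s \<psi> x =
     (A *v x + B s x) \<bullet> grad \<psi> x +
     (\<integral>z. \<psi> (x + R *v z) - \<psi> x - indicator (cball 0 1) z * (grad \<psi> x \<bullet> (R *v z)) \<partial>\<nu>)"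

section \<open>Levy processes\<close>

definition cadlag_on :: "real set \<Rightarrow> (real \<Rightarrow> 'b::topological_space) \<Rightarrow> bool" where
  "cadlag_on I f \<longleftrightarrow> (\<forall>t\<in>I. (f \<longlongrightarrow> f t) (at t within (I \<inter> {t<..})) \<and>
     (\<exists>l. (f \<longlongrightarrow> l) (at t within (I \<inter> {..<t}))))"

text \<open>Processes are indexed by \<open>{0..}\<close>; values at negative times are irrelevant. Stochastic
  continuity follows from right-continuity and stationarity of the increments.\<close>

definition levy_process ::
  "'a measure \<Rightarrow> (real \<Rightarrow> 'a \<Rightarrow> 'b::euclidean_space) \<Rightarrow> bool" where
  "levy_process M X \<longleftrightarrow> prob_space M \<and>
     (\<forall>t\<ge>0. X t \<in> borel_measurable M) \<and>
     (AE \<omega> in M. X 0 \<omega> = 0) \<and>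
     (\<forall>n (t :: nat \<Rightarrow> real). mono t \<longrightarrow> 0 \<le> t 0 \<longrightarrow>
        prob_space.indep_vars M (\<lambda>_. borel) (\<lambda>i \<omega>. X (t (Suc i)) \<omega> - X (t i) \<omega>) {..<n}) \<and>
     (\<forall>s\<ge>0. \<forall>h\<ge>0. distr M borel (\<lambda>\<omega>. X (s + h) \<omega> - X s \<omega>) = distr M borel (X h)) \<and>
     (AE \<omega> in M. cadlag_on {0..} (\<lambda>t. X t \<omega>))"

definition standard_brownian_motion ::
  "'a measure \<Rightarrow> (real \<Rightarrow> 'a \<Rightarrow> real^'n) \<Rightarrow> bool" where
  "standard_brownian_motion M W \<longleftrightarrow> levy_process M W \<and>
     (\<forall>t>0. distributed M lborel (W t) (\<lambda>x. ennreal (\<Prod>i\<in>UNIV. normal_density 0 (sqrt t) (x $ i)))) \<and>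
     (AE \<omega> in M. continuous_on {0..} (\<lambda>t. W t \<omega>))"

definition subordinator :: "'a measure \<Rightarrow> (real \<Rightarrow> 'a \<Rightarrow> real) \<Rightarrow> bool" where
  "subordinator M L \<longleftrightarrow> levy_process M L \<and> (AE \<omega> in M. mono_on {0..} (\<lambda>t. L t \<omega>))"

definition strictly_stable ::
  "'a measure \<Rightarrow> real \<Rightarrow> (real \<Rightarrow> 'a \<Rightarrow> 'b::euclidean_space) \<Rightarrow> bool" where
  "strictly_stable M \<alpha> X \<longleftrightarrow>
     (\<forall>t>0. distr M borel (X t) = distr M borel (\<lambda>\<omega>. (t powr (1 / \<alpha>)) *\<^sub>R X 1 \<omega>))"

text \<open>The sigma-algebra on the sample space generated by a process with time set \<open>{0..}\<close>.\<close>

definition process_algebra ::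
  "'a measure \<Rightarrow> (real \<Rightarrow> 'a \<Rightarrow> 'b::topological_space) \<Rightarrow> 'a measure" where
  "process_algebra M X =
     vimage_algebra (space M) (\<lambda>\<omega>. \<lambda>t\<in>{0..}. X t \<omega>) (Pi\<^sub>M {0..} (\<lambda>_. borel))"

definition indep_processes ::
  "'a measure \<Rightarrow> (real \<Rightarrow> 'a \<Rightarrow> 'b::topological_space) \<Rightarrow>
   (real \<Rightarrow> 'a \<Rightarrow> 'c::topological_space) \<Rightarrow> bool" where
  "indep_processes M X Y \<longleftrightarrow>
     prob_space.indep_set M (sets (process_algebra M X)) (sets (process_algebra M Y))"

definition subordinate ::
  "(real \<Rightarrow> 'a \<Rightarrow> 'b) \<Rightarrow> (real \<Rightarrow> 'a \<Rightarrow> real) \<Rightarrow> real \<Rightarrow> 'a \<Rightarrow> 'b" where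
  "subordinate W L t \<omega> = W (L t \<omega>) \<omega>"

text \<open>\<open>(b, C, \<nu>)\<close> is the characteristic triplet in the Levy-Khintchine formula with truncation
  on the closed unit ball; the Levy measure is its (uniquely determined) last component.\<close>

definition levy_triplet ::
  "'a measure \<Rightarrow> (real \<Rightarrow> 'a \<Rightarrow> real^'n) \<Rightarrow> real^'n \<Rightarrow> real^'n^'n \<Rightarrow> (real^'n) measure \<Rightarrow> bool" where
  "levy_triplet M X b C \<nu> \<longleftrightarrow>
     transpose C = C \<and> (\<forall>u. 0 \<le> u \<bullet> (C *v u)) \<and>
     sets \<nu> = sets borel \<and> emeasure \<nu> {0} = 0 \<and>
     (\<integral>\<^sup>+z. ennreal (min 1 ((norm z)\<^sup>2)) \<partial>\<nu>) < \<infinity> \<and>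
     (\<forall>t\<ge>0. \<forall>u. (CLINT \<omega>|M. iexp (u \<bullet> X t \<omega>)) =
        exp (of_real t * (\<i> * of_real (b \<bullet> u) - of_real (u \<bullet> (C *v u)) / 2 +
          (CLINT z|\<nu>. iexp (u \<bullet> z) - 1 - \<i> * of_real (indicator (cball 0 1) z * (u \<bullet> z))))))"

definition levy_measure ::
  "'a measure \<Rightarrow> (real \<Rightarrow> 'a \<Rightarrow> real^'n) \<Rightarrow> (real^'n) measure \<Rightarrow> bool" where
  "levy_measure M X \<nu> \<longleftrightarrow> (\<exists>b C. levy_triplet M X b C \<nu>)"

section \<open>The stochastic differential equation\<close>

text \<open>The noise \<open>Z\<close> is additive, so the equation is pathwise: no stochastic integral occurs, and
  for \<open>B\<close> Lipschitz in space the solution is unique up to indistinguishability and automatically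
  adapted to the completed filtration of the increments of \<open>Z\<close>.\<close>

definition sde_solution ::
  "'a measure \<Rightarrow> real \<Rightarrow> real^'n^'n \<Rightarrow> (real \<Rightarrow> real^'n \<Rightarrow> real^'n) \<Rightarrow> real^'n^'n \<Rightarrow>
   (real \<Rightarrow> 'a \<Rightarrow> real^'n) \<Rightarrow> real \<Rightarrow> real^'n \<Rightarrow> (real \<Rightarrow> 'a \<Rightarrow> real^'n) \<Rightarrow> bool" where
  "sde_solution M T A B R Z s x Y \<longleftrightarrow>
     (\<forall>t\<in>{s..T}. Y t \<in> borel_measurable M) \<and>
     (AE \<omega> in M. cadlag_on {s..T} (\<lambda>t. Y t \<omega>) \<and>
        (\<forall>t\<in>{s..T}.
           set_integrable lborel {s..t} (\<lambda>r. A *v Y r \<omega> + B r (Y r \<omega>)) \<and>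
           Y t \<omega> = x + (LINT r:{s..t}|lborel. A *v Y r \<omega> + B r (Y r \<omega>))
                     + R *v (Z t \<omega> - Z s \<omega>)))"

text \<open>The transition operators of a family \<open>X s x\<close> of processes, \<open>s\<close> being the initial time and
  \<open>x\<close> the initial state.\<close>

definition transition ::
  "'a measure \<Rightarrow> (real \<Rightarrow> real^'n \<Rightarrow> real \<Rightarrow> 'a \<Rightarrow> real^'n) \<Rightarrow>
   real \<Rightarrow> real \<Rightarrow> (real^'n \<Rightarrow> real) \<Rightarrow> real^'n \<Rightarrow> real" where
  "transition M X s t \<phi> x = (\<integral>\<omega>. \<phi> (X s x t \<omega>) \<partial>M)"

end

theory Submission
  imports Defs
begin

text \<open>The noise is additive, so every solution is the pathwise limit of an Euler scheme driven by the
  increments of the subordinated Brownian motion. Those increments are independent, which yields the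
  Chapman-Kolmogorov relation \<open>P s t = P s r (P r t)\<close>. Each Euler step multiplies the \<open>C\<^sup>k\<close>-bound of
  a test function by at most \<open>1 + C * \<delta>\<close>, so that \<open>P s t\<close> preserves these classes and no
  differentiation of the stochastic flow is needed.

  The analytic core is the expansion \<open>P s (s + h) f = f + h * A s f + o(h)\<close>, uniformly over \<open>f\<close> with a
  given bound on \<open>f\<close>, its gradient and the Lipschitz constant of its gradient. For the noise alone
  it follows from the Levy-Khintchine formula when \<open>f\<close> is a mixture of cosines, and in general by
  approximation; \<open>1 / 2 < \<alpha>\<close> makes the first moment of the increments finite. Writing
  \<open>P s d - P s a = P s a (P a d - 1)\<close> and \<open>P d t - P a t = - (P a d - 1) (P d t)\<close>, the expansion gives
  the limit of the difference quotients along arbitrary \<open>a < d\<close> tending to the same time, hence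
  continuous differentiability and both equations.\<close>

section \<open>Functions with bounded Lipschitz partial derivatives\<close>

text \<open>The obstacle is uniformity. Forward in time the expansion is used at the random point
  \<open>X s x a\<close>, backward it is applied to the moving function \<open>P d t f\<close>, so
  its error may depend on the function only through \<open>K\<close>. The key is a modulus of
  continuity of the integral term \<open>igen f\<close> with constants depending on \<open>K\<close>
  alone: very short jumps contribute little, the others depend on the base point in a Lipschitz way.
  For a mixture of cosines the mean of \<open>f\<close> after a noise increment of length r has as
  derivative in r the mean of \<open>igen f\<close> after that increment; the modulus at the mean
  size of the increment then gives the error \<open>h * (e + C * mom h)\<close>. That mean size
  comes from writing |y| as a multiple of the integral of (1 - cos (u * y)) / u^2 over u > 0; after
  taking expectations the integrand is of order u^(2 * \<alpha> - 2) at 0, integrable because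
  \<alpha> > 1/2. The classes \<open>C_lip\<close> cost one derivative, as
  \<open>C_b (Suc k)\<close> lies in the union of the \<open>C_lip k K\<close>: order 2 leaves the
  Lipschitz gradient that the forward equation needs, order 3 leaves transition functions in
  \<open>C_b 2\<close>.\<close>

abbreviation has_partial :: "(real^'n \<Rightarrow> real) \<Rightarrow> 'n \<Rightarrow> (real^'n \<Rightarrow> real) \<Rightarrow> bool" where
  "has_partial f i g \<equiv> \<forall>x. ((\<lambda>h. f (x + h *\<^sub>R axis i 1)) has_real_derivative g x) (at 0)"

text \<open>Unlike \<open>C_b\<close>, these classes are closed under pointwise limits: the Lipschitz bound on the
  derivatives of top order provides the equicontinuity.\<close>

primrec C_lip :: "nat \<Rightarrow> real \<Rightarrow> (real^'n \<Rightarrow> real) set" where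
  "C_lip 0 K = {f. (\<forall>x. \<bar>f x\<bar> \<le> K) \<and> (\<forall>x y. \<bar>f x - f y\<bar> \<le> K * norm (x - y))}"
| "C_lip (Suc k) K = {f. (\<forall>x. \<bar>f x\<bar> \<le> K) \<and> (\<forall>x y. \<bar>f x - f y\<bar> \<le> K * norm (x - y)) \<and>
     (\<forall>i. \<exists>g\<in>C_lip k K. has_partial f i g)}"

lemma C_lip_bound: "f \<in> C_lip k K \<Longrightarrow> \<bar>f x\<bar> \<le> K"
  by (cases k) auto

lemma C_lip_nonneg: "f \<in> C_lip k K \<Longrightarrow> 0 \<le> K"
  using C_lip_bound[of f k K undefined] by linarith

lemma C_lip_lipschitz: "f \<in> C_lip k K \<Longrightarrow> \<bar>f x - f y\<bar> \<le> K * norm (x - y)"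
  by (cases k) auto

lemma C_lip_0D: "f \<in> C_lip k K \<Longrightarrow> f \<in> C_lip 0 K"
  by (cases k) auto

lemma C_lip_SucI:
  assumes "f \<in> C_lip 0 K" "\<And>i. g i \<in> C_lip k K" "\<And>i. has_partial f i (g i)"
  shows "f \<in> C_lip (Suc k) K"
  using assms by auto

lemma C_lip_SucE:
  assumes "f \<in> C_lip (Suc k) K"
  obtains g where "\<And>i. g i \<in> C_lip k K" "\<And>i. has_partial f i (g i)"
proof -
  have "\<forall>i. \<exists>g. g \<in> C_lip k K \<and> has_partial f i g"
    using assms by (simp, blast)
  then show ?thesis
    using that by metis
qed

lemma C_lip_Suc_D: "f \<in> C_lip (Suc k) K \<Longrightarrow> f \<in> C_lip k K"
proof (induction k arbitrary: f)
  case 0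
  then show ?case by auto
next
  case (Suc k)
  then obtain g where g: "\<And>i. g i \<in> C_lip (Suc k) K" "\<And>i. has_partial f i (g i)"
    using C_lip_SucE by blast
  show ?case
    by (rule C_lip_SucI[OF C_lip_0D[OF Suc.prems] Suc.IH[OF g(1)] g(2)])
qed

lemma C_lip_0_mono:
  assumes "f \<in> C_lip 0 K" "K \<le> K'" shows "f \<in> C_lip 0 K'"
proof -
  have "\<bar>f x - f y\<bar> \<le> K' * norm (x - y)" for x y
    using assms mult_right_mono[of K K' "norm (x - y)"] by (auto intro: order_trans)
  moreover have "\<bar>f x\<bar> \<le> K'" for x
    using assms by (auto intro: order_trans)
  ultimately show ?thesis by auto
qed

lemma C_lip_mono:
  assumes "f \<in> C_lip k K" "K \<le> K'" shows "f \<in> C_lip k K'"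
  using assms
proof (induction k arbitrary: f)
  case 0
  then show ?case using C_lip_0_mono by blast
next
  case (Suc k)
  then obtain g where g: "\<And>i. g i \<in> C_lip k K" "\<And>i. has_partial f i (g i)"
    using C_lip_SucE by blast
  show ?case
    by (rule C_lip_SucI[OF C_lip_0_mono[OF C_lip_0D[OF Suc.prems(1)] Suc.prems(2)]
          Suc.IH[OF g(1) Suc.prems(2)] g(2)])
qed

lemma C_lip_continuous: "f \<in> C_lip k K \<Longrightarrow> continuous_on UNIV f"
proof -
  assume f: "f \<in> C_lip k K"
  have "K-lipschitz_on UNIV f"
    using C_lip_lipschitz[OF f] C_lip_nonneg[OF f] by (auto simp: lipschitz_on_def dist_norm)
  then show ?thesis by (rule lipschitz_on_continuous_on)
qed

lemma C_lip_measurable [measurable_dest]: "f \<in> C_lip k K \<Longrightarrow> f \<in> borel_measurable borel"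
  by (intro borel_measurable_continuous_onI C_lip_continuous)

lemma C_lip_imp_C_b: "f \<in> C_lip k K \<Longrightarrow> f \<in> C_b k"
proof (induction k arbitrary: f)
  case 0
  have "bounded (range f)"
    using C_lip_bound[OF 0] by (auto simp: bounded_iff)
  then show ?case
    using C_lip_continuous[OF 0] by simp
next
  case (Suc k)
  have "bounded (range f)"
    using C_lip_bound[OF Suc.prems] by (auto simp: bounded_iff)
  moreover have "\<exists>g\<in>C_b k. has_partial f i g" for i
    using C_lip_SucE[OF Suc.prems] Suc.IH by metis
  ultimately show ?case
    using C_lip_continuous[OF Suc.prems] by simp
qed

section \<open>Differentiability as a quadratic remainder inequality\<close>

lemma has_partial_at:
  assumes "has_partial f i g"
  shows "((\<lambda>h. f (x + h *\<^sub>R axis i 1)) has_real_derivative g (x + s *\<^sub>R axis i 1)) (at s)"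
proof -
  have "((\<lambda>h. f ((x + s *\<^sub>R axis i 1) + h *\<^sub>R axis i 1))
      has_real_derivative g (x + s *\<^sub>R axis i 1)) (at 0)"
    using assms by blast
  then have "((\<lambda>h. (\<lambda>h. f (x + h *\<^sub>R axis i 1)) (h + s)) 
      has_real_derivative g (x + s *\<^sub>R axis i 1)) (at 0)"
    by (simp add: algebra_simps)
  then show ?thesis
    using DERIV_shift[of "\<lambda>h. f (x + h *\<^sub>R axis i 1)" _ 0 s] by simp
qed

lemma has_partial_unique: "has_partial f i g \<Longrightarrow> has_partial f i g' \<Longrightarrow> g = g'"
  using DERIV_unique by blast

lemma DERIV_cmult_Id_right: "((\<lambda>s. s * c) has_real_derivative c) (at s)"
  for c :: real
  by (auto intro!: derivative_eq_intros)

text \<open>The mean value inequality for \<open>?F\<close>, whose derivative is at most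
  \<open>K * \<bar>h\<bar>\<close> by the Lipschitz bound on \<open>g\<close>. With the converse
  \<open>has_partialI_remainder\<close> it recasts differentiability as a family of inequalities
  with one constant, which survive pointwise limits and expectations.\<close>

lemma partial_remainder:
  fixes f :: "real^'n \<Rightarrow> real"
  assumes "has_partial f i g" and "g \<in> C_lip 0 K"
  shows "\<bar>f (x + h *\<^sub>R axis i 1) - f x - h * g x\<bar> \<le> K * h\<^sup>2"
proof -
  let ?F = "\<lambda>s. f (x + s *\<^sub>R axis i 1) - s * g x"
  have "norm (?F h - ?F 0) \<le> (K * \<bar>h\<bar>) * norm (h - 0)"
  proof (rule field_differentiable_bound[where S="closed_segment 0 h"
        and f'="\<lambda>s. g (x + s *\<^sub>R axis i 1) - g x"])
    fix s assume s: "s \<in> closed_segment 0 h"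
    show "(?F has_real_derivative g (x + s *\<^sub>R axis i 1) - g x) (at s within closed_segment 0 h)"
      by (rule has_field_derivative_at_within[OF DERIV_diff[OF has_partial_at[OF assms(1)]
              DERIV_cmult_Id_right]])
    have "\<bar>s\<bar> \<le> \<bar>h\<bar>"
      using s by (auto simp: closed_segment_eq_real_ivl split: if_splits)
    then have "K * norm (s *\<^sub>R axis i 1 :: real^'n) \<le> K * \<bar>h\<bar>"
      using C_lip_nonneg[OF assms(2)] by (auto intro: mult_left_mono)
    moreover have "\<bar>g (x + s *\<^sub>R axis i 1) - g x\<bar> \<le> K * norm (s *\<^sub>R axis i 1 :: real^'n)"
      using C_lip_lipschitz[OF assms(2), of "x + s *\<^sub>R axis i 1" x] by simp
    ultimately show "norm (g (x + s *\<^sub>R axis i 1) - g x) \<le> K * \<bar>h\<bar>"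
      by simp
  qed auto
  then show ?thesis
    by (simp add: power2_eq_square algebra_simps abs_mult_self_eq)
qed

text \<open>Any constant \<open>K\<close> will do, so that crude estimates suffice wherever a
  derivative is identified below.\<close>

lemma has_partialI_remainder:
  fixes f :: "real^'n \<Rightarrow> real"
  assumes "\<And>x h. \<bar>f (x + h *\<^sub>R axis i 1) - f x - h * g x\<bar> \<le> K * h\<^sup>2"
  shows "has_partial f i g"
proof
  fix x
  have "(\<lambda>h. (f (x + h *\<^sub>R axis i 1) - f x) / h - g x) \<midarrow>0\<rightarrow> 0"
  proof (rule Lim_null_comparison)
    show "(\<lambda>h. K * \<bar>h\<bar>) \<midarrow>0\<rightarrow> 0"
      by (auto intro!: tendsto_eq_intros)
    show "\<forall>\<^sub>F h in at 0. norm ((f (x + h *\<^sub>R axis i 1) - f x) / h - g x) \<le> K * \<bar>h\<bar>"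
    proof (rule eventually_at_filter[THEN iffD2, OF always_eventually], intro allI impI)
      fix h :: real assume h: "h \<noteq> 0"
      have "(f (x + h *\<^sub>R axis i 1) - f x) / h - g x = (f (x + h *\<^sub>R axis i 1) - f x - h * g x) / h"
        using h by (simp add: field_simps)
      also have "norm \<dots> \<le> K * h\<^sup>2 / \<bar>h\<bar>"
        using assms[where x=x and h=h] by (simp add: divide_right_mono)
      also have "\<dots> = K * \<bar>h\<bar>"
        using h by (simp add: field_simps power2_eq_square abs_mult_self_eq)
      finally show "norm ((f (x + h *\<^sub>R axis i 1) - f x) / h - g x) \<le> K * \<bar>h\<bar>" .
    qed
  qed
  then show "((\<lambda>h. f (x + h *\<^sub>R axis i 1)) has_real_derivative g x) (at 0)"
    using LIM_zero_iff[of "\<lambda>h. (f (x + h *\<^sub>R axis i 1) - f x) / h" "g x" "at 0"] by (simp add: DERIV_def)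
qed

text \<open>Move from \<open>x\<close> to \<open>y\<close> one coordinate at a time.\<close>

lemma partials_linear_approx:
  fixes f :: "real^'n \<Rightarrow> real"
  assumes f: "\<And>i. has_partial f i (g i)"
    and g: "\<And>i w. norm (w - x) \<le> norm (y - x) \<Longrightarrow> \<bar>g i w - c i\<bar> \<le> M"
  shows "\<bar>f y - f x - (\<Sum>i\<in>UNIV. c i * (y $ i - x $ i))\<bar> \<le> real CARD('n) * M * norm (y - x)"
proof -
  \<comment> \<open>\<open>p S\<close> has the coordinates in \<open>S\<close> already moved from
    \<open>x\<close> to \<open>y\<close>, so that \<open>p {}\<close> is \<open>x\<close> and
    \<open>p UNIV\<close> is \<open>y\<close>.\<close>
  define p where "p S = (\<chi> i. if i \<in> S then y $ i else x $ i)" for S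
  have "\<bar>f (p S) - f x - (\<Sum>i\<in>S. c i * (y $ i - x $ i))\<bar> \<le> real (card S) * M * norm (y - x)"
    if "finite S" for S
    using that
  proof (induction S rule: finite_induct)
    case empty
    have "p {} = x" by (simp add: p_def vec_eq_iff)
    then show ?case by simp
  next
    case (insert i S)
    let ?d = "y $ i - x $ i"
    have pi: "p (insert i S) = p S + ?d *\<^sub>R axis i 1"
      using insert by (auto simp: p_def vec_eq_iff axis_def)
    let ?F = "\<lambda>s. f (p S + s *\<^sub>R axis i 1) - s * c i"
    have "norm (?F ?d - ?F 0) \<le> M * norm (?d - 0)"
    proof (rule field_differentiable_bound[where S="closed_segment 0 ?d"
          and f'="\<lambda>s. g i (p S + s *\<^sub>R axis i 1) - c i"])
      fix s assume s: "s \<in> closed_segment 0 ?d"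
      show "(?F has_real_derivative g i (p S + s *\<^sub>R axis i 1) - c i) (at s within closed_segment 0 ?d)"
        by (rule has_field_derivative_at_within[OF DERIV_diff[OF has_partial_at[OF f]
                DERIV_cmult_Id_right]])
      have sd: "\<bar>s\<bar> \<le> \<bar>?d\<bar>"
        using s by (auto simp: closed_segment_eq_real_ivl split: if_splits)
      \<comment> \<open>Along the edge from \<open>p S\<close> to \<open>p (insert i S)\<close>
        every coordinate stays between those of \<open>x\<close> and \<open>y\<close>, hence the
        point is no farther from \<open>x\<close> than \<open>y\<close> is and the hypothesis on
        \<open>g\<close> applies.\<close>
      have "norm (p S + s *\<^sub>R axis i 1 - x) \<le> norm (y - x)"
      proof (rule norm_le_componentwise_cart)
        fix j
        show "norm ((p S + s *\<^sub>R axis i 1 - x) $ j) \<le> norm ((y - x) $ j)"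
          using sd insert(2) by (cases "j = i") (auto simp: p_def axis_def)
      qed
      then show "norm (g i (p S + s *\<^sub>R axis i 1) - c i) \<le> M"
        using g by simp
    qed auto
    moreover have "M * norm (?d - 0) \<le> M * norm (y - x)"
    proof (rule mult_left_mono)
      show "0 \<le> M" using g[of x i] by simp
      show "norm (?d - 0) \<le> norm (y - x)"
        using component_le_norm_cart[of "y - x" i] by simp
    qed
    ultimately have "\<bar>f (p (insert i S)) - f (p S) - c i * ?d\<bar> \<le> M * norm (y - x)"
      by (simp add: pi algebra_simps)
    moreover have "real (card (insert i S)) * M * norm (y - x) =
        M * norm (y - x) + real (card S) * M * norm (y - x)"
      using insert by (simp add: algebra_simps)
    ultimately show ?case
      using insert by (simp only: sum.insert[OF insert(1,2)])
  qed
  from this[of UNIV] show ?thesis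
    by (simp add: p_def)
qed

section \<open>From bounded derivatives to Lipschitz classes\<close>

lemma lipschitz_of_partials:
  fixes f :: "real^'n \<Rightarrow> real"
  assumes "\<And>i. has_partial f i (g i)" "\<And>i w. \<bar>g i w\<bar> \<le> M"
  shows "\<bar>f x - f y\<bar> \<le> real CARD('n) * M * norm (x - y)"
  using partials_linear_approx[where f=f and g=g and c="\<lambda>_. 0" and M=M and x=y and y=x] assms by simp

lemma C_lip_0I_partials:
  fixes f :: "real^'n \<Rightarrow> real"
  assumes "\<And>x. \<bar>f x\<bar> \<le> M" "\<And>i. has_partial f i (g i)" "\<And>i w. \<bar>g i w\<bar> \<le> M" "real CARD('n) * M \<le> K"
  shows "f \<in> C_lip 0 K"
proof -
  have M: "0 \<le> M" using assms(1)[of 0] by linarith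
  have "M \<le> real CARD('n) * M"
    using M mult_right_mono[of 1 "real CARD('n)" M] by (simp add: Suc_leI)
  then have "\<bar>f x\<bar> \<le> K" for x
    using assms(1)[of x] assms(4) by linarith
  moreover have "\<bar>f x - f y\<bar> \<le> K * norm (x - y)" for x y
    using lipschitz_of_partials[of f g M x y, OF assms(2,3)] mult_right_mono[OF assms(4), of "norm (x - y)"]
    by simp
  ultimately show ?thesis by simp
qed

text \<open>One derivative is spent: bounds on the partial derivatives of order k + 1 are turned
  into Lipschitz constants for those of order k. Summing the bounds over the coordinates yields a
  common \<open>K\<close>. \<open>base\<close> is proved for every order beforehand because the
  induction step needs it for \<open>f\<close> itself.\<close>

lemma C_b_imp_C_lip:
  fixes f :: "real^'n \<Rightarrow> real"
  assumes "f \<in> C_b (Suc k)"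
  shows "\<exists>K. f \<in> C_lip k K"
  using assms
proof (induction k arbitrary: f)
  have base: "\<exists>K. f \<in> C_lip 0 K" if f: "f \<in> C_b (Suc k)" for k and f :: "real^'n \<Rightarrow> real"
  proof -
    have "\<forall>i. \<exists>g. g \<in> C_b k \<and> has_partial f i g"
      using f by (simp, blast)
    then obtain g where g: "\<And>i. g i \<in> C_b k" "\<And>i. has_partial f i (g i)"
      by metis
    have "bounded (range f)" using f by simp
    then obtain M0 where M0: "\<And>x. \<bar>f x\<bar> \<le> M0"
      by (auto simp: bounded_iff)
    have "bounded (range (g i))" for i
      using g(1)[of i] by (cases k) auto
    then have "\<exists>m. \<forall>x. \<bar>g i x\<bar> \<le> m" for i
      by (fastforce simp: bounded_iff)
    then obtain m where m: "\<And>i x. \<bar>g i x\<bar> \<le> m i"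
      by metis
    have m0: "0 \<le> m i" for i
      using m[of i undefined] by linarith
    define M where "M = \<bar>M0\<bar> + (\<Sum>i\<in>UNIV. m i)"
    have "m i \<le> M" for i
      using member_le_sum[of i UNIV m] m0 unfolding M_def by simp
    then have "\<bar>g i x\<bar> \<le> M" for i x
      using m order_trans by blast
    moreover have "\<bar>f x\<bar> \<le> M" for x
      using M0[of x] sum_nonneg[of UNIV m] m0 unfolding M_def by fastforce
    ultimately have "f \<in> C_lip 0 (real CARD('n) * M)"
      by (intro C_lip_0I_partials[where g=g and M=M] g(2)) auto
    then show ?thesis by blast
  qed
  {
    case 0
    then show ?case using base by blast
  next
    case (Suc k)
    have "\<forall>i. \<exists>g. g \<in> C_b (Suc k) \<and> has_partial f i g"
      using Suc.prems by (subst (asm) C_b.simps) blast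
    then obtain g where g: "\<And>i. g i \<in> C_b (Suc k)" "\<And>i. has_partial f i (g i)"
      by metis
    obtain K0 where K0: "f \<in> C_lip 0 K0"
      using base Suc.prems by blast
    obtain m where m: "\<And>i. g i \<in> C_lip k (m i)"
      using Suc.IH[OF g(1)] by metis
    define K where "K = K0 + (\<Sum>i\<in>UNIV. m i)"
    have m0: "0 \<le> m i" for i
      using C_lip_nonneg[OF m] .
    have "m i \<le> K" for i
      using member_le_sum[of i UNIV m] m0 C_lip_nonneg[OF K0] unfolding K_def by simp
    then have "g i \<in> C_lip k K" for i
      using C_lip_mono[OF m] by blast
    moreover have "f \<in> C_lip 0 K"
      using C_lip_mono[OF K0, of K] sum_nonneg[of UNIV m] m0 unfolding K_def by fastforce
    ultimately have "f \<in> C_lip (Suc k) K"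
      using g(2) C_lip_SucI by blast
    then show ?case by blast
  }
qed

text \<open>The argument of \<open>C_b_imp_C_lip\<close> for each component of a vector field. The
  order of the quantifiers is the point: one \<open>K\<close> serves all times in
  \<open>{0..T}\<close>, since \<open>C_b0\<close> bounds the derivatives on the whole
  strip.\<close>

lemma C_b0_imp_C_lip:
  fixes B :: "real \<Rightarrow> real^'n \<Rightarrow> real^'n"
  assumes "B \<in> C_b0 T (Suc k)"
  shows "\<exists>K. \<forall>t\<in>{0..T}. \<forall>j. (\<lambda>x. B t x $ j) \<in> C_lip k K"
  using assms
proof (induction k arbitrary: B)
  have comp: "has_partial (\<lambda>x. B t x $ j) i (\<lambda>x. g t x $ j)"
    if "\<forall>t\<in>{0..T}. \<forall>x. ((\<lambda>h. B t (x + h *\<^sub>R axis i 1)) has_vector_derivative g t x) (at 0)"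
      "t \<in> {0..T}" for i j t and B g :: "real \<Rightarrow> real^'n \<Rightarrow> real^'n"
  proof
    fix x
    have "((\<lambda>h. B t (x + h *\<^sub>R axis i 1)) has_vector_derivative g t x) (at 0)"
      using that by blast
    from bounded_linear.has_vector_derivative[OF bounded_linear_vec_nth[of j] this]
    show "((\<lambda>h. B t (x + h *\<^sub>R axis i 1) $ j) has_real_derivative g t x $ j) (at 0)"
      by (simp add: has_real_derivative_iff_has_vector_derivative)
  qed
  have base: "\<exists>K. \<forall>t\<in>{0..T}. \<forall>j. (\<lambda>x. B t x $ j) \<in> C_lip 0 K"
    if B: "B \<in> C_b0 T (Suc k)" for k and B :: "real \<Rightarrow> real^'n \<Rightarrow> real^'n"
  proof -
    have "\<forall>i. \<exists>g. g \<in> C_b0 T k \<and> (\<forall>t\<in>{0..T}. \<forall>x. ((\<lambda>h. B t (x + h *\<^sub>R axis i 1)) has_vector_derivative g t x) (at 0))"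
      using B by (simp, blast)
    then obtain g where g: "\<And>i. g i \<in> C_b0 T k"
      "\<And>i. \<forall>t\<in>{0..T}. \<forall>x. ((\<lambda>h. B t (x + h *\<^sub>R axis i 1)) has_vector_derivative g i t x) (at 0)"
      by metis
    have "bounded ((\<lambda>(t, x). B t x) ` ({0..T} \<times> UNIV))" using B by simp
    then obtain M0 where "\<forall>t\<in>{0..T}. \<forall>x. norm (B t x) \<le> M0"
      by (auto simp: bounded_iff)
    then have M0: "\<And>t x. t \<in> {0..T} \<Longrightarrow> norm (B t x) \<le> M0"
      by blast
    have "bounded ((\<lambda>(t, x). g i t x) ` ({0..T} \<times> UNIV))" for i
      using g(1)[of i] by (cases k) auto
    then have "\<exists>m. \<forall>t\<in>{0..T}. \<forall>x. norm (g i t x) \<le> m" for i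
      by (fastforce simp: bounded_iff)
    then have "\<forall>i. \<exists>m. \<forall>t\<in>{0..T}. \<forall>x. norm (g i t x) \<le> m" by blast
    from choice[OF this] obtain m where m: "\<And>i t x. t \<in> {0..T} \<Longrightarrow> norm (g i t x) \<le> m i"
      by blast
    define M where "M = \<bar>M0\<bar> + (\<Sum>i\<in>UNIV. \<bar>m i\<bar>)"
    have mM: "m i \<le> M" for i
      using member_le_sum[of i UNIV "\<lambda>i. \<bar>m i\<bar>"] unfolding M_def by simp
    have "(\<lambda>x. B t x $ j) \<in> C_lip 0 (real CARD('n) * M)" if t: "t \<in> {0..T}" for t j
    proof (rule C_lip_0I_partials[where g="\<lambda>i x. g i t x $ j" and M=M])
      show "\<bar>B t x $ j\<bar> \<le> M" for x
        using M0[OF t, of x] component_le_norm_cart[of "B t x" j] sum_nonneg[of UNIV "\<lambda>i. \<bar>m i\<bar>", OF abs_ge_zero]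
        unfolding M_def by linarith
      show "has_partial (\<lambda>x. B t x $ j) i (\<lambda>x. g i t x $ j)" for i
        by (rule comp[OF g(2) t])
      show "\<bar>g i t w $ j\<bar> \<le> M" for i w
        using m[OF t, of i w] component_le_norm_cart[of "g i t w" j] mM[of i] by simp
    qed simp
    then show ?thesis by blast
  qed
  {
    case 0
    then show ?case using base by blast
  next
    case (Suc k)
    have "\<forall>i. \<exists>g. g \<in> C_b0 T (Suc k) \<and> (\<forall>t\<in>{0..T}. \<forall>x. ((\<lambda>h. B t (x + h *\<^sub>R axis i 1)) has_vector_derivative g t x) (at 0))"
      using Suc.prems by (subst (asm) C_b0.simps) blast
    then obtain g where g: "\<And>i. g i \<in> C_b0 T (Suc k)"
      "\<And>i. \<forall>t\<in>{0..T}. \<forall>x. ((\<lambda>h. B t (x + h *\<^sub>R axis i 1)) has_vector_derivative g i t x) (at 0)"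
      by metis
    obtain K0 where K0: "\<And>t j. t \<in> {0..T} \<Longrightarrow> (\<lambda>x. B t x $ j) \<in> C_lip 0 K0"
      using base[OF Suc.prems] by blast
    have "\<forall>i. \<exists>m. \<forall>t\<in>{0..T}. \<forall>j. (\<lambda>x. g i t x $ j) \<in> C_lip k m"
      using Suc.IH[OF g(1)] by blast
    from choice[OF this] obtain m where m: "\<And>i t j. t \<in> {0..T} \<Longrightarrow> (\<lambda>x. g i t x $ j) \<in> C_lip k (m i)"
      by blast
    define K where "K = \<bar>K0\<bar> + (\<Sum>i\<in>UNIV. \<bar>m i\<bar>)"
    have mK: "m i \<le> K" for i
      using member_le_sum[of i UNIV "\<lambda>i. \<bar>m i\<bar>"] unfolding K_def by simp
    have K0K: "K0 \<le> K"
      using sum_nonneg[of UNIV "\<lambda>i. \<bar>m i\<bar>", OF abs_ge_zero] unfolding K_def by linarith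
    have "(\<lambda>x. B t x $ j) \<in> C_lip (Suc k) K" if t: "t \<in> {0..T}" for t j
      by (rule C_lip_SucI[where g="\<lambda>i x. g i t x $ j", OF C_lip_mono[OF K0[OF t] K0K]
            C_lip_mono[OF m[OF t] mK] comp[OF g(2) t]])
    then show ?case by blast
  }
qed

section \<open>Algebra of the Lipschitz classes\<close>

lemma C_lip_const: "\<bar>c\<bar> \<le> K \<Longrightarrow> (\<lambda>x :: real^'n. c) \<in> C_lip k K"
proof (induction k arbitrary: c)
  case 0
  then show ?case by auto
next
  case (Suc k)
  then have "(\<lambda>x :: real^'n. 0) \<in> C_lip k K" by (intro Suc.IH) auto
  then show ?case using Suc.prems by (auto intro!: bexI[of _ "\<lambda>x. 0"])
qed

lemma C_lip_add:
  assumes "f \<in> C_lip k K" "f' \<in> C_lip k K'"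
  shows "(\<lambda>x. f x + f' x) \<in> C_lip k (K + K')"
  using assms
proof (induction k arbitrary: f f')
  have base: "(\<lambda>x. f x + f' x) \<in> C_lip 0 (K + K')"
    if "f \<in> C_lip k K" "f' \<in> C_lip k K'" for k and f f' :: "real^'a \<Rightarrow> real"
  proof -
    have "\<bar>f x + f' x\<bar> \<le> K + K'" for x
      using C_lip_bound[OF that(1), of x] C_lip_bound[OF that(2), of x] by linarith
    moreover have "\<bar>f x + f' x - (f y + f' y)\<bar> \<le> (K + K') * norm (x - y)" for x y
      using C_lip_lipschitz[OF that(1), of x y] C_lip_lipschitz[OF that(2), of x y]
      unfolding distrib_right by linarith
    ultimately show ?thesis by simp
  qed
  {
    case 0
    then show ?case by (rule base)
  next
    case (Suc k)
    obtain g where g: "\<And>i. g i \<in> C_lip k K" "\<And>i. has_partial f i (g i)"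
      using C_lip_SucE[OF Suc.prems(1)] by metis
    obtain g' where g': "\<And>i. g' i \<in> C_lip k K'" "\<And>i. has_partial f' i (g' i)"
      using C_lip_SucE[OF Suc.prems(2)] by metis
    show ?case
      by (rule C_lip_SucI[where g="\<lambda>i x. g i x + g' i x", OF base[OF Suc.prems] Suc.IH[OF g(1) g'(1)]])
        (intro allI DERIV_add g(2)[THEN spec] g'(2)[THEN spec])
  }
qed

lemma C_lip_sum:
  assumes "finite I" "\<And>i. i \<in> I \<Longrightarrow> f i \<in> C_lip k (K i)"
  shows "(\<lambda>x. \<Sum>i\<in>I. f i x) \<in> C_lip k (\<Sum>i\<in>I. K i)"
  using assms
proof (induction I rule: finite_induct)
  case empty
  show ?case using C_lip_const[of 0 0] by simp
next
  case (insert i I)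
  then show ?case using C_lip_add[of "f i" k "K i" "\<lambda>x. \<Sum>i\<in>I. f i x"] by simp
qed

text \<open>The constant doubles with each order because the product rule yields two products of one
  order less; the first factor 2 comes from splitting an increment of the product in two.\<close>

lemma C_lip_mult:
  assumes "f \<in> C_lip k K" "f' \<in> C_lip k K'"
  shows "(\<lambda>x. f x * f' x) \<in> C_lip k (2 ^ Suc k * K * K')"
  using assms
proof (induction k arbitrary: f f')
  have base: "(\<lambda>x. f x * f' x) \<in> C_lip 0 (2 * K * K')"
    if "f \<in> C_lip k K" "f' \<in> C_lip k K'" for k and f f' :: "real^'a \<Rightarrow> real"
  proof -
    have K: "0 \<le> K" "0 \<le> K'" using that C_lip_nonneg by blast+
    have "\<bar>f x * f' x\<bar> \<le> K * K'" for x
      unfolding abs_mult using K by (intro mult_mono C_lip_bound[OF that(1)] C_lip_bound[OF that(2)]) auto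
    moreover have "K * K' \<le> 2 * K * K'" using K by simp
    ultimately have 1: "\<bar>f x * f' x\<bar> \<le> 2 * K * K'" for x
      using order_trans by blast
    have "\<bar>f x * f' x - f y * f' y\<bar> \<le> 2 * K * K' * norm (x - y)" for x y
    proof -
      have "f x * f' x - f y * f' y = f x * (f' x - f' y) + f' y * (f x - f y)"
        by (simp add: algebra_simps)
      then have "\<bar>f x * f' x - f y * f' y\<bar> \<le> \<bar>f x\<bar> * \<bar>f' x - f' y\<bar> + \<bar>f' y\<bar> * \<bar>f x - f y\<bar>"
        by (metis abs_mult abs_triangle_ineq)
      also have "\<dots> \<le> K * (K' * norm (x - y)) + K' * (K * norm (x - y))"
        using K by (intro add_mono mult_mono C_lip_bound[OF that(1)] C_lip_bound[OF that(2)]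
            C_lip_lipschitz[OF that(1)] C_lip_lipschitz[OF that(2)]) auto
      finally show ?thesis by (simp add: algebra_simps)
    qed
    with 1 show ?thesis by simp
  qed
  {
    case 0
    then show ?case using base[of f 0 f'] by simp
  next
    case (Suc k)
    obtain g where g: "\<And>i. g i \<in> C_lip k K" "\<And>i. has_partial f i (g i)"
      using C_lip_SucE[OF Suc.prems(1)] by metis
    obtain g' where g': "\<And>i. g' i \<in> C_lip k K'" "\<And>i. has_partial f' i (g' i)"
      using C_lip_SucE[OF Suc.prems(2)] by metis
    have K: "0 \<le> K" "0 \<le> K'" using Suc.prems C_lip_nonneg by blast+
    have "(2::real) \<le> 2 ^ Suc (Suc k)"
      using one_le_power[of "2::real" "Suc k"] by simp
    then have le: "2 * K * K' \<le> 2 ^ Suc (Suc k) * K * K'"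
      using K by (intro mult_right_mono) auto
    have g1: "(\<lambda>x. g i x * f' x + g' i x * f x) \<in> C_lip k (2 ^ Suc k * K * K' + 2 ^ Suc k * K * K')" for i
      using C_lip_add[OF Suc.IH[OF g(1) C_lip_Suc_D[OF Suc.prems(2)]] Suc.IH[OF C_lip_Suc_D[OF Suc.prems(1)] g'(1)]]
      by (simp add: mult.commute)
    have eq: "2 ^ Suc k * K * K' + 2 ^ Suc k * K * K' = 2 ^ Suc (Suc k) * K * K'"
      by simp
    show ?case
    proof (rule C_lip_SucI[where g="\<lambda>i x. g i x * f' x + g' i x * f x"])
      show "(\<lambda>x. f x * f' x) \<in> C_lip 0 (2 ^ Suc (Suc k) * K * K')"
        by (rule C_lip_0_mono[OF base[OF Suc.prems] le])
      show "(\<lambda>x. g i x * f' x + g' i x * f x) \<in> C_lip k (2 ^ Suc (Suc k) * K * K')" for i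
        using g1 unfolding eq .
      show "has_partial (\<lambda>x. f x * f' x) i (\<lambda>x. g i x * f' x + g' i x * f x)" for i
      proof
        fix x
        show "((\<lambda>h. f (x + h *\<^sub>R axis i 1) * f' (x + h *\<^sub>R axis i 1)) has_real_derivative
            g i x * f' x + g' i x * f x) (at 0)"
          using DERIV_mult[OF g(2)[of i, THEN spec, of x] g'(2)[of i, THEN spec, of x]] by simp
      qed
    qed
  }
qed

text \<open>The remainder estimate turns convergence of the functions into convergence of the
  derivatives.\<close>

lemma remainder_convergent:
  fixes f :: "nat \<Rightarrow> real^'n \<Rightarrow> real"
  assumes f: "\<And>y. convergent (\<lambda>n. f n y)"
    and rem: "\<And>n h. \<bar>f n (x + h *\<^sub>R axis i 1) - f n x - h * a n\<bar> \<le> K * h\<^sup>2"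
  shows "convergent a"
proof -
  have K: "0 \<le> K" using rem[of 0 1] by simp
  have "Cauchy a"
  proof (rule metric_CauchyI)
    fix e :: real assume e: "0 < e"
    \<comment> \<open>One step for all \<open>n\<close>: every difference quotient
      \<open>q n\<close> lies within \<open>K * h \<le> e / 4\<close> of \<open>a n\<close>, so two
      quotients at distance below \<open>e / 2\<close> force the derivatives to within
      \<open>e\<close>. The 1 in \<open>K + 1\<close> covers \<open>K = 0\<close>.\<close>
    define h where "h = e / (4 * (K + 1))"
    have h: "0 < h" using e K by (simp add: h_def)
    have "K * h \<le> (K + 1) * h" using h by simp
    also have "(K + 1) * h = e / 4" using K by (auto simp: h_def field_simps)
    finally have Kh: "K * h \<le> e / 4" .
    define q where "q n = (f n (x + h *\<^sub>R axis i 1) - f n x) / h" for n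
    have "convergent q"
      unfolding q_def divide_inverse by (intro convergent_mult convergent_diff convergent_const f)
    then have "Cauchy q" by (rule convergent_Cauchy)
    then obtain N where N: "\<And>m n. m \<ge> N \<Longrightarrow> n \<ge> N \<Longrightarrow> dist (q m) (q n) < e / 2"
      using e metric_CauchyD[of q "e/2"] by auto
    have qa: "\<bar>q n - a n\<bar> \<le> e / 4" for n
    proof -
      have "q n - a n = (f n (x + h *\<^sub>R axis i 1) - f n x - h * a n) / h"
        using h by (simp add: q_def field_simps)
      then have "\<bar>q n - a n\<bar> = \<bar>f n (x + h *\<^sub>R axis i 1) - f n x - h * a n\<bar> / h"
        using h by simp
      also have "\<dots> \<le> K * h\<^sup>2 / h"
        using rem h by (intro divide_right_mono) auto
      also have "\<dots> = K * h" using h by (simp add: power2_eq_square)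
      finally show ?thesis using Kh by simp
    qed
    have "dist (a m) (a n) < e" if "m \<ge> N" "n \<ge> N" for m n
      using N[OF that] qa[of m] qa[of n]
      unfolding dist_real_def abs_le_iff abs_less_iff by linarith
    then show "\<exists>N. \<forall>m\<ge>N. \<forall>n\<ge>N. dist (a m) (a n) < e" by blast
  qed
  then show ?thesis by (rule Cauchy_convergent)
qed

section \<open>Closure under limits and expectations\<close>

lemma C_lip_0_limit:
  assumes "\<And>n. f n \<in> C_lip 0 K" "\<And>x. (\<lambda>n. f n x) \<longlonglongrightarrow> F x"
  shows "F \<in> C_lip 0 K"
proof -
  have "\<bar>F x\<bar> \<le> K" for x
    using LIMSEQ_le_const2[OF tendsto_rabs[OF assms(2)[of x]], of K] C_lip_bound[OF assms(1)] by auto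
  moreover have "\<bar>F x - F y\<bar> \<le> K * norm (x - y)" for x y
    using LIMSEQ_le_const2[OF tendsto_rabs[OF tendsto_diff[OF assms(2)[of x] assms(2)[of y]]],
        of "K * norm (x - y)"] C_lip_lipschitz[OF assms(1)] by auto
  ultimately show ?thesis by simp
qed

text \<open>The derivatives converge pointwise by \<open>remainder_convergent\<close>, and the
  remainder inequality passes to the limit with the same \<open>K\<close>, which identifies their
  limits as derivatives of \<open>F\<close>. This carries bounds from the Euler scheme to the
  transition operators.\<close>

lemma C_lip_limit:
  fixes F :: "real^'n \<Rightarrow> real"
  assumes "\<And>n. f n \<in> C_lip k K" "\<And>x. (\<lambda>n. f n x) \<longlonglongrightarrow> F x"
  shows "F \<in> C_lip k K"
  using assms
proof (induction k arbitrary: f F)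
  case 0
  then show ?case using C_lip_0_limit by blast
next
  case (Suc k)
  have "\<exists>g. (\<forall>i. g i \<in> C_lip k K \<and> has_partial (f n) i (g i))" for n
    using C_lip_SucE[OF Suc.prems(1)[of n]] by metis
  then obtain g where g: "\<And>n i. g n i \<in> C_lip k K" "\<And>n i. has_partial (f n) i (g n i)"
    by metis
  have rem: "\<bar>f n (x + h *\<^sub>R axis i 1) - f n x - h * g n i x\<bar> \<le> K * h\<^sup>2" for n x h i
    by (rule partial_remainder[OF g(2) C_lip_0D[OF g(1)]])
  define G where "G i x = lim (\<lambda>n. g n i x)" for i x
  have lim: "(\<lambda>n. g n i x) \<longlonglongrightarrow> G i x" for i x
    unfolding G_def convergent_LIMSEQ_iff[symmetric]
    by (rule remainder_convergent[where f=f, OF _ rem]) (use Suc.prems(2) convergent_def in blast)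
  have "\<bar>F (x + h *\<^sub>R axis i 1) - F x - h * G i x\<bar> \<le> K * h\<^sup>2" for x h i
    by (rule LIMSEQ_le_const2[of "\<lambda>n. \<bar>f n (x + h *\<^sub>R axis i 1) - f n x - h * g n i x\<bar>"])
       (use rem in \<open>auto intro!: tendsto_intros Suc.prems(2) lim\<close>)
  then have "has_partial F i (G i)" for i
    by (rule has_partialI_remainder)
  then show ?case
    using Suc.IH[of "\<lambda>n. g n i" "G i" for i, OF g(1) lim] 
      C_lip_0_limit[of f K F, OF C_lip_0D[OF Suc.prems(1)] Suc.prems(2)]
    by (intro C_lip_SucI[where g=G]) auto
qed

text \<open>Differentiation under the expectation: the remainder inequality holds for every \<omega>
  with the same \<open>K\<close> and is integrated.\<close>

lemma (in prob_space) C_lip_expectation: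
  fixes f :: "'a \<Rightarrow> real^'n \<Rightarrow> real"
  assumes "\<And>\<omega>. \<omega> \<in> space M \<Longrightarrow> f \<omega> \<in> C_lip k K" "\<And>x. (\<lambda>\<omega>. f \<omega> x) \<in> borel_measurable M"
  shows "(\<lambda>x. expectation (\<lambda>\<omega>. f \<omega> x)) \<in> C_lip k K"
  using assms
proof (induction k arbitrary: f)
  have int: "integrable M (\<lambda>\<omega>. f \<omega> x)"
    if "\<And>\<omega>. \<omega> \<in> space M \<Longrightarrow> f \<omega> \<in> C_lip k K" "\<And>x. (\<lambda>\<omega>. f \<omega> x) \<in> borel_measurable M"
    for f :: "'a \<Rightarrow> real^'n \<Rightarrow> real" and k x
    by (rule integrable_const_bound[where B=K])
      (use that(2) C_lip_bound[OF that(1)] in \<open>auto intro!: AE_I2\<close>)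
  have base: "(\<lambda>x. expectation (\<lambda>\<omega>. f \<omega> x)) \<in> C_lip 0 K"
    if f: "\<And>\<omega>. \<omega> \<in> space M \<Longrightarrow> f \<omega> \<in> C_lip k K" "\<And>x. (\<lambda>\<omega>. f \<omega> x) \<in> borel_measurable M"
    for f :: "'a \<Rightarrow> real^'n \<Rightarrow> real" and k
  proof -
    have 1: "\<bar>expectation (\<lambda>\<omega>. f \<omega> x)\<bar> \<le> K" for x
    proof -
      have "\<bar>expectation (\<lambda>\<omega>. f \<omega> x)\<bar> \<le> expectation (\<lambda>\<omega>. \<bar>f \<omega> x\<bar>)" by (rule integral_abs_bound)
      also have "\<dots> \<le> expectation (\<lambda>\<omega>. K)"
        using int[OF f] C_lip_bound[OF f(1)] by (intro integral_mono) auto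
      finally show ?thesis by (simp add: prob_space)
    qed
    have "\<bar>expectation (\<lambda>\<omega>. f \<omega> x) - expectation (\<lambda>\<omega>. f \<omega> y)\<bar> \<le> K * norm (x - y)" for x y
    proof -
      have "\<bar>expectation (\<lambda>\<omega>. f \<omega> x) - expectation (\<lambda>\<omega>. f \<omega> y)\<bar> = \<bar>expectation (\<lambda>\<omega>. f \<omega> x - f \<omega> y)\<bar>"
        using int[OF f] by simp
      also have "\<dots> \<le> expectation (\<lambda>\<omega>. \<bar>f \<omega> x - f \<omega> y\<bar>)" by (rule integral_abs_bound)
      also have "\<dots> \<le> expectation (\<lambda>\<omega>. K * norm (x - y))"
        using int[OF f] C_lip_lipschitz[OF f(1)] by (intro integral_mono) auto
      finally show ?thesis by (simp add: prob_space)
    qed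
    with 1 show ?thesis by simp
  qed
  {
    case 0
    then show ?case using base by blast
  next
    case (Suc k)
    have "\<exists>g. \<omega> \<in> space M \<longrightarrow> (\<forall>i. g i \<in> C_lip k K \<and> has_partial (f \<omega>) i (g i))" for \<omega>
      using C_lip_SucE[OF Suc.prems(1)[of \<omega>]] by metis
    then obtain g where g: "\<And>\<omega> i. \<omega> \<in> space M \<Longrightarrow> g \<omega> i \<in> C_lip k K"
      "\<And>\<omega> i. \<omega> \<in> space M \<Longrightarrow> has_partial (f \<omega>) i (g \<omega> i)"
      by metis
    have rem: "\<bar>f \<omega> (x + h *\<^sub>R axis i 1) - f \<omega> x - h * g \<omega> i x\<bar> \<le> K * h\<^sup>2"
      if "\<omega> \<in> space M" for \<omega> x h i
      by (rule partial_remainder[OF g(2) C_lip_0D[OF g(1)]]) fact+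
    \<comment> \<open>The derivatives were chosen separately for each \<omega>, which gives no
      measurability; it is recovered from difference quotients with step
      \<open>1 / real (Suc n)\<close>.\<close>
    have gm [measurable]: "(\<lambda>\<omega>. g \<omega> i x) \<in> borel_measurable M" for i x
    proof (rule borel_measurable_LIMSEQ_real)
      note Suc.prems(2)[measurable]
      show "(\<lambda>\<omega>. (f \<omega> (x + (1 / real (Suc n)) *\<^sub>R axis i 1) - f \<omega> x) * real (Suc n)) \<in> borel_measurable M" for n
        by measurable
      fix \<omega> assume \<omega>: "\<omega> \<in> space M"
      have "((\<lambda>h. (f \<omega> (x + h *\<^sub>R axis i 1) - f \<omega> x) / h) \<longlongrightarrow> g \<omega> i x) (at 0)"
        using g(2)[OF \<omega>, of i, THEN spec, of x] by (simp add: DERIV_def)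
      moreover have "filterlim (\<lambda>n. 1 / real (Suc n)) (at 0) sequentially"
        unfolding filterlim_at using LIMSEQ_inverse_real_of_nat by (simp add: inverse_eq_divide)
      ultimately have "(\<lambda>n. (f \<omega> (x + (1 / real (Suc n)) *\<^sub>R axis i 1) - f \<omega> x) / (1 / real (Suc n)))
         \<longlonglongrightarrow> g \<omega> i x"
        by (rule filterlim_compose)
      then show "(\<lambda>n. (f \<omega> (x + (1 / real (Suc n)) *\<^sub>R axis i 1) - f \<omega> x) * real (Suc n)) \<longlonglongrightarrow> g \<omega> i x"
        by simp
    qed
    have "\<bar>expectation (\<lambda>\<omega>. f \<omega> (x + h *\<^sub>R axis i 1)) - expectation (\<lambda>\<omega>. f \<omega> x)
        - h * expectation (\<lambda>\<omega>. g \<omega> i x)\<bar> \<le> K * h\<^sup>2" for x h i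
    proof -
      have "expectation (\<lambda>\<omega>. f \<omega> (x + h *\<^sub>R axis i 1)) - expectation (\<lambda>\<omega>. f \<omega> x)
          - h * expectation (\<lambda>\<omega>. g \<omega> i x) = 
          expectation (\<lambda>\<omega>. f \<omega> (x + h *\<^sub>R axis i 1) - f \<omega> x - h * g \<omega> i x)"
        using int[OF Suc.prems] int[of "\<lambda>\<omega>. g \<omega> i" k, OF g(1) gm] by simp
      also have "\<bar>\<dots>\<bar> \<le> expectation (\<lambda>\<omega>. \<bar>f \<omega> (x + h *\<^sub>R axis i 1) - f \<omega> x - h * g \<omega> i x\<bar>)"
        by (rule integral_abs_bound)
      also have "\<dots> \<le> expectation (\<lambda>\<omega>. K * h\<^sup>2)"
        using int[OF Suc.prems] int[of "\<lambda>\<omega>. g \<omega> i" k, OF g(1) gm] rem by (intro integral_mono) auto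
      finally show ?thesis by (simp add: prob_space)
    qed
    then have "has_partial (\<lambda>x. expectation (\<lambda>\<omega>. f \<omega> x)) i (\<lambda>x. expectation (\<lambda>\<omega>. g \<omega> i x))" for i
      by (rule has_partialI_remainder)
    then show ?case
      using Suc.IH[of "\<lambda>\<omega>. g \<omega> i" for i, OF g(1) gm] base[of f, OF Suc.prems]
      by (intro C_lip_SucI[where g="\<lambda>i x. expectation (\<lambda>\<omega>. g \<omega> i x)"]) auto
  }
qed

text \<open>Lipschitz partial derivatives make the total derivative exist. This is the bridge to
  \<open>grad\<close>, which is specified through \<open>GDERIV\<close> and not through partial
  derivatives.\<close>

lemma C_lip_gderiv:
  fixes f :: "real^'n \<Rightarrow> real"
  assumes "f \<in> C_lip (Suc k) K" "\<And>i. has_partial f i (g i)"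
  shows "GDERIV f x :> (\<chi> i. g i x)"
proof -
  have g: "g i \<in> C_lip k K" for i
  proof -
    obtain g' where g': "\<And>i. g' i \<in> C_lip k K" "\<And>i. has_partial f i (g' i)"
      using C_lip_SucE[OF assms(1)] by metis
    show ?thesis
      using has_partial_unique[OF g'(2) assms(2), of i] g'(1)[of i] by simp
  qed
  have K: "0 \<le> K" using assms(1) by (rule C_lip_nonneg)
  let ?D = "\<chi> i. g i x"
  have bound: "\<bar>f y - f x - (y - x) \<bullet> ?D\<bar> \<le> real CARD('n) * (K * norm (y - x)) * norm (y - x)" for y
  proof -
    have "\<bar>f y - f x - (\<Sum>i\<in>UNIV. g i x * (y $ i - x $ i))\<bar>
      \<le> real CARD('n) * (K * norm (y - x)) * norm (y - x)"
    proof (rule partials_linear_approx[OF assms(2)])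
      fix i w assume "norm (w - x) \<le> norm (y - x)"
      then show "\<bar>g i w - g i x\<bar> \<le> K * norm (y - x)"
        using C_lip_lipschitz[OF g, of i w x] mult_left_mono[of "norm (w - x)" "norm (y - x)" K] K by linarith
    qed
    then show ?thesis
      by (simp add: inner_vec_def mult.commute)
  qed
  show ?thesis
    unfolding gderiv_def has_derivative_at_within
  proof (intro conjI)
    show "bounded_linear (\<lambda>h. h \<bullet> ?D)" by (rule bounded_linear_inner_left)
    show "((\<lambda>y. (f y - f x - (y - x) \<bullet> ?D) /\<^sub>R norm (y - x)) \<longlongrightarrow> 0) (at x)"
    proof (rule Lim_null_comparison)
      show "((\<lambda>y. real CARD('n) * (K * norm (y - x))) \<longlongrightarrow> 0) (at x)"
        by (auto intro!: tendsto_eq_intros)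
      show "\<forall>\<^sub>F y in at x. norm ((f y - f x - (y - x) \<bullet> ?D) /\<^sub>R norm (y - x)) \<le> real CARD('n) * (K * norm (y - x))"
      proof (rule eventually_at_filter[THEN iffD2, OF always_eventually], intro allI impI)
        fix y assume "y \<noteq> x"
        then have "0 < norm (y - x)" by simp
        then show "norm ((f y - f x - (y - x) \<bullet> ?D) /\<^sub>R norm (y - x)) \<le> real CARD('n) * (K * norm (y - x))"
          using bound[of y] by (simp add: abs_mult field_simps)
      qed
    qed
  qed
qed

lemma grad_eqI:
  assumes "GDERIV f x :> D"
  shows "grad f x = D"
  unfolding grad_def
proof (rule the_equality)
  show "GDERIV f x :> D" by (rule assms)
  fix D' assume "GDERIV f x :> D'"
  then have "(\<lambda>h. h \<bullet> D') = (\<lambda>h. h \<bullet> D)"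
    using assms unfolding gderiv_def by (rule has_derivative_unique)
  then have "h \<bullet> D' = h \<bullet> D" for h by meson
  then show "D' = D"
    using vector_eq_rdot[of D' D] by (simp add: inner_commute)
qed

context
  fixes f :: "real^'n \<Rightarrow> real" and k K
  assumes f: "f \<in> C_lip (Suc k) K"
begin

lemma C_lip_has_partial_grad: "has_partial f i (\<lambda>x. grad f x $ i)"
proof -
  obtain g where g: "\<And>i. g i \<in> C_lip k K" "\<And>i. has_partial f i (g i)"
    using C_lip_SucE[OF f] by metis
  have "grad f x $ i = g i x" for x
    using grad_eqI[OF C_lip_gderiv[OF f g(2)]] by simp
  then show ?thesis using g(2)[of i] by simp
qed

lemma C_lip_grad_component: "(\<lambda>x. grad f x $ i) \<in> C_lip k K"
proof -
  obtain g where g: "\<And>i. g i \<in> C_lip k K" "\<And>i. has_partial f i (g i)"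
    using C_lip_SucE[OF f] by metis
  show ?thesis
    using g(1)[of i] unfolding has_partial_unique[OF g(2) C_lip_has_partial_grad, of i] .
qed

lemma norm_grad_le: "norm (grad f x) \<le> real CARD('n) * K"
proof -
  have "norm (grad f x) \<le> (\<Sum>i\<in>UNIV. \<bar>grad f x $ i\<bar>)" by (rule norm_le_l1_cart)
  also have "\<dots> \<le> (\<Sum>i\<in>(UNIV::'n set). K)"
    by (intro sum_mono C_lip_bound[OF C_lip_grad_component])
  finally show ?thesis by simp
qed

lemma norm_grad_diff_le: "norm (grad f x - grad f y) \<le> real CARD('n) * K * norm (x - y)"
proof -
  have "norm (grad f x - grad f y) \<le> (\<Sum>i\<in>UNIV. \<bar>(grad f x - grad f y) $ i\<bar>)" by (rule norm_le_l1_cart)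
  also have "\<dots> \<le> (\<Sum>i\<in>(UNIV::'n set). K * norm (x - y))"
    by (rule sum_mono) (use C_lip_lipschitz[OF C_lip_grad_component] in simp)
  finally show ?thesis by simp
qed

text \<open>The quadratic remainder against which the small jumps of the Levy measure are
  integrated; it also controls the shift of a function along the drift.\<close>

lemma C_lip_taylor: "\<bar>f y - f x - grad f x \<bullet> (y - x)\<bar> \<le> real CARD('n) * K * (norm (y - x))\<^sup>2"
proof -
  have "\<bar>f y - f x - (\<Sum>i\<in>UNIV. grad f x $ i * (y $ i - x $ i))\<bar>
    \<le> real CARD('n) * (K * norm (y - x)) * norm (y - x)"
  proof (rule partials_linear_approx[OF C_lip_has_partial_grad])
    fix i w assume "norm (w - x) \<le> norm (y - x)"
    then show "\<bar>grad f w $ i - grad f x $ i\<bar> \<le> K * norm (y - x)"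
      using C_lip_lipschitz[OF C_lip_grad_component, of w i x] C_lip_nonneg[OF f]
        mult_left_mono[of "norm (w - x)" "norm (y - x)" K] by linarith
  qed
  then show ?thesis by (simp add: inner_vec_def power2_eq_square mult.assoc)
qed

end

text \<open>The mechanism of \<open>C_lip_limit\<close> again: the limits of the partial derivatives
  are partial derivatives of \<open>F\<close>, and by uniqueness they are the components of its
  gradient.\<close>

lemma grad_limit:
  fixes F :: "real^'n \<Rightarrow> real"
  assumes f: "\<And>n. f n \<in> C_lip (Suc k) K" and lim: "\<And>x. (\<lambda>n. f n x) \<longlonglongrightarrow> F x"
  shows "(\<lambda>n. grad (f n) x) \<longlonglongrightarrow> grad F x"
proof (rule vec_tendstoI)
  fix i
  have F: "F \<in> C_lip (Suc k) K" by (rule C_lip_limit[OF f lim])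
  have rem: "\<bar>f n (x + h *\<^sub>R axis i 1) - f n x - h * grad (f n) x $ i\<bar> \<le> K * h\<^sup>2" for n x h i
    by (rule partial_remainder[OF C_lip_has_partial_grad[OF f] C_lip_0D[OF C_lip_grad_component[OF f]]])
  define G where "G x = lim (\<lambda>n. grad (f n) x $ i)" for x
  have l: "(\<lambda>n. grad (f n) x $ i) \<longlonglongrightarrow> G x" for x
    unfolding G_def convergent_LIMSEQ_iff[symmetric]
    by (rule remainder_convergent[where f=f, OF _ rem]) (use lim convergent_def in blast)
  have "\<bar>F (x + h *\<^sub>R axis i 1) - F x - h * G x\<bar> \<le> K * h\<^sup>2" for x h
    by (rule LIMSEQ_le_const2[of "\<lambda>n. \<bar>f n (x + h *\<^sub>R axis i 1) - f n x - h * grad (f n) x $ i\<bar>"])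
       (use rem in \<open>auto intro!: tendsto_intros lim l\<close>)
  then have "has_partial F i G" by (rule has_partialI_remainder)
  then have "G = (\<lambda>x. grad F x $ i)"
    by (rule has_partial_unique[OF _ C_lip_has_partial_grad[OF F]])
  then show "(\<lambda>n. grad (f n) x $ i) \<longlonglongrightarrow> grad F x $ i"
    using l[of x] by simp
qed

lemma C_lip_translate: "f \<in> C_lip k K \<Longrightarrow> (\<lambda>x. f (x + v)) \<in> C_lip k K"
proof (induction k arbitrary: f)
  case 0
  have "\<bar>f (x + v) - f (y + v)\<bar> \<le> K * norm (x - y)" for x y
    using C_lip_lipschitz[OF 0, of "x + v" "y + v"] by simp
  then show ?case using C_lip_bound[OF 0] by simp
next
  case (Suc k)
  have "(\<lambda>x. f (x + v)) \<in> C_lip 0 K"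
  proof -
    have "\<bar>f (x + v) - f (y + v)\<bar> \<le> K * norm (x - y)" for x y
      using C_lip_lipschitz[OF Suc.prems, of "x + v" "y + v"] by simp
    then show ?thesis using C_lip_bound[OF Suc.prems] by simp
  qed
  moreover obtain g where g: "\<And>i. g i \<in> C_lip k K" "\<And>i. has_partial f i (g i)"
    using C_lip_SucE[OF Suc.prems] by metis
  moreover have "has_partial (\<lambda>x. f (x + v)) i (\<lambda>x. g i (x + v))" for i
  proof
    fix x
    show "((\<lambda>h. f (x + h *\<^sub>R axis i 1 + v)) has_real_derivative g i (x + v)) (at 0)"
      using g(2)[of i, THEN spec, of "x + v"] by (simp add: algebra_simps)
  qed
  ultimately show ?case
    using C_lip_SucI[of "\<lambda>x. f (x + v)" K "\<lambda>i x. g i (x + v)" k] Suc.IH[OF g(1)] by blast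
qed

lemma C_lip_cmult:
  assumes "0 \<le> c" "f \<in> C_lip k K"
  shows "(\<lambda>x. c * f x) \<in> C_lip k (c * K)"
  using assms(2)
proof (induction k arbitrary: f)
  have base: "(\<lambda>x. c * f x) \<in> C_lip 0 (c * K)" if "f \<in> C_lip k K" for k and f :: "real^'a \<Rightarrow> real"
  proof -
    have "\<bar>c * f x - c * f y\<bar> \<le> c * K * norm (x - y)" for x y
    proof -
      have "\<bar>c * f x - c * f y\<bar> = c * \<bar>f x - f y\<bar>"
        using assms(1) by (simp add: right_diff_distrib[symmetric] abs_mult)
      then show ?thesis
        using C_lip_lipschitz[OF that, of x y] assms(1) by (simp add: mult.assoc mult_left_mono)
    qed
    moreover have "\<bar>c * f x\<bar> \<le> c * K" for x
      using C_lip_bound[OF that, of x] assms(1) by (simp add: abs_mult mult_left_mono)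
    ultimately show ?thesis by simp
  qed
  {
    case 0
    then show ?case by (rule base)
  next
    case (Suc k)
    have "has_partial (\<lambda>x. c * f x) i (\<lambda>x. c * grad f x $ i)" for i
      using C_lip_has_partial_grad[OF Suc.prems, of i] DERIV_cmult by blast
    then show ?case
      by (rule C_lip_SucI[OF base[OF Suc.prems] Suc.IH[OF C_lip_grad_component[OF Suc.prems]]])
  }
qed

lemma norm_le_components: "(\<And>j. \<bar>x $ j\<bar> \<le> c) \<Longrightarrow> norm (x :: real^'n) \<le> real CARD('n) * c"
  using order_trans[OF norm_le_l1_cart sum_mono[of UNIV "\<lambda>j. \<bar>x $ j\<bar>" "\<lambda>j. c"]] by simp

text \<open>The factor \<open>1 + C * \<delta>\<close> is what keeps the bounds of an Euler scheme finite in the limit.\<close>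

lemma C_lip_compose_drift:
  fixes A :: "real^'n^'n"
  assumes D: "0 \<le> D"
  shows "\<exists>C\<ge>0. \<forall>\<delta> p f K. 0 \<le> \<delta> \<longrightarrow> \<delta> \<le> D \<longrightarrow> (\<forall>j. (\<lambda>x. p x $ j) \<in> C_lip k KB) \<longrightarrow>
    f \<in> C_lip k K \<longrightarrow> (\<lambda>x. f (x + \<delta> *\<^sub>R (A *v x + p x))) \<in> C_lip k (K * (1 + C * \<delta>))"
proof (induction k)
  \<comment> \<open>A Lipschitz constant of \<open>A *v x + p x\<close>, so that the step map has
    Lipschitz constant \<open>1 + C0 * \<delta>\<close>. The linear part is kept apart from
    \<open>p\<close> because it is in general unbounded and then lies in no class
    \<open>C_lip\<close>.\<close>
  define C0 where "C0 = onorm ((*v) A) + real CARD('n) * \<bar>KB\<bar>"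
  have A_bl: "bounded_linear ((*v) A)" by simp
  have C0: "0 \<le> C0"
    using onorm_pos_le[OF A_bl] by (simp add: C0_def)
  have lip: "norm ((x + \<delta> *\<^sub>R (A *v x + p x)) - (y + \<delta> *\<^sub>R (A *v y + p y))) \<le> (1 + C0 * \<delta>) * norm (x - y)"
    if "0 \<le> \<delta>" and p: "\<forall>j. (\<lambda>x. p x $ j) \<in> C_lip k KB" for \<delta> k x y and p :: "real^'n \<Rightarrow> real^'n"
  proof -
    have "norm (p x - p y) \<le> real CARD('n) * (KB * norm (x - y))"
      by (rule norm_le_components) (use p C_lip_lipschitz in fastforce)
    also have "\<dots> \<le> real CARD('n) * \<bar>KB\<bar> * norm (x - y)"
      by (simp add: mult.assoc mult_left_mono mult_right_mono)
    finally have 1: "norm (p x - p y) \<le> real CARD('n) * \<bar>KB\<bar> * norm (x - y)" .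
    have 2: "norm (A *v (x - y)) \<le> onorm ((*v) A) * norm (x - y)"
      by (rule onorm[OF A_bl])
    have "norm (A *v (x - y) + (p x - p y)) \<le> C0 * norm (x - y)"
      using norm_triangle_ineq[of "A *v (x - y)" "p x - p y"] 1 2
      unfolding C0_def distrib_right by linarith
    then have 3: "norm (\<delta> *\<^sub>R (A *v (x - y) + (p x - p y))) \<le> \<delta> * (C0 * norm (x - y))"
      using that(1) by (simp add: mult_left_mono)
    have "(x + \<delta> *\<^sub>R (A *v x + p x)) - (y + \<delta> *\<^sub>R (A *v y + p y))
      = (x - y) + \<delta> *\<^sub>R (A *v (x - y) + (p x - p y))"
      by (simp add: algebra_simps matrix_vector_mult_diff_distrib)
    then have "norm ((x + \<delta> *\<^sub>R (A *v x + p x)) - (y + \<delta> *\<^sub>R (A *v y + p y)))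
      = norm ((x - y) + \<delta> *\<^sub>R (A *v (x - y) + (p x - p y)))"
      by (rule arg_cong)
    also have "\<dots> \<le> norm (x - y) + \<delta> * (C0 * norm (x - y))"
      using norm_triangle_ineq[of "x - y" "\<delta> *\<^sub>R (A *v (x - y) + (p x - p y))"] 3 by linarith
    finally show ?thesis by (simp add: algebra_simps)
  qed
  have base: "(\<lambda>x. f (x + \<delta> *\<^sub>R (A *v x + p x))) \<in> C_lip 0 (K * (1 + C0 * \<delta>))"
    if \<delta>: "0 \<le> \<delta>" and p: "\<forall>j. (\<lambda>x. p x $ j) \<in> C_lip k KB" and f: "f \<in> C_lip k K"
    for \<delta> k K and p :: "real^'n \<Rightarrow> real^'n" and f :: "real^'n \<Rightarrow> real"
  proof -
    have K: "0 \<le> K" using f by (rule C_lip_nonneg)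
    have "\<bar>f x\<bar> \<le> K * (1 + C0 * \<delta>)" for x
      using C_lip_bound[OF f, of x] K C0 \<delta> mult_left_mono[of 1 "1 + C0 * \<delta>" K] by simp
    moreover have "\<bar>f (x + \<delta> *\<^sub>R (A *v x + p x)) - f (y + \<delta> *\<^sub>R (A *v y + p y))\<bar>
        \<le> K * (1 + C0 * \<delta>) * norm (x - y)" for x y
      using order_trans[OF C_lip_lipschitz[OF f] mult_left_mono[OF lip[OF \<delta> p] K]]
      by (simp add: mult.assoc)
    ultimately show ?thesis by simp
  qed
  {
    case 0
    show ?case using base C0 by (intro exI[of _ C0]) blast
  next
    case (Suc k)
    then obtain C where C: "0 \<le> C" and IH: "\<And>\<delta> p f K. 0 \<le> \<delta> \<Longrightarrow> \<delta> \<le> D \<Longrightarrow> \<forall>j. (\<lambda>x. p x $ j) \<in> C_lip k KB \<Longrightarrow>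
      f \<in> C_lip k K \<Longrightarrow> (\<lambda>x. f (x + \<delta> *\<^sub>R (A *v x + p x))) \<in> C_lip k (K * (1 + C * \<delta>))"
      by blast
    define KA where "KA = \<bar>KB\<bar> + (\<Sum>i\<in>UNIV. \<Sum>j\<in>UNIV. \<bar>A $ i $ j\<bar>)"
    have A_KA: "\<bar>A $ i $ j\<bar> + \<bar>KB\<bar> \<le> KA" for i j
    proof -
      have "\<bar>A $ i $ j\<bar> \<le> (\<Sum>j\<in>UNIV. \<bar>A $ i $ j\<bar>)"
        by (rule member_le_sum) auto
      also have "\<dots> \<le> (\<Sum>i\<in>UNIV. \<Sum>j\<in>UNIV. \<bar>A $ i $ j\<bar>)"
        by (rule member_le_sum[of i UNIV "\<lambda>i. \<Sum>j\<in>UNIV. \<bar>A $ i $ j\<bar>"]) (auto intro: sum_nonneg)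
      finally show ?thesis by (simp add: KA_def)
    qed
    have KA: "0 \<le> KA" using A_KA[of undefined undefined] by linarith
    \<comment> \<open>Dictated by the bound for \<open>G\<close> below: \<open>C\<close> for the
      leading composition, and \<open>CARD('n)\<close> products, each with the factor
      \<open>2 ^ Suc k\<close> of \<open>C_lip_mult\<close>, where \<open>\<delta> \<le> D\<close>
      absorbs the term quadratic in \<delta>. \<open>C0\<close> covers order 0.\<close>
    define C' where "C' = C0 + C + real CARD('n) * (2 ^ Suc k * KA * (1 + C * D))"
    have C': "0 \<le> C'" using C0 C D KA by (simp add: C'_def)
    have "(\<lambda>x. f (x + \<delta> *\<^sub>R (A *v x + p x))) \<in> C_lip (Suc k) (K * (1 + C' * \<delta>))"
      if \<delta>: "0 \<le> \<delta>" "\<delta> \<le> D" and p: "\<forall>j. (\<lambda>x. p x $ j) \<in> C_lip (Suc k) KB" and f: "f \<in> C_lip (Suc k) K"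
      for \<delta> K and p :: "real^'n \<Rightarrow> real^'n" and f :: "real^'n \<Rightarrow> real"
    proof -
      let ?\<psi> = "\<lambda>x. x + \<delta> *\<^sub>R (A *v x + p x)"
      have K: "0 \<le> K" using f by (rule C_lip_nonneg)
      have pk: "\<forall>j. (\<lambda>x. p x $ j) \<in> C_lip k KB" using p C_lip_Suc_D by blast
      define q where "q j i x = grad (\<lambda>x. p x $ j) x $ i" for j i x
      have q: "q j i \<in> C_lip k KB" "has_partial (\<lambda>x. p x $ j) i (q j i)" for j i
        using C_lip_grad_component[OF p[THEN spec]] C_lip_has_partial_grad[OF p[THEN spec]]
        unfolding q_def by blast+
      define g where "g i x = grad f x $ i" for i x
      have g: "g i \<in> C_lip k K" for i
        using C_lip_grad_component[OF f] unfolding g_def .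
      \<comment> \<open>The chain rule with the identity part of the step map split off: only the
        remaining sum carries the factor \<delta>, which keeps the constant in the form
        \<open>1 + C' * \<delta>\<close>.\<close>
      define G where "G i x = g i (?\<psi> x) + \<delta> * (\<Sum>j\<in>UNIV. (A $ j $ i + q j i x) * g j (?\<psi> x))" for i x
      have g\<psi>: "(\<lambda>x. g i (?\<psi> x)) \<in> C_lip k (K * (1 + C * \<delta>))" for i
        by (rule IH[OF \<delta> pk g])
      have Aq: "(\<lambda>x. A $ j $ i + q j i x) \<in> C_lip k KA" for i j
      proof -
        have "KB \<le> \<bar>KB\<bar>" by simp
        from C_lip_mono[OF C_lip_add[OF C_lip_const[OF order_refl] C_lip_mono[OF q(1) this]] A_KA]
        show ?thesis .
      qed
      have G: "G i \<in> C_lip k (K * (1 + C' * \<delta>))" for i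
      proof -
        let ?S = "2 ^ Suc k * KA * (K * (1 + C * \<delta>))"
        have sum: "(\<lambda>x. \<Sum>j\<in>UNIV. (A $ j $ i + q j i x) * g j (?\<psi> x)) \<in> C_lip k (\<Sum>j\<in>(UNIV::'n set). ?S)"
          by (rule C_lip_sum[OF finite C_lip_mult[OF Aq g\<psi>]])
        have S0: "0 \<le> ?S" using KA K C \<delta> by simp
        have "G i \<in> C_lip k (K * (1 + C * \<delta>) + \<delta> * (\<Sum>j\<in>(UNIV::'n set). ?S))"
          unfolding G_def by (rule C_lip_add[OF g\<psi> C_lip_cmult[OF \<delta>(1) sum]])
        moreover have "K * (1 + C * \<delta>) + \<delta> * (\<Sum>j\<in>(UNIV::'n set). ?S) \<le> K * (1 + C' * \<delta>)"
        proof -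
          have "?S \<le> K * (2 ^ Suc k * KA * (1 + C * D))"
            using mult_left_mono[of "1 + C * \<delta>" "1 + C * D" "2 ^ Suc k * KA * K"]
              mult_left_mono[OF \<delta>(2) C] KA K by (simp add: algebra_simps)
          then have "\<delta> * (real CARD('n) * ?S) \<le> \<delta> * (real CARD('n) * (K * (2 ^ Suc k * KA * (1 + C * D))))"
            using \<delta> by (intro mult_left_mono) auto
          moreover have "0 \<le> K * C0 * \<delta>" using K C0 \<delta> by simp
          ultimately show ?thesis
            by (simp add: C'_def algebra_simps)
        qed
        ultimately show ?thesis by (rule C_lip_mono)
      qed
      have "has_partial (\<lambda>x. f (?\<psi> x)) i (G i)" for i
      proof (rule has_partialI_remainder)
        fix x and h :: real
        let ?e = "axis i 1 :: real^'n"
        let ?y = "?\<psi> (x + h *\<^sub>R ?e)" and ?x = "?\<psi> x"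
        \<comment> \<open>The derivative of the step map in direction \<open>?e\<close>. Its
          remainder is quadratic in \<open>h\<close> with the constant of \<open>p\<close> alone,
          since the linear part leaves no remainder.\<close>
        define w where "w = ?e + \<delta> *\<^sub>R (A *v ?e + (\<chi> j. q j i x))"
        have Gw: "G i x = grad f ?x \<bullet> w"
        proof -
          have "grad f ?x \<bullet> w = grad f ?x \<bullet> ?e + \<delta> * (grad f ?x \<bullet> (A *v ?e + (\<chi> j. q j i x)))"
            by (simp add: w_def inner_add_right)
          also have "grad f ?x \<bullet> ?e = g i ?x" by (simp add: inner_axis g_def)
          also have "grad f ?x \<bullet> (A *v ?e + (\<chi> j. q j i x)) = (\<Sum>j\<in>UNIV. (A $ j $ i + q j i x) * g j ?x)"
            by (simp add: inner_vec_def matrix_vector_mult_basis column_def g_def mult.commute)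
          finally show ?thesis by (simp add: G_def)
        qed
        have yx: "norm (?y - ?x) \<le> (1 + C0 * \<delta>) * \<bar>h\<bar>"
          using lip[OF \<delta>(1) p, of "x + h *\<^sub>R ?e" x] by simp
        have rem: "norm (?y - ?x - h *\<^sub>R w) \<le> \<delta> * (real CARD('n) * (KB * h\<^sup>2))"
        proof -
          have "?y - ?x - h *\<^sub>R w = \<delta> *\<^sub>R (p (x + h *\<^sub>R ?e) - p x - h *\<^sub>R (\<chi> j. q j i x))"
            by (simp add: w_def algebra_simps matrix_vector_right_distrib matrix_vector_mult_scaleR)
          moreover have "norm (p (x + h *\<^sub>R ?e) - p x - h *\<^sub>R (\<chi> j. q j i x)) \<le> real CARD('n) * (KB * h\<^sup>2)"
          proof (rule norm_le_components)
            fix j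
            show "\<bar>(p (x + h *\<^sub>R ?e) - p x - h *\<^sub>R (\<chi> j. q j i x)) $ j\<bar> \<le> KB * h\<^sup>2"
              using partial_remainder[OF q(2)[where j=j and i=i] C_lip_0D[OF q(1)[where j=j and i=i]], of x h] by simp
          qed
          ultimately show ?thesis using \<delta> by (simp add: mult_left_mono)
        qed
        have "\<bar>f ?y - f ?x - h * G i x\<bar> \<le> \<bar>f ?y - f ?x - grad f ?x \<bullet> (?y - ?x)\<bar> + \<bar>grad f ?x \<bullet> (?y - ?x - h *\<^sub>R w)\<bar>"
          unfolding Gw by (simp add: inner_diff_right)
        also have "\<dots> \<le> real CARD('n) * K * (norm (?y - ?x))\<^sup>2 + (real CARD('n) * K) * (\<delta> * (real CARD('n) * (KB * h\<^sup>2)))"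
          using order_trans[OF Cauchy_Schwarz_ineq2 mult_mono[OF norm_grad_le[OF f] rem]] K
          by (intro add_mono C_lip_taylor[OF f]) auto
        also have "\<dots> \<le> real CARD('n) * K * ((1 + C0 * \<delta>) * \<bar>h\<bar>)\<^sup>2 + (real CARD('n) * K) * (\<delta> * (real CARD('n) * (KB * h\<^sup>2)))"
          using K by (intro add_right_mono mult_left_mono power_mono yx) auto
        also have "\<dots> = (real CARD('n) * K * (1 + C0 * \<delta>)\<^sup>2 + (real CARD('n) * K) * (\<delta> * (real CARD('n) * KB))) * h\<^sup>2"
          unfolding power_mult_distrib power2_abs by (simp only: distrib_right mult.assoc)
        finally show "\<bar>f ?y - f ?x - h * G i x\<bar> \<le> (real CARD('n) * K * (1 + C0 * \<delta>)\<^sup>2 + (real CARD('n) * K) * (\<delta> * (real CARD('n) * KB))) * h\<^sup>2" .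
      qed
      moreover have "(\<lambda>x. f (?\<psi> x)) \<in> C_lip 0 (K * (1 + C' * \<delta>))"
      proof (rule C_lip_0_mono[OF base[OF \<delta>(1) p f]])
        have "C0 \<le> C'" using C D KA by (simp add: C'_def)
        then show "K * (1 + C0 * \<delta>) \<le> K * (1 + C' * \<delta>)"
          using K \<delta> by (intro mult_left_mono add_left_mono mult_right_mono) auto
      qed
      ultimately show ?thesis
        using G C_lip_SucI by blast
    qed
    then show ?case using C' by blast
  }
qed

section \<open>The Euler scheme\<close>

text \<open>In each step the noise increment is added before the drift is applied. For a cadlag path the
  drift is then sampled to the right of the current time, so that convergence needs only
  right-continuity.\<close>

primrec euler :: "(real \<Rightarrow> real^'n \<Rightarrow> real^'n) \<Rightarrow> real \<Rightarrow> real \<Rightarrow> (nat \<Rightarrow> real^'n) \<Rightarrow> nat \<Rightarrow> real^'n \<Rightarrow> real^'n" where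
  "euler b r \<delta> d 0 y = y"
| "euler b r \<delta> d (Suc k) y = (let v = euler b r \<delta> d k y + d k in v + \<delta> *\<^sub>R b (r + real (Suc k) * \<delta>) v)"

lemma euler_cong: "(\<And>j. j < k \<Longrightarrow> d j = d' j) \<Longrightarrow> euler b r \<delta> d k y = euler b r \<delta> d' k y"
  by (induction k) (auto simp: Let_def)

text \<open>The last step is composed into \<open>f\<close>, which multiplies the constant by
  \<open>1 + C * \<delta>\<close>, and the earlier steps are left to the induction hypothesis; hence
  \<open>f\<close> and \<open>K\<close> vary in the induction. The noise is a mere translation and
  costs nothing.\<close>

lemma C_lip_euler:
  assumes step: "\<And>t f K. t \<in> {0..T} \<Longrightarrow> f \<in> C_lip k K \<Longrightarrow>
      (\<lambda>x. f (x + \<delta> *\<^sub>R b t x)) \<in> C_lip k (K * (1 + C * \<delta>))"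
    and r: "0 \<le> r" "r + real n * \<delta> \<le> T" "0 \<le> \<delta>" and C: "0 \<le> C" and f: "f \<in> C_lip k K"
  shows "(\<lambda>y. f (euler b r \<delta> d n y)) \<in> C_lip k (K * exp (C * (real n * \<delta>)))"
proof -
  have "(\<lambda>y. f (euler b r \<delta> d n y)) \<in> C_lip k (K * (1 + C * \<delta>) ^ n)"
    using r(2) f
  proof (induction n arbitrary: f K)
    case 0
    then show ?case by simp
  next
    case (Suc n)
    have "r + real (Suc n) * \<delta> \<in> {0..T}" using Suc.prems(1) r by simp
    from C_lip_translate[OF step[OF this Suc.prems(2)], of "d n"]
    have "(\<lambda>x. f (x + d n + \<delta> *\<^sub>R b (r + real (Suc n) * \<delta>) (x + d n))) \<in> C_lip k (K * (1 + C * \<delta>))" .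
    moreover have "r + real n * \<delta> \<le> T"
      using Suc.prems(1) r(3) by (simp add: algebra_simps)
    ultimately show ?case
      using Suc.IH[of "\<lambda>x. f (x + d n + \<delta> *\<^sub>R b (r + real (Suc n) * \<delta>) (x + d n))" "K * (1 + C * \<delta>)"]
      by (simp add: Let_def mult.assoc mult.commute mult.left_commute)
  qed
  moreover have "K * (1 + C * \<delta>) ^ n \<le> K * exp (C * (real n * \<delta>))"
  proof -
    have "(1 + C * \<delta>) ^ n \<le> exp (C * \<delta>) ^ n"
      using C r by (intro power_mono) (auto simp: add.commute intro: exp_ge_add_one_self)
    also have "\<dots> = exp (C * (real n * \<delta>))"
      by (simp add: exp_of_nat_mult[symmetric] algebra_simps)
    finally show ?thesis using C_lip_nonneg[OF f] by (rule mult_left_mono)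
  qed
  ultimately show ?thesis by (rule C_lip_mono)
qed

section \<open>Boundedness and right-continuity of cadlag paths\<close>

lemma locally_bounded_imp_bounded:
  fixes x :: "real \<Rightarrow> 'b::real_normed_vector"
  assumes "\<And>u. u \<in> {s..T} \<Longrightarrow> \<exists>B. eventually (\<lambda>v. norm (x v) \<le> B) (at u within {s..T})"
  shows "\<exists>B. \<forall>u\<in>{s..T}. norm (x u) \<le> B"
proof (rule ccontr)
  assume "\<not> ?thesis"
  then have "\<forall>n::nat. \<exists>u\<in>{s..T}. real n < norm (x u)"
    by (meson not_le)
  then obtain u where u: "\<And>n. u n \<in> {s..T}" "\<And>n::nat. real n < norm (x (u n))"
    by metis
  have "seq_compact {s..T}" by (simp add: compact_imp_seq_compact)
  then obtain l r where l: "l \<in> {s..T}" "strict_mono r" "(u \<circ> r) \<longlonglongrightarrow> l"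
    using u(1) by (meson seq_compactE)
  obtain B where "eventually (\<lambda>v. norm (x v) \<le> B) (at l within {s..T})"
    using assms[OF l(1)] by blast
  \<comment> \<open>A punctured neighbourhood says nothing about \<open>l\<close> itself, while the
    subsequence may hit \<open>l\<close>; hence the maximum with the value there.\<close>
  then have "eventually (\<lambda>v. v \<in> {s..T} \<longrightarrow> norm (x v) \<le> max B (norm (x l))) (nhds l)"
    unfolding eventually_at_filter by eventually_elim auto
  then have ev1: "eventually (\<lambda>n. norm (x (u (r n))) \<le> max B (norm (x l))) sequentially"
    using l(3) u(1) by (auto simp: filterlim_iff o_def dest: filterlim_compose)
  obtain N :: nat where N: "max B (norm (x l)) < real N"
    using reals_Archimedean2 by blast
  have "eventually (\<lambda>n. n \<ge> N) sequentially" by (rule eventually_ge_at_top)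
  with ev1 have "eventually (\<lambda>n. False) sequentially"
  proof eventually_elim
    case (elim n)
    have "real N \<le> real (r n)" using seq_suble[OF l(2), of n] elim by simp
    then show ?case using u(2)[of "r n"] elim N by linarith
  qed
  then show False by simp
qed

lemma cadlag_on_bounded:
  fixes x :: "real \<Rightarrow> 'b::real_normed_vector"
  assumes "cadlag_on {s..T} x"
  shows "\<exists>B. \<forall>u\<in>{s..T}. norm (x u) \<le> B"
proof (rule locally_bounded_imp_bounded)
  fix u assume u: "u \<in> {s..T}"
  have lim: "\<exists>B. eventually (\<lambda>v. norm (x v) \<le> B) F" if l: "(x \<longlongrightarrow> l) F" for l F
  proof -
    have "eventually (\<lambda>v. dist (x v) l < 1) F"
      using l by (rule tendstoD) simp
    then have "eventually (\<lambda>v. norm (x v) \<le> norm l + 1) F"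
    proof eventually_elim
      case (elim v)
      then show ?case using norm_triangle_ineq2[of "x v" l] by (simp add: dist_norm)
    qed
    then show ?thesis by blast
  qed
  obtain B1 B2 where B: "eventually (\<lambda>v. norm (x v) \<le> B1) (at u within ({s..T} \<inter> {u<..}))"
    "eventually (\<lambda>v. norm (x v) \<le> B2) (at u within ({s..T} \<inter> {..<u}))"
    using assms u lim unfolding cadlag_on_def by metis
  have "at u within {s..T} = sup (at u within ({s..T} \<inter> {u<..})) (at u within ({s..T} \<inter> {..<u}))"
  proof -
    have "{s..T} - {u} = (({s..T} \<inter> {u<..}) \<union> ({s..T} \<inter> {..<u}))" by auto
    moreover have "at u within {s..T} = at u within ({s..T} - {u})"
      by (simp add: at_within_def)
    ultimately show ?thesis by (simp add: at_within_union)
  qed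
  moreover have "eventually (\<lambda>v. norm (x v) \<le> max B1 B2) (sup (at u within ({s..T} \<inter> {u<..})) (at u within ({s..T} \<inter> {..<u})))"
    unfolding eventually_sup using B by (auto elim: eventually_mono)
  ultimately show "\<exists>B. eventually (\<lambda>v. norm (x v) \<le> B) (at u within {s..T})"
    by auto
qed

lemma cadlag_on_right_continuous:
  assumes "cadlag_on {s..T} x" "u \<in> {s..T}" "t \<le> T"
  shows "continuous (at u within {u..t}) x"
proof -
  have "(x \<longlongrightarrow> x u) (at u within ({s..T} \<inter> {u<..}))"
    using assms unfolding cadlag_on_def by blast
  moreover have "at u within {u..t} \<le> at u within ({s..T} \<inter> {u<..})"
    using assms unfolding at_within_def by (intro inf_mono) auto
  ultimately show ?thesis
    unfolding continuous_within by (rule tendsto_mono[rotated])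
qed

text \<open>\<open>b\<close> stands for the whole drift \<open>A *v x + B t x\<close>, which may
  grow linearly, so a growth bound takes the place of boundedness. A single \<kappa> plays both
  roles, so that all Gronwall factors are exponentials of \<kappa> times a length of time.\<close>

locale drift =
  fixes T :: real and b :: "real \<Rightarrow> real^'n \<Rightarrow> real^'n" and \<kappa> :: real
  assumes T: "0 < T" and \<kappa>: "0 \<le> \<kappa>"
    and b_continuous: "continuous_on ({0..T} \<times> UNIV) (\<lambda>(t, x). b t x)"
    and b_lipschitz: "t \<in> {0..T} \<Longrightarrow> norm (b t x - b t y) \<le> \<kappa> * norm (x - y)"
    and b_growth: "t \<in> {0..T} \<Longrightarrow> norm (b t x) \<le> \<kappa> * (1 + norm x)"
begin

lemma b_tendsto:
  assumes "u \<in> {0..T}" "\<And>n. v n \<in> {0..T}" "v \<longlonglongrightarrow> u" "y \<longlonglongrightarrow> x"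
  shows "(\<lambda>n. b (v n) (y n)) \<longlonglongrightarrow> b u x"
proof -
  have "(\<lambda>n. (\<lambda>(t, x). b t x) (v n, y n)) \<longlonglongrightarrow> (\<lambda>(t, x). b t x) (u, x)"
    by (rule continuous_on_tendsto_compose[OF b_continuous])
       (use assms in \<open>auto intro!: tendsto_Pair\<close>)
  then show ?thesis by simp
qed

text \<open>Discrete Gronwall estimate. Three errors accumulate: the initial one; the variation of
  the drift along the path within each cell, measured by \<open>G\<close> from the right end of the
  cell; and \<open>\<delta> * \<kappa> * B\<close> per unit of time, because the scheme evaluates
  \<open>b\<close> at a point that lacks the drift of the current cell.\<close>

lemma euler_error:
  fixes x z :: "real \<Rightarrow> real^'n"
  defines "\<beta> \<equiv> \<lambda>\<rho>. b \<rho> (x \<rho>)"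
  assumes rt: "0 \<le> r" "r \<le> t" "t \<le> T"
    and int: "set_integrable lborel {r..t} \<beta>"
    and eq: "\<And>u. u \<in> {r..t} \<Longrightarrow> x u = x r + (LINT \<rho>:{r..u}|lborel. \<beta> \<rho>) + (z u - z r)"
    and bnd: "\<And>u. u \<in> {r..t} \<Longrightarrow> norm (\<beta> u) \<le> B"
    and \<delta>: "0 \<le> \<delta>" "k \<le> n" "r + real n * \<delta> = t"
    and d: "\<And>j. d j = z (r + real (Suc j) * \<delta>) - z (r + real j * \<delta>)"
    and G: "\<And>j \<rho>. j < n \<Longrightarrow> \<rho> \<in> {r + real j * \<delta><..r + real (Suc j) * \<delta>} \<Longrightarrow> G \<rho> = norm (\<beta> \<rho> - \<beta> (r + real (Suc j) * \<delta>))"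
    and G_int: "set_integrable lborel {r<..t} G"
  shows "norm (x (r + real k * \<delta>) - euler b r \<delta> d k y)
    \<le> (norm (x r - y) + (LINT \<rho>:{r<..r + real k * \<delta>}|lborel. G \<rho>) + real k * \<delta> * (\<delta> * \<kappa> * B)) * exp (\<kappa> * (real k * \<delta>))"
  using \<delta>(2)
proof (induction k)
  case 0
  then show ?case by (simp add: set_lebesgue_integral_def)
next
  case (Suc k)
  define \<tau> where "\<tau> j = r + real j * \<delta>" for j
  have \<tau>_Suc: "\<tau> (Suc k) = \<tau> k + \<delta>" by (simp add: \<tau>_def algebra_simps)
  have \<tau>_le: "\<tau> j \<le> t" "r \<le> \<tau> j" if "j \<le> n" for j
    using that \<delta> mult_right_mono[of "real j" "real n" \<delta>] by (auto simp: \<tau>_def)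
  note k = \<tau>_le[of k] \<tau>_le[of "Suc k"]
  have kn: "k \<le> n" "Suc k \<le> n" using Suc.prems by auto
  have \<tau>T: "\<tau> (Suc k) \<in> {0..T}" using k kn rt by auto
  have B: "0 \<le> B" using order_trans[OF norm_ge_zero bnd[of r]] rt by simp
  define E where "E = euler b r \<delta> d k y"
  define e where "e = norm (x (\<tau> k) - E)"
  define v where "v = E + d k"
  define I where "I = (LINT \<rho>:{\<tau> k<..\<tau> (Suc k)}|lborel. \<beta> \<rho>)"
  define a where "a = (LINT \<rho>:{\<tau> k<..\<tau> (Suc k)}|lborel. G \<rho>)"
  have sub: "set_integrable lborel S \<beta>" if "S \<subseteq> {r..t}" "S \<in> sets lborel" for S
    using set_integrable_subset[OF int] that by blast
  have subG: "set_integrable lborel S G" if "S \<subseteq> {r<..t}" "S \<in> sets lborel" for S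
    using set_integrable_subset[OF G_int] that by blast
  have split: "(LINT \<rho>:{r..\<tau> (Suc k)}|lborel. \<beta> \<rho>) = (LINT \<rho>:{r..\<tau> k}|lborel. \<beta> \<rho>) + I"
  proof -
    have un: "{r..\<tau> (Suc k)} = {r..\<tau> k} \<union> {\<tau> k<..\<tau> (Suc k)}"
      using k kn \<tau>_Suc \<delta> by auto
    show ?thesis
      unfolding I_def un by (rule set_integral_Un) (use k kn rt in \<open>auto intro!: sub\<close>)
  qed
  have splitG: "(LINT \<rho>:{r<..\<tau> (Suc k)}|lborel. G \<rho>) = (LINT \<rho>:{r<..\<tau> k}|lborel. G \<rho>) + a"
  proof -
    have un: "{r<..\<tau> (Suc k)} = {r<..\<tau> k} \<union> {\<tau> k<..\<tau> (Suc k)}"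
      using k kn \<tau>_Suc \<delta> by auto
    show ?thesis
      unfolding a_def un by (rule set_integral_Un) (use k kn rt in \<open>auto intro!: subG\<close>)
  qed
  have xs: "x (\<tau> (Suc k)) = x (\<tau> k) + I + d k"
  proof -
    have e1: "x (\<tau> (Suc k)) = x r + ((LINT \<rho>:{r..\<tau> k}|lborel. \<beta> \<rho>) + I) + (z (\<tau> (Suc k)) - z r)"
      using eq[of "\<tau> (Suc k)"] k kn split by simp
    have e2: "x (\<tau> k) = x r + (LINT \<rho>:{r..\<tau> k}|lborel. \<beta> \<rho>) + (z (\<tau> k) - z r)"
      using eq[of "\<tau> k"] k kn by simp
    have e3: "d k = z (\<tau> (Suc k)) - z (\<tau> k)"
      unfolding d \<tau>_def ..
    show ?thesis unfolding e1 e2 e3 by simp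
  qed
  have cellI: "set_integrable lborel {\<tau> k<..\<tau> (Suc k)} \<beta>"
    by (rule sub) (use k kn in auto)
  have I_le: "norm I \<le> \<delta> * B"
  proof -
    have "norm I \<le> (LINT \<rho>:{\<tau> k<..\<tau> (Suc k)}|lborel. norm (\<beta> \<rho>))"
      unfolding I_def by (rule set_integral_norm_bound) (use k kn in \<open>auto intro!: sub\<close>)
    also have "\<dots> \<le> (LINT \<rho>:{\<tau> k<..\<tau> (Suc k)}|lborel. B)"
    proof (rule set_integral_mono)
      show "set_integrable lborel {\<tau> k<..\<tau> (Suc k)} (\<lambda>\<rho>. norm (\<beta> \<rho>))"
        by (rule set_integrable_norm) (use k kn in \<open>auto intro!: sub\<close>)
      show "set_integrable lborel {\<tau> k<..\<tau> (Suc k)} (\<lambda>\<rho>. B)"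
        unfolding set_integrable_def using \<tau>_Suc \<delta> by simp
    qed (use bnd k kn in auto)
    also have "\<dots> = \<delta> * B"
      using \<delta> by (simp add: set_lebesgue_integral_def \<tau>_Suc)
    finally show ?thesis .
  qed
  have step: "norm (I - \<delta> *\<^sub>R \<beta> (\<tau> (Suc k))) \<le> a"
  proof -
    have "I - \<delta> *\<^sub>R \<beta> (\<tau> (Suc k)) = (LINT \<rho>:{\<tau> k<..\<tau> (Suc k)}|lborel. \<beta> \<rho> - \<beta> (\<tau> (Suc k)))"
    proof -
      have "(LINT \<rho>:{\<tau> k<..\<tau> (Suc k)}|lborel. \<beta> (\<tau> (Suc k))) = \<delta> *\<^sub>R \<beta> (\<tau> (Suc k))"
        using \<delta> by (simp add: set_lebesgue_integral_def \<tau>_Suc)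
      moreover have "set_integrable lborel {\<tau> k<..\<tau> (Suc k)} (\<lambda>\<rho>. \<beta> (\<tau> (Suc k)))"
        unfolding set_integrable_def using \<tau>_Suc \<delta> by simp
      ultimately show ?thesis
        unfolding I_def using cellI by (subst set_integral_diff) auto
    qed
    also have "norm \<dots> \<le> (LINT \<rho>:{\<tau> k<..\<tau> (Suc k)}|lborel. norm (\<beta> \<rho> - \<beta> (\<tau> (Suc k))))"
    proof (rule set_integral_norm_bound)
      show "set_integrable lborel {\<tau> k<..\<tau> (Suc k)} (\<lambda>\<rho>. \<beta> \<rho> - \<beta> (\<tau> (Suc k)))"
        using cellI \<tau>_Suc \<delta>
        by (intro set_integral_diff) (auto simp: set_integrable_def)
    qed
    also have "\<dots> = a"
      unfolding a_def
    proof (rule set_lebesgue_integral_cong)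
      show "\<forall>\<rho>. \<rho> \<in> {\<tau> k<..\<tau> (Suc k)} \<longrightarrow> norm (\<beta> \<rho> - \<beta> (\<tau> (Suc k))) = G \<rho>"
        using G[of k] kn by (auto simp: \<tau>_def)
    qed simp
    finally show ?thesis .
  qed
  have a0: "0 \<le> a" using step norm_ge_zero order_trans by blast
  have SG: "0 \<le> (LINT \<rho>:{r<..\<tau> k}|lborel. G \<rho>)"
  proof -
    have "0 \<le> indicat_real {r<..\<tau> k} \<rho> * G \<rho>" for \<rho>
    proof (cases "\<rho> \<in> {r<..\<tau> k}")
      case True
      then have \<delta>0: "0 < \<delta>" using \<delta> by (cases "\<delta> = 0") (auto simp: \<tau>_def)
      define j where "j = nat (\<lceil>(\<rho> - r) / \<delta>\<rceil> - 1)"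
      have c1: "0 < (\<rho> - r) / \<delta>" using True \<delta>0 by simp
      then have c: "1 \<le> \<lceil>(\<rho> - r) / \<delta>\<rceil>" by linarith
      have j: "real j = real_of_int \<lceil>(\<rho> - r) / \<delta>\<rceil> - 1" using c by (simp add: j_def)
      have "real j < (\<rho> - r) / \<delta>" "(\<rho> - r) / \<delta> \<le> real j + 1"
        unfolding j by linarith+
      then have j1: "real j * \<delta> < \<rho> - r" "\<rho> - r \<le> (real j + 1) * \<delta>"
        using \<delta>0 by (simp_all add: field_simps)
      have "real j * \<delta> < real k * \<delta>" using j1 True by (simp add: \<tau>_def)
      then have "j < k" using \<delta>0 by simp
      then have "G \<rho> = norm (\<beta> \<rho> - \<beta> (r + real (Suc j) * \<delta>))"
        by (intro G) (use kn j1 in \<open>auto simp: algebra_simps\<close>)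
      then show ?thesis by simp
    qed simp
    then show ?thesis
      unfolding set_lebesgue_integral_def by (intro integral_nonneg_AE) auto
  qed
  have ev: "euler b r \<delta> d (Suc k) y = v + \<delta> *\<^sub>R b (\<tau> (Suc k)) v"
    by (simp add: Let_def v_def E_def \<tau>_def)
  \<comment> \<open>The point \<open>v\<close> has received the noise of the cell but not its drift,
    which is at most \<open>\<delta> * B\<close>.\<close>
  have xv: "norm (x (\<tau> (Suc k)) - v) \<le> e + \<delta> * B"
  proof -
    have "x (\<tau> (Suc k)) - v = (x (\<tau> k) - E) + I" by (simp add: xs v_def)
    then show ?thesis
      using norm_triangle_ineq[of "x (\<tau> k) - E" I] I_le by (simp add: e_def)
  qed
  have "x (\<tau> (Suc k)) - euler b r \<delta> d (Suc k) y =
      (x (\<tau> k) - E) + (I - \<delta> *\<^sub>R \<beta> (\<tau> (Suc k))) + \<delta> *\<^sub>R (b (\<tau> (Suc k)) (x (\<tau> (Suc k))) - b (\<tau> (Suc k)) v)"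
    unfolding ev by (simp add: xs v_def \<beta>_def algebra_simps)
  then have "norm (x (\<tau> (Suc k)) - euler b r \<delta> d (Suc k) y) \<le> e + a + \<delta> * (\<kappa> * (e + \<delta> * B))"
  proof -
    have "norm (\<delta> *\<^sub>R (b (\<tau> (Suc k)) (x (\<tau> (Suc k))) - b (\<tau> (Suc k)) v)) \<le> \<delta> * (\<kappa> * (e + \<delta> * B))"
      using order_trans[OF b_lipschitz[OF \<tau>T] mult_left_mono[OF xv \<kappa>]] \<delta> by (simp add: mult_left_mono)
    then show ?thesis
      unfolding \<open>x (\<tau> (Suc k)) - euler b r \<delta> d (Suc k) y = _\<close>
      using step norm_triangle_ineq[of "x (\<tau> k) - E + (I - \<delta> *\<^sub>R \<beta> (\<tau> (Suc k)))"
          "\<delta> *\<^sub>R (b (\<tau> (Suc k)) (x (\<tau> (Suc k))) - b (\<tau> (Suc k)) v)"]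
        norm_triangle_ineq[of "x (\<tau> k) - E" "I - \<delta> *\<^sub>R \<beta> (\<tau> (Suc k))"]
      unfolding e_def by linarith
  qed
  also have "\<dots> = (1 + \<kappa> * \<delta>) * e + (a + \<delta> * (\<delta> * \<kappa> * B))"
    by (simp add: algebra_simps)
  also have "\<dots> \<le> exp (\<kappa> * \<delta>) * ((norm (x r - y) + (LINT \<rho>:{r<..\<tau> k}|lborel. G \<rho>) + real k * \<delta> * (\<delta> * \<kappa> * B)) * exp (\<kappa> * (real k * \<delta>)))
     + (a + \<delta> * (\<delta> * \<kappa> * B)) * exp (\<kappa> * (real (Suc k) * \<delta>))"
  proof (rule add_mono)
    show "(1 + \<kappa> * \<delta>) * e \<le> exp (\<kappa> * \<delta>) * ((norm (x r - y) + (LINT \<rho>:{r<..\<tau> k}|lborel. G \<rho>) + real k * \<delta> * (\<delta> * \<kappa> * B)) * exp (\<kappa> * (real k * \<delta>)))"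
      using Suc.IH kn by (intro mult_mono) (auto simp: e_def E_def \<tau>_def)
    show "a + \<delta> * (\<delta> * \<kappa> * B) \<le> (a + \<delta> * (\<delta> * \<kappa> * B)) * exp (\<kappa> * (real (Suc k) * \<delta>))"
      using a0 \<delta> \<kappa> B mult_left_mono[of 1 "exp (\<kappa> * (real (Suc k) * \<delta>))" "a + \<delta> * (\<delta> * \<kappa> * B)"] by simp
  qed
  also have "\<dots> = (norm (x r - y) + ((LINT \<rho>:{r<..\<tau> k}|lborel. G \<rho>) + a) + real (Suc k) * \<delta> * (\<delta> * \<kappa> * B)) * exp (\<kappa> * (real (Suc k) * \<delta>))"
  proof -
    have "exp (\<kappa> * (real (Suc k) * \<delta>)) = exp (\<kappa> * \<delta>) * exp (\<kappa> * (real k * \<delta>))"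
      by (simp add: exp_add[symmetric] algebra_simps)
    then show ?thesis by (simp add: algebra_simps)
  qed
  finally show ?case
    unfolding splitG[symmetric] by (simp add: \<tau>_def)
qed

text \<open>The starting points \<open>y n\<close> may vary: the Markov property needs a scheme on a
  second interval that starts from the scheme on the first. The drift along the path is bounded, so
  the quadrature error vanishes by dominated convergence.\<close>

lemma euler_converges:
  fixes x z :: "real \<Rightarrow> real^'n" and y :: "nat \<Rightarrow> real^'n"
  assumes rt: "0 \<le> r" "r \<le> t" "t \<le> T"
    and int: "set_integrable lborel {r..t} (\<lambda>\<rho>. b \<rho> (x \<rho>))"
    and eq: "\<And>u. u \<in> {r..t} \<Longrightarrow> x u = x r + (LINT \<rho>:{r..u}|lborel. b \<rho> (x \<rho>)) + (z u - z r)"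
    and bnd: "\<And>u. u \<in> {r..t} \<Longrightarrow> norm (x u) \<le> B"
    and cont: "\<And>u. u \<in> {r..t} \<Longrightarrow> continuous (at u within {u..t}) x"
    and y: "y \<longlonglongrightarrow> x r"
    and \<delta>: "\<And>n. \<delta> n = (t - r) / real (Suc n)"
    and d: "\<And>n j. j < Suc n \<Longrightarrow> d n j = z (r + real (Suc j) * \<delta> n) - z (r + real j * \<delta> n)"
  shows "(\<lambda>n. euler b r (\<delta> n) (d n) (Suc n) (y n)) \<longlonglongrightarrow> x t"
proof -
  define \<beta> where "\<beta> \<rho> = b \<rho> (x \<rho>)" for \<rho>
  define B' where "B' = \<kappa> * (1 + B)"
  have \<beta>B: "norm (\<beta> u) \<le> B'" if "u \<in> {r..t}" for u
    using order_trans[OF b_growth[of u "x u"] mult_left_mono[OF add_left_mono[OF bnd[OF that], of 1] \<kappa>]] that rt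
    by (simp add: \<beta>_def B'_def)
  have \<delta>0: "0 \<le> \<delta> n" for n using rt by (simp add: \<delta>)
  have \<delta>n: "real (Suc n) * \<delta> n = t - r" for n by (simp add: \<delta>)
  have final: "r + real (Suc n) * \<delta> n = t" for n by (simp only: \<delta>n)
  have \<delta>lim: "\<delta> \<longlonglongrightarrow> 0"
    unfolding \<delta> divide_inverse using tendsto_mult_left[OF LIMSEQ_inverse_real_of_nat, of "t - r"] by simp
  \<comment> \<open>The step function that takes on each cell the value of the drift at the right
    end, so that the integral of \<open>G n\<close> is the quadrature error.\<close>
  define \<gamma> where "\<gamma> n \<rho> = (\<Sum>j<Suc n. indicat_real {r + real j * \<delta> n<..r + real (Suc j) * \<delta> n} \<rho> *\<^sub>R \<beta> (r + real (Suc j) * \<delta> n))" for n \<rho>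
  define G where "G n \<rho> = norm (\<beta> \<rho> - \<gamma> n \<rho>)" for n \<rho>
  have \<gamma>: "\<gamma> n \<rho> = \<beta> (r + real (Suc j) * \<delta> n)"
    if "j < Suc n" "\<rho> \<in> {r + real j * \<delta> n<..r + real (Suc j) * \<delta> n}" for n j \<rho>
  proof -
    have \<delta>p: "0 < \<delta> n" using that(2) \<delta>0[of n] by (auto simp: algebra_simps)
    have ij: "i = j" if "\<rho> \<in> {r + real i * \<delta> n<..r + real (Suc i) * \<delta> n}" for i
    proof -
      have "real i * \<delta> n < real (Suc j) * \<delta> n" "real j * \<delta> n < real (Suc i) * \<delta> n"
        using that \<open>\<rho> \<in> {r + real j * \<delta> n<..r + real (Suc j) * \<delta> n}\<close> by auto
      then show ?thesis using \<delta>p by (simp del: of_nat_Suc)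
    qed
    have "indicat_real {r + real i * \<delta> n<..r + real (Suc i) * \<delta> n} \<rho> *\<^sub>R \<beta> (r + real (Suc i) * \<delta> n)
      = (if i = j then \<beta> (r + real (Suc j) * \<delta> n) else 0)" for i
    proof (cases "i = j")
      case True
      then show ?thesis using that(2) by simp
    next
      case False
      then have "\<rho> \<notin> {r + real i * \<delta> n<..r + real (Suc i) * \<delta> n}" using ij by blast
      then show ?thesis using False by simp
    qed
    then show ?thesis
      unfolding \<gamma>_def using that(1) by (simp add: sum.delta del: of_nat_Suc sum.lessThan_Suc)
  qed
  have cell: "\<exists>j<Suc n. \<rho> \<in> {r + real j * \<delta> n<..r + real (Suc j) * \<delta> n}" if "\<rho> \<in> {r<..t}" for n \<rho>
  proof -
    have \<delta>p: "0 < \<delta> n" using that by (simp add: \<delta>)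
    define j where "j = nat (\<lceil>(\<rho> - r) / \<delta> n\<rceil> - 1)"
    have "0 < (\<rho> - r) / \<delta> n" using that \<delta>p by simp
    then have c: "1 \<le> \<lceil>(\<rho> - r) / \<delta> n\<rceil>" by linarith
    have j: "real j = real_of_int \<lceil>(\<rho> - r) / \<delta> n\<rceil> - 1" using c by (simp add: j_def)
    have "real j < (\<rho> - r) / \<delta> n" "(\<rho> - r) / \<delta> n \<le> real j + 1"
      unfolding j by linarith+
    then have j1: "real j * \<delta> n < \<rho> - r" "\<rho> - r \<le> (real j + 1) * \<delta> n"
      using \<delta>p by (simp_all add: field_simps)
    have "real j * \<delta> n < real (Suc n) * \<delta> n" using j1 that \<delta>n[of n] by simp
    then have "j < Suc n" using \<delta>p by (simp del: of_nat_Suc)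
    then show ?thesis using j1 by (auto simp: algebra_simps)
  qed
  have grid: "r + real (Suc j) * \<delta> n \<in> {r..t}" if "j < Suc n" for j n
    using mult_right_mono[of "real (Suc j)" "real (Suc n)" "\<delta> n"] that \<delta>0[of n] \<delta>n[of n]
    by (auto simp del: of_nat_Suc)
  have meas: "(\<lambda>\<rho>. indicat_real {r<..t} \<rho> *\<^sub>R \<beta> \<rho>) \<in> borel_measurable lborel"
  proof -
    have "set_integrable lborel {r<..t} \<beta>"
      using int unfolding \<beta>_def[symmetric] by (rule set_integrable_subset) auto
    then show ?thesis unfolding set_integrable_def by (rule borel_measurable_integrable)
  qed
  have \<gamma>m [measurable]: "\<gamma> n \<in> borel_measurable lborel" for n
    unfolding \<gamma>_def by measurable
  have Gm: "(\<lambda>\<rho>. indicat_real {r<..t} \<rho> *\<^sub>R G n \<rho>) \<in> borel_measurable lborel" for n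
  proof -
    have "(\<lambda>\<rho>. norm (indicat_real {r<..t} \<rho> *\<^sub>R \<beta> \<rho> - indicat_real {r<..t} \<rho> *\<^sub>R \<gamma> n \<rho>)) \<in> borel_measurable lborel"
      using meas by measurable
    moreover have "norm (indicat_real {r<..t} \<rho> *\<^sub>R \<beta> \<rho> - indicat_real {r<..t} \<rho> *\<^sub>R \<gamma> n \<rho>) = indicat_real {r<..t} \<rho> *\<^sub>R G n \<rho>" for \<rho>
      by (simp add: G_def indicator_def)
    ultimately show ?thesis by simp
  qed
  have Gb: "norm (indicat_real {r<..t} \<rho> *\<^sub>R G n \<rho>) \<le> indicat_real {r<..t} \<rho> *\<^sub>R (2 * B')" for n \<rho>
  proof (cases "\<rho> \<in> {r<..t}")
    case True
    then obtain j where j: "j < Suc n" "\<rho> \<in> {r + real j * \<delta> n<..r + real (Suc j) * \<delta> n}"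
      using cell by blast
    have "norm (\<beta> \<rho> - \<beta> (r + real (Suc j) * \<delta> n)) \<le> B' + B'"
      using True by (intro order_trans[OF norm_triangle_ineq4] add_mono \<beta>B grid j) auto
    then show ?thesis using True by (simp add: G_def \<gamma>[OF j] del: of_nat_Suc)
  qed simp
  have dom: "integrable lborel (\<lambda>\<rho>. indicat_real {r<..t} \<rho> *\<^sub>R (2 * B'))"
    using rt by simp
  have G_int: "set_integrable lborel {r<..t} (G n)" for n
    unfolding set_integrable_def
  proof (rule Bochner_Integration.integrable_bound[OF dom Gm], rule AE_I2)
    show "norm (indicat_real {r<..t} \<rho> *\<^sub>R G n \<rho>) \<le> norm (indicat_real {r<..t} \<rho> *\<^sub>R (2 * B'))" for \<rho>
      using Gb[of \<rho> n] abs_ge_self order_trans unfolding real_norm_def by blast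
  qed
  \<comment> \<open>The right end \<open>u n\<close> of the cell containing the time
    \<open>\<rho>\<close> satisfies \<open>\<rho> \<le> u n\<close> and
    \<open>u n \<le> \<rho> + \<delta> n\<close>, so that right-continuity of the path at this time
    is enough.\<close>
  have G_lim: "(\<lambda>n. indicat_real {r<..t} \<rho> *\<^sub>R G n \<rho>) \<longlonglongrightarrow> 0" for \<rho>
  proof (cases "\<rho> \<in> {r<..t}")
    case True
    have "\<forall>n. \<exists>j. j < Suc n \<and> \<rho> \<in> {r + real j * \<delta> n<..r + real (Suc j) * \<delta> n}"
      using cell[OF True] by blast
    from choice[OF this] obtain j where j: "\<And>n. j n < Suc n"
      "\<And>n. \<rho> \<in> {r + real (j n) * \<delta> n<..r + real (Suc (j n)) * \<delta> n}" by blast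
    define u where "u n = r + real (Suc (j n)) * \<delta> n" for n
    have u1: "u n \<in> {\<rho>..t}" for n
      using grid[OF j(1)[of n]] j(2)[of n] unfolding u_def by auto
    have u2: "u n \<le> \<rho> + \<delta> n" for n
      using j(2)[of n] by (auto simp: u_def algebra_simps)
    have ul: "u \<longlonglongrightarrow> \<rho>"
    proof (rule tendsto_sandwich[where f="\<lambda>n. \<rho>" and h="\<lambda>n. \<rho> + \<delta> n"])
      show "(\<lambda>n. \<rho> + \<delta> n) \<longlonglongrightarrow> \<rho>"
        using tendsto_add[OF tendsto_const \<delta>lim] by simp
    qed (use u1 u2 in auto)
    have "\<rho> \<in> {r..t}" using True by auto
    from cont[OF this] have "(\<lambda>n. x (u n)) \<longlonglongrightarrow> x \<rho>"
      using u1 ul unfolding continuous_within_sequentially by (auto simp: o_def)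
    then have "(\<lambda>n. \<beta> (u n)) \<longlonglongrightarrow> \<beta> \<rho>"
      unfolding \<beta>_def
    proof (rule b_tendsto[OF _ _ ul, rotated 2])
      show "u n \<in> {0..T}" for n using u1[of n] True rt by auto
      show "\<rho> \<in> {0..T}" using True rt by auto
    qed
    then have "(\<lambda>n. norm (\<beta> \<rho> - \<beta> (u n))) \<longlonglongrightarrow> norm (\<beta> \<rho> - \<beta> \<rho>)"
      by (intro tendsto_intros)
    then show ?thesis
      using True by (simp add: G_def \<gamma>[OF j] u_def[symmetric] del: of_nat_Suc)
  qed simp
  have GI: "(\<lambda>n. LINT \<rho>:{r<..t}|lborel. G n \<rho>) \<longlonglongrightarrow> 0"
  proof -
    have "(\<lambda>n. LINT \<rho>|lborel. indicat_real {r<..t} \<rho> *\<^sub>R G n \<rho>) \<longlonglongrightarrow> (LINT \<rho>|(lborel :: real measure). 0)"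
    proof (rule integral_dominated_convergence[where w="\<lambda>\<rho>. indicat_real {r<..t} \<rho> *\<^sub>R (2 * B')"])
      show "AE \<rho> in lborel. norm (indicat_real {r<..t} \<rho> *\<^sub>R G n \<rho>) \<le> indicat_real {r<..t} \<rho> *\<^sub>R (2 * B')" for n
        by (rule AE_I2) (rule Gb)
      show "AE \<rho> in lborel. (\<lambda>n. indicat_real {r<..t} \<rho> *\<^sub>R G n \<rho>) \<longlonglongrightarrow> 0"
        by (rule AE_I2) (rule G_lim)
    qed (use Gm dom in auto)
    then show ?thesis by (simp add: set_lebesgue_integral_def)
  qed
  have err: "norm (x t - euler b r (\<delta> n) (d n) (Suc n) (y n)) \<le>
    (norm (x r - y n) + (LINT \<rho>:{r<..t}|lborel. G n \<rho>) + (t - r) * (\<delta> n * \<kappa> * B')) * exp (\<kappa> * (t - r))" for n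
  proof -
    have "norm (x (r + real (Suc n) * \<delta> n) - euler b r (\<delta> n) (\<lambda>j. z (r + real (Suc j) * \<delta> n) - z (r + real j * \<delta> n)) (Suc n) (y n))
    \<le> (norm (x r - y n) + (LINT \<rho>:{r<..r + real (Suc n) * \<delta> n}|lborel. G n \<rho>) + real (Suc n) * \<delta> n * (\<delta> n * \<kappa> * B')) * exp (\<kappa> * (real (Suc n) * \<delta> n))"
    proof (rule euler_error[OF rt int eq])
      show "G n \<rho> = norm (b \<rho> (x \<rho>) - b (r + real (Suc j) * \<delta> n) (x (r + real (Suc j) * \<delta> n)))"
        if "j < Suc n" "\<rho> \<in> {r + real j * \<delta> n<..r + real (Suc j) * \<delta> n}" for j \<rho>
        using \<gamma>[OF that] by (simp add: G_def \<beta>_def del: of_nat_Suc)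
      show "norm (b u (x u)) \<le> B'" if "u \<in> {r..t}" for u
        using \<beta>B[OF that] by (simp add: \<beta>_def)
    qed (auto simp: final \<delta>0 G_int simp del: of_nat_Suc)
    moreover have "euler b r (\<delta> n) (\<lambda>j. z (r + real (Suc j) * \<delta> n) - z (r + real j * \<delta> n)) (Suc n) (y n)
      = euler b r (\<delta> n) (d n) (Suc n) (y n)"
      by (rule euler_cong) (use d in simp)
    ultimately show ?thesis by (simp only: final \<delta>n add_diff_cancel_left' diff_add_cancel add.commute[of r])
  qed
  have "(\<lambda>n. x t - euler b r (\<delta> n) (d n) (Suc n) (y n)) \<longlonglongrightarrow> 0"
  proof (rule Lim_null_comparison[OF always_eventually[OF allI[OF err]]])
    have "(\<lambda>n. (norm (x r - y n) + (LINT \<rho>:{r<..t}|lborel. G n \<rho>) + (t - r) * (\<delta> n * \<kappa> * B')) * exp (\<kappa> * (t - r)))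
      \<longlonglongrightarrow> (norm (x r - x r) + 0 + (t - r) * (0 * \<kappa> * B')) * exp (\<kappa> * (t - r))"
      by (intro tendsto_intros y GI \<delta>lim)
    then show "(\<lambda>n. (norm (x r - y n) + (LINT \<rho>:{r<..t}|lborel. G n \<rho>) + (t - r) * (\<delta> n * \<kappa> * B')) * exp (\<kappa> * (t - r))) \<longlonglongrightarrow> 0"
      by simp
  qed
  from tendsto_diff[OF tendsto_const[of "x t"] this] show ?thesis by simp
qed

end

section \<open>Subordinated Brownian motion\<close>

lemma closed_indicator_limit:
  fixes C :: "'b::metric_space set"
  assumes "closed C" "C \<noteq> {}"
  shows "(\<lambda>k. max 0 (1 - real k * infdist x C)) \<longlonglongrightarrow> indicator C x"
proof (cases "x \<in> C")
  case True
  then show ?thesis by simp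
next
  case False
  then have d: "0 < infdist x C"
    using assms by (metis in_closed_iff_infdist_zero infdist_nonneg less_eq_real_def)
  obtain N :: nat where N: "1 / infdist x C < real N"
    using reals_Archimedean2 by blast
  have "max 0 (1 - real k * infdist x C) = 0" if "k \<ge> N" for k
  proof -
    have "1 < real N * infdist x C" using N d by (simp add: field_simps)
    also have "\<dots> \<le> real k * infdist x C" using that d by simp
    finally show ?thesis by simp
  qed
  then have "eventually (\<lambda>k. max 0 (1 - real k * infdist x C) = 0) sequentially"
    unfolding eventually_sequentially by blast
  then show ?thesis using False by (simp add: tendsto_eventually)
qed

text \<open>Continuous functions approximate the indicators of closed sets, and these form an
  intersection-stable generator of the Borel sets. Only continuous test functions are at hand
  because the product formula for \<open>Z\<close> is obtained as a limit along grids.\<close>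

lemma (in prob_space) indep_vars_of_expectation_prod:
  fixes X :: "'i \<Rightarrow> 'a \<Rightarrow> 'b::metric_space"
  assumes "finite I" and X [measurable]: "\<And>i. i \<in> I \<Longrightarrow> X i \<in> borel_measurable M"
    and prod: "\<And>f. (\<And>i. continuous_on UNIV (f i)) \<Longrightarrow> (\<And>i x. 0 \<le> f i x \<and> f i x \<le> (1::real)) \<Longrightarrow>
      expectation (\<lambda>\<omega>. \<Prod>i\<in>I. f i (X i \<omega>)) = (\<Prod>i\<in>I. expectation (\<lambda>\<omega>. f i (X i \<omega>)))"
  shows "indep_vars (\<lambda>_. borel) X I"
proof -
  define F where "F i = {X i -` C \<inter> space M | C. closed C}" for i
  have gen: "{X i -` A \<inter> space M | A. A \<in> sets borel} = sigma_sets (space M) (F i)" if "i \<in> I" for i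
  proof -
    have "sets borel = sigma_sets UNIV {C :: 'b set. closed C}"
      by (simp add: borel_eq_closed)
    then show ?thesis
      using sigma_sets_vimage_commute[of "X i" "space M" UNIV "{C :: 'b set. closed C}"]
      unfolding F_def by auto
  qed
  have stable: "Int_stable (F i)" for i
    unfolding Int_stable_def F_def
  proof safe
    fix C C' :: "'b set" assume "closed C" "closed C'"
    then show "\<exists>D. X i -` C \<inter> space M \<inter> (X i -` C' \<inter> space M) = X i -` D \<inter> space M \<and> closed D"
      by (intro exI[of _ "C \<inter> C'"]) auto
  qed
  have "indep_sets F I"
    unfolding indep_sets_def
  proof (intro conjI ballI allI impI)
    fix i assume i: "i \<in> I"
    show "F i \<subseteq> events"
      unfolding F_def using measurable_sets[OF X[OF i]] by auto
  next
    fix J A assume J: "J \<subseteq> I" "J \<noteq> {}" "finite J" and A: "A \<in> Pi J F"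
    have "\<forall>j. \<exists>C. j \<in> J \<longrightarrow> closed C \<and> A j = X j -` C \<inter> space M"
    proof
      fix j
      show "\<exists>C. j \<in> J \<longrightarrow> closed C \<and> A j = X j -` C \<inter> space M"
      proof (cases "j \<in> J")
        case True
        then have "A j \<in> F j" using A by (rule Pi_mem[rotated])
        then show ?thesis unfolding F_def by blast
      qed simp
    qed
    from choice[OF this] obtain C where C: "\<And>j. j \<in> J \<Longrightarrow> closed (C j)" "\<And>j. j \<in> J \<Longrightarrow> A j = X j -` C j \<inter> space M"
      by blast
    \<comment> \<open>Factors outside \<open>J\<close> are 1, so that the hypothesis on all of
      \<open>I\<close> covers every subfamily. The empty set is treated apart because
      \<open>infdist\<close> to it is 0, which would produce the constant 1 in place of 0.\<close>
    define f :: "nat \<Rightarrow> 'i \<Rightarrow> 'b \<Rightarrow> real" where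
      "f k j x = (if j \<in> J then if C j = {} then 0 else max 0 (1 - real k * infdist x (C j)) else 1)" for k j x
    define g :: "'i \<Rightarrow> 'b \<Rightarrow> real" where "g j x = (if j \<in> J then indicator (C j) x else 1)" for j x
    have fc: "continuous_on UNIV (f k j)" for k j
      unfolding f_def by (cases "j \<in> J"; cases "C j = {}") (auto intro!: continuous_intros)
    have f01: "0 \<le> f k j x \<and> f k j x \<le> 1" for k j x
      by (auto simp: f_def infdist_nonneg)
    have fg: "(\<lambda>k. f k j x) \<longlonglongrightarrow> g j x" for j x
      unfolding f_def g_def using closed_indicator_limit[OF C(1), of j x] by (cases "C j = {}") auto
    have fm [measurable]: "f k j \<in> borel_measurable borel" for k j
      by (intro borel_measurable_continuous_onI fc)
    have gm: "(\<lambda>\<omega>. g j (X j \<omega>)) \<in> borel_measurable M" if "j \<in> I" for j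
      by (rule borel_measurable_LIMSEQ_real[of M "\<lambda>k \<omega>. f k j (X j \<omega>)"]) (use fg X[OF that] in auto)
    have 1: "(\<lambda>k. expectation (\<lambda>\<omega>. \<Prod>i\<in>I. f k i (X i \<omega>))) \<longlonglongrightarrow> expectation (\<lambda>\<omega>. \<Prod>i\<in>I. g i (X i \<omega>))"
    proof (rule integral_dominated_convergence[where w="\<lambda>_. 1"])
      show "AE \<omega> in M. norm (\<Prod>i\<in>I. f k i (X i \<omega>)) \<le> 1" for k
        using f01 by (auto simp: abs_prod intro!: prod_le_1)
    qed (auto intro!: AE_I2 tendsto_prod fg borel_measurable_prod gm)
    have 2: "(\<lambda>k. \<Prod>i\<in>I. expectation (\<lambda>\<omega>. f k i (X i \<omega>))) \<longlonglongrightarrow> (\<Prod>i\<in>I. expectation (\<lambda>\<omega>. g i (X i \<omega>)))"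
    proof (rule tendsto_prod)
      fix i assume i: "i \<in> I"
      show "(\<lambda>k. expectation (\<lambda>\<omega>. f k i (X i \<omega>))) \<longlonglongrightarrow> expectation (\<lambda>\<omega>. g i (X i \<omega>))"
        by (rule integral_dominated_convergence[where w="\<lambda>_. 1"]) (use f01 i in \<open>auto intro!: AE_I2 fg gm\<close>)
    qed
    have eq: "expectation (\<lambda>\<omega>. \<Prod>i\<in>I. g i (X i \<omega>)) = (\<Prod>i\<in>I. expectation (\<lambda>\<omega>. g i (X i \<omega>)))"
      using 1 2 unfolding prod[OF fc f01] by (rule LIMSEQ_unique)
    have meas: "X j -` C j \<inter> space M \<in> events" if "j \<in> J" for j
      using measurable_sets[OF X[of j], of "C j"] C(1)[OF that] J that by auto
    have "expectation (\<lambda>\<omega>. \<Prod>i\<in>I. g i (X i \<omega>)) = prob (\<Inter>j\<in>J. A j)"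
    proof -
      have "(\<Prod>i\<in>I. g i (X i \<omega>)) = indicator (\<Inter>j\<in>J. A j) \<omega>" if "\<omega> \<in> space M" for \<omega>
      proof -
        have "(\<Prod>i\<in>I. g i (X i \<omega>)) = (\<Prod>i\<in>J. indicator (C i) (X i \<omega>))"
          using J \<open>finite I\<close> by (intro prod.mono_neutral_cong_right) (auto simp: g_def)
        also have "\<dots> = indicator (\<Inter>j\<in>J. A j) \<omega>"
        proof (cases "\<forall>j\<in>J. X j \<omega> \<in> C j")
          case True
          then show ?thesis using that C(2) by (simp add: indicator_def)
        next
          case False
          then have "(\<Prod>i\<in>J. indicator (C i) (X i \<omega>)) = (0::real)"
            using J(3) by (auto simp: prod_zero_iff indicator_def)
          moreover have "\<omega> \<notin> (\<Inter>j\<in>J. A j)" using False C(2) by auto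
          ultimately show ?thesis by simp
        qed
        finally show ?thesis .
      qed
      then have "expectation (\<lambda>\<omega>. \<Prod>i\<in>I. g i (X i \<omega>)) = expectation (indicator (\<Inter>j\<in>J. A j))"
        by (intro Bochner_Integration.integral_cong) auto
      moreover have "(\<Inter>j\<in>J. A j) \<in> events"
        using J meas C(2) by (intro sets.finite_INT) auto
      ultimately show ?thesis
        using sets.sets_into_space[of "\<Inter>j\<in>J. A j" M] by (simp add: Int_absorb2)
    qed
    moreover have "(\<Prod>i\<in>I. expectation (\<lambda>\<omega>. g i (X i \<omega>))) = (\<Prod>j\<in>J. prob (A j))"
    proof -
      have "(\<Prod>i\<in>I. expectation (\<lambda>\<omega>. g i (X i \<omega>))) = (\<Prod>j\<in>J. expectation (\<lambda>\<omega>. g j (X j \<omega>)))"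
        using J \<open>finite I\<close> by (intro prod.mono_neutral_right) (auto simp: g_def prob_space)
      also have "\<dots> = (\<Prod>j\<in>J. prob (A j))"
      proof (rule prod.cong[OF refl])
        fix j assume j: "j \<in> J"
        have "expectation (\<lambda>\<omega>. g j (X j \<omega>)) = expectation (indicator (A j))"
          using j C(2)[OF j] by (intro Bochner_Integration.integral_cong) (auto simp: g_def indicator_def)
        then show "expectation (\<lambda>\<omega>. g j (X j \<omega>)) = prob (A j)"
          using C(2)[OF j] by (simp add: Int_assoc)
      qed
      finally show ?thesis .
    qed
    ultimately show "prob (\<Inter>j\<in>J. A j) = (\<Prod>j\<in>J. prob (A j))"
      using eq by simp
  qed
  from indep_sets_sigma[OF this stable]
  have "indep_sets (\<lambda>i. {X i -` A \<inter> space M | A. A \<in> sets borel}) I"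
    using gen by (subst indep_sets_cong[OF refl gen]) auto
  then show ?thesis
    unfolding indep_vars_def2 using X by auto
qed

text \<open>This is where completeness enters: \<open>Z t\<close> is a limit of measurable variables
  only almost everywhere, since path continuity of \<open>W\<close> and positivity of
  \<open>L\<close> hold only almost surely.\<close>

lemma (in complete_measure) measurable_AE_eq:
  fixes f :: "'a \<Rightarrow> 'b::topological_space"
  assumes "f \<in> borel_measurable M" "AE \<omega> in M. f \<omega> = g \<omega>"
  shows "g \<in> borel_measurable M"
proof (rule measurableI)
  fix A :: "'b set" assume "A \<in> sets borel"
  then have "f -` A \<inter> space M \<in> sets M" using assms(1) by (rule measurable_sets[rotated])
  moreover have "AE \<omega> in M. \<omega> \<in> f -` A \<inter> space M \<longleftrightarrow> \<omega> \<in> g -` A \<inter> space M"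
    using assms(2) by eventually_elim auto
  ultimately show "g -` A \<inter> space M \<in> sets M"
    using in_sets_AE by blast
qed auto

lemma levy_process_expectation_prod:
  fixes f :: "nat \<Rightarrow> 'b::euclidean_space \<Rightarrow> real"
  assumes X: "levy_process M X" and t: "mono t" "0 \<le> t 0"
    and f [measurable]: "\<And>j. f j \<in> borel_measurable borel" and fb: "\<And>j x. \<bar>f j x\<bar> \<le> 1"
  shows "(\<integral>\<omega>. (\<Prod>j<n. f j (X (t (Suc j)) \<omega> - X (t j) \<omega>)) \<partial>M) = (\<Prod>j<n. \<integral>\<omega>. f j (X (t (Suc j) - t j) \<omega>) \<partial>M)"
proof -
  interpret prob_space M using X by (simp add: levy_process_def)
  have t0: "0 \<le> t j" for j using t(2) monoD[OF t(1), of 0 j] by simp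
  have tS: "t j \<le> t (Suc j)" for j using monoD[OF t(1), of j "Suc j"] by simp
  have Xm [measurable]: "X (t j) \<in> borel_measurable M" for j
    using X t0 by (simp add: levy_process_def)
  have Xd [measurable]: "X (t (Suc j) - t j) \<in> borel_measurable M" for j
    using X tS[of j] by (simp add: levy_process_def)
  have "indep_vars (\<lambda>_. borel) (\<lambda>i \<omega>. X (t (Suc i)) \<omega> - X (t i) \<omega>) {..<n}"
    using X t by (simp add: levy_process_def)
  then have "indep_vars (\<lambda>_. borel) (\<lambda>i \<omega>. f i (X (t (Suc i)) \<omega> - X (t i) \<omega>)) {..<n}"
    by (rule indep_vars_compose2) simp
  then have "(\<integral>\<omega>. (\<Prod>j<n. f j (X (t (Suc j)) \<omega> - X (t j) \<omega>)) \<partial>M) = (\<Prod>j<n. \<integral>\<omega>. f j (X (t (Suc j)) \<omega> - X (t j) \<omega>) \<partial>M)"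
    by (intro indep_vars_lebesgue_integral) (auto intro!: integrable_const_bound[where B=1] AE_I2 simp: fb)
  moreover have "(\<integral>\<omega>. f j (X (t (Suc j)) \<omega> - X (t j) \<omega>) \<partial>M) = (\<integral>\<omega>. f j (X (t (Suc j) - t j) \<omega>) \<partial>M)" for j
  proof -
    have "distr M borel (\<lambda>\<omega>. X (t j + (t (Suc j) - t j)) \<omega> - X (t j) \<omega>) = distr M borel (X (t (Suc j) - t j))"
      using X t0[of j] tS[of j] unfolding levy_process_def by (metis diff_ge_0_iff_ge)
    then have "(\<integral>x. f j x \<partial>distr M borel (\<lambda>\<omega>. X (t (Suc j)) \<omega> - X (t j) \<omega>)) = (\<integral>x. f j x \<partial>distr M borel (X (t (Suc j) - t j)))"
      by simp
    then show ?thesis by (simp add: integral_distr)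
  qed
  ultimately show ?thesis by simp
qed

text \<open>The index of the point obtained by rounding \<open>x\<close> up to the mesh
  \<open>1 / m\<close> and truncating at \<open>m\<close>. Truncation makes the range finite, and
  both operations are monotone, so that the order of the values of \<open>L\<close> is kept.\<close>

definition grid :: "nat \<Rightarrow> real \<Rightarrow> nat" where
  "grid m x = min (nat \<lceil>real m * x\<rceil>) (m * m)"

lemma grid_le: "grid m x \<le> m * m" by (simp add: grid_def)

lemma grid_mono: "x \<le> y \<Longrightarrow> grid m x \<le> grid m y"
  unfolding grid_def by (intro min.mono nat_mono ceiling_mono mult_left_mono) auto

lemma grid_measurable [measurable]: "grid m \<in> measurable borel (count_space UNIV)"
  unfolding grid_def by measurable

lemma grid_tendsto:
  assumes "0 \<le> x"
  shows "(\<lambda>m. real (grid m x) / real m) \<longlonglongrightarrow> x"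
proof (rule tendsto_sandwich[where f="\<lambda>_. x" and h="\<lambda>m. x + 1 / real m"])
  obtain N :: nat where N: "x + 1 \<le> real N"
    using real_arch_simple by blast
  have *: "x \<le> real (grid m x) / real m \<and> real (grid m x) / real m \<le> x + 1 / real m" if m: "m \<ge> max 1 N" for m
  proof -
    have c: "real_of_int \<lceil>real m * x\<rceil> = real (nat \<lceil>real m * x\<rceil>)"
      using assms by simp
    have "real m * x + 1 \<le> real m * (x + 1)" using m by (simp add: algebra_simps)
    also have "\<dots> \<le> real m * real m" using N m by (intro mult_left_mono) auto
    finally have "\<lceil>real m * x\<rceil> \<le> int (m * m)" by (simp add: ceiling_le_iff)
    then have g: "real (grid m x) = real_of_int \<lceil>real m * x\<rceil>"
      unfolding grid_def c by (simp add: nat_le_iff min_absorb1)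
    have "real m * x \<le> real (grid m x)" "real (grid m x) \<le> real m * x + 1"
      unfolding g by linarith+
    then show ?thesis using m by (auto simp: field_simps)
  qed
  show "eventually (\<lambda>m. x \<le> real (grid m x) / real m) sequentially"
    "eventually (\<lambda>m. real (grid m x) / real m \<le> x + 1 / real m) sequentially"
    unfolding eventually_sequentially using * by blast+
  show "(\<lambda>m. x + 1 / real m) \<longlonglongrightarrow> x"
    using tendsto_add[OF tendsto_const lim_1_over_n, of x] by simp
qed simp

section \<open>Independent increments of the subordinated Brownian motion\<close>

locale subordination = prob_space M for M :: "'a measure" +
  fixes W :: "real \<Rightarrow> 'a \<Rightarrow> real^'n" and L :: "real \<Rightarrow> 'a \<Rightarrow> real"
  assumes complete: "complete_measure M"
    and W: "standard_brownian_motion M W"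
    and L: "subordinator M L"
    and indep: "indep_processes M W L"
begin

abbreviation Z where "Z \<equiv> subordinate W L"

lemma W_levy: "levy_process M W" and L_levy: "levy_process M L"
  using W L by (simp_all add: standard_brownian_motion_def subordinator_def)

lemma W_measurable: "0 \<le> t \<Longrightarrow> W t \<in> borel_measurable M"
  using W_levy by (simp add: levy_process_def)

lemma L_measurable: "0 \<le> t \<Longrightarrow> L t \<in> borel_measurable M"
  using L_levy by (simp add: levy_process_def)

lemma AE_W_continuous: "AE \<omega> in M. continuous_on {0..} (\<lambda>t. W t \<omega>)"
  using W by (simp add: standard_brownian_motion_def)

lemma AE_L_mono: "AE \<omega> in M. mono_on {0..} (\<lambda>t. L t \<omega>) \<and> L 0 \<omega> = 0"
  using L unfolding subordinator_def levy_process_def by auto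

lemma AE_L_nonneg: "AE \<omega> in M. \<forall>t\<ge>0. 0 \<le> L t \<omega>"
  using AE_L_mono
proof eventually_elim
  case (elim \<omega>)
  then show ?case
    using mono_onD[of "{0..}" "\<lambda>t. L t \<omega>" 0] by force
qed

lemma AE_Z_0: "AE \<omega> in M. Z 0 \<omega> = 0"
proof -
  have "AE \<omega> in M. W 0 \<omega> = 0" using W_levy by (simp add: levy_process_def)
  with AE_L_mono show ?thesis
    by eventually_elim (simp add: subordinate_def)
qed

lemma W_tendsto:
  assumes "continuous_on {0..} (\<lambda>t. W t \<omega>)" "\<And>i. 0 \<le> l i" "0 \<le> l'" "l \<longlonglongrightarrow> l'"
  shows "(\<lambda>i. W (l i) \<omega>) \<longlonglongrightarrow> W l' \<omega>"
  using continuous_on_tendsto_compose[OF assms(1) assms(4)] assms by simp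

lemma Z_grid_tendsto:
  "AE \<omega> in M. \<forall>t\<ge>0. (\<lambda>m. W (real (grid m (L t \<omega>)) / real m) \<omega>) \<longlonglongrightarrow> Z t \<omega>"
  using AE_W_continuous AE_L_nonneg
proof eventually_elim
  case (elim \<omega>)
  show ?case
    unfolding subordinate_def
  proof (intro allI impI)
    fix t :: real assume "0 \<le> t"
    then have "0 \<le> L t \<omega>" using elim(2) by blast
    then show "(\<lambda>m. W (real (grid m (L t \<omega>)) / real m) \<omega>) \<longlonglongrightarrow> W (L t \<omega>) \<omega>"
      using W_tendsto[OF elim(1) _ _ grid_tendsto] by simp
  qed
qed

lemma W_grid_measurable:
  assumes "0 \<le> t"
  shows "(\<lambda>\<omega>. W (real (grid m (L t \<omega>)) / real m) \<omega>) \<in> borel_measurable M"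
proof (rule measurable_compose_countable[where f="\<lambda>k. W (real k / real m)" and g="\<lambda>\<omega>. grid m (L t \<omega>)"])
  show "W (real k / real m) \<in> borel_measurable M" for k
    by (rule W_measurable) simp
  show "(\<lambda>\<omega>. grid m (L t \<omega>)) \<in> measurable M (count_space UNIV)"
    using L_measurable[OF assms] by measurable
qed

lemma Z_measurable:
  assumes "0 \<le> t"
  shows "Z t \<in> borel_measurable M"
proof -
  interpret complete_measure M by (rule complete)
  note W_grid_measurable[OF assms, measurable]
  have "(\<lambda>\<omega>. lim (\<lambda>m. W (real (grid m (L t \<omega>)) / real m) \<omega>)) \<in> borel_measurable M"
    by (rule borel_measurable_lim_metric) measurable
  moreover have "AE \<omega> in M. lim (\<lambda>m. W (real (grid m (L t \<omega>)) / real m) \<omega>) = Z t \<omega>"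
    using Z_grid_tendsto by eventually_elim (use assms limI in blast)
  ultimately show ?thesis by (rule measurable_AE_eq)
qed

text \<open>The heat semigroup evaluated at the origin. Clipping the time at 0 yields a bounded
  continuous function on the whole line for continuous bounded \<open>f\<close>, which can be
  composed with \<open>L\<close> regardless of the null set where \<open>L\<close> is
  negative.\<close>

definition heat :: "(real^'n \<Rightarrow> real) \<Rightarrow> real \<Rightarrow> real" where
  "heat f l = expectation (\<lambda>\<omega>. f (W (max 0 l) \<omega>))"

lemma heat_bound:
  assumes "\<And>x. \<bar>f x\<bar> \<le> 1" and [measurable]: "f \<in> borel_measurable borel"
  shows "\<bar>heat f l\<bar> \<le> 1"
proof -
  have [measurable]: "W (max 0 l) \<in> borel_measurable M" by (rule W_measurable) simp
  have "\<bar>heat f l\<bar> \<le> expectation (\<lambda>\<omega>. \<bar>f (W (max 0 l) \<omega>)\<bar>)"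
    unfolding heat_def by (rule integral_abs_bound)
  also have "\<dots> \<le> expectation (\<lambda>\<omega>. 1)"
    by (intro integral_mono) (auto intro!: integrable_const_bound[where B=1] simp: assms)
  finally show ?thesis by (simp add: prob_space)
qed

lemma heat_continuous:
  assumes fb: "\<And>x. \<bar>f x\<bar> \<le> 1" and fc: "continuous_on UNIV f"
  shows "continuous_on UNIV (heat f)"
  unfolding continuous_on_sequentially
proof (intro allI ballI impI)
  fix l and x :: real assume "(\<forall>n. l n \<in> UNIV) \<and> l \<longlonglongrightarrow> x"
  then have lx: "(\<lambda>n. max 0 (l n)) \<longlonglongrightarrow> max 0 x" by (auto intro: tendsto_intros)
  have [measurable]: "f \<in> borel_measurable borel" by (rule borel_measurable_continuous_onI[OF fc])
  have [measurable]: "W (max 0 l) \<in> borel_measurable M" for l by (rule W_measurable) simp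
  show "(heat f \<circ> l) \<longlonglongrightarrow> heat f x"
    unfolding heat_def o_def
  proof (rule integral_dominated_convergence[where w="\<lambda>_. 1"])
    show "AE \<omega> in M. (\<lambda>n. f (W (max 0 (l n)) \<omega>)) \<longlonglongrightarrow> f (W (max 0 x) \<omega>)"
      using AE_W_continuous
    proof eventually_elim
      case (elim \<omega>)
      show ?case
        by (rule continuous_on_tendsto_compose[OF fc W_tendsto[OF elim _ _ lx]]) auto
    qed
  qed (auto simp: fb)
qed

lemma indep_W_L:
  fixes \<Psi> :: "(real \<Rightarrow> real^'n) \<Rightarrow> real" and \<Phi> :: "(real \<Rightarrow> real) \<Rightarrow> real"
  assumes \<Psi>: "\<Psi> \<in> borel_measurable (Pi\<^sub>M {0..} (\<lambda>_. borel))" "\<And>w. \<bar>\<Psi> w\<bar> \<le> 1"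
    and \<Phi>: "\<Phi> \<in> borel_measurable (Pi\<^sub>M {0..} (\<lambda>_. borel))" "\<And>w. \<bar>\<Phi> w\<bar> \<le> 1"
  shows "expectation (\<lambda>\<omega>. \<Psi> (\<lambda>t\<in>{0..}. W t \<omega>) * \<Phi> (\<lambda>t\<in>{0..}. L t \<omega>)) =
    expectation (\<lambda>\<omega>. \<Psi> (\<lambda>t\<in>{0..}. W t \<omega>)) * expectation (\<lambda>\<omega>. \<Phi> (\<lambda>t\<in>{0..}. L t \<omega>))"
proof -
  let ?W = "\<lambda>\<omega>. \<lambda>t\<in>{0..}. W t \<omega>" and ?L = "\<lambda>\<omega>. \<lambda>t\<in>{0..}. L t \<omega>"
  have Wm [measurable]: "?W \<in> measurable M (Pi\<^sub>M {0..} (\<lambda>_. borel))"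
    by (intro measurable_restrict W_measurable) auto
  have Lm [measurable]: "?L \<in> measurable M (Pi\<^sub>M {0..} (\<lambda>_. borel))"
    by (intro measurable_restrict L_measurable) auto
  have sub: "sigma_sets (space M) {(f \<circ> X) -` A \<inter> space M | A. A \<in> sets borel} \<subseteq> sets (vimage_algebra (space M) X N)"
    if X: "X \<in> measurable M N" and f: "f \<in> borel_measurable N"
    for X and N :: "'b measure" and f :: "'b \<Rightarrow> real"
  proof -
    have "X \<in> measurable (vimage_algebra (space M) X N) N"
      using X by (intro measurable_vimage_algebra1) (auto simp: measurable_def)
    from measurable_comp[OF this f]
    have "(f \<circ> X) -` A \<inter> space M \<in> sets (vimage_algebra (space M) X N)" if "A \<in> sets borel" for A
      using measurable_sets[of "f \<circ> X" "vimage_algebra (space M) X N" borel A] that by simp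
    then show ?thesis
      using sets.sigma_sets_subset[of "{(f \<circ> X) -` A \<inter> space M | A. A \<in> sets borel}" "vimage_algebra (space M) X N"]
      by auto
  qed
  have "indep_var borel (\<Psi> \<circ> ?W) borel (\<Phi> \<circ> ?L)"
    unfolding indep_var_eq
  proof (intro conjI)
    show "indep_set (sigma_sets (space M) {(\<Psi> \<circ> ?W) -` A \<inter> space M | A. A \<in> sets borel})
       (sigma_sets (space M) {(\<Phi> \<circ> ?L) -` A \<inter> space M | A. A \<in> sets borel})"
      using indep sub[OF Wm \<Psi>(1)] sub[OF Lm \<Phi>(1)]
      unfolding indep_processes_def process_algebra_def indep_set_def
      by (elim indep_sets_mono_sets) (auto split: bool.split)
  qed (use measurable_comp[OF Wm \<Psi>(1)] measurable_comp[OF Lm \<Phi>(1)] in auto)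
  then have "expectation (\<lambda>\<omega>. (\<Psi> \<circ> ?W) \<omega> * (\<Phi> \<circ> ?L) \<omega>) = expectation (\<Psi> \<circ> ?W) * expectation (\<Phi> \<circ> ?L)"
    by (rule indep_var_lebesgue_integral)
       (use \<Psi> \<Phi> in \<open>auto intro!: integrable_const_bound[where B=1] measurable_comp[OF Wm] measurable_comp[OF Lm]\<close>)
  then show ?thesis by (simp add: o_def)
qed

text \<open>On the grid the increments of \<open>L\<close> take finitely many values, so that conditioning on \<open>L\<close>
  is a finite sum and no joint measurability of \<open>W\<close> is needed.\<close>

lemma grid_expectation_prod:
  fixes f :: "nat \<Rightarrow> real^'n \<Rightarrow> real" and m :: nat
  assumes t: "mono t" "0 \<le> t 0"
    and f [measurable]: "\<And>j. f j \<in> borel_measurable borel" and fb: "\<And>j x. \<bar>f j x\<bar> \<le> 1"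
  defines "g \<equiv> \<lambda>j \<omega>. real (grid m (L (t j) \<omega>)) / real m"
  shows "expectation (\<lambda>\<omega>. \<Prod>j<n. f j (W (g (Suc j) \<omega>) \<omega> - W (g j \<omega>) \<omega>)) =
    expectation (\<lambda>\<omega>. \<Prod>j<n. heat (f j) (g (Suc j) \<omega> - g j \<omega>))"
proof -
  have t0: "0 \<le> t j" for j using t(2) monoD[OF t(1), of 0 j] by simp
  define S where "S = PiE {..n} (\<lambda>_. {..m * m})"
  have finS: "finite S" unfolding S_def by (intro finite_PiE) auto
  define K where "K \<omega> = restrict (\<lambda>j. grid m (L (t j) \<omega>)) {..n}" for \<omega>
  have KS: "K \<omega> \<in> S" for \<omega>
    unfolding K_def S_def by (auto simp: grid_le)
  define LP where "LP \<omega> = (\<lambda>t\<in>{0..}. L t \<omega>)" for \<omega>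
  define WP where "WP \<omega> = (\<lambda>t\<in>{0..}. W t \<omega>)" for \<omega>
  define \<Phi> where "\<Phi> \<kappa> l = (\<Prod>j\<le>n. indicat_real {\<kappa> j} (grid m (l (t j))))" for \<kappa> and l :: "real \<Rightarrow> real"
  define \<Psi> where "\<Psi> \<kappa> w = (\<Prod>j<n. f j (w (real (\<kappa> (Suc j)) / real m) - w (real (\<kappa> j) / real m)))"
    for \<kappa> :: "nat \<Rightarrow> nat" and w :: "real \<Rightarrow> real^'n"
  define c where "c \<kappa> = (\<Prod>j<n. heat (f j) ((real (\<kappa> (Suc j)) - real (\<kappa> j)) / real m))" for \<kappa> :: "nat \<Rightarrow> nat"
  have WPm [measurable]: "WP \<in> measurable M (Pi\<^sub>M {0..} (\<lambda>_. borel))"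
    unfolding WP_def by (intro measurable_restrict W_measurable) auto
  have LPm [measurable]: "LP \<in> measurable M (Pi\<^sub>M {0..} (\<lambda>_. borel))"
    unfolding LP_def by (intro measurable_restrict L_measurable) auto
  have \<Phi>m [measurable]: "\<Phi> \<kappa> \<in> borel_measurable (Pi\<^sub>M {0..} (\<lambda>_. borel))" for \<kappa>
  proof -
    have [measurable]: "(\<lambda>l. l (t j)) \<in> borel_measurable (Pi\<^sub>M {0..} (\<lambda>_. borel :: real measure))" for j
      by (rule measurable_component_singleton) (simp add: t0)
    have [measurable]: "(\<lambda>x. indicat_real {k} (grid m x)) \<in> borel_measurable borel" for k
      by (rule measurable_compose[OF grid_measurable]) simp
    show ?thesis unfolding \<Phi>_def by measurable
  qed
  have \<Psi>m [measurable]: "\<Psi> \<kappa> \<in> borel_measurable (Pi\<^sub>M {0..} (\<lambda>_. borel))" for \<kappa>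
  proof -
    have [measurable]: "(\<lambda>w. w (real k / real m)) \<in> borel_measurable (Pi\<^sub>M {0..} (\<lambda>_. borel :: (real^'n) measure))" for k
      by (rule measurable_component_singleton) simp
    show ?thesis unfolding \<Psi>_def by measurable
  qed
  have \<Phi>b: "\<bar>\<Phi> \<kappa> l\<bar> \<le> 1" for \<kappa> l
    unfolding \<Phi>_def abs_prod by (intro prod_le_1) (auto simp: indicator_def)
  have \<Psi>b: "\<bar>\<Psi> \<kappa> w\<bar> \<le> 1" for \<kappa> w
    unfolding \<Psi>_def abs_prod by (intro prod_le_1) (auto simp: fb)
  have \<Phi>K: "\<Phi> \<kappa> (LP \<omega>) = (if K \<omega> = \<kappa> then 1 else 0)" if "\<kappa> \<in> S" for \<kappa> \<omega>
  proof (cases "K \<omega> = \<kappa>")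
    case True
    then have "grid m (L (t j) \<omega>) = \<kappa> j" if "j \<le> n" for j
      using that unfolding K_def by (metis atMost_iff restrict_apply')
    then show ?thesis using True t0 by (simp add: \<Phi>_def LP_def)
  next
    case False
    then obtain j where "K \<omega> j \<noteq> \<kappa> j" by blast
    moreover then have "j \<le> n"
      using PiE_arb[OF that[unfolded S_def]] unfolding K_def by (metis atMost_iff restrict_apply)
    ultimately have "indicat_real {\<kappa> j} (grid m (LP \<omega> (t j))) = 0" "j \<le> n"
      using t0 by (auto simp: K_def LP_def)
    then show ?thesis using False unfolding \<Phi>_def by (auto simp: prod_zero_iff)
  qed
  have lhs: "(\<Prod>j<n. f j (W (g (Suc j) \<omega>) \<omega> - W (g j \<omega>) \<omega>)) = (\<Sum>\<kappa>\<in>S. \<Psi> \<kappa> (WP \<omega>) * \<Phi> \<kappa> (LP \<omega>))" for \<omega>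
  proof -
    have "(\<Sum>\<kappa>\<in>S. \<Psi> \<kappa> (WP \<omega>) * \<Phi> \<kappa> (LP \<omega>)) = (\<Sum>\<kappa>\<in>S. if K \<omega> = \<kappa> then \<Psi> (K \<omega>) (WP \<omega>) else 0)"
      by (intro sum.cong refl) (simp add: \<Phi>K)
    also have "\<dots> = \<Psi> (K \<omega>) (WP \<omega>)"
      using KS finS by (simp add: sum.delta)
    also have "\<dots> = (\<Prod>j<n. f j (W (g (Suc j) \<omega>) \<omega> - W (g j \<omega>) \<omega>))"
      unfolding \<Psi>_def by (intro prod.cong refl) (simp add: K_def WP_def g_def)
    finally show ?thesis ..
  qed
  have rhs: "(\<Prod>j<n. heat (f j) (g (Suc j) \<omega> - g j \<omega>)) = (\<Sum>\<kappa>\<in>S. c \<kappa> * \<Phi> \<kappa> (LP \<omega>))" for \<omega>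
  proof -
    have "(\<Sum>\<kappa>\<in>S. c \<kappa> * \<Phi> \<kappa> (LP \<omega>)) = (\<Sum>\<kappa>\<in>S. if K \<omega> = \<kappa> then c (K \<omega>) else 0)"
      by (intro sum.cong refl) (simp add: \<Phi>K)
    also have "\<dots> = c (K \<omega>)"
      using KS finS by (simp add: sum.delta)
    also have "\<dots> = (\<Prod>j<n. heat (f j) (g (Suc j) \<omega> - g j \<omega>))"
      unfolding c_def by (intro prod.cong refl) (simp add: K_def g_def diff_divide_distrib)
    finally show ?thesis ..
  qed
  have term_eq: "expectation (\<lambda>\<omega>. \<Psi> \<kappa> (WP \<omega>) * \<Phi> \<kappa> (LP \<omega>)) = expectation (\<lambda>\<omega>. c \<kappa> * \<Phi> \<kappa> (LP \<omega>))" for \<kappa>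
  proof -
    have "expectation (\<lambda>\<omega>. \<Psi> \<kappa> (WP \<omega>) * \<Phi> \<kappa> (LP \<omega>)) = expectation (\<lambda>\<omega>. \<Psi> \<kappa> (WP \<omega>)) * expectation (\<lambda>\<omega>. \<Phi> \<kappa> (LP \<omega>))"
      unfolding WP_def LP_def by (rule indep_W_L[OF \<Psi>m \<Psi>b \<Phi>m \<Phi>b])
    also have "\<dots> = c \<kappa> * expectation (\<lambda>\<omega>. \<Phi> \<kappa> (LP \<omega>))"
    \<comment> \<open>For increasing \<open>\<kappa>\<close> the times of \<open>W\<close> are
      deterministic and ordered, and its independent increments apply. Any other
      \<open>\<kappa>\<close> occurs with probability 0 because \<open>L\<close> is almost surely
      increasing.\<close>
    proof (cases "\<forall>j<n. \<kappa> j \<le> \<kappa> (Suc j)")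
      case True
      \<comment> \<open>Held constant after \<open>n\<close>, since independence of increments is
        formulated for monotone sequences on all of \<open>nat\<close>.\<close>
      define s where "s j = real (\<kappa> (min j n)) / real m" for j
      have smono: "mono s"
      proof (rule incseq_SucI)
        fix j
        show "s j \<le> s (Suc j)"
          using True by (cases "j < n") (auto simp: s_def min_def divide_right_mono)
      qed
      have "expectation (\<lambda>\<omega>. \<Psi> \<kappa> (WP \<omega>)) = expectation (\<lambda>\<omega>. \<Prod>j<n. f j (W (s (Suc j)) \<omega> - W (s j) \<omega>))"
        unfolding \<Psi>_def by (intro Bochner_Integration.integral_cong prod.cong refl) (simp add: WP_def s_def)
      also have "\<dots> = (\<Prod>j<n. expectation (\<lambda>\<omega>. f j (W (s (Suc j) - s j) \<omega>)))"
        by (rule levy_process_expectation_prod[OF W_levy smono _ f fb]) (simp add: s_def)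
      also have "\<dots> = c \<kappa>"
        unfolding c_def
      proof (intro prod.cong refl)
        fix j assume "j \<in> {..<n}"
        then have "s (Suc j) - s j = (real (\<kappa> (Suc j)) - real (\<kappa> j)) / real m"
          by (simp add: s_def diff_divide_distrib)
        moreover have "0 \<le> s (Suc j) - s j" using monoD[OF smono, of j "Suc j"] by simp
        ultimately show "expectation (\<lambda>\<omega>. f j (W (s (Suc j) - s j) \<omega>)) = heat (f j) ((real (\<kappa> (Suc j)) - real (\<kappa> j)) / real m)"
          unfolding heat_def by (simp add: max_absorb2)
      qed
      finally show ?thesis by simp
    next
      case False
      then obtain j where j: "j < n" "\<kappa> (Suc j) < \<kappa> j" by (auto simp: not_le)
      have "AE \<omega> in M. \<Phi> \<kappa> (LP \<omega>) = 0"
        using AE_L_mono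
      proof eventually_elim
        case (elim \<omega>)
        have "L (t j) \<omega> \<le> L (t (Suc j)) \<omega>"
          using elim t0 monoD[OF t(1), of j "Suc j"] by (auto simp: mono_on_def)
        from grid_mono[OF this, of m]
        have "grid m (L (t j) \<omega>) \<noteq> \<kappa> j \<or> grid m (L (t (Suc j)) \<omega>) \<noteq> \<kappa> (Suc j)"
          using j by auto
        then have "\<exists>i\<le>n. indicat_real {\<kappa> i} (grid m (LP \<omega> (t i))) = 0"
        proof
          assume "grid m (L (t j) \<omega>) \<noteq> \<kappa> j"
          then show ?thesis using j t0 by (intro exI[of _ j]) (simp add: LP_def)
        next
          assume "grid m (L (t (Suc j)) \<omega>) \<noteq> \<kappa> (Suc j)"
          then show ?thesis using j t0 by (intro exI[of _ "Suc j"]) (simp add: LP_def)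
        qed
        then show ?case unfolding \<Phi>_def by (auto simp: prod_zero_iff)
      qed
      then have "expectation (\<lambda>\<omega>. \<Phi> \<kappa> (LP \<omega>)) = 0" by (rule integral_eq_zero_AE)
      then show ?thesis by simp
    qed
    finally show ?thesis by simp
  qed
  have int: "integrable M (\<lambda>\<omega>. \<Psi> \<kappa> (WP \<omega>) * \<Phi> \<kappa> (LP \<omega>))" "integrable M (\<lambda>\<omega>. c \<kappa> * \<Phi> \<kappa> (LP \<omega>))" for \<kappa>
  proof -
    have "\<bar>\<Psi> \<kappa> (WP \<omega>) * \<Phi> \<kappa> (LP \<omega>)\<bar> \<le> 1" for \<omega>
      unfolding abs_mult using mult_mono[OF \<Psi>b \<Phi>b] by simp
    then show "integrable M (\<lambda>\<omega>. \<Psi> \<kappa> (WP \<omega>) * \<Phi> \<kappa> (LP \<omega>))"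
      by (intro integrable_const_bound[where B=1]) auto
    show "integrable M (\<lambda>\<omega>. c \<kappa> * \<Phi> \<kappa> (LP \<omega>))"
      by (intro integrable_mult_right integrable_const_bound[where B=1]) (auto simp: \<Phi>b)
  qed
  show ?thesis
    unfolding lhs rhs by (simp only: Bochner_Integration.integral_sum[OF int(1)] Bochner_Integration.integral_sum[OF int(2)] term_eq)
qed

text \<open>The grid identity in the limit of vanishing mesh. On its right-hand side only
  \<open>L\<close> is random, and the independent stationary increments of \<open>L\<close> factor
  the expectation. Independence and stationarity of the increments of \<open>Z\<close> are both read
  off from this formula.\<close>

lemma Z_expectation_prod:
  fixes f :: "nat \<Rightarrow> real^'n \<Rightarrow> real"
  assumes t: "mono t" "0 \<le> t 0"
    and f: "\<And>j. continuous_on UNIV (f j)" and fb: "\<And>j x. \<bar>f j x\<bar> \<le> 1"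
  shows "expectation (\<lambda>\<omega>. \<Prod>j<n. f j (Z (t (Suc j)) \<omega> - Z (t j) \<omega>)) =
    (\<Prod>j<n. expectation (\<lambda>\<omega>. heat (f j) (L (t (Suc j) - t j) \<omega>)))"
proof -
  have t0: "0 \<le> t j" for j using t(2) monoD[OF t(1), of 0 j] by simp
  have fm [measurable]: "f j \<in> borel_measurable borel" for j
    by (rule borel_measurable_continuous_onI[OF f])
  have hb: "\<bar>heat (f j) l\<bar> \<le> 1" for j l by (rule heat_bound[OF fb fm])
  have hc: "continuous_on UNIV (heat (f j))" for j by (rule heat_continuous[OF fb f])
  have hm [measurable]: "heat (f j) \<in> borel_measurable borel" for j
    by (rule borel_measurable_continuous_onI[OF hc])
  have [measurable]: "Z (t j) \<in> borel_measurable M" for j by (rule Z_measurable[OF t0])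
  have [measurable]: "L (t j) \<in> borel_measurable M" for j by (rule L_measurable[OF t0])
  define g where "g m j \<omega> = real (grid m (L (t j) \<omega>)) / real m" for m j \<omega>
  have [measurable]: "(\<lambda>\<omega>. W (g m j \<omega>) \<omega>) \<in> borel_measurable M" for m j
    unfolding g_def by (rule W_grid_measurable[OF t0])
  have [measurable]: "g m j \<in> borel_measurable M" for m j
    unfolding g_def by measurable
  have 1: "(\<lambda>m. expectation (\<lambda>\<omega>. \<Prod>j<n. f j (W (g m (Suc j) \<omega>) \<omega> - W (g m j \<omega>) \<omega>)))
    \<longlonglongrightarrow> expectation (\<lambda>\<omega>. \<Prod>j<n. f j (Z (t (Suc j)) \<omega> - Z (t j) \<omega>))"
  proof (rule integral_dominated_convergence[where w="\<lambda>_. 1"])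
    show "AE \<omega> in M. (\<lambda>m. \<Prod>j<n. f j (W (g m (Suc j) \<omega>) \<omega> - W (g m j \<omega>) \<omega>)) \<longlonglongrightarrow> (\<Prod>j<n. f j (Z (t (Suc j)) \<omega> - Z (t j) \<omega>))"
      using Z_grid_tendsto
    proof eventually_elim
      case (elim \<omega>)
      have *: "(\<lambda>m. W (g m j \<omega>) \<omega>) \<longlonglongrightarrow> Z (t j) \<omega>" for j
        using elim t0[of j] unfolding g_def by blast
      have "(\<lambda>m. f j (W (g m (Suc j) \<omega>) \<omega> - W (g m j \<omega>) \<omega>)) \<longlonglongrightarrow> f j (Z (t (Suc j)) \<omega> - Z (t j) \<omega>)" for j
        by (rule continuous_on_tendsto_compose[OF f tendsto_diff[OF * *]]) auto
      then show ?case by (rule tendsto_prod)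
    qed
    show "AE \<omega> in M. norm (\<Prod>j<n. f j (W (g m (Suc j) \<omega>) \<omega> - W (g m j \<omega>) \<omega>)) \<le> 1" for m
      unfolding real_norm_def abs_prod by (intro AE_I2 prod_le_1) (auto simp: fb)
  qed simp_all
  have 2: "(\<lambda>m. expectation (\<lambda>\<omega>. \<Prod>j<n. heat (f j) (g m (Suc j) \<omega> - g m j \<omega>)))
    \<longlonglongrightarrow> expectation (\<lambda>\<omega>. \<Prod>j<n. heat (f j) (L (t (Suc j)) \<omega> - L (t j) \<omega>))"
  proof (rule integral_dominated_convergence[where w="\<lambda>_. 1"])
    show "AE \<omega> in M. (\<lambda>m. \<Prod>j<n. heat (f j) (g m (Suc j) \<omega> - g m j \<omega>)) \<longlonglongrightarrow> (\<Prod>j<n. heat (f j) (L (t (Suc j)) \<omega> - L (t j) \<omega>))"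
      using AE_L_nonneg
    proof eventually_elim
      case (elim \<omega>)
      have *: "(\<lambda>m. g m j \<omega>) \<longlonglongrightarrow> L (t j) \<omega>" for j
        using elim t0[of j] unfolding g_def by (intro grid_tendsto) blast
      have "(\<lambda>m. heat (f j) (g m (Suc j) \<omega> - g m j \<omega>)) \<longlonglongrightarrow> heat (f j) (L (t (Suc j)) \<omega> - L (t j) \<omega>)" for j
        by (rule continuous_on_tendsto_compose[OF hc tendsto_diff[OF * *]]) auto
      then show ?case by (rule tendsto_prod)
    qed
    show "AE \<omega> in M. norm (\<Prod>j<n. heat (f j) (g m (Suc j) \<omega> - g m j \<omega>)) \<le> 1" for m
      unfolding real_norm_def abs_prod by (intro AE_I2 prod_le_1) (auto simp: hb)
  qed simp_all
  have "expectation (\<lambda>\<omega>. \<Prod>j<n. f j (Z (t (Suc j)) \<omega> - Z (t j) \<omega>)) =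
      expectation (\<lambda>\<omega>. \<Prod>j<n. heat (f j) (L (t (Suc j)) \<omega> - L (t j) \<omega>))"
    using LIMSEQ_unique[OF 1] 2 unfolding g_def grid_expectation_prod[OF t fm fb] by blast
  also have "\<dots> = (\<Prod>j<n. expectation (\<lambda>\<omega>. heat (f j) (L (t (Suc j) - t j) \<omega>)))"
    by (rule levy_process_expectation_prod[OF L_levy t hm hb])
  finally show ?thesis .
qed

lemma Z_increment_expectation:
  fixes f :: "real^'n \<Rightarrow> real"
  assumes "0 \<le> s" "0 \<le> h" and f: "continuous_on UNIV f" and fb: "\<And>x. \<bar>f x\<bar> \<le> 1"
  shows "expectation (\<lambda>\<omega>. f (Z (s + h) \<omega> - Z s \<omega>)) = expectation (\<lambda>\<omega>. heat f (L h \<omega>))"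
proof -
  define t :: "nat \<Rightarrow> real" where "t j = (if j = 0 then s else s + h)" for j
  have "mono t" using assms by (auto simp: mono_def t_def)
  from Z_expectation_prod[OF this _ f fb, where n=1] show ?thesis
    using assms by (simp add: t_def)
qed

lemma Z_indep_increments:
  assumes t: "mono t" "0 \<le> t 0"
  shows "indep_vars (\<lambda>_. borel) (\<lambda>j \<omega>. Z (t (Suc j)) \<omega> - Z (t j) \<omega>) {..<n}"
proof (rule indep_vars_of_expectation_prod)
  have t0: "0 \<le> t j" for j using t(2) monoD[OF t(1), of 0 j] by simp
  have Z: "Z (t j) \<in> borel_measurable M" for j by (rule Z_measurable[OF t0])
  show "(\<lambda>\<omega>. Z (t (Suc j)) \<omega> - Z (t j) \<omega>) \<in> borel_measurable M" for j
    using Z by measurable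
  fix f :: "nat \<Rightarrow> real^'n \<Rightarrow> real"
  assume f: "\<And>j. continuous_on UNIV (f j)" "\<And>j x. 0 \<le> f j x \<and> f j x \<le> 1"
  have fb: "\<bar>f j x\<bar> \<le> 1" for j x using f(2)[of j x] by simp
  have "expectation (\<lambda>\<omega>. heat (f j) (L (t (Suc j) - t j) \<omega>)) = expectation (\<lambda>\<omega>. f j (Z (t (Suc j)) \<omega> - Z (t j) \<omega>))" for j
    using Z_increment_expectation[of "t j" "t (Suc j) - t j" "f j"] t0[of j] monoD[OF t(1), of j "Suc j"] f(1) fb
    by simp
  then show "expectation (\<lambda>\<omega>. \<Prod>j<n. f j (Z (t (Suc j)) \<omega> - Z (t j) \<omega>)) = (\<Prod>j<n. expectation (\<lambda>\<omega>. f j (Z (t (Suc j)) \<omega> - Z (t j) \<omega>)))"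
    unfolding Z_expectation_prod[OF t f(1) fb] by simp
qed simp

end

section \<open>Gaussian vectors\<close>

lemma Basis_vec_real: "(Basis :: (real^'n) set) = range (\<lambda>i. axis i 1)"
  by (auto simp: Basis_vec_def)

text \<open>Fubini for functions of product form. Coordinates are indexed by \<open>'n\<close>,
  while \<open>lborel\<close> is the image of a product measure over \<open>Basis\<close>; the
  bijection between the two index sets carries the product formula over.\<close>

lemma lborel_vec_prod:
  fixes f :: "'n::finite \<Rightarrow> real \<Rightarrow> 'b::{real_normed_field,banach,second_countable_topology}"
  assumes f: "\<And>i. integrable lborel (f i)"
  shows "integrable lborel (\<lambda>x::real^'n. \<Prod>i\<in>UNIV. f i (x $ i))"
    and "(LINT x|lborel. (\<Prod>i\<in>UNIV. f i ((x :: real^'n) $ i))) = (\<Prod>i\<in>UNIV. (LINT x|lborel. f i x))"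
proof -
  interpret product_sigma_finite "\<lambda>_ :: real^'n. lborel :: real measure" by standard
  let ?P = "Pi\<^sub>M (Basis :: (real^'n) set) (\<lambda>_. lborel :: real measure)"
  let ?T = "\<lambda>g. \<Sum>b\<in>(Basis :: (real^'n) set). g b *\<^sub>R b"
  have inj: "inj (\<lambda>i. axis i 1 :: real^'n)"
    by (auto simp: inj_on_def axis_eq_axis)
  define F where "F b = f (the_inv (\<lambda>i. axis i 1 :: real^'n) b)" for b
  have Fax: "F (axis i 1) = f i" for i
    unfolding F_def by (simp add: the_inv_f_f[OF inj])
  have eq: "(\<Prod>i\<in>UNIV. f i (x $ i)) = (\<Prod>b\<in>Basis. F b (x \<bullet> b))" for x :: "real^'n"
    unfolding Basis_vec_real by (subst prod.reindex[OF inj]) (simp add: Fax inner_axis)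
  have Fint: "integrable lborel (F b)" for b
    unfolding F_def by (rule f)
  have Fm [measurable]: "F b \<in> borel_measurable borel" for b
    using borel_measurable_integrable[OF Fint[of b]] by simp
  have [measurable]: "?T \<in> borel_measurable ?P" by measurable
  have T: "(\<Prod>b\<in>Basis. F b (?T g \<bullet> b)) = (\<Prod>b\<in>Basis. F b (g b))" for g :: "real^'n \<Rightarrow> real"
    by (intro prod.cong refl) (simp add: inner_sum_left_Basis)
  have int: "integrable ?P (\<lambda>g. \<Prod>b\<in>Basis. F b (g b))"
    by (rule product_integrable_prod[OF finite_Basis Fint])
  show "integrable lborel (\<lambda>x::real^'n. \<Prod>i\<in>UNIV. f i (x $ i))"
    unfolding eq by (subst lborel_eq, subst integrable_distr_eq) (use int in \<open>auto simp: T\<close>)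
  have "(LINT x|lborel. (\<Prod>i\<in>UNIV. f i ((x :: real^'n) $ i))) = (LINT g|?P. (\<Prod>b\<in>Basis. F b (g b)))"
    unfolding eq by (subst lborel_eq, subst integral_distr) (auto simp: T)
  also have "\<dots> = (\<Prod>b\<in>Basis. (LINT x|lborel. F b x))"
    by (rule product_integral_prod[OF finite_Basis Fint])
  also have "\<dots> = (\<Prod>i\<in>UNIV. (LINT x|lborel. f i x))"
    unfolding Basis_vec_real by (subst prod.reindex[OF inj]) (simp add: Fax)
  finally show "(LINT x|lborel. (\<Prod>i\<in>UNIV. f i ((x :: real^'n) $ i))) = (\<Prod>i\<in>UNIV. (LINT x|lborel. f i x))" .
qed

definition gauss :: "real \<Rightarrow> real^'n \<Rightarrow> real" where
  "gauss \<sigma> x = (\<Prod>i\<in>UNIV. normal_density 0 \<sigma> (x $ i))"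

lemma gauss_nonneg: "0 \<le> gauss \<sigma> x"
  unfolding gauss_def by (intro prod_nonneg) auto

lemma gauss_measurable [measurable]: "gauss \<sigma> \<in> borel_measurable borel"
  unfolding gauss_def by measurable

lemma gauss_eq:
  fixes x :: "real^'n"
  assumes "0 < \<sigma>"
  shows "gauss \<sigma> x = (1 / sqrt (2 * pi * \<sigma>\<^sup>2)) ^ CARD('n) * exp (- (norm x)\<^sup>2 / (2 * \<sigma>\<^sup>2))"
proof -
  have "(norm x)\<^sup>2 = (\<Sum>i\<in>UNIV. (x $ i)\<^sup>2)"
    by (simp add: norm_vec_def L2_set_def sum_nonneg)
  then have "exp (- (norm x)\<^sup>2 / (2 * \<sigma>\<^sup>2)) = (\<Prod>i\<in>UNIV. exp (- (x $ i)\<^sup>2 / (2 * \<sigma>\<^sup>2)))"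
    by (simp add: exp_sum[symmetric] sum_negf sum_divide_distrib)
  then show ?thesis
    by (simp add: gauss_def normal_density_def prod_dividef power_one_over)
qed

lemma normal_density_iexp:
  assumes s: "0 < s"
  shows "integrable lborel (\<lambda>x. normal_density 0 s x *\<^sub>R iexp (a * x))"
    and "(CLINT x|lborel. normal_density 0 s x *\<^sub>R iexp (a * x)) = of_real (exp (- (s\<^sup>2 * a\<^sup>2 / 2)))"
proof -
  have nd: "normal_density 0 s (s * y) = std_normal_density y / s" for y
    using s by (simp add: normal_density_def power_mult_distrib real_sqrt_mult)
  show "integrable lborel (\<lambda>x. normal_density 0 s x *\<^sub>R iexp (a * x))"
  proof (rule Bochner_Integration.integrable_bound[OF integrable_normal_density[OF s, of 0]])
    show "AE x in lborel. norm (normal_density 0 s x *\<^sub>R iexp (a * x)) \<le> norm (normal_density 0 s x)"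
      by simp
  qed simp
  have "(CLINT x|lborel. normal_density 0 s x *\<^sub>R iexp (a * x)) = \<bar>s\<bar> *\<^sub>R (CLINT y|lborel. normal_density 0 s (0 + s * y) *\<^sub>R iexp (a * (0 + s * y)))"
    by (rule lborel_integral_real_affine) (use s in simp)
  also have "\<dots> = (CLINT y|lborel. \<bar>s\<bar> *\<^sub>R (normal_density 0 s (0 + s * y) *\<^sub>R iexp (a * (0 + s * y))))"
    by (rule integral_scaleR_right[symmetric])
  also have "\<dots> = (CLINT y|lborel. std_normal_density y *\<^sub>R iexp ((a * s) * y))"
    using s by (intro Bochner_Integration.integral_cong refl) (simp add: nd mult.assoc)
  also have "\<dots> = char std_normal_distribution (a * s)"
    unfolding char_def by (subst integral_density) auto
  also have "\<dots> = of_real (exp (- (s\<^sup>2 * a\<^sup>2 / 2)))"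
    by (simp add: char_std_normal_distribution power_mult_distrib mult.commute)
  finally show "(CLINT x|lborel. normal_density 0 s x *\<^sub>R iexp (a * x)) = of_real (exp (- (s\<^sup>2 * a\<^sup>2 / 2)))" .
qed

lemma gauss_integral_iexp:
  fixes u :: "real^'n"
  assumes s: "0 < s"
  shows "integrable lborel (\<lambda>x. gauss s x *\<^sub>R iexp (u \<bullet> x))"
    and "(CLINT x|lborel. gauss s x *\<^sub>R iexp (u \<bullet> x)) = of_real (exp (- (s\<^sup>2 * (norm u)\<^sup>2 / 2)))"
proof -
  have eq: "gauss s x *\<^sub>R iexp (u \<bullet> x) = (\<Prod>i\<in>UNIV. normal_density 0 s (x $ i) *\<^sub>R iexp (u $ i * x $ i))" for x
  proof -
    have "iexp (u \<bullet> x) = (\<Prod>i\<in>UNIV. iexp (u $ i * x $ i))"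
      by (simp add: inner_vec_def exp_sum[symmetric] sum_distrib_left)
    then show ?thesis
      by (simp add: gauss_def scaleR_conv_of_real prod.distrib)
  qed
  show "integrable lborel (\<lambda>x. gauss s x *\<^sub>R iexp (u \<bullet> x))"
    unfolding eq by (rule lborel_vec_prod(1)[OF normal_density_iexp(1)[OF s]])
  have "(CLINT x|lborel. gauss s x *\<^sub>R iexp (u \<bullet> x)) = (\<Prod>i\<in>UNIV. of_real (exp (- (s\<^sup>2 * (u $ i)\<^sup>2 / 2))))"
    unfolding eq by (subst lborel_vec_prod(2)[OF normal_density_iexp(1)[OF s]]) (simp only: normal_density_iexp(2)[OF s])
  also have "\<dots> = of_real (exp (\<Sum>i\<in>UNIV. - (s\<^sup>2 * (u $ i)\<^sup>2 / 2)))"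
    by (simp add: exp_sum)
  also have "(\<Sum>i\<in>UNIV. - (s\<^sup>2 * (u $ i)\<^sup>2 / 2)) = - (s\<^sup>2 * (norm u)\<^sup>2 / 2)"
    by (simp add: norm_vec_def L2_set_def sum_nonneg sum_negf sum_distrib_left sum_divide_distrib)
  finally show "(CLINT x|lborel. gauss s x *\<^sub>R iexp (u \<bullet> x)) = of_real (exp (- (s\<^sup>2 * (norm u)\<^sup>2 / 2)))" .
qed

lemma one_minus_cos_le: "1 - cos x \<le> x\<^sup>2 / 2" for x :: real
proof -
  have "1 - cos x = 2 * (sin (x / 2))\<^sup>2"
    using cos_double_sin[of "x / 2"] by simp
  also have "(sin (x / 2))\<^sup>2 \<le> (x / 2)\<^sup>2"
    using abs_sin_x_le_abs_x[of "x / 2"] by (metis abs_le_square_iff)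
  finally show ?thesis by (simp add: power_divide)
qed

context subordination
begin

lemma W_cos_sin:
  assumes l: "0 \<le> l"
  shows "expectation (\<lambda>\<omega>. cos (u \<bullet> W l \<omega>)) = exp (- (l * (norm u)\<^sup>2 / 2))"
    and "expectation (\<lambda>\<omega>. sin (u \<bullet> W l \<omega>)) = 0"
proof -
  have Wm [measurable]: "W l \<in> borel_measurable M" by (rule W_measurable[OF l])
  have "(CLINT \<omega>|M. iexp (u \<bullet> W l \<omega>)) = of_real (exp (- (l * (norm u)\<^sup>2 / 2)))"
  \<comment> \<open>A density is prescribed only at positive times; at time 0 the process vanishes
    almost surely.\<close>
  proof (cases "l = 0")
    case True
    have "AE \<omega> in M. W 0 \<omega> = 0" using W_levy by (simp add: levy_process_def)
    then have "(CLINT \<omega>|M. iexp (u \<bullet> W l \<omega>)) = (CLINT \<omega>|M. 1)"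
      using Wm unfolding True by (intro integral_cong_AE) auto
    then show ?thesis using True by (simp add: prob_space)
  next
    case False
    then have l0: "0 < l" using l by simp
    have "distributed M lborel (W l) (\<lambda>x. ennreal (gauss (sqrt l) x))"
      using W l0 unfolding standard_brownian_motion_def gauss_def by blast
    then have d: "distr M lborel (W l) = density lborel (\<lambda>x. ennreal (gauss (sqrt l) x))"
      by (rule distributed_distr_eq_density)
    have "(CLINT \<omega>|M. iexp (u \<bullet> W l \<omega>)) = (CLINT x|distr M lborel (W l). iexp (u \<bullet> x))"
      by (subst integral_distr) auto
    also have "\<dots> = (CLINT x|lborel. gauss (sqrt l) x *\<^sub>R iexp (u \<bullet> x))"
      unfolding d by (subst integral_density) (auto simp: gauss_nonneg)
    also have "\<dots> = of_real (exp (- (l * (norm u)\<^sup>2 / 2)))"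
      using gauss_integral_iexp(2)[of "sqrt l" u] l0 by simp
    finally show ?thesis .
  qed
  moreover have "integrable M (\<lambda>\<omega>. iexp (u \<bullet> W l \<omega>))"
    by (rule integrable_const_bound[where B=1]) auto
  ultimately show "expectation (\<lambda>\<omega>. cos (u \<bullet> W l \<omega>)) = exp (- (l * (norm u)\<^sup>2 / 2))"
    "expectation (\<lambda>\<omega>. sin (u \<bullet> W l \<omega>)) = 0"
    using integral_Re[of M "\<lambda>\<omega>. iexp (u \<bullet> W l \<omega>)"] integral_Im[of M "\<lambda>\<omega>. iexp (u \<bullet> W l \<omega>)"]
    by (simp_all add: Re_exp Im_exp)
qed

lemma Z_increment_cos_sin:
  assumes "0 \<le> s" "0 \<le> h"
  shows "expectation (\<lambda>\<omega>. cos (u \<bullet> (Z (s + h) \<omega> - Z s \<omega>))) = expectation (\<lambda>\<omega>. exp (- (L h \<omega> * (norm u)\<^sup>2 / 2)))"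
    and "expectation (\<lambda>\<omega>. sin (u \<bullet> (Z (s + h) \<omega> - Z s \<omega>))) = 0"
proof -
  have c: "continuous_on UNIV (\<lambda>x. cos (u \<bullet> x))" "continuous_on UNIV (\<lambda>x. sin (u \<bullet> x))"
    by (auto intro!: continuous_intros)
  have Lm [measurable]: "L h \<in> borel_measurable M" by (rule L_measurable[OF assms(2)])
  have "expectation (\<lambda>\<omega>. cos (u \<bullet> (Z (s + h) \<omega> - Z s \<omega>))) = expectation (\<lambda>\<omega>. heat (\<lambda>x. cos (u \<bullet> x)) (L h \<omega>))"
    by (rule Z_increment_expectation[OF assms c(1)]) simp
  also have "\<dots> = expectation (\<lambda>\<omega>. exp (- (max 0 (L h \<omega>) * (norm u)\<^sup>2 / 2)))"
    unfolding heat_def by (simp add: W_cos_sin)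
  also have "\<dots> = expectation (\<lambda>\<omega>. exp (- (L h \<omega> * (norm u)\<^sup>2 / 2)))"
  proof (rule integral_cong_AE)
    show "AE \<omega> in M. exp (- (max 0 (L h \<omega>) * (norm u)\<^sup>2 / 2)) = exp (- (L h \<omega> * (norm u)\<^sup>2 / 2))"
      using AE_L_nonneg by eventually_elim (simp add: assms)
  qed simp_all
  finally show "expectation (\<lambda>\<omega>. cos (u \<bullet> (Z (s + h) \<omega> - Z s \<omega>))) = expectation (\<lambda>\<omega>. exp (- (L h \<omega> * (norm u)\<^sup>2 / 2)))" .
  have "expectation (\<lambda>\<omega>. sin (u \<bullet> (Z (s + h) \<omega> - Z s \<omega>))) = expectation (\<lambda>\<omega>. heat (\<lambda>x. sin (u \<bullet> x)) (L h \<omega>))"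
    by (rule Z_increment_expectation[OF assms c(2)]) simp
  then show "expectation (\<lambda>\<omega>. sin (u \<bullet> (Z (s + h) \<omega> - Z s \<omega>))) = 0"
    unfolding heat_def by (simp add: W_cos_sin)
qed

end

section \<open>The symbol and the first moment of the noise\<close>

locale stable_noise = subordination M W L for M :: "'a measure" and W :: "real \<Rightarrow> 'a \<Rightarrow> real^'n" and L +
  fixes \<alpha> c :: real and \<nu> :: "(real^'n) measure"
  assumes alpha: "1 / 2 < \<alpha>" "\<alpha> < 1" and c: "0 < c"
    and stable: "strictly_stable M \<alpha> L"
    and nu: "\<nu> = density lborel (\<lambda>z. ennreal (c * norm z powr (- (real CARD('n) + 2 * \<alpha>))))"
    and nu_levy: "levy_measure M (subordinate W L) \<nu>"
begin

lemma sets_nu [measurable_cong]: "sets \<nu> = sets borel" and space_nu [simp]: "space \<nu> = UNIV"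
  by (simp_all add: nu)

lemma integral_nu:
  fixes f :: "real^'n \<Rightarrow> real"
  assumes [measurable]: "f \<in> borel_measurable borel"
  shows "(LINT z|\<nu>. f z) = (LINT z|lborel. c * norm z powr (- (real CARD('n) + 2 * \<alpha>)) * f z)"
  unfolding nu by (subst integral_density) (use c in auto)

lemma sigma_finite_nu: "sigma_finite_measure \<nu>"
  unfolding nu by (subst sigma_finite_measure.sigma_finite_iff_density_finite[OF sigma_finite_lborel]) auto

lemma integrable_truncated_square: "integrable \<nu> (\<lambda>z. min 1 ((norm z)\<^sup>2))"
proof (rule integrableI_nonneg)
  show "(\<integral>\<^sup>+ z. ennreal (min 1 ((norm z)\<^sup>2)) \<partial>\<nu>) < \<infinity>"
    using nu_levy unfolding levy_measure_def levy_triplet_def by blast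
qed auto

lemma integrable_nu_bound:
  fixes f :: "real^'n \<Rightarrow> 'b::{banach,second_countable_topology}"
  assumes "f \<in> borel_measurable borel" "\<And>z. norm (f z) \<le> K * min 1 ((norm z)\<^sup>2)"
  shows "integrable \<nu> f"
proof (rule Bochner_Integration.integrable_bound[OF integrable_mult_right[OF integrable_truncated_square, of K]])
  show "f \<in> borel_measurable \<nu>" using assms(1) by simp
  show "AE z in \<nu>. norm (f z) \<le> norm (K * min 1 ((norm z)\<^sup>2))"
    using assms(2) by (intro AE_I2) (metis abs_ge_self order_trans real_norm_def)
qed

text \<open>Reflection at the origin preserves Lebesgue measure and the radial density. This removes
  the compensated sine terms in the generator of a cosine.\<close>

lemma integral_nu_odd:
  fixes f :: "real^'n \<Rightarrow> real"
  assumes [measurable]: "f \<in> borel_measurable borel" and odd: "\<And>z. f (- z) = - f z"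
  shows "(LINT z|\<nu>. f z) = 0"
proof -
  let ?F = "\<lambda>z. c * norm z powr (- (real CARD('n) + 2 * \<alpha>)) * f z"
  have "(LINT z|lborel. ?F z) = (LINT z|distr lborel borel uminus. ?F z)"
    using lborel_affine[of "-1" "0 :: real^'n"] by (simp add: density_1 del: lborel_distr_uminus)
  also have "\<dots> = (LINT z|lborel. ?F (- z))"
    by (subst integral_distr) auto
  also have "\<dots> = - (LINT z|lborel. ?F z)"
    by (simp add: odd)
  finally show ?thesis by (simp add: integral_nu)
qed

text \<open>The characteristic exponent of \<open>Z\<close>, as \<open>Z_increment_char\<close>
  shows; it is real because \<nu> is symmetric.\<close>

definition symbol :: "real^'n \<Rightarrow> real" where
  "symbol u = (LINT z|\<nu>. 1 - cos (u \<bullet> z))"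

lemma cos_bound: "1 - cos (u \<bullet> z) \<le> (2 + (norm u)\<^sup>2) * min 1 ((norm z)\<^sup>2)"
proof (cases "norm z \<le> 1")
  case True
  then have m: "min 1 ((norm z)\<^sup>2) = (norm z)\<^sup>2" by (simp add: power_le_one min_absorb2)
  have "(u \<bullet> z)\<^sup>2 \<le> (norm u * norm z)\<^sup>2"
    using Cauchy_Schwarz_ineq2[of u z] by (simp add: abs_le_square_iff[symmetric] abs_mult)
  then have "1 - cos (u \<bullet> z) \<le> (norm u)\<^sup>2 * (norm z)\<^sup>2"
    using one_minus_cos_le[of "u \<bullet> z"] zero_le_power2[of "u \<bullet> z"] unfolding power_mult_distrib by linarith
  also have "\<dots> \<le> (2 + (norm u)\<^sup>2) * (norm z)\<^sup>2" by (intro mult_right_mono) auto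
  finally show ?thesis unfolding m .
next
  case False
  then have m: "min 1 ((norm z)\<^sup>2) = 1" by (simp add: one_le_power min_absorb1)
  have "1 - cos (u \<bullet> z) \<le> 2" using cos_ge_minus_one[of "u \<bullet> z"] by linarith
  then show ?thesis unfolding m mult_1_right using zero_le_power2[of "norm u"] by linarith
qed

lemma integrable_one_minus_cos: "integrable \<nu> (\<lambda>z. 1 - cos (u \<bullet> z))"
  by (rule integrable_nu_bound[of _ "2 + (norm u)\<^sup>2"]) (use cos_bound in auto)

lemma symbol_nonneg: "0 \<le> symbol u"
  unfolding symbol_def by (intro integral_nonneg_AE) auto

lemma symbol_bound: "symbol u \<le> (2 + (norm u)\<^sup>2) * (LINT z|\<nu>. min 1 ((norm z)\<^sup>2))"
proof -
  have "symbol u \<le> (LINT z|\<nu>. (2 + (norm u)\<^sup>2) * min 1 ((norm z)\<^sup>2))"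
    unfolding symbol_def
    by (intro integral_mono integrable_one_minus_cos integrable_mult_right integrable_truncated_square cos_bound)
  then show ?thesis by simp
qed

lemma symbol_measurable [measurable]: "symbol \<in> borel_measurable borel"
proof -
  interpret sigma_finite_measure \<nu> by (rule sigma_finite_nu)
  show ?thesis unfolding symbol_def by measurable
qed

text \<open>Substituting \<open>r *\<^sub>R z\<close> for \<open>z\<close>: the Jacobian
  \<open>r ^ CARD('n)\<close> cancels part of the homogeneous density and leaves
  \<open>r powr (- (2 * \<alpha>))\<close>.\<close>

lemma symbol_scale:
  assumes "0 < r"
  shows "symbol (r *\<^sub>R u) = r powr (2 * \<alpha>) * symbol u"
proof -
  let ?p = "- (real CARD('n) + 2 * \<alpha>)"
  define F where "F z = c * norm z powr ?p * (1 - cos (u \<bullet> z))" for z :: "real^'n"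
  have [measurable]: "F \<in> borel_measurable borel" unfolding F_def by measurable
  have "symbol u = (LINT z|lborel. F z)"
    unfolding symbol_def F_def by (rule integral_nu) simp
  also have "\<dots> = (LINT z|density (distr lborel borel (\<lambda>x. 0 + r *\<^sub>R x)) (\<lambda>_. \<bar>r\<bar> ^ DIM(real^'n)). F z)"
    using lborel_affine[of r "0 :: real^'n"] assms by simp
  also have "\<dots> = (LINT z|distr lborel borel (\<lambda>x. 0 + r *\<^sub>R x). (r ^ CARD('n)) *\<^sub>R F z)"
    using assms by (subst integral_density) auto
  also have "\<dots> = (LINT z|lborel. (r ^ CARD('n)) *\<^sub>R F (r *\<^sub>R z))"
    by (subst integral_distr) auto
  also have "\<dots> = (LINT z|lborel. r powr (- (2 * \<alpha>)) * (c * norm z powr ?p * (1 - cos ((r *\<^sub>R u) \<bullet> z))))"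
  proof (intro Bochner_Integration.integral_cong refl)
    fix z :: "real^'n"
    have "r ^ CARD('n) * r powr ?p = r powr (- (2 * \<alpha>))"
      using assms by (simp add: powr_realpow[symmetric] powr_add[symmetric])
    then show "(r ^ CARD('n)) *\<^sub>R F (r *\<^sub>R z) = r powr (- (2 * \<alpha>)) * (c * norm z powr ?p * (1 - cos ((r *\<^sub>R u) \<bullet> z)))"
      using assms by (simp add: F_def powr_mult mult.assoc[symmetric])
  qed
  also have "\<dots> = r powr (- (2 * \<alpha>)) * symbol (r *\<^sub>R u)"
    unfolding symbol_def by (subst integral_nu) auto
  finally have "symbol u = r powr (- (2 * \<alpha>)) * symbol (r *\<^sub>R u)" .
  then show ?thesis
    using assms by (simp add: mult.assoc[symmetric] powr_add[symmetric])
qed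

lemma expectation_exp_L:
  assumes "0 < t" "0 \<le> r"
  shows "expectation (\<lambda>\<omega>. exp (- (L t \<omega> * r))) = expectation (\<lambda>\<omega>. exp (- (L 1 \<omega> * (t powr (1 / \<alpha>) * r))))"
proof -
  have [measurable]: "L t \<in> borel_measurable M" "L 1 \<in> borel_measurable M"
    using assms by (auto intro: L_measurable)
  have "distr M borel (L t) = distr M borel (\<lambda>\<omega>. t powr (1 / \<alpha>) *\<^sub>R L 1 \<omega>)"
    using stable assms by (simp add: strictly_stable_def)
  then have "(LINT x|distr M borel (L t). exp (- (x * r))) = (LINT x|distr M borel (\<lambda>\<omega>. t powr (1 / \<alpha>) *\<^sub>R L 1 \<omega>). exp (- (x * r)))"
    by simp
  then show ?thesis
    by (simp add: integral_distr mult_ac)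
qed

text \<open>The Gaussian part of \<open>Z\<close> vanishes because \<open>symbol\<close> scales with exponent \<open>2 * \<alpha> < 2\<close>, as
  does the exponent of the characteristic function by strict stability of \<open>L\<close>.\<close>

lemma Z_increment_char:
  assumes "0 \<le> s" "0 \<le> h"
  shows "expectation (\<lambda>\<omega>. cos (u \<bullet> (Z (s + h) \<omega> - Z s \<omega>))) = exp (- (h * symbol u))"
proof -
  obtain b C where triplet: "levy_triplet M Z b C \<nu>"
    using nu_levy unfolding levy_measure_def by blast
  define q where "q v = v \<bullet> (C *v v)" for v
  \<comment> \<open>Two expressions for the same characteristic function: subordination gives a
    Laplace transform of \<open>L\<close>, which is real and nonnegative, and the triplet gives an
    exponential. Comparing absolute values removes the drift \<open>b\<close>, which contributes
    only a phase.\<close>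
  have key: "expectation (\<lambda>\<omega>. exp (- (L t \<omega> * (norm v)\<^sup>2 / 2))) = exp (- (t * (q v / 2 + symbol v)))"
    if t: "0 \<le> t" for t v
  proof -
    have Zm [measurable]: "Z t \<in> borel_measurable M" "Z 0 \<in> borel_measurable M" by (auto intro: Z_measurable t)
    define h where "h z = iexp (v \<bullet> z) - 1 - \<i> * of_real (indicator (cball 0 1) z * (v \<bullet> z))" for z
    have hint: "integrable \<nu> h"
    proof (rule integrable_nu_bound[of _ "2 + (norm v)\<^sup>2"])
      have [measurable]: "(\<bullet>) v \<in> borel_measurable borel"
        by (intro borel_measurable_continuous_onI linear_continuous_on bounded_linear_inner_right)
      have [measurable]: "cball 0 1 \<in> sets (borel :: (real^'n) measure)" by simp
      show "h \<in> borel_measurable borel" unfolding h_def by measurable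
      fix z
      show "norm (h z) \<le> (2 + (norm v)\<^sup>2) * min 1 ((norm z)\<^sup>2)"
      proof (cases "norm z \<le> 1")
        case True
        then have m: "min 1 ((norm z)\<^sup>2) = (norm z)\<^sup>2" by (simp add: power_le_one min_absorb2)
        have "norm (h z) \<le> \<bar>v \<bullet> z\<bar> ^ 2 / 2"
          using iexp_approx1[of "v \<bullet> z" 1] True by (simp add: h_def diff_diff_eq power2_eq_square)
        also have "\<bar>v \<bullet> z\<bar> ^ 2 \<le> (norm v * norm z)\<^sup>2"
          by (intro power_mono Cauchy_Schwarz_ineq2) auto
        finally have "norm (h z) \<le> (norm v)\<^sup>2 * (norm z)\<^sup>2 / 2" by (simp add: power_mult_distrib)
        also have "\<dots> \<le> (2 + (norm v)\<^sup>2) * (norm z)\<^sup>2"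
          using mult_nonneg_nonneg[of "(norm v)\<^sup>2" "(norm z)\<^sup>2"] unfolding distrib_right by simp
        finally show ?thesis unfolding m .
      next
        case False
        then have m: "min 1 ((norm z)\<^sup>2) = 1" by (simp add: one_le_power min_absorb1)
        have "norm (h z) \<le> norm (iexp (v \<bullet> z)) + norm (1 :: complex)"
          using False norm_triangle_ineq4[of "iexp (v \<bullet> z)" 1] by (simp add: h_def)
        then have "norm (h z) \<le> 2" by simp
        then show ?thesis unfolding m mult_1_right using zero_le_power2[of "norm v"] by linarith
      qed
    qed
    have "Re (CLINT z|\<nu>. h z) = (LINT z|\<nu>. Re (h z))" using hint by simp
    also have "\<dots> = (LINT z|\<nu>. - (1 - cos (v \<bullet> z)))"
      by (intro Bochner_Integration.integral_cong refl) (simp add: h_def Re_exp)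
    also have "\<dots> = - symbol v" unfolding symbol_def by (rule integral_minus)
    finally have Reh: "Re (CLINT z|\<nu>. h z) = - symbol v" .
    have "(CLINT \<omega>|M. iexp (v \<bullet> Z t \<omega>)) =
        exp (of_real t * (\<i> * of_real (b \<bullet> v) - of_real (q v) / 2 + (CLINT z|\<nu>. h z)))"
      using triplet t unfolding levy_triplet_def q_def h_def by blast
    then have n: "norm (CLINT \<omega>|M. iexp (v \<bullet> Z t \<omega>)) = exp (- (t * (q v / 2 + symbol v)))"
      by (simp add: Reh algebra_simps)
    have int: "integrable M (\<lambda>\<omega>. iexp (v \<bullet> Z t \<omega>))"
      by (rule integrable_const_bound[where B=1]) auto
    have AEZ: "AE \<omega> in M. Z (0 + t) \<omega> - Z 0 \<omega> = Z t \<omega>"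
      using AE_Z_0 by eventually_elim simp
    have "Re (CLINT \<omega>|M. iexp (v \<bullet> Z t \<omega>)) = expectation (\<lambda>\<omega>. cos (v \<bullet> Z t \<omega>))"
      using integral_Re[OF int] by (simp add: Re_exp)
    also have "\<dots> = expectation (\<lambda>\<omega>. cos (v \<bullet> (Z (0 + t) \<omega> - Z 0 \<omega>)))"
      using AEZ by (intro integral_cong_AE) auto
    also have "\<dots> = expectation (\<lambda>\<omega>. exp (- (L t \<omega> * (norm v)\<^sup>2 / 2)))"
      by (rule Z_increment_cos_sin(1)) (use t in auto)
    finally have re: "Re (CLINT \<omega>|M. iexp (v \<bullet> Z t \<omega>)) = expectation (\<lambda>\<omega>. exp (- (L t \<omega> * (norm v)\<^sup>2 / 2)))" .
    have "Im (CLINT \<omega>|M. iexp (v \<bullet> Z t \<omega>)) = expectation (\<lambda>\<omega>. sin (v \<bullet> Z t \<omega>))"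
      using integral_Im[OF int] by (simp add: Im_exp)
    also have "\<dots> = expectation (\<lambda>\<omega>. sin (v \<bullet> (Z (0 + t) \<omega> - Z 0 \<omega>)))"
      using AEZ by (intro integral_cong_AE) auto
    also have "\<dots> = 0"
      by (rule Z_increment_cos_sin(2)) (use t in auto)
    finally have "norm (CLINT \<omega>|M. iexp (v \<bullet> Z t \<omega>)) = \<bar>Re (CLINT \<omega>|M. iexp (v \<bullet> Z t \<omega>))\<bar>"
      by (simp add: cmod_eq_Re)
    moreover have "0 \<le> expectation (\<lambda>\<omega>. exp (- (L t \<omega> * (norm v)\<^sup>2 / 2)))"
      by (intro integral_nonneg_AE) auto
    ultimately show ?thesis using n re by simp
  qed
  have q0: "q v = 0" for v
  proof -
    \<comment> \<open>Chosen so that \<open>?t powr (1 / \<alpha>) = 1 / 4\<close>, whence the law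
      of \<open>L ?t\<close> compensates the doubling of \<open>v\<close>. Under this change the
      symbol term is invariant, whereas the quadratic form is multiplied by \<open>4 * ?t\<close>,
      which differs from 1.\<close>
    let ?t = "2 powr (- (2 * \<alpha>))"
    have a: "?t powr (1 / \<alpha>) = 1 / 4"
    proof -
      have "?t powr (1 / \<alpha>) = 2 powr (- (2 * \<alpha>) * (1 / \<alpha>))" by (rule powr_powr)
      also have "- (2 * \<alpha>) * (1 / \<alpha>) = - 2" using alpha by simp
      finally show ?thesis by (simp add: powr_minus_divide)
    qed
    have "expectation (\<lambda>\<omega>. exp (- (L ?t \<omega> * (norm (2 *\<^sub>R v))\<^sup>2 / 2))) = expectation (\<lambda>\<omega>. exp (- (L 1 \<omega> * (norm v)\<^sup>2 / 2)))"
      using expectation_exp_L[of ?t "(norm (2 *\<^sub>R v))\<^sup>2 / 2"] unfolding a by (simp add: power_mult_distrib mult_ac)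
    then have "exp (- (?t * (q (2 *\<^sub>R v) / 2 + symbol (2 *\<^sub>R v)))) = exp (- (1 * (q v / 2 + symbol v)))"
      using key[of ?t "2 *\<^sub>R v"] key[of 1 v] by simp
    then have "?t * (q (2 *\<^sub>R v) / 2 + symbol (2 *\<^sub>R v)) = q v / 2 + symbol v"
      by simp
    moreover have "symbol (2 *\<^sub>R v) = 2 powr (2 * \<alpha>) * symbol v" by (rule symbol_scale) simp
    moreover have "q (2 *\<^sub>R v) = 4 * q v"
      by (simp add: q_def matrix_vector_mult_scaleR)
    moreover have "?t * 2 powr (2 * \<alpha>) = 1" by (simp add: powr_add[symmetric])
    ultimately have "?t * 2 * q v + symbol v = q v / 2 + symbol v"
      by (simp add: algebra_simps)
    then have "(?t * 4 - 1) * q v = 0" by (simp add: algebra_simps)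
    moreover have "?t * 4 \<noteq> 1"
    proof -
      have "?t * 4 = 2 powr (2 - 2 * \<alpha>)"
        by (simp add: powr_diff powr_minus_divide)
      moreover have "(1::real) < 2 powr (2 - 2 * \<alpha>)" 
        using powr_less_mono[of 0 "2 - 2 * \<alpha>" 2] alpha by simp
      ultimately show ?thesis using alpha by simp
    qed
    ultimately show ?thesis by simp
  qed
  show ?thesis
    using Z_increment_cos_sin(1)[OF assms, of u] key[OF assms(2), of u] by (simp add: q0)
qed

text \<open>The bound 1/2 for \<alpha> enters here: \<open>u powr (2 * \<alpha> - 2)\<close> is
  integrable at 0 exactly when its exponent exceeds -1.\<close>

lemma half_line_finite:
  fixes f :: "real \<Rightarrow> real"
  assumes [measurable]: "f \<in> borel_measurable borel" and AB: "0 \<le> A" "0 \<le> B"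
    and f1: "\<And>u. 0 < u \<Longrightarrow> u \<le> 1 \<Longrightarrow> f u \<le> A * u powr (2 * \<alpha> - 2)"
    and f2: "\<And>u. 1 < u \<Longrightarrow> f u \<le> B * u powr - 2"
  shows "(\<integral>\<^sup>+u. ennreal (f u) * indicator {0<..} u \<partial>lborel) < \<infinity>"
proof -
  let ?a = "\<lambda>u. ennreal (u powr (2 * \<alpha> - 2)) * indicator {0..1} u"
  let ?b = "\<lambda>u. ennreal (u powr - 2) * indicator {1..} u"
  have a: "(\<integral>\<^sup>+u. ?a u \<partial>lborel) < \<infinity>"
    by (subst nn_integral_has_integral_lebesgue'[OF _ has_integral_powr_from_0]) (use alpha in auto)
  have b: "(\<integral>\<^sup>+u. ?b u \<partial>lborel) < \<infinity>"
    by (subst nn_integral_has_integral_lebesgue'[OF _ has_integral_powr_to_inf]) auto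
  have "(\<integral>\<^sup>+u. ennreal (f u) * indicator {0<..} u \<partial>lborel) \<le> (\<integral>\<^sup>+u. ennreal A * ?a u + ennreal B * ?b u \<partial>lborel)"
  proof (rule nn_integral_mono)
    fix u :: real
    show "ennreal (f u) * indicator {0<..} u \<le> ennreal A * ?a u + ennreal B * ?b u"
    proof (cases "0 < u")
      case True
      show ?thesis
      proof (cases "u \<le> 1")
        case u1: True
        then have "ennreal (f u) \<le> ennreal A * ennreal (u powr (2 * \<alpha> - 2))"
          using f1[OF True] AB by (simp add: ennreal_mult[symmetric] ennreal_leI)
        then show ?thesis using True u1 by (simp add: add_increasing2)
      next
        case False
        then have "ennreal (f u) \<le> ennreal B * ennreal (u powr - 2)"
          using f2[of u] AB by (simp add: ennreal_mult[symmetric] ennreal_leI)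
        then show ?thesis using True False by simp
      qed
    qed simp
  qed
  also have "\<dots> = ennreal A * (\<integral>\<^sup>+u. ?a u \<partial>lborel) + ennreal B * (\<integral>\<^sup>+u. ?b u \<partial>lborel)"
    by (subst nn_integral_add) (auto simp: nn_integral_cmult)
  also have "\<dots> < \<infinity>" using a b by (simp add: ennreal_mult_less_top)
  finally show ?thesis .
qed

text \<open>The constant in the representation of an absolute value by cosines, see
  \<open>cos_kernel_scale\<close>. Its value is pi / 2, but only its being positive and finite
  matters.\<close>

definition cos_kernel :: ennreal where
  "cos_kernel = (\<integral>\<^sup>+u. ennreal ((1 - cos u) / u\<^sup>2) * indicator {0<..} u \<partial>lborel)"

lemma cos_kernel_finite: "cos_kernel < \<infinity>"
  unfolding cos_kernel_def
proof (rule half_line_finite[of _ 1 2])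
  fix u :: real assume u: "0 < u" "u \<le> 1"
  have "(1 - cos u) / u\<^sup>2 \<le> (u\<^sup>2 / 2) / u\<^sup>2"
    by (intro divide_right_mono one_minus_cos_le) simp
  also have "\<dots> \<le> 1" using u by simp
  also have "1 \<le> u powr (2 * \<alpha> - 2)"
    using u alpha powr_mono'[of "2 * \<alpha> - 2" 0 u] by simp
  finally show "(1 - cos u) / u\<^sup>2 \<le> 1 * u powr (2 * \<alpha> - 2)" by simp
next
  fix u :: real assume u: "1 < u"
  have "(1 - cos u) / u\<^sup>2 \<le> 2 / u\<^sup>2"
    using cos_ge_minus_one[of u] by (intro divide_right_mono) auto
  also have "\<dots> = 2 * u powr - 2" using u by (simp add: powr_minus_divide)
  finally show "(1 - cos u) / u\<^sup>2 \<le> 2 * u powr - 2" .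
qed auto

lemma cos_kernel_nonzero: "cos_kernel \<noteq> 0"
proof
  assume "cos_kernel = 0"
  then have "AE u in lborel. ennreal ((1 - cos u) / u\<^sup>2) * indicator {0<..} u = 0"
    unfolding cos_kernel_def by (subst (asm) nn_integral_0_iff_AE) auto
  then have "AE u in lborel. u \<notin> {1<..<2::real}"
  proof eventually_elim
    case (elim u)
    show ?case
    proof
      assume u: "u \<in> {1<..<2::real}"
      then have "cos u < cos 0" using pi_gt3 by (intro cos_monotone_0_pi) auto
      then have "0 < (1 - cos u) / u\<^sup>2" using u by simp
      then show False using elim u by (simp add: ennreal_eq_0_iff)
    qed
  qed
  then have "emeasure lborel {1<..<2::real} = 0"
    by (subst (asm) AE_iff_measurable[where N="{1<..<2::real}"]) auto
  then show False by simp
qed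

text \<open>Scaling the variable by |y| extracts this factor from the integral. A first absolute
  moment thereby becomes an integral of real parts of characteristic functions.\<close>

lemma cos_kernel_scale:
  "(\<integral>\<^sup>+u. ennreal ((1 - cos (u * y)) / u\<^sup>2) * indicator {0<..} u \<partial>lborel) = ennreal \<bar>y\<bar> * cos_kernel"
proof (cases "y = 0")
  case False
  let ?c = "1 / \<bar>y\<bar>"
  have c: "?c \<noteq> 0" "0 < ?c" using False by auto
  have "(\<integral>\<^sup>+u. ennreal ((1 - cos (u * y)) / u\<^sup>2) * indicator {0<..} u \<partial>lborel)
     = ennreal \<bar>?c\<bar> * (\<integral>\<^sup>+u. ennreal ((1 - cos ((0 + ?c * u) * y)) / (0 + ?c * u)\<^sup>2) * indicator {0<..} (0 + ?c * u) \<partial>lborel)"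
    by (rule nn_integral_real_affine) (use c in auto)
  also have "(\<integral>\<^sup>+u. ennreal ((1 - cos ((0 + ?c * u) * y)) / (0 + ?c * u)\<^sup>2) * indicator {0<..} (0 + ?c * u) \<partial>lborel)
     = (\<integral>\<^sup>+u. ennreal (y\<^sup>2) * (ennreal ((1 - cos u) / u\<^sup>2) * indicator {0<..} u) \<partial>lborel)"
  proof (rule nn_integral_cong)
    fix u :: real
    have "cos ((0 + ?c * u) * y) = cos u"
    proof (cases "0 < y")
      case True then show ?thesis by simp
    next
      case False
      then have "(0 + ?c * u) * y = - u" using \<open>y \<noteq> 0\<close> by (simp add: field_simps)
      then show ?thesis by simp
    qed
    moreover have "(0 + ?c * u)\<^sup>2 = u\<^sup>2 / y\<^sup>2" by (simp add: power_divide)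
    moreover have "indicator {0<..} (0 + ?c * u) = (indicator {0<..} u :: ennreal)"
      using False by (simp add: indicator_def zero_less_divide_iff)
    moreover have "(1 - cos u) / (u\<^sup>2 / y\<^sup>2) = y\<^sup>2 * ((1 - cos u) / u\<^sup>2)" by simp
    moreover have "ennreal (y\<^sup>2 * ((1 - cos u) / u\<^sup>2)) = ennreal (y\<^sup>2) * ennreal ((1 - cos u) / u\<^sup>2)"
      by (rule ennreal_mult) auto
    ultimately show "ennreal ((1 - cos ((0 + ?c * u) * y)) / (0 + ?c * u)\<^sup>2) * indicator {0<..} (0 + ?c * u) =
        ennreal (y\<^sup>2) * (ennreal ((1 - cos u) / u\<^sup>2) * indicator {0<..} u)"
      by (simp only: mult.assoc)
  qed
  also have "\<dots> = ennreal (y\<^sup>2) * cos_kernel"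
    unfolding cos_kernel_def by (rule nn_integral_cmult) measurable
  also have "ennreal \<bar>?c\<bar> * (ennreal (y\<^sup>2) * cos_kernel) = ennreal (\<bar>?c\<bar> * y\<^sup>2) * cos_kernel"
    by (simp only: mult.assoc[symmetric] ennreal_mult[OF abs_ge_zero zero_le_power2])
  also have "\<bar>?c\<bar> * y\<^sup>2 = \<bar>y\<bar>"
    using False by (cases "0 < y") (auto simp: power2_eq_square field_simps)
  finally show ?thesis .
qed simp

text \<open>A sum where a maximum over the coordinate directions would do; any common upper bound of
  the symbols in these directions serves.\<close>

definition symbol_max :: real where
  "symbol_max = (\<Sum>i\<in>UNIV. symbol (axis i 1))"

text \<open>By Tonelli this dominates \<open>cos_kernel\<close> times the first absolute moment of a
  coordinate of an increment over time \<open>h\<close>; the exact exponent is replaced by the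
  common bound \<open>symbol_max * u powr (2 * \<alpha>)\<close>.\<close>

definition tail_int :: "real \<Rightarrow> ennreal" where
  "tail_int h = (\<integral>\<^sup>+u. ennreal ((1 - exp (- (h * symbol_max * u powr (2 * \<alpha>)))) / u\<^sup>2) * indicator {0<..} u \<partial>lborel)"

lemma symbol_max_nonneg: "0 \<le> symbol_max"
  unfolding symbol_max_def by (intro sum_nonneg symbol_nonneg)

lemma tail_int_integrand:
  assumes "0 \<le> h" "0 < u"
  shows "(1 - exp (- (h * symbol_max * u powr (2 * \<alpha>)))) / u\<^sup>2 \<le> h * symbol_max * u powr (2 * \<alpha> - 2)"
    and "(1 - exp (- (h * symbol_max * u powr (2 * \<alpha>)))) / u\<^sup>2 \<le> 1 * u powr - 2"
proof -
  let ?x = "h * symbol_max * u powr (2 * \<alpha>)"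
  have x: "0 \<le> ?x" using assms symbol_max_nonneg by simp
  have u2: "u\<^sup>2 = u powr 2" using assms by simp
  have "(1 - exp (- ?x)) / u\<^sup>2 \<le> ?x / u\<^sup>2"
    using exp_ge_add_one_self[of "- ?x"] by (intro divide_right_mono) auto
  also have "\<dots> = h * symbol_max * u powr (2 * \<alpha> - 2)"
    unfolding u2 powr_diff by simp
  finally show "(1 - exp (- ?x)) / u\<^sup>2 \<le> h * symbol_max * u powr (2 * \<alpha> - 2)" .
  have "(1 - exp (- ?x)) / u\<^sup>2 \<le> 1 / u\<^sup>2" by (intro divide_right_mono) auto
  then show "(1 - exp (- ?x)) / u\<^sup>2 \<le> 1 * u powr - 2"
    using assms by (simp add: powr_minus_divide)
qed

lemma tail_int_finite: "0 \<le> h \<Longrightarrow> tail_int h < \<infinity>"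
  unfolding tail_int_def
  by (rule half_line_finite[of _ "h * symbol_max" 1])
     (use tail_int_integrand symbol_max_nonneg in auto)

lemma tail_int_mono:
  assumes "0 \<le> h" "h \<le> h'"
  shows "tail_int h \<le> tail_int h'"
  unfolding tail_int_def
proof (intro nn_integral_mono mult_right_mono ennreal_leI divide_right_mono)
  fix u :: real
  have "h * symbol_max * u powr (2 * \<alpha>) \<le> h' * symbol_max * u powr (2 * \<alpha>)"
    using assms symbol_max_nonneg by (intro mult_right_mono) auto
  then show "1 - exp (- (h * symbol_max * u powr (2 * \<alpha>))) \<le> 1 - exp (- (h' * symbol_max * u powr (2 * \<alpha>)))"
    by simp
qed auto

text \<open>A bound for the mean norm of an increment over time \<open>h\<close>, estimated by the
  sum of the coordinates. What counts is that it is a deterministic monotone function with limit 0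
  at 0, so that its value at \<open>h\<close> bounds all shorter increments too.\<close>

definition mom :: "real \<Rightarrow> real" where
  "mom h = real CARD('n) * (enn2real (tail_int h) / enn2real cos_kernel)"

lemma cos_kernel_pos: "0 < enn2real cos_kernel"
  using cos_kernel_finite cos_kernel_nonzero by (simp add: enn2real_positive_iff zero_less_iff_neq_zero)

lemma mom_nonneg: "0 \<le> mom h"
  unfolding mom_def by simp

lemma mom_mono: "0 \<le> h \<Longrightarrow> h \<le> h' \<Longrightarrow> mom h \<le> mom h'"
  unfolding mom_def using tail_int_finite[of h'] cos_kernel_pos
  by (intro mult_left_mono divide_right_mono enn2real_mono tail_int_mono) auto

text \<open>Dominated convergence along \<open>1 / real (Suc n)\<close>, with the integrand at
  \<open>h = 1\<close> as majorant; monotonicity fills in the other values of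
  \<open>h\<close>.\<close>

lemma mom_small:
  assumes "0 < e"
  obtains d where "0 < d" "\<And>h. 0 \<le> h \<Longrightarrow> h \<le> d \<Longrightarrow> mom h < e"
proof -
  let ?h = "\<lambda>n. 1 / real (Suc n)"
  have hl: "?h \<longlonglongrightarrow> 0"
    using LIMSEQ_inverse_real_of_nat by (simp add: inverse_eq_divide)
  have "(\<lambda>n. tail_int (?h n)) \<longlonglongrightarrow> (\<integral>\<^sup>+u. (0::ennreal) \<partial>(lborel :: real measure))"
    unfolding tail_int_def
  proof (rule nn_integral_dominated_convergence[where w="\<lambda>u. ennreal ((1 - exp (- (1 * symbol_max * u powr (2 * \<alpha>)))) / u\<^sup>2) * indicator {0<..} u"])
    show "(\<integral>\<^sup>+u. ennreal ((1 - exp (- (1 * symbol_max * u powr (2 * \<alpha>)))) / u\<^sup>2) * indicator {0<..} u \<partial>lborel) < \<infinity>"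
      using tail_int_finite[of 1] by (simp add: tail_int_def)
    show "AE u in lborel. ennreal ((1 - exp (- (?h n * symbol_max * u powr (2 * \<alpha>)))) / u\<^sup>2) * indicator {0<..} u
        \<le> ennreal ((1 - exp (- (1 * symbol_max * u powr (2 * \<alpha>)))) / u\<^sup>2) * indicator {0<..} u" for n
    proof (intro AE_I2 mult_right_mono ennreal_leI divide_right_mono)
      fix u :: real
      have "?h n * symbol_max * u powr (2 * \<alpha>) \<le> 1 * symbol_max * u powr (2 * \<alpha>)"
        using symbol_max_nonneg by (intro mult_right_mono) auto
      then show "1 - exp (- (?h n * symbol_max * u powr (2 * \<alpha>))) \<le> 1 - exp (- (1 * symbol_max * u powr (2 * \<alpha>)))"
        by simp
    qed auto
    show "AE u in lborel. (\<lambda>n. ennreal ((1 - exp (- (?h n * symbol_max * u powr (2 * \<alpha>)))) / u\<^sup>2) * indicator {0<..} u) \<longlonglongrightarrow> 0"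
    proof (rule AE_I2)
      fix u :: real
      have "(\<lambda>n. (1 - exp (- (?h n * symbol_max * u powr (2 * \<alpha>)))) / u\<^sup>2) \<longlonglongrightarrow> (1 - exp (- (0 * symbol_max * u powr (2 * \<alpha>)))) * inverse (u\<^sup>2)"
        unfolding divide_inverse[of _ "u\<^sup>2"] by (intro tendsto_intros hl)
      then have "(\<lambda>n. ennreal ((1 - exp (- (?h n * symbol_max * u powr (2 * \<alpha>)))) / u\<^sup>2)) \<longlonglongrightarrow> ennreal 0"
        by (intro tendsto_ennrealI) simp
      then show "(\<lambda>n. ennreal ((1 - exp (- (?h n * symbol_max * u powr (2 * \<alpha>)))) / u\<^sup>2) * indicator {0<..} u) \<longlonglongrightarrow> 0"
        by (cases "u \<in> {0<..}") auto
    qed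
  qed auto
  then have "(\<lambda>n. tail_int (?h n)) \<longlonglongrightarrow> ennreal 0" by simp
  then have lim: "(\<lambda>n. enn2real (tail_int (?h n))) \<longlonglongrightarrow> 0"
    by (rule tendsto_enn2real) simp
  then have "(\<lambda>n. mom (?h n)) \<longlonglongrightarrow> real CARD('n) * (0 / enn2real cos_kernel)"
    unfolding mom_def
    by (intro tendsto_mult tendsto_const tendsto_divide lim) (use cos_kernel_pos in auto)
  then have "(\<lambda>n. mom (?h n)) \<longlonglongrightarrow> 0" by simp
  from order_tendstoD(2)[OF this assms] obtain n where "mom (?h n) < e"
    by (auto simp: eventually_sequentially)
  then have "mom h < e" if "0 \<le> h" "h \<le> ?h n" for h
    using mom_mono[OF that] by linarith
  then show ?thesis using that[of "?h n"] by auto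
qed

text \<open>Tonelli for the cosine representation of each coordinate; inside, the mean of the cosine
  is known from \<open>Z_increment_char\<close>. Working with nonnegative integrals proves
  integrability and the bound at once.\<close>

lemma Z_increment_moment:
  assumes s: "0 \<le> s" and h: "0 \<le> h"
  shows "integrable M (\<lambda>\<omega>. Z (s + h) \<omega> - Z s \<omega>)"
    and "expectation (\<lambda>\<omega>. norm (Z (s + h) \<omega> - Z s \<omega>)) \<le> mom h"
proof -
  define Y where "Y \<omega> = Z (s + h) \<omega> - Z s \<omega>" for \<omega>
  have Ym [measurable]: "Y \<in> borel_measurable M"
    unfolding Y_def using Z_measurable[of "s + h"] Z_measurable[of s] s h by simp
  have [measurable]: "(\<lambda>x :: real^'n. x $ i) \<in> borel_measurable borel" for i
    by (intro borel_measurable_continuous_onI continuous_intros)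
  have comp: "(\<integral>\<^sup>+\<omega>. ennreal \<bar>Y \<omega> $ i\<bar> \<partial>M) \<le> ennreal (enn2real (tail_int h) / enn2real cos_kernel)" for i
  proof -
    interpret P: pair_sigma_finite M lborel by standard
    have "cos_kernel * (\<integral>\<^sup>+\<omega>. ennreal \<bar>Y \<omega> $ i\<bar> \<partial>M) = (\<integral>\<^sup>+\<omega>. ennreal \<bar>Y \<omega> $ i\<bar> * cos_kernel \<partial>M)"
      by (subst nn_integral_multc) (auto simp: mult.commute)
    also have "\<dots> = (\<integral>\<^sup>+\<omega>. \<integral>\<^sup>+u. ennreal ((1 - cos (u * Y \<omega> $ i)) / u\<^sup>2) * indicator {0<..} u \<partial>lborel \<partial>M)"
      by (simp add: cos_kernel_scale)
    also have "\<dots> = (\<integral>\<^sup>+u. \<integral>\<^sup>+\<omega>. ennreal ((1 - cos (u * Y \<omega> $ i)) / u\<^sup>2) * indicator {0<..} u \<partial>M \<partial>lborel)"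
      by (rule P.Fubini'[symmetric]) measurable
    also have "\<dots> \<le> tail_int h"
      unfolding tail_int_def
    proof (rule nn_integral_mono)
      fix u :: real
      show "(\<integral>\<^sup>+\<omega>. ennreal ((1 - cos (u * Y \<omega> $ i)) / u\<^sup>2) * indicator {0<..} u \<partial>M)
        \<le> ennreal ((1 - exp (- (h * symbol_max * u powr (2 * \<alpha>)))) / u\<^sup>2) * indicator {0<..} u"
      proof (cases "0 < u")
        case True
        have c: "integrable M (\<lambda>\<omega>. cos (u * Y \<omega> $ i))"
          by (rule integrable_const_bound[where B=1]) auto
        have "symbol (u *\<^sub>R axis i 1) \<le> symbol_max * u powr (2 * \<alpha>)"
        proof -
          have "symbol (axis i 1) \<le> symbol_max"
            unfolding symbol_max_def by (rule member_le_sum) (auto intro: symbol_nonneg)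
          then show ?thesis
            unfolding symbol_scale[OF True] by (simp add: mult.commute mult_right_mono)
        qed
        then have le: "1 - exp (- (h * symbol (u *\<^sub>R axis i 1))) \<le> 1 - exp (- (h * symbol_max * u powr (2 * \<alpha>)))"
          using h by (simp add: mult_left_mono mult.assoc)
        have "expectation (\<lambda>\<omega>. cos (u * Y \<omega> $ i)) = exp (- (h * symbol (u *\<^sub>R axis i 1)))"
          using Z_increment_char[OF s h, of "u *\<^sub>R axis i 1"] by (simp add: Y_def inner_axis')
        then have "expectation (\<lambda>\<omega>. (1 - cos (u * Y \<omega> $ i)) / u\<^sup>2) = (1 - exp (- (h * symbol (u *\<^sub>R axis i 1)))) / u\<^sup>2"
          using c by (simp add: prob_space)
        moreover have "(\<integral>\<^sup>+\<omega>. ennreal ((1 - cos (u * Y \<omega> $ i)) / u\<^sup>2) \<partial>M) = ennreal (expectation (\<lambda>\<omega>. (1 - cos (u * Y \<omega> $ i)) / u\<^sup>2))"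
          using c by (intro nn_integral_eq_integral) auto
        ultimately have "(\<integral>\<^sup>+\<omega>. ennreal ((1 - cos (u * Y \<omega> $ i)) / u\<^sup>2) \<partial>M) = ennreal ((1 - exp (- (h * symbol (u *\<^sub>R axis i 1)))) / u\<^sup>2)"
          by (simp only:)
        also have "\<dots> \<le> ennreal ((1 - exp (- (h * symbol_max * u powr (2 * \<alpha>)))) / u\<^sup>2)"
          by (intro ennreal_leI divide_right_mono le) simp
        finally have "(\<integral>\<^sup>+\<omega>. ennreal ((1 - cos (u * Y \<omega> $ i)) / u\<^sup>2) \<partial>M) \<le> ennreal ((1 - exp (- (h * symbol_max * u powr (2 * \<alpha>)))) / u\<^sup>2)" .
        then show ?thesis using True by simp
      qed simp
    qed
    finally have "cos_kernel * (\<integral>\<^sup>+\<omega>. ennreal \<bar>Y \<omega> $ i\<bar> \<partial>M) \<le> tail_int h" .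
    also have "tail_int h = ennreal (enn2real cos_kernel * (enn2real (tail_int h) / enn2real cos_kernel))"
      using tail_int_finite[OF h] cos_kernel_pos by simp
    also have "\<dots> = cos_kernel * ennreal (enn2real (tail_int h) / enn2real cos_kernel)"
      using cos_kernel_finite by (subst ennreal_mult) auto
    finally show ?thesis
      using cos_kernel_finite cos_kernel_nonzero by (subst (asm) ennreal_mult_le_mult_iff) auto
  qed
  have int: "integrable M (\<lambda>\<omega>. Y \<omega> $ i)" for i
  proof (rule integrableI_bounded)
    show "(\<integral>\<^sup>+\<omega>. ennreal (norm (Y \<omega> $ i)) \<partial>M) < \<infinity>"
      using order.strict_trans1[OF comp[of i], of \<infinity>] by simp
  qed measurable
  have E: "expectation (\<lambda>\<omega>. \<bar>Y \<omega> $ i\<bar>) \<le> enn2real (tail_int h) / enn2real cos_kernel" for i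
  proof -
    have "ennreal (expectation (\<lambda>\<omega>. \<bar>Y \<omega> $ i\<bar>)) = (\<integral>\<^sup>+\<omega>. ennreal \<bar>Y \<omega> $ i\<bar> \<partial>M)"
      using int[of i] by (intro nn_integral_eq_integral[symmetric]) auto
    then have "ennreal (expectation (\<lambda>\<omega>. \<bar>Y \<omega> $ i\<bar>)) \<le> ennreal (enn2real (tail_int h) / enn2real cos_kernel)"
      using comp[of i] by simp
    then show ?thesis by (subst (asm) ennreal_le_iff) auto
  qed
  have sum: "integrable M (\<lambda>\<omega>. \<Sum>i\<in>UNIV. \<bar>Y \<omega> $ i\<bar>)"
    using int by (intro Bochner_Integration.integrable_sum integrable_abs)
  have "integrable M Y"
    by (rule Bochner_Integration.integrable_bound[OF sum Ym]) (auto intro!: AE_I2 order_trans[OF norm_le_l1_cart] abs_ge_self)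
  then show "integrable M (\<lambda>\<omega>. Z (s + h) \<omega> - Z s \<omega>)" by (simp add: Y_def[abs_def])
  have "expectation (\<lambda>\<omega>. norm (Y \<omega>)) \<le> expectation (\<lambda>\<omega>. \<Sum>i\<in>UNIV. \<bar>Y \<omega> $ i\<bar>)"
    using \<open>integrable M Y\<close> by (intro integral_mono sum integrable_norm norm_le_l1_cart)
  also have "\<dots> = (\<Sum>i\<in>UNIV. expectation (\<lambda>\<omega>. \<bar>Y \<omega> $ i\<bar>))"
    using int by (intro Bochner_Integration.integral_sum integrable_abs)
  also have "\<dots> \<le> (\<Sum>i\<in>(UNIV::'n set). enn2real (tail_int h) / enn2real cos_kernel)"
    by (intro sum_mono E)
  finally show "expectation (\<lambda>\<omega>. norm (Z (s + h) \<omega> - Z s \<omega>)) \<le> mom h"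
    by (simp add: mom_def Y_def)
qed

end

declare C_lip.simps [simp del]

section \<open>The generator of the noise\<close>

locale noise_matrix = stable_noise M W L \<alpha> c \<nu>
  for M :: "'a measure" and W :: "real \<Rightarrow> 'a \<Rightarrow> real^'n" and L \<alpha> c \<nu> +
  fixes R :: "real^'n^'n"
begin

definition \<rho> :: real where "\<rho> = onorm ((*v) R)"

lemma norm_R_le: "norm (R *v z) \<le> \<rho> * norm z"
  unfolding \<rho>_def by (rule onorm) simp

lemma \<rho>_nonneg: "0 \<le> \<rho>"
  unfolding \<rho>_def by (rule onorm_pos_le) simp

lemma R_measurable [measurable]: "(*v) R \<in> borel_measurable borel"
  by (intro borel_measurable_continuous_onI linear_continuous_on) simp

definition jump :: "(real^'n \<Rightarrow> real) \<Rightarrow> real^'n \<Rightarrow> real^'n \<Rightarrow> real" where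
  "jump f x z = f (x + R *v z) - f x - indicator (cball 0 1) z * (grad f x \<bullet> (R *v z))"

text \<open>The generator of the noise \<open>R *v Z\<close> alone, that is, the integral term of
  \<open>generator\<close>.\<close>

definition igen :: "(real^'n \<Rightarrow> real) \<Rightarrow> real^'n \<Rightarrow> real" where
  "igen f x = (LINT z|\<nu>. jump f x z)"

definition trunc_mass :: real where "trunc_mass = (LINT z|\<nu>. min 1 ((norm z)\<^sup>2))"

lemma trunc_mass_nonneg: "0 \<le> trunc_mass"
  unfolding trunc_mass_def by (intro integral_nonneg_AE) auto

lemma jump_measurable:
  assumes "f \<in> borel_measurable borel"
  shows "jump f x \<in> borel_measurable borel"
proof -
  note assms[measurable]
  have [measurable]: "cball 0 1 \<in> sets (borel :: (real^'n) measure)" by simp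
  have [measurable]: "(\<lambda>z. grad f x \<bullet> (R *v z)) \<in> borel_measurable borel"
    by (intro borel_measurable_continuous_onI continuous_intros linear_continuous_on) simp
  show ?thesis unfolding jump_def by measurable
qed

abbreviation jump_const :: "real \<Rightarrow> real" where
  "jump_const K \<equiv> K * (2 + real CARD('n) * \<rho>\<^sup>2)"

lemma jump_bound:
  assumes f: "f \<in> C_lip 1 K"
  shows "\<bar>jump f x z\<bar> \<le> jump_const K * min 1 ((norm z)\<^sup>2)"
proof (cases "norm z \<le> 1")
  case True
  have f': "f \<in> C_lip (Suc 0) K" using f by simp
  have K: "0 \<le> K" using f by (rule C_lip_nonneg)
  have m: "min 1 ((norm z)\<^sup>2) = (norm z)\<^sup>2" using True by (simp add: power_le_one min_absorb2)
  have "\<bar>jump f x z\<bar> \<le> real CARD('n) * K * (norm (R *v z))\<^sup>2"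
    using C_lip_taylor[OF f', of "x + R *v z" x] True by (simp add: jump_def)
  also have "\<dots> \<le> real CARD('n) * K * (\<rho> * norm z)\<^sup>2"
    using K by (intro mult_left_mono power_mono norm_R_le) auto
  also have "\<dots> \<le> jump_const K * (norm z)\<^sup>2"
    using K by (simp add: power_mult_distrib algebra_simps)
  finally show ?thesis unfolding m .
next
  case False
  have K: "0 \<le> K" using f by (rule C_lip_nonneg)
  have m: "min 1 ((norm z)\<^sup>2) = 1" using False by (simp add: one_le_power min_absorb1)
  have "\<bar>jump f x z\<bar> \<le> \<bar>f (x + R *v z)\<bar> + \<bar>f x\<bar>"
    using False by (simp add: jump_def)
  also have "\<dots> \<le> 2 * K" using C_lip_bound[OF f, of "x + R *v z"] C_lip_bound[OF f, of x] by linarith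
  also have "\<dots> \<le> jump_const K" using K by (simp add: algebra_simps)
  finally show ?thesis unfolding m by simp
qed

lemma jump_integrable: "f \<in> C_lip 1 K \<Longrightarrow> integrable \<nu> (jump f x)"
  using integrable_nu_bound[OF jump_measurable[OF C_lip_measurable]] jump_bound
  unfolding real_norm_def by blast

lemma igen_bound:
  assumes f: "f \<in> C_lip 1 K"
  shows "\<bar>igen f x\<bar> \<le> jump_const K * trunc_mass"
proof -
  have "\<bar>igen f x\<bar> \<le> (LINT z|\<nu>. \<bar>jump f x z\<bar>)"
    unfolding igen_def by (rule integral_abs_bound)
  also have "\<dots> \<le> (LINT z|\<nu>. jump_const K * min 1 ((norm z)\<^sup>2))"
    by (intro integral_mono integrable_abs jump_integrable[OF f] integrable_mult_right integrable_truncated_square jump_bound[OF f])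
  finally show ?thesis by (simp add: trunc_mass_def)
qed

text \<open>Continuity of \<open>igen f\<close> with constants that depend on \<open>f\<close> only
  through \<open>K\<close>. Jumps of size at most \<open>1 / real (Suc n)\<close> contribute less
  than \<open>e\<close> in total for some \<open>n\<close>, by dominated convergence of the
  truncated second moment; for longer jumps \<open>jump f x z\<close> is Lipschitz in
  \<open>x\<close>, and they have finite mass.\<close>

lemma igen_modulus:
  assumes e: "0 < e" and K: "0 \<le> K"
  obtains C where "0 \<le> C" "\<And>f x y. f \<in> C_lip 1 K \<Longrightarrow> \<bar>igen f x - igen f y\<bar> \<le> e + C * norm (x - y)"
proof -
  let ?q = "\<lambda>z :: real^'n. min 1 ((norm z)\<^sup>2)"
  let ?S = "\<lambda>n. {z :: real^'n. norm z \<le> 1 / real (Suc n)}"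
  \<comment> \<open>The Lipschitz constant of \<open>jump f x z\<close> in \<open>x\<close>: two
    differences of \<open>f\<close>, plus the gradient term, which lives on the unit ball
    only.\<close>
  let ?K2 = "2 * K + real CARD('n) * K * \<rho>"
  have Sm [measurable]: "?S n \<in> sets borel" for n by measurable
  have "(\<lambda>n. LINT z|\<nu>. 2 * jump_const K * ?q z * indicator (?S n) z) \<longlonglongrightarrow> (LINT z|\<nu>. 0)"
  proof (rule integral_dominated_convergence[where w="\<lambda>z. 2 * jump_const K * ?q z"])
    show "integrable \<nu> (\<lambda>z. 2 * jump_const K * ?q z)"
      by (intro integrable_mult_right integrable_truncated_square)
    show "AE z in \<nu>. norm (2 * jump_const K * ?q z * indicator (?S n) z) \<le> 2 * jump_const K * ?q z" for n
      using K \<rho>_nonneg by (intro AE_I2) (auto simp: indicator_def)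
    show "AE z in \<nu>. (\<lambda>n. 2 * jump_const K * ?q z * indicator (?S n) z) \<longlonglongrightarrow> 0"
    proof (rule AE_I2)
      fix z :: "real^'n"
      show "(\<lambda>n. 2 * jump_const K * ?q z * indicator (?S n) z) \<longlonglongrightarrow> 0"
      proof (cases "z = 0")
        case False
        then have "0 < norm z" by simp
        then obtain N where N: "1 / real (Suc N) < norm z"
          using nat_approx_posE by blast
        have "z \<notin> ?S n" if "n \<ge> N" for n
        proof -
          have "1 / real (Suc n) \<le> 1 / real (Suc N)" using that by (simp add: frac_le)
          then show ?thesis using N by simp
        qed
        then have "eventually (\<lambda>n. 2 * jump_const K * ?q z * indicator (?S n) z = 0) sequentially"
          unfolding eventually_sequentially by (intro exI[of _ N]) simp
        then show ?thesis by (rule tendsto_eventually)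
      qed simp
    qed
  qed auto
  then have "(\<lambda>n. LINT z|\<nu>. 2 * jump_const K * ?q z * indicator (?S n) z) \<longlonglongrightarrow> 0" by simp
  from order_tendstoD(2)[OF this e] obtain n where n: "(LINT z|\<nu>. 2 * jump_const K * ?q z * indicator (?S n) z) < e"
    by (auto simp: eventually_sequentially)
  \<comment> \<open>Outside \<open>?S n\<close> the truncated square of the norm is at least
    \<open>1 / (real (Suc n))\<^sup>2\<close>; multiplying by the square of \<open>Suc n\<close>
    therefore allows integration against it, at the price \<open>trunc_mass\<close>.\<close>
  define C where "C = ?K2 * (real (Suc n))\<^sup>2 * trunc_mass"
  have C: "0 \<le> C" unfolding C_def using K \<rho>_nonneg trunc_mass_nonneg by simp
  have "\<bar>igen f x - igen f y\<bar> \<le> e + C * norm (x - y)" if f: "f \<in> C_lip 1 K" for f x y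
  proof -
    have f': "f \<in> C_lip (Suc 0) K" using f by simp
    have d: "\<bar>jump f x z - jump f y z\<bar> \<le> ?K2 * norm (x - y)" for z
    proof -
      have g: "\<bar>indicator (cball 0 1) z * (grad f x \<bullet> (R *v z)) - indicator (cball 0 1) z * (grad f y \<bullet> (R *v z))\<bar>
          \<le> real CARD('n) * K * norm (x - y) * \<rho>"
      proof (cases "norm z \<le> 1")
        case True
        have "\<bar>(grad f x - grad f y) \<bullet> (R *v z)\<bar> \<le> norm (grad f x - grad f y) * norm (R *v z)"
          by (rule Cauchy_Schwarz_ineq2)
        also have "\<dots> \<le> (real CARD('n) * K * norm (x - y)) * (\<rho> * 1)"
          using K \<rho>_nonneg True
          by (intro mult_mono norm_grad_diff_le[OF f'] order_trans[OF norm_R_le] mult_left_mono) auto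
        finally show ?thesis using True by (simp add: inner_diff_left)
      next
        case False
        then show ?thesis using K \<rho>_nonneg by simp
      qed
      have "\<bar>f (x + R *v z) - f (y + R *v z)\<bar> \<le> K * norm (x - y)"
        using C_lip_lipschitz[OF f, of "x + R *v z" "y + R *v z"] by simp
      then show ?thesis
        using g C_lip_lipschitz[OF f, of x y] unfolding jump_def by (simp add: algebra_simps)
    qed
    have "\<bar>jump f x z - jump f y z\<bar> \<le> 2 * jump_const K * ?q z * indicator (?S n) z + (?K2 * (real (Suc n))\<^sup>2 * norm (x - y)) * ?q z" for z
    proof (cases "z \<in> ?S n")
      case True
      have "\<bar>jump f x z - jump f y z\<bar> \<le> 2 * jump_const K * ?q z"
        using jump_bound[OF f, of x z] jump_bound[OF f, of y z] by linarith
      moreover have "0 \<le> (?K2 * (real (Suc n))\<^sup>2 * norm (x - y)) * ?q z"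
        using K \<rho>_nonneg by simp
      ultimately show ?thesis using True by simp
    next
      case False
      then have "1 / real (Suc n) < norm z" by simp
      then have "(1 / real (Suc n))\<^sup>2 \<le> (norm z)\<^sup>2" by (intro power_mono) auto
      moreover have "(1 / real (Suc n))\<^sup>2 \<le> 1" by (simp add: power_le_one)
      ultimately have "(1 / real (Suc n))\<^sup>2 \<le> ?q z" by simp
      then have "(real (Suc n))\<^sup>2 * (1 / real (Suc n))\<^sup>2 \<le> (real (Suc n))\<^sup>2 * ?q z"
        by (rule mult_left_mono) simp
      moreover have "(real (Suc n))\<^sup>2 * (1 / real (Suc n))\<^sup>2 = 1"
        by (simp only: power_mult_distrib[symmetric]) simp
      ultimately have q: "1 \<le> (real (Suc n))\<^sup>2 * ?q z" by (simp only:)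
      have "?K2 * norm (x - y) * 1 \<le> ?K2 * norm (x - y) * ((real (Suc n))\<^sup>2 * ?q z)"
        using K \<rho>_nonneg by (intro mult_left_mono q) auto
      also have "\<dots> = (?K2 * (real (Suc n))\<^sup>2 * norm (x - y)) * ?q z"
        by (simp only: mult.assoc mult.left_commute)
      finally have "?K2 * norm (x - y) \<le> (?K2 * (real (Suc n))\<^sup>2 * norm (x - y)) * ?q z"
        by (simp only: mult_1_right)
      then show ?thesis using d[of z] False by simp
    qed note bound = this
    have i1: "integrable \<nu> (\<lambda>z. 2 * jump_const K * ?q z * indicator (?S n) z)"
      by (rule integrable_nu_bound[of _ "2 * jump_const K"]) (use K \<rho>_nonneg in \<open>auto simp: indicator_def abs_mult\<close>)
    have i2: "integrable \<nu> (\<lambda>z. (?K2 * (real (Suc n))\<^sup>2 * norm (x - y)) * ?q z)"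
      by (intro integrable_mult_right integrable_truncated_square)
    have "\<bar>igen f x - igen f y\<bar> = \<bar>LINT z|\<nu>. jump f x z - jump f y z\<bar>"
      unfolding igen_def using jump_integrable[OF f] by simp
    also have "\<dots> \<le> (LINT z|\<nu>. \<bar>jump f x z - jump f y z\<bar>)" by (rule integral_abs_bound)
    also have "\<dots> \<le> (LINT z|\<nu>. 2 * jump_const K * ?q z * indicator (?S n) z + (?K2 * (real (Suc n))\<^sup>2 * norm (x - y)) * ?q z)"
      by (intro integral_mono integrable_abs Bochner_Integration.integrable_diff jump_integrable[OF f] Bochner_Integration.integrable_add i1 i2 bound)
    also have "\<dots> = (LINT z|\<nu>. 2 * jump_const K * ?q z * indicator (?S n) z) + (?K2 * (real (Suc n))\<^sup>2 * norm (x - y)) * trunc_mass"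
      using i1 i2 unfolding trunc_mass_def by (simp only: Bochner_Integration.integral_add integral_mult_right_zero)
    also have "\<dots> \<le> e + C * norm (x - y)"
      using n unfolding C_def by (simp only: mult.assoc mult.commute[of "norm (x - y)"])
    finally show ?thesis .
  qed
  with C show ?thesis using that by blast
qed

text \<open>Dominated convergence handles the functions at the fixed point \<open>y\<close>; the
  modulus of \<open>igen_modulus\<close>, common to all \<open>f n\<close>, handles the moving
  point.\<close>

lemma igen_tendsto:
  assumes f: "\<And>n. f n \<in> C_lip 1 K" and lim: "\<And>x. (\<lambda>n. f n x) \<longlonglongrightarrow> F x" and x: "x \<longlonglongrightarrow> y"
  shows "(\<lambda>n. igen (f n) (x n)) \<longlonglongrightarrow> igen F y"
proof -
  have f': "f n \<in> C_lip (Suc 0) K" for n using f by simp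
  have F: "F \<in> C_lip 1 K" by (rule C_lip_limit[OF f lim])
  have K: "0 \<le> K" using f C_lip_nonneg by blast
  have 1: "(\<lambda>n. igen (f n) y) \<longlonglongrightarrow> igen F y"
    unfolding igen_def
  proof (rule integral_dominated_convergence[where w="\<lambda>z. jump_const K * min 1 ((norm z)\<^sup>2)"])
    show "integrable \<nu> (\<lambda>z. jump_const K * min 1 ((norm z)\<^sup>2))"
      by (intro integrable_mult_right integrable_truncated_square)
    show "AE z in \<nu>. (\<lambda>n. jump (f n) y z) \<longlonglongrightarrow> jump F y z"
      unfolding jump_def by (intro AE_I2 tendsto_intros lim grad_limit[OF f' lim])
    show "AE z in \<nu>. norm (jump (f n) y z) \<le> jump_const K * min 1 ((norm z)\<^sup>2)" for n
      using jump_bound[OF f] by simp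
  qed (use jump_integrable[OF f] jump_integrable[OF F] in \<open>auto dest: borel_measurable_integrable\<close>)
  have 2: "(\<lambda>n. igen (f n) (x n) - igen (f n) y) \<longlonglongrightarrow> 0"
  proof (rule LIMSEQ_I)
    fix e :: real assume e: "0 < e"
    obtain C where C: "0 \<le> C" "\<And>f x y. f \<in> C_lip 1 K \<Longrightarrow> \<bar>igen f x - igen f y\<bar> \<le> e / 2 + C * norm (x - y)"
      using igen_modulus[of "e / 2" K] e K by auto
    have "(\<lambda>n. C * norm (x n - y)) \<longlonglongrightarrow> C * norm (y - y)"
      by (intro tendsto_intros x)
    then have "(\<lambda>n. C * norm (x n - y)) \<longlonglongrightarrow> 0" by simp
    from order_tendstoD(2)[OF this, of "e / 2"] e obtain N where N: "\<And>n. n \<ge> N \<Longrightarrow> C * norm (x n - y) < e / 2"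
      by (auto simp: eventually_sequentially)
    have "norm (igen (f n) (x n) - igen (f n) y - 0) < e" if "n \<ge> N" for n
      using C(2)[OF f, of n "x n" y] N[OF that] by simp
    then show "\<exists>no. \<forall>n\<ge>no. norm (igen (f n) (x n) - igen (f n) y - 0) < e" by blast
  qed
  show ?thesis using tendsto_add[OF 2 1] by simp
qed

lemma igen_continuous: "f \<in> C_lip 1 K \<Longrightarrow> continuous_on UNIV (igen f)"
  unfolding continuous_on_sequentially o_def by (auto intro: igen_tendsto[of "\<lambda>_. f" K])

end

section \<open>Action of the noise on mixtures of cosines\<close>

lemma cos_remainder: "\<bar>cos (\<phi> + t) - cos \<phi> + t * sin \<phi>\<bar> \<le> t\<^sup>2" for \<phi> t :: real
proof -
  let ?F = "\<lambda>s. cos (\<phi> + s) + s * sin \<phi>"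
  have "norm (?F t - ?F 0) \<le> \<bar>t\<bar> * norm (t - 0)"
  proof (rule field_differentiable_bound[where S="closed_segment 0 t" and f'="\<lambda>s. - sin (\<phi> + s) + sin \<phi>"])
    fix s assume s: "s \<in> closed_segment 0 t"
    show "(?F has_real_derivative - sin (\<phi> + s) + sin \<phi>) (at s within closed_segment 0 t)"
      by (auto intro!: derivative_eq_intros)
    have "\<bar>s\<bar> \<le> \<bar>t\<bar>"
      using s by (auto simp: closed_segment_eq_real_ivl split: if_splits)
    moreover have "\<bar>sin \<phi> - sin (\<phi> + s)\<bar> \<le> \<bar>s\<bar>"
    proof -
      have "sin \<phi> - sin (\<phi> + s) = 2 * sin (- s / 2) * cos ((\<phi> + (\<phi> + s)) / 2)"
        by (subst sin_diff_sin) simp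
      then have "\<bar>sin \<phi> - sin (\<phi> + s)\<bar> = 2 * \<bar>sin (- s / 2)\<bar> * \<bar>cos ((\<phi> + (\<phi> + s)) / 2)\<bar>"
        by (simp add: abs_mult)
      also have "\<dots> \<le> 2 * \<bar>- s / 2\<bar> * 1"
        by (intro mult_mono abs_sin_x_le_abs_x) auto
      finally show ?thesis by simp
    qed
    ultimately show "norm (- sin (\<phi> + s) + sin \<phi>) \<le> \<bar>t\<bar>" by simp
  qed auto
  then show ?thesis by (simp add: power2_eq_square abs_mult_self_eq algebra_simps)
qed

text \<open>Taylor expansion of \<open>exp (- (k * a))\<close> in \<open>k\<close> around
  \<open>h\<close>, with second derivative at most \<open>a\<^sup>2\<close> on the half line. Both
  orders of \<open>h\<close> and \<open>k\<close> are covered because the time derivative is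
  two-sided inside the interval.\<close>

lemma exp_remainder:
  fixes h k a :: real
  assumes "0 \<le> h" "0 \<le> k" "0 \<le> a"
  shows "\<bar>exp (- (k * a)) - exp (- (h * a)) + (k - h) * (a * exp (- (h * a)))\<bar> \<le> a\<^sup>2 * (k - h)\<^sup>2"
proof -
  have e: "\<bar>exp (- s) - 1 + s\<bar> \<le> s\<^sup>2" if "0 \<le> s" for s :: real
  proof -
    have "1 - s \<le> exp (- s)" using exp_ge_add_one_self[of "- s"] by simp
    moreover have "exp (- s) \<le> 1 - s + s\<^sup>2"
    proof -
      have "1 \<le> (1 - s + s\<^sup>2) * (1 + s)"
        using that by (simp add: algebra_simps power2_eq_square)
      also have "\<dots> \<le> (1 - s + s\<^sup>2) * exp s"
      proof (rule mult_left_mono)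
        show "1 + s \<le> exp s" by (rule exp_ge_add_one_self)
        have "0 \<le> (s - 1/2)\<^sup>2 + 3/4" by simp
        then show "0 \<le> 1 - s + s\<^sup>2" by (simp add: power2_eq_square algebra_simps)
      qed
      finally show ?thesis by (simp add: exp_minus field_simps)
    qed
    ultimately show ?thesis by simp
  qed
  show ?thesis
  proof (cases "h \<le> k")
    case True
    let ?s = "(k - h) * a"
    have s: "0 \<le> ?s" using True assms by simp
    have "exp (- (k * a)) = exp (- (h * a)) * exp (- ?s)"
      by (simp add: exp_add[symmetric] algebra_simps)
    then have "exp (- (k * a)) - exp (- (h * a)) + (k - h) * (a * exp (- (h * a))) = exp (- (h * a)) * (exp (- ?s) - 1 + ?s)"
      by (simp add: algebra_simps)
    then have "\<bar>exp (- (k * a)) - exp (- (h * a)) + (k - h) * (a * exp (- (h * a)))\<bar> = exp (- (h * a)) * \<bar>exp (- ?s) - 1 + ?s\<bar>"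
      by (simp add: abs_mult)
    also have "\<dots> \<le> 1 * ?s\<^sup>2"
      using e[OF s] assms by (intro mult_mono) auto
    finally show ?thesis by (simp add: power_mult_distrib mult.commute)
  next
    case False
    let ?s = "(h - k) * a"
    have s: "0 \<le> ?s" using False assms by simp
    have "exp (- (h * a)) = exp (- (k * a)) * exp (- ?s)"
      by (simp add: exp_add[symmetric] algebra_simps)
    then have "exp (- (k * a)) - exp (- (h * a)) + (k - h) * (a * exp (- (h * a))) = exp (- (k * a)) * (1 - exp (- ?s) * (1 + ?s))"
      by (simp add: algebra_simps)
    then have "\<bar>exp (- (k * a)) - exp (- (h * a)) + (k - h) * (a * exp (- (h * a)))\<bar> = exp (- (k * a)) * \<bar>1 - exp (- ?s) * (1 + ?s)\<bar>"
      by (simp add: abs_mult)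
    also have "\<dots> \<le> 1 * ?s\<^sup>2"
    proof (rule mult_mono)
      have "exp (- ?s) * (1 + ?s) \<le> exp (- ?s) * exp ?s"
        by (intro mult_left_mono exp_ge_add_one_self) simp
      then have 1: "exp (- ?s) * (1 + ?s) \<le> 1" by (simp add: exp_minus)
      have "(1 - ?s) * (1 + ?s) \<le> exp (- ?s) * (1 + ?s)"
        using exp_ge_add_one_self[of "- ?s"] s by (intro mult_right_mono) auto
      then have "1 - exp (- ?s) * (1 + ?s) \<le> ?s\<^sup>2" by (simp add: algebra_simps power2_eq_square)
      with 1 show "\<bar>1 - exp (- ?s) * (1 + ?s)\<bar> \<le> ?s\<^sup>2" by simp
    qed (use assms in auto)
    finally show ?thesis by (simp add: power_mult_distrib power2_commute mult.commute)
  qed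
qed

text \<open>Functions of the form \<open>f x = \<integral> w cos (v \<bullet> x - \<theta>) dQ\<close>, on which the semigroup of the noise acts
  by multiplication of the weight.\<close>

locale cosine_mixture = noise_matrix M W L \<alpha> c \<nu> R + Q: sigma_finite_measure Q
  for M :: "'a measure" and W :: "real \<Rightarrow> 'a \<Rightarrow> real^'n" and L \<alpha> c \<nu> R and Q :: "'q measure" +
  fixes w \<theta> :: "'q \<Rightarrow> real" and v :: "'q \<Rightarrow> real^'n" and f :: "real^'n \<Rightarrow> real" and K :: real
  assumes w [measurable]: "w \<in> borel_measurable Q" and \<theta> [measurable]: "\<theta> \<in> borel_measurable Q"
    and v [measurable]: "v \<in> borel_measurable Q"
    and w_int: "integrable Q (\<lambda>q. w q * (1 + (norm (v q))\<^sup>2)\<^sup>2)"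
    and f_eq: "\<And>x. f x = (LINT q|Q. w q * cos (v q \<bullet> x - \<theta> q))"
    and f: "f \<in> C_lip 1 K"
begin

text \<open>The weight \<open>(1 + (norm (v q))\<^sup>2)\<^sup>2\<close> of the locale dominates
  every factor that occurs: the symbol grows at most quadratically in the frequency, and its square
  is met in the second time derivative.\<close>

lemma w_integrable:
  assumes [measurable]: "g \<in> borel_measurable Q" and g: "\<And>q. \<bar>g q\<bar> \<le> B * (1 + (norm (v q))\<^sup>2)\<^sup>2"
  shows "integrable Q (\<lambda>q. w q * g q)"
proof (rule Bochner_Integration.integrable_bound[OF integrable_mult_right[OF w_int, of B]])
  show "AE q in Q. norm (w q * g q) \<le> norm (B * (w q * (1 + (norm (v q))\<^sup>2)\<^sup>2))"
  proof (rule AE_I2)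
    fix q
    have "\<bar>w q\<bar> * \<bar>g q\<bar> \<le> \<bar>w q\<bar> * \<bar>B * (1 + (norm (v q))\<^sup>2)\<^sup>2\<bar>"
      using g[of q] by (intro mult_left_mono) auto
    then show "norm (w q * g q) \<le> norm (B * (w q * (1 + (norm (v q))\<^sup>2)\<^sup>2))"
      by (simp add: abs_mult mult_ac)
  qed
qed measurable

lemma weight_ge: "1 \<le> (1 + (norm (v q))\<^sup>2)\<^sup>2" "(norm (v q))\<^sup>2 \<le> (1 + (norm (v q))\<^sup>2)\<^sup>2"
  "1 + (norm (v q))\<^sup>2 \<le> (1 + (norm (v q))\<^sup>2)\<^sup>2"
proof -
  have "1 + (norm (v q))\<^sup>2 \<le> (1 + (norm (v q))\<^sup>2)\<^sup>2"
    using self_le_power[of "1 + (norm (v q))\<^sup>2" 2] by simp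
  then show "1 \<le> (1 + (norm (v q))\<^sup>2)\<^sup>2" "(norm (v q))\<^sup>2 \<le> (1 + (norm (v q))\<^sup>2)\<^sup>2"
    "1 + (norm (v q))\<^sup>2 \<le> (1 + (norm (v q))\<^sup>2)\<^sup>2"
    using zero_le_power2[of "norm (v q)"] by linarith+
qed

lemma norm_le_weight: "norm (v q) \<le> (1 + (norm (v q))\<^sup>2)\<^sup>2"
proof -
  have "0 \<le> (norm (v q) - 1)\<^sup>2" by simp
  then have "norm (v q) \<le> 1 + (norm (v q))\<^sup>2"
    using norm_ge_zero[of "v q"] unfolding power2_diff one_power2 mult_1_right by linarith
  then show ?thesis using weight_ge(3) by (rule order_trans)
qed

text \<open>The frequency seen by \<open>Z\<close> once the matrix is moved to the other factor of
  the inner product, see \<open>a_inner\<close>.\<close>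

definition a :: "'q \<Rightarrow> real^'n" where "a q = v q v* R"

lemma a_inner: "v q \<bullet> (R *v z) = a q \<bullet> z"
  unfolding a_def by (simp add: dot_lmul_matrix)

lemma a_measurable [measurable]: "a \<in> borel_measurable Q"
proof -
  have [measurable]: "(*v) (transpose R) \<in> borel_measurable borel"
    by (intro borel_measurable_continuous_onI linear_continuous_on) simp
  have "(\<lambda>q. transpose R *v v q) \<in> borel_measurable Q" by measurable
  then show ?thesis by (simp add: a_def[abs_def] transpose_matrix_vector)
qed

lemma norm_a_le: "norm (a q) \<le> \<rho> * norm (v q)"
proof (cases "a q = 0")
  case False
  have "norm (a q) * norm (a q) = v q \<bullet> (R *v a q)"
    by (simp add: a_inner power2_norm_eq_inner[symmetric] power2_eq_square)
  also have "\<dots> \<le> norm (v q) * norm (R *v a q)"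
    by (rule norm_cauchy_schwarz)
  also have "\<dots> \<le> norm (v q) * (\<rho> * norm (a q))"
    by (intro mult_left_mono norm_R_le) simp
  finally have "norm (a q) * norm (a q) \<le> (\<rho> * norm (v q)) * norm (a q)"
    by (simp add: mult_ac)
  then show ?thesis using False by (simp only: mult_le_cancel_right) simp
qed (simp add: \<rho>_nonneg)

text \<open>A decay rate: averaging over an increment of length \<open>r\<close> multiplies the
  component \<open>q\<close> of the mixture by \<open>exp (- (r * s q))\<close>.\<close>

definition s :: "'q \<Rightarrow> real" where "s q = symbol (a q)"

lemma s_measurable [measurable]: "s \<in> borel_measurable Q"
  unfolding s_def by measurable

lemma s_nonneg: "0 \<le> s q"
  unfolding s_def by (rule symbol_nonneg)

lemma s_bound: "s q \<le> (2 + \<rho>\<^sup>2) * trunc_mass * (1 + (norm (v q))\<^sup>2)"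
proof -
  have "(norm (a q))\<^sup>2 \<le> \<rho>\<^sup>2 * (norm (v q))\<^sup>2"
    using power_mono[OF norm_a_le, of q 2] by (simp add: power_mult_distrib)
  then have "2 + (norm (a q))\<^sup>2 \<le> (2 + \<rho>\<^sup>2) * (1 + (norm (v q))\<^sup>2)"
    using zero_le_power2[of "norm (v q)"] zero_le_power2[of \<rho>] unfolding distrib_right distrib_left mult_1_right by linarith
  then have "(2 + (norm (a q))\<^sup>2) * trunc_mass \<le> (2 + \<rho>\<^sup>2) * (1 + (norm (v q))\<^sup>2) * trunc_mass"
    by (rule mult_right_mono[OF _ trunc_mass_nonneg])
  then show ?thesis
    using symbol_bound[of "a q"] unfolding s_def trunc_mass_def[symmetric] by (simp add: mult_ac)
qed

text \<open>Differentiation under the integral by the remainder criterion, with the integral of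
  \<open>\<bar>w q\<bar> * (norm (v q))\<^sup>2\<close> as its constant.\<close>

lemma grad_f: "grad f x \<bullet> y = - (LINT q|Q. w q * ((v q \<bullet> y) * sin (v q \<bullet> x - \<theta> q)))"
proof -
  have vm [measurable]: "(\<lambda>q. v q $ i) \<in> borel_measurable Q" for i
  proof -
    have "(\<lambda>q. v q \<bullet> axis i 1) \<in> borel_measurable Q" by measurable
    then show ?thesis by (simp add: inner_axis)
  qed
  have lin: "integrable Q (\<lambda>q. w q * ((v q \<bullet> y) * sin (v q \<bullet> x - \<theta> q)))" for x y
  proof (rule w_integrable[where B="norm y"])
    fix q
    have "\<bar>(v q \<bullet> y) * sin (v q \<bullet> x - \<theta> q)\<bar> \<le> (norm (v q) * norm y) * 1"
      unfolding abs_mult by (intro mult_mono Cauchy_Schwarz_ineq2) auto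
    also have "\<dots> \<le> norm y * (1 + (norm (v q))\<^sup>2)\<^sup>2"
      using norm_le_weight by (simp add: mult.commute mult_left_mono)
    finally show "\<bar>(v q \<bullet> y) * sin (v q \<bullet> x - \<theta> q)\<bar> \<le> norm y * (1 + (norm (v q))\<^sup>2)\<^sup>2" .
  qed measurable
  have cint: "integrable Q (\<lambda>q. w q * cos (v q \<bullet> x - \<theta> q))" for x
    by (rule w_integrable[where B=1]) (use weight_ge(1) order_trans[OF abs_cos_le_one] in auto)
  have vint: "integrable Q (\<lambda>q. \<bar>w q\<bar> * (norm (v q))\<^sup>2)"
    using w_integrable[of "\<lambda>q. (norm (v q))\<^sup>2" 1] weight_ge(2) integrable_abs[of Q "\<lambda>q. w q * (norm (v q))\<^sup>2"]
    by (simp add: abs_mult)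
  let ?g = "\<lambda>i x. - (LINT q|Q. w q * (v q $ i * sin (v q \<bullet> x - \<theta> q)))"
  have hp: "has_partial f i (?g i)" for i
  proof (rule has_partialI_remainder[where K="LINT q|Q. \<bar>w q\<bar> * (norm (v q))\<^sup>2"])
    fix x and h :: real
    let ?e = "axis i 1 :: real^'n"
    have li: "integrable Q (\<lambda>q. w q * (v q $ i * sin (v q \<bullet> x - \<theta> q)))"
      using lin[of ?e x] by (simp add: inner_axis)
    have "f (x + h *\<^sub>R ?e) - f x - h * ?g i x =
      (LINT q|Q. w q * (cos (v q \<bullet> (x + h *\<^sub>R ?e) - \<theta> q) - cos (v q \<bullet> x - \<theta> q) + (h * v q $ i) * sin (v q \<bullet> x - \<theta> q)))"
    proof -
      have "(LINT q|Q. w q * (cos (v q \<bullet> (x + h *\<^sub>R ?e) - \<theta> q) - cos (v q \<bullet> x - \<theta> q) + (h * v q $ i) * sin (v q \<bullet> x - \<theta> q)))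
        = (LINT q|Q. w q * cos (v q \<bullet> (x + h *\<^sub>R ?e) - \<theta> q) - w q * cos (v q \<bullet> x - \<theta> q) + h * (w q * (v q $ i * sin (v q \<bullet> x - \<theta> q))))"
        by (intro Bochner_Integration.integral_cong refl) (simp add: algebra_simps)
      also have "\<dots> = f (x + h *\<^sub>R ?e) - f x - h * ?g i x"
        unfolding f_eq using cint li by simp
      finally show ?thesis ..
    qed
    then have "\<bar>f (x + h *\<^sub>R ?e) - f x - h * ?g i x\<bar> =
      \<bar>LINT q|Q. w q * (cos (v q \<bullet> (x + h *\<^sub>R ?e) - \<theta> q) - cos (v q \<bullet> x - \<theta> q) + (h * v q $ i) * sin (v q \<bullet> x - \<theta> q))\<bar>"
      by (rule arg_cong)
    also have "\<dots> \<le> (LINT q|Q. \<bar>w q * (cos (v q \<bullet> (x + h *\<^sub>R ?e) - \<theta> q) - cos (v q \<bullet> x - \<theta> q) + (h * v q $ i) * sin (v q \<bullet> x - \<theta> q))\<bar>)"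
      by (rule integral_abs_bound)
    also have "\<dots> \<le> (LINT q|Q. h\<^sup>2 * (\<bar>w q\<bar> * (norm (v q))\<^sup>2))"
    proof (rule integral_mono')
      show "integrable Q (\<lambda>q. h\<^sup>2 * (\<bar>w q\<bar> * (norm (v q))\<^sup>2))"
        by (rule integrable_mult_right[OF vint])
      fix q
      have "\<bar>cos (v q \<bullet> (x + h *\<^sub>R ?e) - \<theta> q) - cos (v q \<bullet> x - \<theta> q) + (h * v q $ i) * sin (v q \<bullet> x - \<theta> q)\<bar> \<le> (h * v q $ i)\<^sup>2"
        using cos_remainder[of "v q \<bullet> x - \<theta> q" "h * v q $ i"]
        by (simp add: inner_add_right inner_axis algebra_simps)
      also have "\<dots> \<le> h\<^sup>2 * (norm (v q))\<^sup>2"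
        unfolding power_mult_distrib using component_le_norm_cart[of "v q" i]
        by (intro mult_left_mono) (auto simp: abs_le_square_iff[symmetric])
      finally show "\<bar>w q * (cos (v q \<bullet> (x + h *\<^sub>R ?e) - \<theta> q) - cos (v q \<bullet> x - \<theta> q) + (h * v q $ i) * sin (v q \<bullet> x - \<theta> q))\<bar> \<le> h\<^sup>2 * (\<bar>w q\<bar> * (norm (v q))\<^sup>2)"
        unfolding abs_mult by (simp add: mult.left_commute mult_left_mono)
    qed auto
    also have "\<dots> = (LINT q|Q. \<bar>w q\<bar> * (norm (v q))\<^sup>2) * h\<^sup>2" by simp
    finally show "\<bar>f (x + h *\<^sub>R ?e) - f x - h * ?g i x\<bar> \<le> (LINT q|Q. \<bar>w q\<bar> * (norm (v q))\<^sup>2) * h\<^sup>2" .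
  qed
  have "f \<in> C_lip (Suc 0) K" using f by simp
  from grad_eqI[OF C_lip_gderiv[OF this hp]] have "grad f x = (\<chi> i. ?g i x)" .
  then have "grad f x \<bullet> y = (\<Sum>i\<in>UNIV. - (LINT q|Q. w q * (v q $ i * sin (v q \<bullet> x - \<theta> q))) * y $ i)"
    by (simp add: inner_vec_def)
  also have "\<dots> = - (\<Sum>i\<in>UNIV. (LINT q|Q. w q * (v q $ i * sin (v q \<bullet> x - \<theta> q)) * y $ i))"
    by (simp add: sum_negf)
  also have "(\<Sum>i\<in>UNIV. (LINT q|Q. w q * (v q $ i * sin (v q \<bullet> x - \<theta> q)) * y $ i)) = (LINT q|Q. (\<Sum>i\<in>UNIV. w q * (v q $ i * sin (v q \<bullet> x - \<theta> q)) * y $ i))"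
  proof (rule Bochner_Integration.integral_sum[symmetric])
    fix i
    show "integrable Q (\<lambda>q. w q * (v q $ i * sin (v q \<bullet> x - \<theta> q)) * y $ i)"
      using lin[of "axis i 1" x] by (simp add: inner_axis)
  qed
  also have "\<dots> = (LINT q|Q. w q * ((v q \<bullet> y) * sin (v q \<bullet> x - \<theta> q)))"
    by (intro Bochner_Integration.integral_cong refl) (simp add: inner_vec_def sum_distrib_left sum_distrib_right mult_ac)
  finally show ?thesis .
qed

end

lemma (in pair_sigma_finite) integrable_mult_pair:
  fixes g :: "'a \<Rightarrow> real" and h :: "'b \<Rightarrow> real"
  assumes g: "integrable M1 g" and h: "integrable M2 h"
  shows "integrable (M1 \<Otimes>\<^sub>M M2) (\<lambda>(x, y). g x * h y)"
proof (rule Fubini_integrable)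
  note borel_measurable_integrable[OF g, measurable] borel_measurable_integrable[OF h, measurable]
  show "(\<lambda>(x, y). g x * h y) \<in> borel_measurable (M1 \<Otimes>\<^sub>M M2)" by measurable
  have "(\<lambda>x. \<integral>y. norm (case (x, y) of (x, y) \<Rightarrow> g x * h y) \<partial>M2) = (\<lambda>x. \<bar>g x\<bar> * (\<integral>y. \<bar>h y\<bar> \<partial>M2))"
    by (simp add: abs_mult)
  then show "integrable M1 (\<lambda>x. \<integral>y. norm (case (x, y) of (x, y) \<Rightarrow> g x * h y) \<partial>M2)"
    using g by simp
  show "AE x in M1. integrable M2 (\<lambda>y. case (x, y) of (x, y) \<Rightarrow> g x * h y)"
    using h by simp
qed

context cosine_mixture
begin

abbreviation \<phi> where "\<phi> x q \<equiv> v q \<bullet> x - \<theta> q"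

text \<open>After exchanging the integrals, the addition theorem splits each cosine. The part odd in
  \<open>z\<close>, a compensated sine, integrates to 0 by the symmetry of \<nu>; the even part
  yields the symbol with a minus sign.\<close>

lemma igen_f: "igen f x = - (LINT q|Q. w q * (s q * cos (\<phi> x q)))"
proof -
  interpret N: sigma_finite_measure \<nu> by (rule sigma_finite_nu)
  interpret P: pair_sigma_finite \<nu> Q by standard
  let ?D = "\<lambda>z. indicat_real (cball (0::real^'n) 1) z"
  define J where "J q z = cos (\<phi> x q + a q \<bullet> z) - cos (\<phi> x q) + ?D z * (a q \<bullet> z) * sin (\<phi> x q)" for q z
  have Dm [measurable]: "cball 0 1 \<in> sets (borel :: (real^'n) measure)" by simp
  have jump: "jump f x z = (LINT q|Q. w q * J q z)" for z
  proof -
    have c: "integrable Q (\<lambda>q. w q * cos (v q \<bullet> y - \<theta> q))" for y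
      by (rule w_integrable[where B=1]) (use weight_ge(1) order_trans[OF abs_cos_le_one] in auto)
    have l: "integrable Q (\<lambda>q. w q * ((v q \<bullet> (R *v z)) * sin (v q \<bullet> x - \<theta> q)))"
    proof (rule w_integrable[where B="norm (R *v z)"])
      fix q
      have "norm (v q) * norm (R *v z) * 1 \<le> norm (R *v z) * (1 + (norm (v q))\<^sup>2)\<^sup>2"
        using mult_right_mono[OF norm_le_weight norm_ge_zero, of q "R *v z"] by (simp add: mult.commute)
      moreover have "\<bar>v q \<bullet> (R *v z) * sin (v q \<bullet> x - \<theta> q)\<bar> \<le> norm (v q) * norm (R *v z) * 1"
        unfolding abs_mult by (intro mult_mono Cauchy_Schwarz_ineq2) auto
      ultimately show "\<bar>v q \<bullet> (R *v z) * sin (v q \<bullet> x - \<theta> q)\<bar> \<le> norm (R *v z) * (1 + (norm (v q))\<^sup>2)\<^sup>2"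
        by linarith
    qed measurable
    have "(LINT q|Q. w q * J q z) = (LINT q|Q. w q * cos (v q \<bullet> (x + R *v z) - \<theta> q) - w q * cos (v q \<bullet> x - \<theta> q)
        + ?D z * (w q * ((v q \<bullet> (R *v z)) * sin (v q \<bullet> x - \<theta> q))))"
      by (intro Bochner_Integration.integral_cong refl) (simp add: J_def a_inner inner_add_right algebra_simps)
    also have "\<dots> = f (x + R *v z) - f x + ?D z * (LINT q|Q. w q * ((v q \<bullet> (R *v z)) * sin (v q \<bullet> x - \<theta> q)))"
      unfolding f_eq using c l by simp
    also have "\<dots> = jump f x z" by (simp add: jump_def grad_f)
    finally show ?thesis ..
  qed
  have Jm [measurable]: "(\<lambda>(z, q). w q * J q z) \<in> borel_measurable (\<nu> \<Otimes>\<^sub>M Q)"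
    unfolding J_def by measurable
  define B where "B = 2 + \<rho>\<^sup>2"
  have Jb: "\<bar>J q z\<bar> \<le> B * (1 + (norm (v q))\<^sup>2)\<^sup>2 * min 1 ((norm z)\<^sup>2)" for q z
  proof (cases "norm z \<le> 1")
    case True
    have "\<bar>J q z\<bar> \<le> (a q \<bullet> z)\<^sup>2"
      using cos_remainder[of "\<phi> x q" "a q \<bullet> z"] True by (simp add: J_def)
    also have "\<dots> \<le> (norm (a q) * norm z)\<^sup>2"
      using Cauchy_Schwarz_ineq2[of "a q" z] by (simp add: abs_le_square_iff[symmetric] abs_mult)
    also have "\<dots> \<le> (\<rho> * norm (v q) * norm z)\<^sup>2"
      by (intro power_mono mult_right_mono norm_a_le) auto
    also have "\<dots> = \<rho>\<^sup>2 * (norm (v q))\<^sup>2 * (norm z)\<^sup>2" by (simp add: power_mult_distrib)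
    also have "\<dots> \<le> B * (1 + (norm (v q))\<^sup>2)\<^sup>2 * (norm z)\<^sup>2"
      using weight_ge(2)[of q] unfolding B_def by (intro mult_right_mono mult_mono) auto
    finally show ?thesis using True by (simp add: power_le_one min_absorb2)
  next
    case False
    then have m: "min 1 ((norm z)\<^sup>2) = 1" by (simp add: one_le_power min_absorb1)
    have "\<bar>J q z\<bar> \<le> \<bar>cos (\<phi> x q + a q \<bullet> z)\<bar> + \<bar>cos (\<phi> x q)\<bar>"
      using False abs_triangle_ineq4[of "cos (\<phi> x q + a q \<bullet> z)" "cos (\<phi> x q)"] by (simp add: J_def)
    also have "\<dots> \<le> 1 + 1" by (intro add_mono abs_cos_le_one)
    also have "\<dots> \<le> B * (1 + (norm (v q))\<^sup>2)\<^sup>2"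
      using mult_mono[of 2 B 1 "(1 + (norm (v q))\<^sup>2)\<^sup>2"] weight_ge(1)[of q] by (simp add: B_def)
    finally show ?thesis unfolding m by simp
  qed
  have int: "integrable (\<nu> \<Otimes>\<^sub>M Q) (\<lambda>(z, q). w q * J q z)"
  proof (rule Bochner_Integration.integrable_bound[OF P.integrable_mult_pair[OF integrable_truncated_square integrable_mult_right[OF w_int, of B]] Jm])
    show "AE zq in \<nu> \<Otimes>\<^sub>M Q. norm (case zq of (z, q) \<Rightarrow> w q * J q z)
      \<le> norm (case zq of (z, q) \<Rightarrow> min 1 ((norm z)\<^sup>2) * (B * (w q * (1 + (norm (v q))\<^sup>2)\<^sup>2)))"
    proof (rule AE_I2, clarify)
      fix z q
      have B: "0 \<le> B" unfolding B_def by simp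
      have "\<bar>w q\<bar> * \<bar>J q z\<bar> \<le> \<bar>w q\<bar> * (B * (1 + (norm (v q))\<^sup>2)\<^sup>2 * min 1 ((norm z)\<^sup>2))"
        by (intro mult_left_mono Jb) simp
      then show "norm (w q * J q z) \<le> norm (min 1 ((norm z)\<^sup>2) * (B * (w q * (1 + (norm (v q))\<^sup>2)\<^sup>2)))"
        using B by (simp add: abs_mult mult_ac)
    qed
  qed
  have inner: "(LINT z|\<nu>. J q z) = - (s q * cos (\<phi> x q))" for q
  proof -
    let ?o = "\<lambda>z. sin (a q \<bullet> z) - ?D z * (a q \<bullet> z)"
    have om: "?o \<in> borel_measurable borel" by measurable
    have oint: "integrable \<nu> ?o"
    proof (rule integrable_nu_bound[OF om, of "2 + (norm (a q))\<^sup>2"])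
      fix z
      show "norm (?o z) \<le> (2 + (norm (a q))\<^sup>2) * min 1 ((norm z)\<^sup>2)"
      proof (cases "norm z \<le> 1")
        case True
        \<comment> \<open>At the angle \<open>- pi / 2\<close> the cosine remainder says that sin t
          differs from t by at most t^2.\<close>
        have "norm (?o z) \<le> (a q \<bullet> z)\<^sup>2"
          using cos_remainder[of "- pi / 2" "a q \<bullet> z"] True by (simp add: cos_diff cos_add sin_diff)
        also have "\<dots> \<le> (norm (a q) * norm z)\<^sup>2"
          using Cauchy_Schwarz_ineq2[of "a q" z] by (simp add: abs_le_square_iff[symmetric] abs_mult)
        also have "\<dots> \<le> (2 + (norm (a q))\<^sup>2) * (norm z)\<^sup>2"
          by (simp add: power_mult_distrib mult_right_mono)
        finally show ?thesis using True by (simp add: power_le_one min_absorb2)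
      next
        case False
        then have m: "min 1 ((norm z)\<^sup>2) = 1" by (simp add: one_le_power min_absorb1)
        have "norm (?o z) \<le> 1" using False by simp
        then show ?thesis unfolding m mult_1_right using zero_le_power2[of "norm (a q)"] by linarith
      qed
    qed
    have o0: "(LINT z|\<nu>. ?o z) = 0"
      by (rule integral_nu_odd[OF om]) (simp add: indicator_def)
    have "(LINT z|\<nu>. J q z) = (LINT z|\<nu>. - (cos (\<phi> x q) * (1 - cos (a q \<bullet> z))) - sin (\<phi> x q) * ?o z)"
    proof (intro Bochner_Integration.integral_cong refl)
      fix z
      have "cos (\<phi> x q + a q \<bullet> z) = cos (\<phi> x q) * cos (a q \<bullet> z) - sin (\<phi> x q) * sin (a q \<bullet> z)"
        by (rule cos_add)
      then show "J q z = - (cos (\<phi> x q) * (1 - cos (a q \<bullet> z))) - sin (\<phi> x q) * ?o z"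
        unfolding J_def by (simp only: right_diff_distrib mult_1_right) (simp add: mult_ac)
    qed
    also have "\<dots> = - (cos (\<phi> x q) * s q)"
      using oint integrable_one_minus_cos[of "a q"] unfolding s_def symbol_def
      by (subst Bochner_Integration.integral_diff) (auto simp: o0)
    finally show ?thesis by (simp add: mult.commute)
  qed
  have "igen f x = (LINT z|\<nu>. LINT q|Q. w q * J q z)"
    unfolding igen_def jump ..
  also have "\<dots> = (LINT q|Q. LINT z|\<nu>. w q * J q z)"
    by (rule P.Fubini_integral[symmetric]) (rule int)
  also have "\<dots> = (LINT q|Q. - (w q * (s q * cos (\<phi> x q))))"
    by (simp add: inner)
  finally show ?thesis by simp
qed

text \<open>The factor \<open>g\<close> is 1 for the function itself and \<open>s\<close> for its
  generator, so that one exchange of integrals gives both averages.\<close>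

lemma expectation_shift:
  assumes t: "0 \<le> t" "0 \<le> r" and [measurable]: "g \<in> borel_measurable Q"
    and g: "\<And>q. \<bar>g q\<bar> \<le> B * (1 + (norm (v q))\<^sup>2)\<^sup>2"
  shows "expectation (\<lambda>\<omega>. LINT q|Q. w q * (g q * cos (\<phi> (x + R *v (Z (t + r) \<omega> - Z t \<omega>)) q)))
    = (LINT q|Q. w q * (g q * (cos (\<phi> x q) * exp (- (r * s q)))))"
proof -
  interpret P: pair_sigma_finite M Q by standard
  define Y where "Y \<omega> = Z (t + r) \<omega> - Z t \<omega>" for \<omega>
  have Ym [measurable]: "Y \<in> borel_measurable M"
    unfolding Y_def using Z_measurable[of "t + r"] Z_measurable[of t] t by simp
  have wg: "integrable Q (\<lambda>q. w q * g q)"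
    by (rule w_integrable[OF _ g]) measurable
  have int: "integrable (M \<Otimes>\<^sub>M Q) (\<lambda>(\<omega>, q). w q * (g q * cos (\<phi> (x + R *v Y \<omega>) q)))"
  proof (rule Bochner_Integration.integrable_bound[OF P.integrable_mult_pair[OF integrable_const[of 1] wg]])
    show "AE p in M \<Otimes>\<^sub>M Q. norm (case p of (\<omega>, q) \<Rightarrow> w q * (g q * cos (\<phi> (x + R *v Y \<omega>) q)))
      \<le> norm (case p of (\<omega>, q) \<Rightarrow> 1 * (w q * g q))"
    proof (rule AE_I2, clarify)
      fix \<omega> q
      have "\<bar>w q\<bar> * (\<bar>g q\<bar> * \<bar>cos (\<phi> (x + R *v Y \<omega>) q)\<bar>) \<le> \<bar>w q\<bar> * (\<bar>g q\<bar> * 1)"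
        by (intro mult_left_mono) auto
      then show "norm (w q * (g q * cos (\<phi> (x + R *v Y \<omega>) q))) \<le> norm (1 * (w q * g q))"
        by (simp add: abs_mult)
    qed
  qed measurable
  have inner: "expectation (\<lambda>\<omega>. cos (\<phi> (x + R *v Y \<omega>) q)) = cos (\<phi> x q) * exp (- (r * s q))" for q
  proof -
    have i: "integrable M (\<lambda>\<omega>. cos (a q \<bullet> Y \<omega>))" "integrable M (\<lambda>\<omega>. sin (a q \<bullet> Y \<omega>))"
      by (auto intro!: integrable_const_bound[where B=1])
    have "cos (\<phi> (x + R *v Y \<omega>) q) = cos (\<phi> x q) * cos (a q \<bullet> Y \<omega>) - sin (\<phi> x q) * sin (a q \<bullet> Y \<omega>)" for \<omega>
    proof -
      have "\<phi> (x + R *v Y \<omega>) q = \<phi> x q + a q \<bullet> Y \<omega>" by (simp add: inner_add_right a_inner)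
      then show ?thesis by (simp only: cos_add)
    qed
    then have "expectation (\<lambda>\<omega>. cos (\<phi> (x + R *v Y \<omega>) q)) = cos (\<phi> x q) * expectation (\<lambda>\<omega>. cos (a q \<bullet> Y \<omega>)) - sin (\<phi> x q) * expectation (\<lambda>\<omega>. sin (a q \<bullet> Y \<omega>))"
      using i by simp
    then show ?thesis
      unfolding Y_def Z_increment_char[OF t] Z_increment_cos_sin(2)[OF t] s_def by simp
  qed
  have "expectation (\<lambda>\<omega>. LINT q|Q. w q * (g q * cos (\<phi> (x + R *v Y \<omega>) q)))
    = (LINT q|Q. expectation (\<lambda>\<omega>. w q * (g q * cos (\<phi> (x + R *v Y \<omega>) q))))"
    by (rule P.Fubini_integral[symmetric]) (rule int)
  also have "\<dots> = (LINT q|Q. w q * (g q * (cos (\<phi> x q) * exp (- (r * s q)))))"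
    by (simp add: inner)
  finally show ?thesis unfolding Y_def .
qed

text \<open>\<open>F r\<close> is the mean of \<open>f\<close> after an increment of length
  \<open>r\<close>, and its derivative \<open>F' r\<close> is the mean of \<open>igen f\<close>
  there, which differs from \<open>igen f x\<close> by the modulus at the mean size of the
  increment. The mean value inequality on \<open>{0..h}\<close> gives the bound, and its constants
  do not depend on the mixture.\<close>

lemma estimate:
  assumes t: "0 \<le> t" and h: "0 \<le> h" and C: "0 \<le> C" and mod: "\<And>y. \<bar>igen f y - igen f x\<bar> \<le> e + C * norm (y - x)"
  shows "\<bar>expectation (\<lambda>\<omega>. f (x + R *v (Z (t + h) \<omega> - Z t \<omega>))) - f x - h * igen f x\<bar> \<le> h * (e + C * \<rho> * mom h)"
proof -
  define F where "F r = (LINT q|Q. w q * (cos (\<phi> x q) * exp (- (r * s q))))" for r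
  define F' where "F' r = - (LINT q|Q. w q * (s q * (cos (\<phi> x q) * exp (- (r * s q)))))" for r
  define Bs where "Bs = (2 + \<rho>\<^sup>2) * trunc_mass"
  have Bs: "0 \<le> Bs" unfolding Bs_def using trunc_mass_nonneg by simp
  have sB: "\<bar>s q\<bar> \<le> Bs * (1 + (norm (v q))\<^sup>2)\<^sup>2" for q
    using s_bound[of q] s_nonneg[of q] mult_left_mono[OF weight_ge(3) Bs, of q] unfolding Bs_def by linarith
  have ssB: "(s q)\<^sup>2 \<le> Bs\<^sup>2 * (1 + (norm (v q))\<^sup>2)\<^sup>2" for q
    using power_mono[OF s_bound s_nonneg, of q 2] unfolding Bs_def by (simp add: power_mult_distrib)
  have FE: "F r = expectation (\<lambda>\<omega>. f (x + R *v (Z (t + r) \<omega> - Z t \<omega>)))" if "0 \<le> r" for r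
    using expectation_shift[OF t that, of "\<lambda>_. 1" 1 x] weight_ge(1) unfolding F_def f_eq by simp
  have F'E: "F' r = expectation (\<lambda>\<omega>. igen f (x + R *v (Z (t + r) \<omega> - Z t \<omega>)))" if "0 \<le> r" for r
    using expectation_shift[OF t that s_measurable sB, of x] unfolding F'_def igen_f by simp
  have F0: "F 0 = f x" unfolding F_def f_eq by simp
  have expb: "\<bar>cos (\<phi> x q) * exp (- (r * s q))\<bar> \<le> 1" if "0 \<le> r" for r q
    unfolding abs_mult using that s_nonneg[of q] mult_mono[of "\<bar>cos (\<phi> x q)\<bar>" 1 "exp (- (r * s q))" 1] by simp
  have F_int: "integrable Q (\<lambda>q. w q * (cos (\<phi> x q) * exp (- (r * s q))))" if "0 \<le> r" for r
    by (rule w_integrable[where B=1]) (use order_trans[OF expb[OF that] weight_ge(1)] in auto)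
  have F'_int: "integrable Q (\<lambda>q. w q * (s q * (cos (\<phi> x q) * exp (- (r * s q)))))" if "0 \<le> r" for r
  proof (rule w_integrable[where B=Bs])
    show "\<bar>s q * (cos (\<phi> x q) * exp (- (r * s q)))\<bar> \<le> Bs * (1 + (norm (v q))\<^sup>2)\<^sup>2" for q
      using mult_mono[OF sB[of q] expb[OF that, of q]] Bs by (simp add: abs_mult)
  qed measurable
  \<comment> \<open>A bound for the second time derivative of \<open>F\<close>, finite by the
    fourth-order weight. It serves to establish differentiability only and does not enter the final
    estimate.\<close>
  define A where "A = (LINT q|Q. \<bar>w q * (s q)\<^sup>2\<bar>)"
  have A_int: "integrable Q (\<lambda>q. \<bar>w q * (s q)\<^sup>2\<bar>)"
    by (rule integrable_abs, rule w_integrable[where B="Bs\<^sup>2"]) (use ssB in auto)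
  have rem: "\<bar>F k - F r - (k - r) * F' r\<bar> \<le> A * (k - r)\<^sup>2" if "0 \<le> r" "0 \<le> k" for r k
  proof -
    have "F k - F r - (k - r) * F' r = (LINT q|Q. w q * cos (\<phi> x q) * (exp (- (k * s q)) - exp (- (r * s q)) + (k - r) * (s q * exp (- (r * s q)))))"
    proof -
      have "(LINT q|Q. w q * cos (\<phi> x q) * (exp (- (k * s q)) - exp (- (r * s q)) + (k - r) * (s q * exp (- (r * s q)))))
        = (LINT q|Q. w q * (cos (\<phi> x q) * exp (- (k * s q))) - w q * (cos (\<phi> x q) * exp (- (r * s q))) + (k - r) * (w q * (s q * (cos (\<phi> x q) * exp (- (r * s q))))))"
        by (intro Bochner_Integration.integral_cong refl) (simp add: algebra_simps)
      also have "\<dots> = F k - F r - (k - r) * F' r"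
        unfolding F_def F'_def using F_int that F'_int by simp
      finally show ?thesis ..
    qed
    then have "\<bar>F k - F r - (k - r) * F' r\<bar> = \<bar>LINT q|Q. w q * cos (\<phi> x q) * (exp (- (k * s q)) - exp (- (r * s q)) + (k - r) * (s q * exp (- (r * s q))))\<bar>"
      by (rule arg_cong)
    also have "\<dots> \<le> (LINT q|Q. \<bar>w q * cos (\<phi> x q) * (exp (- (k * s q)) - exp (- (r * s q)) + (k - r) * (s q * exp (- (r * s q))))\<bar>)"
      by (rule integral_abs_bound)
    also have "\<dots> \<le> (LINT q|Q. \<bar>w q * (s q)\<^sup>2\<bar> * (k - r)\<^sup>2)"
    proof (rule integral_mono')
      show "integrable Q (\<lambda>q. \<bar>w q * (s q)\<^sup>2\<bar> * (k - r)\<^sup>2)" using A_int by simp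
      fix q
      have "\<bar>w q\<bar> * \<bar>cos (\<phi> x q)\<bar> * \<bar>exp (- (k * s q)) - exp (- (r * s q)) + (k - r) * (s q * exp (- (r * s q)))\<bar>
          \<le> \<bar>w q\<bar> * 1 * ((s q)\<^sup>2 * (k - r)\<^sup>2)"
        by (intro mult_mono exp_remainder that s_nonneg) auto
      then show "\<bar>w q * cos (\<phi> x q) * (exp (- (k * s q)) - exp (- (r * s q)) + (k - r) * (s q * exp (- (r * s q))))\<bar> \<le> \<bar>w q * (s q)\<^sup>2\<bar> * (k - r)\<^sup>2"
        by (simp add: abs_mult mult_ac)
    qed auto
    also have "\<dots> = A * (k - r)\<^sup>2" unfolding A_def by simp
    finally show ?thesis .
  qed
  have deriv: "(F has_real_derivative F' r) (at r within {0..h})" if r: "r \<in> {0..h}" for r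
    unfolding has_field_derivative_iff
  proof (rule Lim_null[THEN iffD2])
    show "((\<lambda>k. (F k - F r) / (k - r) - F' r) \<longlongrightarrow> 0) (at r within {0..h})"
    proof (rule Lim_null_comparison)
      show "((\<lambda>k. A * \<bar>k - r\<bar>) \<longlongrightarrow> 0) (at r within {0..h})"
        by (auto intro!: tendsto_eq_intros)
      show "\<forall>\<^sub>F k in at r within {0..h}. norm ((F k - F r) / (k - r) - F' r) \<le> A * \<bar>k - r\<bar>"
        unfolding eventually_at_filter
      proof (intro always_eventually allI impI)
        fix k assume k: "k \<noteq> r" "k \<in> {0..h}"
        have "(F k - F r) / (k - r) - F' r = (F k - F r - (k - r) * F' r) / (k - r)"
          using k by (simp add: field_simps)
        then have "norm ((F k - F r) / (k - r) - F' r) = \<bar>F k - F r - (k - r) * F' r\<bar> / \<bar>k - r\<bar>"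
          by simp
        also have "\<dots> \<le> A * (k - r)\<^sup>2 / \<bar>k - r\<bar>"
          using rem[of r k] r k by (intro divide_right_mono) auto
        also have "\<dots> = A * \<bar>k - r\<bar>"
        proof -
          have e: "(k - r)\<^sup>2 = \<bar>k - r\<bar> * \<bar>k - r\<bar>" by (metis power2_abs power2_eq_square)
          show ?thesis unfolding e using k by (simp del: abs_mult_self_eq)
        qed
        finally show "norm ((F k - F r) / (k - r) - F' r) \<le> A * \<bar>k - r\<bar>" .
      qed
    qed
  qed
  have F'0: "\<bar>F' r - igen f x\<bar> \<le> e + C * \<rho> * mom h" if r: "r \<in> {0..h}" for r
  proof -
    have r0: "0 \<le> r" "r \<le> h" using r by auto
    let ?Y = "\<lambda>\<omega>. Z (t + r) \<omega> - Z t \<omega>"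
    have Ym [measurable]: "?Y \<in> borel_measurable M"
      using Z_measurable[of "t + r"] Z_measurable[of t] t r0 by simp
    have Yint: "integrable M ?Y" by (rule Z_increment_moment(1)[OF t r0(1)])
    have im [measurable]: "igen f \<in> borel_measurable borel"
      by (intro borel_measurable_continuous_onI igen_continuous[OF f])
    have ii: "integrable M (\<lambda>\<omega>. igen f (x + R *v ?Y \<omega>))"
      by (rule integrable_const_bound[where B="jump_const K * trunc_mass"]) (use igen_bound[OF f] in auto)
    have "\<bar>F' r - igen f x\<bar> = \<bar>expectation (\<lambda>\<omega>. igen f (x + R *v ?Y \<omega>) - igen f x)\<bar>"
      unfolding F'E[OF r0(1)] using ii by (simp add: prob_space)
    also have "\<dots> \<le> expectation (\<lambda>\<omega>. \<bar>igen f (x + R *v ?Y \<omega>) - igen f x\<bar>)"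
      by (rule integral_abs_bound)
    also have "\<dots> \<le> expectation (\<lambda>\<omega>. e + C * \<rho> * norm (?Y \<omega>))"
    proof (rule integral_mono)
      show "integrable M (\<lambda>\<omega>. \<bar>igen f (x + R *v ?Y \<omega>) - igen f x\<bar>)" using ii by simp
      show "integrable M (\<lambda>\<omega>. e + C * \<rho> * norm (?Y \<omega>))" using Yint by simp
      fix \<omega>
      have "C * norm (R *v ?Y \<omega>) \<le> C * (\<rho> * norm (?Y \<omega>))"
        by (intro mult_left_mono norm_R_le C)
      then show "\<bar>igen f (x + R *v ?Y \<omega>) - igen f x\<bar> \<le> e + C * \<rho> * norm (?Y \<omega>)"
        using mod[of "x + R *v ?Y \<omega>"] by simp
    qed
    also have "\<dots> = e + C * \<rho> * expectation (\<lambda>\<omega>. norm (?Y \<omega>))"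
      using Yint by (simp add: prob_space)
    also have "\<dots> \<le> e + C * \<rho> * mom h"
      using Z_increment_moment(2)[OF t r0(1)] mom_mono[OF r0] C \<rho>_nonneg
      by (intro add_left_mono mult_left_mono) auto
    finally show ?thesis .
  qed
  have "norm ((F h - h * igen f x) - (F 0 - 0 * igen f x)) \<le> (e + C * \<rho> * mom h) * norm (h - 0)"
  proof (rule field_differentiable_bound[where S="{0..h}" and f'="\<lambda>r. F' r - igen f x"])
    show "((\<lambda>r. F r - r * igen f x) has_real_derivative F' r - igen f x) (at r within {0..h})" if "r \<in> {0..h}" for r
      by (rule DERIV_diff[OF deriv[OF that] has_field_derivative_at_within[OF DERIV_cmult_Id_right]])
  qed (use F'0 h in auto)
  then show ?thesis
    using h unfolding F0 FE[OF h] by (simp add: mult.commute algebra_simps)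
qed

end

section \<open>Approximation by cosine mixtures\<close>

lemma gauss_integrable:
  assumes "0 < s" shows "integrable lborel (gauss s :: real^'n \<Rightarrow> real)"
  unfolding gauss_def by (rule lborel_vec_prod(1)) (rule integrable_normal_density[OF assms])

text \<open>Order four matches the weight required of a cosine mixture, whose frequencies will be
  Gaussian.\<close>

lemma gauss_fourth_moment:
  assumes s: "0 < s"
  shows "integrable lborel (\<lambda>x :: real^'n. gauss s x * (1 + (norm x)\<^sup>2)\<^sup>2)"
proof -
  have comp: "integrable lborel (\<lambda>x :: real^'n. gauss s x * (x $ i) ^ 4)" for i
  proof -
    let ?f = "\<lambda>j x. normal_density 0 s x * (if j = i then x ^ 4 else 1)"
    have "integrable lborel (?f j)" for j
      using integrable_normal_moment[OF s, of 0 4] integrable_normal_density[OF s, of 0] by (cases "j = i") auto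
    then have "integrable lborel (\<lambda>x :: real^'n. \<Prod>j\<in>UNIV. ?f j (x $ j))"
      by (rule lborel_vec_prod(1))
    then show ?thesis by (simp add: gauss_def prod.distrib prod.delta)
  qed
  have "integrable lborel (\<lambda>x :: real^'n. 2 * gauss s x + 2 * real CARD('n) * (\<Sum>i\<in>UNIV. gauss s x * (x $ i) ^ 4))"
    using comp gauss_integrable[OF s] by (intro Bochner_Integration.integrable_add integrable_mult_right Bochner_Integration.integrable_sum)
  then show ?thesis
  proof (rule Bochner_Integration.integrable_bound)
    show "AE x :: real^'n in lborel. norm (gauss s x * (1 + (norm x)\<^sup>2)\<^sup>2)
      \<le> norm (2 * gauss s x + 2 * real CARD('n) * (\<Sum>i\<in>UNIV. gauss s x * (x $ i) ^ 4))"
    proof (rule AE_I2)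
      fix x :: "real^'n"
      have n: "(norm x)\<^sup>2 = (\<Sum>i\<in>UNIV. (x $ i)\<^sup>2)"
        by (simp add: norm_vec_def L2_set_def sum_nonneg)
      have "((norm x)\<^sup>2)\<^sup>2 \<le> real CARD('n) * (\<Sum>i\<in>UNIV. (x $ i) ^ 4)"
        using sum_squared_le_sum_of_squares[of "\<lambda>i. (x $ i)\<^sup>2" UNIV]
        unfolding n by (simp add: power_mult[symmetric] mult.commute)
      moreover have "(1 + (norm x)\<^sup>2)\<^sup>2 \<le> 2 + 2 * ((norm x)\<^sup>2)\<^sup>2"
        using zero_le_power2[of "1 - (norm x)\<^sup>2"] by (simp add: power2_sum power2_diff)
      ultimately have "(1 + (norm x)\<^sup>2)\<^sup>2 \<le> 2 + 2 * (real CARD('n) * (\<Sum>i\<in>UNIV. (x $ i) ^ 4))"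
        by linarith
      from mult_left_mono[OF this gauss_nonneg[of s x]]
      have "gauss s x * (1 + (norm x)\<^sup>2)\<^sup>2 \<le> 2 * gauss s x + 2 * real CARD('n) * (\<Sum>i\<in>UNIV. gauss s x * (x $ i) ^ 4)"
        by (simp add: sum_distrib_left algebra_simps)
      moreover have "0 \<le> gauss s x * (1 + (norm x)\<^sup>2)\<^sup>2" using gauss_nonneg[of s x] by simp
      ultimately show "norm (gauss s x * (1 + (norm x)\<^sup>2)\<^sup>2)
        \<le> norm (2 * gauss s x + 2 * real CARD('n) * (\<Sum>i\<in>UNIV. gauss s x * (x $ i) ^ 4))"
        by simp
    qed
  qed measurable
qed

text \<open>Gaussian damping: integrable for each \<open>m\<close>, and tending to 1 pointwise as
  \<open>m\<close> grows.\<close>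

definition cutoff :: "real \<Rightarrow> real^'n \<Rightarrow> real" where
  "cutoff m x = exp (- ((norm x)\<^sup>2 / (2 * m)))"

lemma cutoff_bounds: "0 < m \<Longrightarrow> 0 < cutoff m x" "0 < m \<Longrightarrow> cutoff m x \<le> 1"
  by (simp_all add: cutoff_def)

lemma cutoff_integrable:
  assumes "0 < m" shows "integrable lborel (cutoff m :: real^'n \<Rightarrow> real)"
proof -
  let ?c = "(1 / sqrt (2 * pi * (sqrt m)\<^sup>2)) ^ CARD('n)"
  have c: "?c \<noteq> 0" using assms by simp
  have eq: "cutoff m = (\<lambda>x :: real^'n. gauss (sqrt m) x / ?c)"
  proof
    show "cutoff m x = gauss (sqrt m) x / ?c" for x :: "real^'n"
      using gauss_eq[of "sqrt m" x] assms c by (simp add: cutoff_def)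
  qed
  show ?thesis
    unfolding eq by (intro integrable_divide gauss_integrable) (use assms in simp)
qed

lemma cutoff_measurable [measurable]: "cutoff m \<in> borel_measurable borel"
  unfolding cutoff_def by measurable

lemma has_partial_cutoff:
  fixes i :: "'n::finite"
  assumes m: "0 < m"
  shows "has_partial (cutoff m) i (\<lambda>x. - (x $ i / m) * cutoff m x)"
proof
  fix x :: "real^'n"
  have eq: "cutoff m (x + h *\<^sub>R axis i 1) = exp (- (((norm x)\<^sup>2 + 2 * h * x $ i + h\<^sup>2) / (2 * m)))" for h
    unfolding cutoff_def power2_norm_eq_inner
    by (simp add: inner_add_left inner_add_right inner_axis inner_axis' power2_eq_square algebra_simps)
  show "((\<lambda>h. cutoff m (x + h *\<^sub>R axis i 1)) has_real_derivative - (x $ i / m) * cutoff m x) (at 0)"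
    unfolding eq using m by (auto intro!: derivative_eq_intros simp: cutoff_def field_simps)
qed

lemma cutoff_moment:
  assumes m: "1 \<le> m"
  shows "(norm x)\<^sup>2 / m * cutoff m x \<le> 2" "norm x / m * cutoff m x \<le> 3"
proof -
  let ?t = "(norm x)\<^sup>2 / (2 * m)"
  have "?t \<le> exp ?t" using exp_ge_add_one_self[of ?t] by linarith
  from mult_right_mono[OF this, of "exp (- ?t)"] have t: "?t * exp (- ?t) \<le> 1"
    by (simp add: exp_add[symmetric])
  then show 1: "(norm x)\<^sup>2 / m * cutoff m x \<le> 2"
    using m by (simp add: cutoff_def field_simps)
  have "norm x \<le> 1 + (norm x)\<^sup>2"
    using zero_le_power2[of "norm x - 1"] norm_ge_zero[of x] unfolding power2_diff one_power2 mult_1_right by linarith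
  then have "norm x / m * cutoff m x \<le> (1 + (norm x)\<^sup>2) / m * cutoff m x"
    using m cutoff_bounds[of m x] by (intro mult_right_mono divide_right_mono) auto
  also have "\<dots> = 1 / m * cutoff m x + (norm x)\<^sup>2 / m * cutoff m x"
    by (simp add: add_divide_distrib distrib_right)
  also have "\<dots> \<le> 1 + 2"
    using m cutoff_bounds[of m x] mult_mono[of "1 / m" 1 "cutoff m x" 1] by (intro add_mono 1) auto
  finally show "norm x / m * cutoff m x \<le> 3" by simp
qed

text \<open>The constant is the same for all \<open>m \<ge> 1\<close>, so that products with the
  cutoff stay in one class while the cutoff tends to 1. The number 3 bounds the first and second
  partial derivatives by way of \<open>cutoff_moment\<close>.\<close>

lemma cutoff_C_lip:
  assumes m: "1 \<le> m"
  shows "(cutoff m :: real^'n \<Rightarrow> real) \<in> C_lip 1 (real CARD('n) * 3)"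
proof -
  have m0: "0 < m" using m by simp
  let ?g = "\<lambda>i (x :: real^'n). - (x $ i / m) * cutoff m x"
  have gb: "\<bar>?g i x\<bar> \<le> 3" for i x
  proof -
    have "\<bar>?g i x\<bar> \<le> norm x / m * cutoff m x"
      using m0 cutoff_bounds[OF m0, of x] component_le_norm_cart[of x i]
      by (simp add: abs_mult mult_right_mono divide_right_mono)
    then show ?thesis using cutoff_moment(2)[OF m, of x] by linarith
  qed
  let ?k = "\<lambda>i j (x :: real^'n). - ((if i = j then 1 else 0) / m) * cutoff m x + (x $ i / m) * (x $ j / m) * cutoff m x"
  have k: "has_partial (?g i) j (?k i j)" for i j
  proof
    fix x :: "real^'n"
    have 1: "((\<lambda>h. - ((x + h *\<^sub>R axis j 1) $ i / m)) has_real_derivative - ((if i = j then 1 else 0) / m)) (at 0)"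
      using m0 by (cases "i = j") (auto intro!: derivative_eq_intros simp: axis_def)
    from DERIV_mult[OF 1 has_partial_cutoff[OF m0, of j, THEN spec, of x]]
    show "((\<lambda>h. ?g i (x + h *\<^sub>R axis j 1)) has_real_derivative ?k i j x) (at 0)"
      by (simp add: mult_ac)
  qed
  have kb: "\<bar>?k i j x\<bar> \<le> 3" for i j x
  proof -
    have c: "0 < cutoff m x" "cutoff m x \<le> 1" using cutoff_bounds[OF m0] by auto
    have 1: "\<bar>- ((if i = j then 1 else 0) / m) * cutoff m x\<bar> \<le> 1"
      using m c mult_mono[of "1 / m" 1 "cutoff m x" 1] by (simp add: abs_mult)
    have "\<bar>(x $ i / m) * (x $ j / m) * cutoff m x\<bar> \<le> (norm x / m) * (norm x / 1) * cutoff m x"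
      unfolding abs_mult abs_divide using m c component_le_norm_cart[of x i] component_le_norm_cart[of x j]
      by (intro mult_mono frac_le) auto
    also have "\<dots> = (norm x)\<^sup>2 / m * cutoff m x" by (simp add: power2_eq_square)
    also have "\<dots> \<le> 2" by (rule cutoff_moment(1)[OF m])
    finally show ?thesis using 1 by linarith
  qed
  have "?g i \<in> C_lip 0 (real CARD('n) * 3)" for i
    by (rule C_lip_0I_partials[where M=3, OF gb k kb]) simp
  moreover have "(cutoff m :: real^'n \<Rightarrow> real) \<in> C_lip 0 (real CARD('n) * 3)"
  proof (rule C_lip_0I_partials[where M=3, OF _ has_partial_cutoff[OF m0] gb])
    show "\<bar>cutoff m x\<bar> \<le> 3" for x :: "real^'n"
      using cutoff_bounds(1)[OF m0, of x] cutoff_bounds(2)[OF m0, of x] by linarith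
  qed simp
  ultimately have "(cutoff m :: real^'n \<Rightarrow> real) \<in> C_lip (Suc 0) (real CARD('n) * 3)"
    by (intro C_lip_SucI[OF _ _ has_partial_cutoff[OF m0]])
  then show ?thesis by simp
qed

context noise_matrix
begin

lemma W_gauss:
  assumes l: "0 < l"
  shows "distr M lborel (W l) = density lborel (\<lambda>x. ennreal (gauss (sqrt l) x))"
proof -
  have "distributed M lborel (W l) (\<lambda>x. ennreal (gauss (sqrt l) x))"
    using W l unfolding standard_brownian_motion_def gauss_def by blast
  then show ?thesis by (rule distributed_distr_eq_density)
qed

lemma W_fourth_moment:
  assumes l: "0 < l"
  shows "integrable M (\<lambda>\<omega>. (1 + (norm (W l \<omega>))\<^sup>2)\<^sup>2)"
proof -
  have Wm: "W l \<in> measurable M lborel" using W_measurable[of l] l by simp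
  have "integrable (distr M lborel (W l)) (\<lambda>x. (1 + (norm x)\<^sup>2)\<^sup>2)"
    unfolding W_gauss[OF l] using gauss_fourth_moment[of "sqrt l"] l
    by (subst integrable_density) (auto simp: gauss_nonneg)
  then show ?thesis by (rule integrable_distr[OF Wm])
qed

lemma W_expectation:
  fixes g :: "real^'n \<Rightarrow> real"
  assumes l: "0 < l" and [measurable]: "g \<in> borel_measurable borel"
  shows "expectation (\<lambda>\<omega>. g (W l \<omega>)) = (LINT x|lborel. gauss (sqrt l) x * g x)"
proof -
  have [measurable]: "W l \<in> borel_measurable M" using W_measurable[of l] l by simp
  have "expectation (\<lambda>\<omega>. g (W l \<omega>)) = (LINT x|distr M lborel (W l). g x)"
    by (subst integral_distr) auto
  also have "\<dots> = (LINT x|lborel. gauss (sqrt l) x * g x)"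
    unfolding W_gauss[OF l] by (subst integral_density) (auto simp: gauss_nonneg)
  finally show ?thesis .
qed

text \<open>Convolution with a Gaussian of variance \<open>l\<close> in each coordinate. Up to
  normalization by \<open>C\<close>, its density at \<open>y - x\<close> is the characteristic
  function of a Gaussian of variance \<open>1 / l\<close>, for which \<open>W (1 / l)\<close> is at
  hand. Integrating over \<open>y\<close> and \<omega> writes the mollified function as a mixture
  with explicit weight, frequency and phase.\<close>

lemma mollify_mixture:
  assumes l: "0 < l" and f: "f \<in> C_lip 1 K" and fint: "integrable lborel f"
  shows "\<exists>Q :: ((real^'n) \<times> 'a) measure. \<exists>w \<theta> v. cosine_mixture M W L \<alpha> c \<nu> Q w \<theta> v (\<lambda>x. expectation (\<lambda>\<omega>. f (x + W l \<omega>))) K"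
proof -
  interpret P: pair_sigma_finite "lborel :: (real^'n) measure" M by standard
  let ?Q = "(lborel :: (real^'n) measure) \<Otimes>\<^sub>M M"
  define C where "C = (1 / sqrt (2 * pi * (sqrt l)\<^sup>2)) ^ CARD('n)"
  let ?V = "W (1 / l)"
  define w where "w q = C * f (fst q)" for q :: "(real^'n) \<times> 'a"
  define \<theta> where "\<theta> q = ?V (snd q) \<bullet> fst q" for q :: "(real^'n) \<times> 'a"
  define v where "v q = ?V (snd q)" for q :: "(real^'n) \<times> 'a"
  have fm [measurable]: "f \<in> borel_measurable borel" using f by (rule C_lip_measurable)
  have Vm [measurable]: "?V \<in> borel_measurable M" by (rule W_measurable) (use l in simp)
  have Wm [measurable]: "W l \<in> borel_measurable M" by (rule W_measurable) (use l in simp)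
  have w_int: "integrable ?Q (\<lambda>q. w q * (1 + (norm (v q))\<^sup>2)\<^sup>2)"
    using P.integrable_mult_pair[OF integrable_mult_right[OF fint, of C] W_fourth_moment[of "1 / l"]] l
    by (simp add: w_def v_def split_beta')
  have f_eq: "expectation (\<lambda>\<omega>. f (x + W l \<omega>)) = (LINT q|?Q. w q * cos (v q \<bullet> x - \<theta> q))" for x
  proof -
    have int: "integrable ?Q (\<lambda>q. w q * cos (v q \<bullet> x - \<theta> q))"
    proof (rule Bochner_Integration.integrable_bound[OF w_int])
      show "(\<lambda>q. w q * cos (v q \<bullet> x - \<theta> q)) \<in> borel_measurable ?Q"
        unfolding w_def v_def \<theta>_def by measurable
      show "AE q in ?Q. norm (w q * cos (v q \<bullet> x - \<theta> q)) \<le> norm (w q * (1 + (norm (v q))\<^sup>2)\<^sup>2)"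
      proof (rule AE_I2)
        fix q
        have "1 \<le> (1 + (norm (v q))\<^sup>2)\<^sup>2" by (rule one_le_power) simp
        then have "\<bar>cos (v q \<bullet> x - \<theta> q)\<bar> \<le> (1 + (norm (v q))\<^sup>2)\<^sup>2"
          using abs_cos_le_one order_trans by blast
        then show "norm (w q * cos (v q \<bullet> x - \<theta> q)) \<le> norm (w q * (1 + (norm (v q))\<^sup>2)\<^sup>2)"
          by (simp add: abs_mult mult_left_mono)
      qed
    qed
    have "(LINT q|?Q. w q * cos (v q \<bullet> x - \<theta> q)) = (LINT y|lborel. expectation (\<lambda>\<omega>. w (y, \<omega>) * cos (v (y, \<omega>) \<bullet> x - \<theta> (y, \<omega>))))"
      by (rule P.integral_fst'[OF int, symmetric])
    also have "\<dots> = (LINT y|lborel. f y * gauss (sqrt l) (y - x))"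
    proof (intro Bochner_Integration.integral_cong refl)
      fix y :: "real^'n"
      have "expectation (\<lambda>\<omega>. w (y, \<omega>) * cos (v (y, \<omega>) \<bullet> x - \<theta> (y, \<omega>))) = C * f y * expectation (\<lambda>\<omega>. cos ((x - y) \<bullet> ?V \<omega>))"
        by (simp add: w_def v_def \<theta>_def inner_diff_left inner_diff_right inner_commute)
      also have "\<dots> = C * f y * exp (- (1 / l * (norm (x - y))\<^sup>2 / 2))"
        using W_cos_sin(1)[of "1 / l" "x - y"] l by simp
      also have "\<dots> = f y * gauss (sqrt l) (y - x)"
        using gauss_eq[of "sqrt l" "y - x"] l by (simp add: C_def norm_minus_commute)
      finally show "expectation (\<lambda>\<omega>. w (y, \<omega>) * cos (v (y, \<omega>) \<bullet> x - \<theta> (y, \<omega>))) = f y * gauss (sqrt l) (y - x)" .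
    qed
    also have "\<dots> = (LINT y|distr lborel borel ((+) x). f y * gauss (sqrt l) (y - x))"
      by (simp add: lborel_distr_plus)
    also have "\<dots> = (LINT u|lborel. f (x + u) * gauss (sqrt l) (x + u - x))"
      by (subst integral_distr) auto
    also have "\<dots> = expectation (\<lambda>\<omega>. f (x + W l \<omega>))"
      by (subst W_expectation[OF l]) (auto simp: mult.commute)
    finally show ?thesis ..
  qed
  have fK: "(\<lambda>x. expectation (\<lambda>\<omega>. f (x + W l \<omega>))) \<in> C_lip 1 K"
    by (rule C_lip_expectation) (use C_lip_translate[OF f] in auto)
  have "cosine_mixture M W L \<alpha> c \<nu> ?Q w \<theta> v (\<lambda>x. expectation (\<lambda>\<omega>. f (x + W l \<omega>))) K"
  proof unfold_locales
    show "w \<in> borel_measurable ?Q" "\<theta> \<in> borel_measurable ?Q" "v \<in> borel_measurable ?Q"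
      unfolding w_def \<theta>_def v_def by measurable
  qed (use w_int f_eq fK in auto)
  then show ?thesis by blast
qed

lemma estimate_limit:
  assumes t: "0 \<le> t" and h: "0 \<le> h"
    and f: "\<And>n. f n \<in> C_lip 1 K" and lim: "\<And>x. (\<lambda>n. f n x) \<longlonglongrightarrow> F x"
    and est: "\<And>n. \<bar>expectation (\<lambda>\<omega>. f n (x + R *v (Z (t + h) \<omega> - Z t \<omega>))) - f n x - h * igen (f n) x\<bar> \<le> B"
  shows "\<bar>expectation (\<lambda>\<omega>. F (x + R *v (Z (t + h) \<omega> - Z t \<omega>))) - F x - h * igen F x\<bar> \<le> B"
proof -
  have F: "F \<in> C_lip 1 K" by (rule C_lip_limit[OF f lim])
  note C_lip_measurable[OF f, measurable] C_lip_measurable[OF F, measurable]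
  have [measurable]: "(\<lambda>\<omega>. Z (t + h) \<omega> - Z t \<omega>) \<in> borel_measurable M"
    using Z_measurable[of "t + h"] Z_measurable[of t] t h by simp
  have "(\<lambda>n. expectation (\<lambda>\<omega>. f n (x + R *v (Z (t + h) \<omega> - Z t \<omega>)))) \<longlonglongrightarrow> expectation (\<lambda>\<omega>. F (x + R *v (Z (t + h) \<omega> - Z t \<omega>)))"
    by (rule integral_dominated_convergence[where w="\<lambda>_. K"]) (use lim C_lip_bound[OF f] in auto)
  then have "(\<lambda>n. \<bar>expectation (\<lambda>\<omega>. f n (x + R *v (Z (t + h) \<omega> - Z t \<omega>))) - f n x - h * igen (f n) x\<bar>)
    \<longlonglongrightarrow> \<bar>expectation (\<lambda>\<omega>. F (x + R *v (Z (t + h) \<omega> - Z t \<omega>))) - F x - h * igen F x\<bar>"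
    by (intro tendsto_intros lim igen_tendsto[OF f lim])
  then show ?thesis
    by (rule LIMSEQ_le_const2) (use est in blast)
qed

text \<open>Two approximations lead to mixtures: a cutoff makes \<open>f\<close> integrable, then
  mollification applies. Neither may alter the constants, so the modulus is fixed beforehand for the
  enlarged class \<open>C_lip 1 K1\<close>, and \<open>estimate_limit\<close> removes both
  approximations.\<close>

lemma noise_estimate:
  assumes e: "0 < e" and K: "0 \<le> K"
  obtains C where "0 \<le> C" "\<And>f x t h. f \<in> C_lip 1 K \<Longrightarrow> 0 \<le> t \<Longrightarrow> 0 \<le> h \<Longrightarrow>
    \<bar>expectation (\<lambda>\<omega>. f (x + R *v (Z (t + h) \<omega> - Z t \<omega>))) - f x - h * igen f x\<bar> \<le> h * (e + C * mom h)"
proof -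
  \<comment> \<open>The bound that \<open>C_lip_mult\<close> gives at order 1 for \<open>f\<close>
    times any of the cutoffs.\<close>
  define K1 where "K1 = 2 ^ Suc 1 * K * (real CARD('n) * 3)"
  have K1: "0 \<le> K1" using K by (simp add: K1_def)
  obtain C where C: "0 \<le> C" "\<And>f x y. f \<in> C_lip 1 K1 \<Longrightarrow> \<bar>igen f x - igen f y\<bar> \<le> e + C * norm (x - y)"
    using igen_modulus[OF e K1] by blast
  have int: "\<bar>expectation (\<lambda>\<omega>. f (x + R *v (Z (t + h) \<omega> - Z t \<omega>))) - f x - h * igen f x\<bar> \<le> h * (e + C * \<rho> * mom h)"
    if f: "f \<in> C_lip 1 K1" and fint: "integrable lborel f" and t: "0 \<le> t" "0 \<le> h" for f x t h
  proof (rule estimate_limit[OF t])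
    let ?l = "\<lambda>n. 1 / real (Suc n)"
    let ?f = "\<lambda>n x. expectation (\<lambda>\<omega>. f (x + W (?l n) \<omega>))"
    note C_lip_measurable[OF f, measurable]
    have [measurable]: "W (?l n) \<in> borel_measurable M" for n by (rule W_measurable) simp
    show fn: "?f n \<in> C_lip 1 K1" for n
    proof (rule C_lip_expectation)
      show "(\<lambda>x. f (x + W (?l n) \<omega>)) \<in> C_lip 1 K1" for \<omega>
        by (rule C_lip_translate[OF f])
    qed measurable
    show "(\<lambda>n. ?f n x) \<longlonglongrightarrow> f x" for x
    proof -
      have "AE \<omega> in M. W 0 \<omega> = 0" using W_levy by (simp add: levy_process_def)
      with AE_W_continuous have lim: "AE \<omega> in M. (\<lambda>n. f (x + W (?l n) \<omega>)) \<longlonglongrightarrow> f (x + 0)"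
      proof eventually_elim
        case (elim \<omega>)
        have "?l \<longlonglongrightarrow> 0" using LIMSEQ_inverse_real_of_nat by (simp add: inverse_eq_divide)
        from W_tendsto[OF elim(1) _ _ this] have "(\<lambda>n. W (?l n) \<omega>) \<longlonglongrightarrow> 0" using elim(2) by simp
        then show ?case
          by (intro continuous_on_tendsto_compose[OF C_lip_continuous[OF f]] tendsto_add tendsto_const) auto
      qed
      have "(\<lambda>n. ?f n x) \<longlonglongrightarrow> expectation (\<lambda>\<omega>. f (x + 0))"
      proof (rule integral_dominated_convergence[where w="\<lambda>_. K1"])
        show "(\<lambda>\<omega>. f (x + W (?l n) \<omega>)) \<in> borel_measurable M" for n by measurable
      qed (use lim C_lip_bound[OF f] in auto)
      then show ?thesis by (simp add: prob_space)
    qed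
    fix n
    obtain Q :: "((real^'n) \<times> 'a) measure" and w \<theta> v where "cosine_mixture M W L \<alpha> c \<nu> Q w \<theta> v (?f n) K1"
      using mollify_mixture[OF _ f fint, of "?l n"] by auto
    then interpret mix: cosine_mixture M W L \<alpha> c \<nu> R Q w \<theta> v "?f n" K1 .
    show "\<bar>expectation (\<lambda>\<omega>. ?f n (x + R *v (Z (t + h) \<omega> - Z t \<omega>))) - ?f n x - h * igen (?f n) x\<bar> \<le> h * (e + C * \<rho> * mom h)"
      by (rule mix.estimate[OF t C(1)]) (rule C(2)[OF fn])
  qed
  have "\<bar>expectation (\<lambda>\<omega>. f (x + R *v (Z (t + h) \<omega> - Z t \<omega>))) - f x - h * igen f x\<bar> \<le> h * (e + C * \<rho> * mom h)"
    if f: "f \<in> C_lip 1 K" and t: "0 \<le> t" "0 \<le> h" for f x t h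
  proof (rule estimate_limit[OF t])
    let ?f = "\<lambda>n x. f x * cutoff (real (Suc n)) x"
    note C_lip_measurable[OF f, measurable]
    show fn: "?f n \<in> C_lip 1 K1" for n
      unfolding K1_def by (rule C_lip_mult[OF f cutoff_C_lip]) simp
    show "(\<lambda>n. ?f n x) \<longlonglongrightarrow> f x" for x
    proof -
      have eq: "cutoff (real (Suc n)) x = exp (- ((norm x)\<^sup>2 * inverse (real (Suc n)) / 2))" for n
        by (simp only: cutoff_def divide_inverse inverse_mult_distrib mult_ac)
      have "(\<lambda>n. cutoff (real (Suc n)) x) \<longlonglongrightarrow> exp (- ((norm x)\<^sup>2 * 0 / 2))"
        unfolding eq by (intro tendsto_exp tendsto_minus tendsto_divide tendsto_mult tendsto_const LIMSEQ_inverse_real_of_nat) auto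
      then have "(\<lambda>n. cutoff (real (Suc n)) x) \<longlonglongrightarrow> 1"
        by (simp only: mult_zero_right div_0 minus_zero exp_zero)
      from tendsto_mult[OF tendsto_const[of "f x"] this] show ?thesis by simp
    qed
    have "integrable lborel (?f n)" for n
    proof (rule Bochner_Integration.integrable_bound)
      show "integrable lborel (\<lambda>x :: real^'n. K * cutoff (real (Suc n)) x)"
        by (intro integrable_mult_right cutoff_integrable) simp
      show "AE x in lborel. norm (?f n x) \<le> norm (K * cutoff (real (Suc n)) x)"
        using C_lip_bound[OF f] K by (intro AE_I2) (auto simp: abs_mult intro!: mult_right_mono)
    qed auto
    then show "\<bar>expectation (\<lambda>\<omega>. ?f n (x + R *v (Z (t + h) \<omega> - Z t \<omega>))) - ?f n x - h * igen (?f n) x\<bar> \<le> h * (e + C * \<rho> * mom h)" for n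
      by (rule int[OF fn _ t])
  qed
  then show ?thesis using that[of "C * \<rho>"] C(1) \<rho>_nonneg by simp
qed

end

section \<open>Moments and the Markov property of the solution\<close>

text \<open>Fatou's lemma; it transfers mean bounds from the Euler scheme to the solution.\<close>

lemma (in prob_space) expectation_norm_limit:
  fixes Y :: "nat \<Rightarrow> 'a \<Rightarrow> 'b::{banach,second_countable_topology}"
  assumes Y: "\<And>n. integrable M (Y n)" and Y' [measurable]: "Y' \<in> borel_measurable M"
    and lim: "AE \<omega> in M. (\<lambda>n. Y n \<omega>) \<longlonglongrightarrow> Y' \<omega>"
    and C: "\<And>n. expectation (\<lambda>\<omega>. norm (Y n \<omega>)) \<le> C"
  shows "integrable M Y'" and "expectation (\<lambda>\<omega>. norm (Y' \<omega>)) \<le> C"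
proof -
  have [measurable]: "Y n \<in> borel_measurable M" for n using Y by auto
  have C0: "0 \<le> C"
    using C[of 0] order_trans[OF integral_nonneg_AE[of "\<lambda>\<omega>. norm (Y 0 \<omega>)" M]] by auto
  have "(\<integral>\<^sup>+\<omega>. ennreal (norm (Y' \<omega>)) \<partial>M) = (\<integral>\<^sup>+\<omega>. liminf (\<lambda>n. ennreal (norm (Y n \<omega>))) \<partial>M)"
  proof (rule nn_integral_cong_AE)
    show "AE \<omega> in M. ennreal (norm (Y' \<omega>)) = liminf (\<lambda>n. ennreal (norm (Y n \<omega>)))"
      using lim
    proof eventually_elim
      case (elim \<omega>)
      then have "(\<lambda>n. ennreal (norm (Y n \<omega>))) \<longlonglongrightarrow> ennreal (norm (Y' \<omega>))"
        by (intro tendsto_ennrealI tendsto_norm)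
      from lim_imp_Liminf[OF _ this] show ?case by simp
    qed
  qed
  also have "\<dots> \<le> liminf (\<lambda>n. \<integral>\<^sup>+\<omega>. ennreal (norm (Y n \<omega>)) \<partial>M)"
    by (rule nn_integral_liminf) measurable
  also have "\<dots> \<le> ennreal C"
  proof (rule Liminf_le)
    show "\<forall>\<^sub>F n in sequentially. (\<integral>\<^sup>+\<omega>. ennreal (norm (Y n \<omega>)) \<partial>M) \<le> ennreal C"
    proof (intro always_eventually allI)
      fix n
      have "(\<integral>\<^sup>+\<omega>. ennreal (norm (Y n \<omega>)) \<partial>M) = ennreal (expectation (\<lambda>\<omega>. norm (Y n \<omega>)))"
        using Y[of n] by (intro nn_integral_eq_integral) auto
      then show "(\<integral>\<^sup>+\<omega>. ennreal (norm (Y n \<omega>)) \<partial>M) \<le> ennreal C"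
        using C[of n] by (simp add: ennreal_leI)
    qed
  qed simp
  finally have le: "(\<integral>\<^sup>+\<omega>. ennreal (norm (Y' \<omega>)) \<partial>M) \<le> ennreal C" .
  then show int: "integrable M Y'"
    by (intro integrableI_bounded) (auto intro: order.strict_trans1)
  have "ennreal (expectation (\<lambda>\<omega>. norm (Y' \<omega>))) = (\<integral>\<^sup>+\<omega>. ennreal (norm (Y' \<omega>)) \<partial>M)"
    using int by (intro nn_integral_eq_integral[symmetric]) auto
  then have "ennreal (expectation (\<lambda>\<omega>. norm (Y' \<omega>))) \<le> ennreal C"
    using le by (simp only:)
  then show "expectation (\<lambda>\<omega>. norm (Y' \<omega>)) \<le> C"
    using ennreal_le_iff[OF C0] by blast
qed

lemma set_integral_split:
  fixes f :: "real \<Rightarrow> 'b::{banach,second_countable_topology}"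
  assumes f: "set_integrable lborel {s..u} f" and "s \<le> r" "r \<le> u"
  shows "(LINT x:{s..u}|lborel. f x) = (LINT x:{s..r}|lborel. f x) + (LINT x:{r..u}|lborel. f x)"
proof -
  have "{s..u} = {s..r} \<union> {r<..u}" using assms by auto
  then have "(LINT x:{s..u}|lborel. f x) = (LINT x:{s..r} \<union> {r<..u}|lborel. f x)" by simp
  also have "\<dots> = (LINT x:{s..r}|lborel. f x) + (LINT x:{r<..u}|lborel. f x)"
    by (rule set_integral_Un) (use assms in \<open>auto intro: set_integrable_subset[OF f]\<close>)
  also have "(LINT x:{r<..u}|lborel. f x) = (LINT x:{r..u}|lborel. f x)"
  proof -
    have i: "set_integrable lborel {r..u} f" "set_integrable lborel {r<..u} f"
      using assms by (auto intro: set_integrable_subset[OF f])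
    have "AE x in lborel. x \<noteq> r" by (rule AE_lborel_singleton)
    then have "AE x in lborel. indicat_real {r<..u} x *\<^sub>R f x = indicat_real {r..u} x *\<^sub>R f x"
      by eventually_elim (auto simp: indicator_def)
    then show ?thesis
      unfolding set_lebesgue_integral_def
      using i unfolding set_integrable_def by (intro integral_cong_AE) auto
  qed
  finally show ?thesis .
qed

locale sde = noise_matrix M W L \<alpha> c \<nu> R + drift T b \<kappa>
  for M :: "'a measure" and W :: "real \<Rightarrow> 'a \<Rightarrow> real^'n" and L \<alpha> c \<nu> R T b \<kappa> +
  fixes X :: "real \<Rightarrow> real^'n \<Rightarrow> real \<Rightarrow> 'a \<Rightarrow> real^'n"
  assumes X_measurable: "\<And>s x t. s \<in> {0..T} \<Longrightarrow> t \<in> {s..T} \<Longrightarrow> X s x t \<in> borel_measurable M"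
    and X_solution: "\<And>s x. s \<in> {0..T} \<Longrightarrow> AE \<omega> in M. cadlag_on {s..T} (\<lambda>t. X s x t \<omega>) \<and>
        (\<forall>t\<in>{s..T}. set_integrable lborel {s..t} (\<lambda>r. b r (X s x r \<omega>)) \<and>
           X s x t \<omega> = x + (LINT r:{s..t}|lborel. b r (X s x r \<omega>)) + R *v (Z t \<omega> - Z s \<omega>))"
begin

definition inc :: "real \<Rightarrow> real \<Rightarrow> 'a \<Rightarrow> nat \<Rightarrow> real^'n" where
  "inc r \<delta> \<omega> j = R *v (Z (r + real (Suc j) * \<delta>) \<omega> - Z (r + real j * \<delta>) \<omega>)"

lemma b_measurable:
  assumes "t \<in> {0..T}" shows "b t \<in> borel_measurable borel"
proof (rule borel_measurable_continuous_onI)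
  show "continuous_on UNIV (b t)"
    unfolding continuous_on_sequentially o_def using assms by (auto intro: b_tendsto)
qed

text \<open>The quantifier over \<open>y\<close> stands inside the almost sure statement: the
  starting points may depend on \<omega>, as those produced by a preceding scheme do.\<close>

lemma euler_path:
  assumes s: "0 \<le> s" "s \<le> r" "r \<le> t" "t \<le> T"
  shows "AE \<omega> in M. \<forall>y. y \<longlonglongrightarrow> X s x r \<omega> \<longrightarrow>
    (\<lambda>n. euler b r ((t - r) / real (Suc n)) (inc r ((t - r) / real (Suc n)) \<omega>) (Suc n) (y n)) \<longlonglongrightarrow> X s x t \<omega>"
proof -
  have "s \<in> {0..T}" using s by simp
  from X_solution[OF this, of x] show ?thesis
  proof eventually_elim
    case (elim \<omega>)
    have cadlag: "cadlag_on {s..T} (\<lambda>t. X s x t \<omega>)" using elim by blast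
    have int: "set_integrable lborel {s..u} (\<lambda>r. b r (X s x r \<omega>))" if "u \<in> {s..T}" for u
      using elim that by blast
    have eq: "X s x u \<omega> = x + (LINT r:{s..u}|lborel. b r (X s x r \<omega>)) + R *v (Z u \<omega> - Z s \<omega>)" if "u \<in> {s..T}" for u
      using elim that by blast
    obtain B where B: "\<And>u. u \<in> {s..T} \<Longrightarrow> norm (X s x u \<omega>) \<le> B"
      using cadlag_on_bounded[OF cadlag] by blast
    show ?case
    proof (intro allI impI, rule euler_converges[where x="\<lambda>u. X s x u \<omega>" and z="\<lambda>u. R *v Z u \<omega>" and B=B])
      show "set_integrable lborel {r..t} (\<lambda>\<rho>. b \<rho> (X s x \<rho> \<omega>))"
        using int[of t] s by (auto intro: set_integrable_subset)
      show "X s x u \<omega> = X s x r \<omega> + (LINT \<rho>:{r..u}|lborel. b \<rho> (X s x \<rho> \<omega>)) + (R *v Z u \<omega> - R *v Z r \<omega>)"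
        if u: "u \<in> {r..t}" for u
      proof -
        have u': "u \<in> {s..T}" "r \<in> {s..T}" "r \<le> u" "s \<le> r" using u s by auto
        have "(LINT r:{s..u}|lborel. b r (X s x r \<omega>)) = (LINT r:{s..r}|lborel. b r (X s x r \<omega>)) + (LINT r:{r..u}|lborel. b r (X s x r \<omega>))"
          by (rule set_integral_split[OF int[OF u'(1)] u'(4,3)])
        then show ?thesis
          unfolding eq[OF u'(1)] eq[OF u'(2)] by (simp add: matrix_vector_mult_diff_distrib)
      qed
      show "norm (X s x u \<omega>) \<le> B" if "u \<in> {r..t}" for u using B that s by auto
      show "continuous (at u within {u..t}) (\<lambda>u. X s x u \<omega>)" if "u \<in> {r..t}" for u
        by (rule cadlag_on_right_continuous[OF cadlag]) (use that s in auto)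
    qed (use s in \<open>auto simp: inc_def matrix_vector_mult_diff_distrib\<close>)
  qed
qed

lemma Z_shift:
  assumes "0 \<le> r" "r \<le> t"
  shows "(\<lambda>\<omega>. R *v (Z t \<omega> - Z r \<omega>)) \<in> borel_measurable M"
    and "integrable M (\<lambda>\<omega>. R *v (Z t \<omega> - Z r \<omega>))"
    and "expectation (\<lambda>\<omega>. norm (R *v (Z t \<omega> - Z r \<omega>))) \<le> \<rho> * mom (t - r)"
proof -
  have i: "integrable M (\<lambda>\<omega>. Z t \<omega> - Z r \<omega>)"
    using Z_increment_moment(1)[of r "t - r"] assms by simp
  have e: "expectation (\<lambda>\<omega>. norm (Z t \<omega> - Z r \<omega>)) \<le> mom (t - r)"
    using Z_increment_moment(2)[of r "t - r"] assms by simp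
  show m: "(\<lambda>\<omega>. R *v (Z t \<omega> - Z r \<omega>)) \<in> borel_measurable M"
    by (rule measurable_compose[OF borel_measurable_integrable[OF i] R_measurable])
  have i': "integrable M (\<lambda>\<omega>. \<rho> * norm (Z t \<omega> - Z r \<omega>))" using i by simp
  show i2: "integrable M (\<lambda>\<omega>. R *v (Z t \<omega> - Z r \<omega>))"
    by (rule Bochner_Integration.integrable_bound[OF i' m])
       (auto intro!: AE_I2 order_trans[OF norm_R_le] abs_ge_self simp: abs_mult \<rho>_nonneg)
  have "expectation (\<lambda>\<omega>. norm (R *v (Z t \<omega> - Z r \<omega>))) \<le> expectation (\<lambda>\<omega>. \<rho> * norm (Z t \<omega> - Z r \<omega>))"
    by (intro integral_mono integrable_norm i2 i' norm_R_le)
  also have "\<dots> \<le> \<rho> * mom (t - r)"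
    using e \<rho>_nonneg by (simp add: mult_left_mono)
  finally show "expectation (\<lambda>\<omega>. norm (R *v (Z t \<omega> - Z r \<omega>))) \<le> \<rho> * mom (t - r)" .
qed

section \<open>Mean size of the drift accumulated by the Euler scheme\<close>

context
  fixes r \<delta> :: real and n :: nat and y :: "'a \<Rightarrow> real^'n"
  assumes r: "0 \<le> r" and \<delta>: "0 \<le> \<delta>" and rT: "r + real n * \<delta> \<le> T" and y: "integrable M y"
begin

lemma grid_le_T: "k \<le> n \<Longrightarrow> r + real k * \<delta> \<in> {0..T}" "k \<le> n \<Longrightarrow> r + real k * \<delta> \<in> {r..r + real n * \<delta>}"
  using mult_right_mono[of "real k" "real n" \<delta>] r \<delta> rT by auto

abbreviation "E k \<omega> \<equiv> euler b r \<delta> (inc r \<delta> \<omega>) k (y \<omega>)"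
abbreviation "N k \<omega> \<equiv> R *v (Z (r + real k * \<delta>) \<omega> - Z r \<omega>)"
text \<open>The accumulated drift, without start and noise. Its mean is bounded by a multiple of the
  elapsed time, whereas the noise \<open>N\<close> is only bounded by \<open>mom\<close>; separating
  the two is what allows an error small compared with the elapsed time.\<close>

abbreviation "D k \<omega> \<equiv> E k \<omega> - y \<omega> - N k \<omega>"

lemma D_0: "D 0 \<omega> = 0" by simp

lemma D_Suc: "D (Suc k) \<omega> = D k \<omega> + \<delta> *\<^sub>R b (r + real (Suc k) * \<delta>) (y \<omega> + D k \<omega> + N (Suc k) \<omega>)"
proof -
  have "E k \<omega> + inc r \<delta> \<omega> k = y \<omega> + D k \<omega> + N (Suc k) \<omega>"
    by (simp add: inc_def matrix_vector_mult_diff_distrib del: of_nat_Suc)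
  then have "E (Suc k) \<omega> = (y \<omega> + D k \<omega> + N (Suc k) \<omega>) + \<delta> *\<^sub>R b (r + real (Suc k) * \<delta>) (y \<omega> + D k \<omega> + N (Suc k) \<omega>)"
    by (simp only: euler.simps Let_def)
  then show ?thesis by (simp del: euler.simps of_nat_Suc)
qed

lemma N_bound:
  assumes "k \<le> n"
  shows "integrable M (N k)" "expectation (\<lambda>\<omega>. norm (N k \<omega>)) \<le> \<rho> * mom (real n * \<delta>)"
proof -
  show "integrable M (N k)"
    by (rule Z_shift(2)) (use r \<delta> in auto)
  have "expectation (\<lambda>\<omega>. norm (N k \<omega>)) \<le> \<rho> * mom (r + real k * \<delta> - r)"
    by (rule Z_shift(3)) (use r \<delta> in auto)
  also have "\<dots> \<le> \<rho> * mom (real n * \<delta>)"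
    using assms \<delta> \<rho>_nonneg by (intro mult_left_mono mom_mono) (auto intro: mult_right_mono)
  finally show "expectation (\<lambda>\<omega>. norm (N k \<omega>)) \<le> \<rho> * mom (real n * \<delta>)" .
qed

lemma D_integrable_Suc:
  assumes k: "Suc k \<le> n" and D: "integrable M (D k)"
  shows "integrable M (\<lambda>\<omega>. b (r + real (Suc k) * \<delta>) (y \<omega> + D k \<omega> + N (Suc k) \<omega>))"
proof -
  let ?v = "\<lambda>\<omega>. y \<omega> + D k \<omega> + N (Suc k) \<omega>"
  have v: "integrable M ?v"
    using y D N_bound(1)[OF k] by (intro Bochner_Integration.integrable_add)
  have \<tau>: "r + real (Suc k) * \<delta> \<in> {0..T}" by (rule grid_le_T(1)[OF k])
  have i: "integrable M (\<lambda>\<omega>. \<kappa> * (1 + norm (?v \<omega>)))"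
    by (intro integrable_mult_right Bochner_Integration.integrable_add integrable_const integrable_norm v)
  show ?thesis
  proof (rule Bochner_Integration.integrable_bound[OF i])
    show "(\<lambda>\<omega>. b (r + real (Suc k) * \<delta>) (?v \<omega>)) \<in> borel_measurable M"
      by (rule measurable_compose[OF borel_measurable_integrable[OF v] b_measurable[OF \<tau>]])
    show "AE \<omega> in M. norm (b (r + real (Suc k) * \<delta>) (?v \<omega>)) \<le> norm (\<kappa> * (1 + norm (?v \<omega>)))"
      by (intro AE_I2 order_trans[OF b_growth[OF \<tau>]]) simp
  qed
qed

lemma D_integrable: "k \<le> n \<Longrightarrow> integrable M (D k)"
proof (induction k)
  case 0
  show ?case by (simp only: D_0) simp
next
  case (Suc k)
  then have "integrable M (D k)" by simp
  then have "integrable M (\<lambda>\<omega>. D k \<omega> + \<delta> *\<^sub>R b (r + real (Suc k) * \<delta>) (y \<omega> + D k \<omega> + N (Suc k) \<omega>))"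
    by (intro Bochner_Integration.integrable_add integrable_scaleR_right D_integrable_Suc Suc.prems)
  then show ?case by (simp only: D_Suc)
qed

text \<open>Gronwall for means: a step multiplies by \<open>1 + \<kappa> * \<delta>\<close> and adds
  the growth bound at the start and at the noise. The result involves the mesh only through elapsed
  times and so survives its refinement.\<close>

lemma D_moment:
  assumes "k \<le> n"
  shows "expectation (\<lambda>\<omega>. norm (D k \<omega>)) \<le> real k * \<delta> * (\<kappa> * (1 + expectation (\<lambda>\<omega>. norm (y \<omega>)) + \<rho> * mom (real n * \<delta>))) * exp (\<kappa> * (real k * \<delta>))"
  using assms
proof (induction k)
  case 0
  show ?case by (simp only: D_0) simp
next
  case (Suc k)
  let ?K = "1 + expectation (\<lambda>\<omega>. norm (y \<omega>)) + \<rho> * mom (real n * \<delta>)"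
  have K: "0 \<le> ?K" using \<rho>_nonneg mom_nonneg by (intro add_nonneg_nonneg mult_nonneg_nonneg integral_nonneg_AE) auto
  have k: "k \<le> n" using Suc.prems by simp
  note Dk = D_integrable[OF k]
  let ?v = "\<lambda>\<omega>. y \<omega> + D k \<omega> + N (Suc k) \<omega>"
  let ?d = "expectation (\<lambda>\<omega>. norm (D k \<omega>))"
  have \<tau>: "r + real (Suc k) * \<delta> \<in> {0..T}" by (rule grid_le_T(1)[OF Suc.prems])
  have "expectation (\<lambda>\<omega>. norm (D (Suc k) \<omega>)) \<le> expectation (\<lambda>\<omega>. norm (D k \<omega>) + \<delta> * (\<kappa> * (1 + (norm (y \<omega>) + norm (D k \<omega>) + norm (N (Suc k) \<omega>)))))"
  proof (rule integral_mono)
    show "integrable M (\<lambda>\<omega>. norm (D (Suc k) \<omega>))" using D_integrable[OF Suc.prems] by (rule integrable_norm)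
    show "integrable M (\<lambda>\<omega>. norm (D k \<omega>) + \<delta> * (\<kappa> * (1 + (norm (y \<omega>) + norm (D k \<omega>) + norm (N (Suc k) \<omega>)))))"
      using y Dk N_bound(1)[OF Suc.prems]
      by (intro Bochner_Integration.integrable_add integrable_mult_right integrable_norm) auto
    fix \<omega>
    have "norm (b (r + real (Suc k) * \<delta>) (?v \<omega>)) \<le> \<kappa> * (1 + norm (?v \<omega>))" by (rule b_growth[OF \<tau>])
    also have "\<dots> \<le> \<kappa> * (1 + (norm (y \<omega>) + norm (D k \<omega>) + norm (N (Suc k) \<omega>)))"
      using \<kappa> norm_triangle_ineq[of "y \<omega> + D k \<omega>" "N (Suc k) \<omega>"] norm_triangle_ineq[of "y \<omega>" "D k \<omega>"]
      by (intro mult_left_mono) linarith+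
    finally have "norm (\<delta> *\<^sub>R b (r + real (Suc k) * \<delta>) (?v \<omega>)) \<le> \<delta> * (\<kappa> * (1 + (norm (y \<omega>) + norm (D k \<omega>) + norm (N (Suc k) \<omega>))))"
      using \<delta> by (simp only: norm_scaleR abs_of_nonneg mult_left_mono)
    then show "norm (D (Suc k) \<omega>) \<le> norm (D k \<omega>) + \<delta> * (\<kappa> * (1 + (norm (y \<omega>) + norm (D k \<omega>) + norm (N (Suc k) \<omega>))))"
      unfolding D_Suc using norm_triangle_ineq[of "D k \<omega>" "\<delta> *\<^sub>R b (r + real (Suc k) * \<delta>) (?v \<omega>)"] by linarith
  qed
  also have "\<dots> = ?d + \<delta> * (\<kappa> * (1 + (expectation (\<lambda>\<omega>. norm (y \<omega>)) + ?d + expectation (\<lambda>\<omega>. norm (N (Suc k) \<omega>)))))"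
  proof -
    have i: "integrable M (\<lambda>\<omega>. norm (D k \<omega>))" "integrable M (\<lambda>\<omega>. norm (y \<omega>))" "integrable M (\<lambda>\<omega>. norm (N (Suc k) \<omega>))"
      using y Dk N_bound(1)[OF Suc.prems] by (auto intro: integrable_norm simp del: of_nat_Suc)
    have "expectation (\<lambda>\<omega>. p \<omega> + \<delta> * (\<kappa> * (1 + (q \<omega> + p \<omega> + u \<omega>)))) = expectation p + \<delta> * (\<kappa> * (1 + (expectation q + expectation p + expectation u)))"
      if "integrable M p" "integrable M q" "integrable M u" for p q u :: "'a \<Rightarrow> real"
      using that by (simp add: prob_space)
    from this[OF i] show ?thesis .
  qed
  also have "\<dots> \<le> ?d + \<delta> * (\<kappa> * (?K + ?d))"
    using N_bound(2)[OF Suc.prems] \<delta> \<kappa> by (intro add_left_mono mult_left_mono) auto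
  also have "\<dots> = (1 + \<kappa> * \<delta>) * ?d + \<delta> * (\<kappa> * ?K)"
    by (simp add: algebra_simps)
  also have "\<dots> \<le> exp (\<kappa> * \<delta>) * (real k * \<delta> * (\<kappa> * ?K) * exp (\<kappa> * (real k * \<delta>))) + \<delta> * (\<kappa> * ?K) * exp (\<kappa> * (real (Suc k) * \<delta>))"
  proof (rule add_mono)
    show "(1 + \<kappa> * \<delta>) * ?d \<le> exp (\<kappa> * \<delta>) * (real k * \<delta> * (\<kappa> * ?K) * exp (\<kappa> * (real k * \<delta>)))"
      by (intro mult_mono Suc.IH[OF k]) (auto intro: integral_nonneg_AE simp del: euler.simps)
    show "\<delta> * (\<kappa> * ?K) \<le> \<delta> * (\<kappa> * ?K) * exp (\<kappa> * (real (Suc k) * \<delta>))"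
      using mult_left_mono[of 1 "exp (\<kappa> * (real (Suc k) * \<delta>))" "\<delta> * (\<kappa> * ?K)"] \<delta> \<kappa> K by simp
  qed
  also have "\<dots> = real (Suc k) * \<delta> * (\<kappa> * ?K) * exp (\<kappa> * (real (Suc k) * \<delta>))"
  proof -
    have "exp (\<kappa> * (real (Suc k) * \<delta>)) = exp (\<kappa> * \<delta>) * exp (\<kappa> * (real k * \<delta>))"
      by (simp add: exp_add[symmetric] algebra_simps)
    then show ?thesis by (simp add: algebra_simps)
  qed
  finally show ?case .
qed

text \<open>Every evaluation of \<open>b\<close> is replaced by \<open>b r x\<close>: the change of
  position costs \<kappa> times the mean sizes of \<open>D\<close> and \<open>N\<close>, the change
  of time costs \<open>osc\<close>. All of this is multiplied by the elapsed time, hence the error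
  is of smaller order.\<close>

lemma D_first_order:
  assumes "k \<le> n" and y': "\<And>\<omega>. y \<omega> = x" and osc: "\<And>\<tau>. \<tau> \<in> {r..r + real n * \<delta>} \<Longrightarrow> norm (b \<tau> x - b r x) \<le> osc"
    and B: "\<And>k. k \<le> n \<Longrightarrow> expectation (\<lambda>\<omega>. norm (D k \<omega>)) \<le> B"
  shows "expectation (\<lambda>\<omega>. norm (D k \<omega> - (real k * \<delta>) *\<^sub>R b r x)) \<le> real k * \<delta> * (\<kappa> * (B + \<rho> * mom (real n * \<delta>)) + osc)"
  using assms(1)
proof (induction k)
  case 0
  show ?case by (simp only: D_0) simp
next
  case (Suc k)
  have k: "k \<le> n" using Suc.prems by simp
  have \<tau>: "r + real (Suc k) * \<delta> \<in> {0..T}" by (rule grid_le_T(1)[OF Suc.prems])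
  have \<tau>': "r + real (Suc k) * \<delta> \<in> {r..r + real n * \<delta>}" by (rule grid_le_T(2)[OF Suc.prems])
  let ?v = "\<lambda>\<omega>. y \<omega> + D k \<omega> + N (Suc k) \<omega>"
  let ?F = "\<lambda>k \<omega>. D k \<omega> - (real k * \<delta>) *\<^sub>R b r x"
  have Fi: "integrable M (?F k)" if "k \<le> n" for k
    using D_integrable[OF that] by (rule Bochner_Integration.integrable_diff) simp
  have "expectation (\<lambda>\<omega>. norm (?F (Suc k) \<omega>)) \<le> expectation (\<lambda>\<omega>. norm (?F k \<omega>) + \<delta> * (\<kappa> * (norm (D k \<omega>) + norm (N (Suc k) \<omega>)) + osc))"
  proof (rule integral_mono)
    show "integrable M (\<lambda>\<omega>. norm (?F (Suc k) \<omega>))" using Fi[OF Suc.prems] by (rule integrable_norm)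
    show "integrable M (\<lambda>\<omega>. norm (?F k \<omega>) + \<delta> * (\<kappa> * (norm (D k \<omega>) + norm (N (Suc k) \<omega>)) + osc))"
      using Fi[OF k] D_integrable[OF k] N_bound(1)[OF Suc.prems]
      by (intro Bochner_Integration.integrable_add integrable_mult_right integrable_norm) auto
    fix \<omega>
    have eq: "?F (Suc k) \<omega> = ?F k \<omega> + \<delta> *\<^sub>R (b (r + real (Suc k) * \<delta>) (?v \<omega>) - b r x)"
      unfolding D_Suc by (simp add: algebra_simps del: euler.simps)
    have "norm (b (r + real (Suc k) * \<delta>) (?v \<omega>) - b r x) \<le> norm (b (r + real (Suc k) * \<delta>) (?v \<omega>) - b (r + real (Suc k) * \<delta>) x) + norm (b (r + real (Suc k) * \<delta>) x - b r x)"
      using norm_triangle_ineq[of "b (r + real (Suc k) * \<delta>) (?v \<omega>) - b (r + real (Suc k) * \<delta>) x" "b (r + real (Suc k) * \<delta>) x - b r x"] by (simp del: of_nat_Suc)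
    also have "\<dots> \<le> \<kappa> * norm (?v \<omega> - x) + osc"
      by (intro add_mono b_lipschitz[OF \<tau>] osc[OF \<tau>'])
    also have "\<dots> \<le> \<kappa> * (norm (D k \<omega>) + norm (N (Suc k) \<omega>)) + osc"
    proof -
      have "?v \<omega> - x = D k \<omega> + N (Suc k) \<omega>" unfolding y' by simp
      then have "norm (?v \<omega> - x) \<le> norm (D k \<omega>) + norm (N (Suc k) \<omega>)"
        by (simp only: norm_triangle_ineq)
      then show ?thesis using \<kappa> by (intro add_right_mono mult_left_mono)
    qed
    finally have "norm (\<delta> *\<^sub>R (b (r + real (Suc k) * \<delta>) (?v \<omega>) - b r x)) \<le> \<delta> * (\<kappa> * (norm (D k \<omega>) + norm (N (Suc k) \<omega>)) + osc)"
      using \<delta> by (simp only: norm_scaleR abs_of_nonneg mult_left_mono)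
    then show "norm (?F (Suc k) \<omega>) \<le> norm (?F k \<omega>) + \<delta> * (\<kappa> * (norm (D k \<omega>) + norm (N (Suc k) \<omega>)) + osc)"
      unfolding eq using norm_triangle_ineq[of "?F k \<omega>" "\<delta> *\<^sub>R (b (r + real (Suc k) * \<delta>) (?v \<omega>) - b r x)"] by linarith
  qed
  also have "\<dots> = expectation (\<lambda>\<omega>. norm (?F k \<omega>)) + \<delta> * (\<kappa> * (expectation (\<lambda>\<omega>. norm (D k \<omega>)) + expectation (\<lambda>\<omega>. norm (N (Suc k) \<omega>))) + osc)"
  proof -
    have i: "integrable M (\<lambda>\<omega>. norm (?F k \<omega>))" "integrable M (\<lambda>\<omega>. norm (D k \<omega>))" "integrable M (\<lambda>\<omega>. norm (N (Suc k) \<omega>))"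
      by (intro integrable_norm Fi[OF k] D_integrable[OF k] N_bound(1)[OF Suc.prems])+
    have "expectation (\<lambda>\<omega>. p \<omega> + \<delta> * (\<kappa> * (q \<omega> + u \<omega>) + osc)) = expectation p + \<delta> * (\<kappa> * (expectation q + expectation u) + osc)"
      if "integrable M p" "integrable M q" "integrable M u" for p q u :: "'a \<Rightarrow> real"
      using that by (simp add: prob_space)
    from this[OF i] show ?thesis .
  qed
  also have "\<dots> \<le> real k * \<delta> * (\<kappa> * (B + \<rho> * mom (real n * \<delta>)) + osc) + \<delta> * (\<kappa> * (B + \<rho> * mom (real n * \<delta>)) + osc)"
    using N_bound(2)[OF Suc.prems] B[OF k] \<delta> \<kappa>
    by (intro add_mono Suc.IH[OF k] mult_left_mono order_refl) auto
  also have "\<dots> = real (Suc k) * \<delta> * (\<kappa> * (B + \<rho> * mom (real n * \<delta>)) + osc)"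
    by (simp add: algebra_simps)
  finally show ?case .
qed

end

end

lemma (in prob_space) expectation_indep_pair:
  fixes F :: "'b \<times> 'b \<Rightarrow> real"
  assumes ind: "indep_var S X T Y" and F [measurable]: "F \<in> borel_measurable (S \<Otimes>\<^sub>M T)" and Fb: "\<And>p. \<bar>F p\<bar> \<le> K"
  shows "expectation (\<lambda>\<omega>. F (X \<omega>, Y \<omega>)) = expectation (\<lambda>\<omega>'. expectation (\<lambda>\<omega>. F (X \<omega>', Y \<omega>)))"
proof -
  have X [measurable]: "X \<in> measurable M S" and Y [measurable]: "Y \<in> measurable M T"
    using ind by (auto dest: indep_var_rv1 indep_var_rv2)
  interpret DX: prob_space "distr M S X" by (rule prob_space_distr[OF X])
  interpret DY: prob_space "distr M T Y" by (rule prob_space_distr[OF Y])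
  interpret P: pair_sigma_finite "distr M S X" "distr M T Y" by standard
  interpret PP: pair_prob_space "distr M S X" "distr M T Y" by standard
  have eq: "distr M (S \<Otimes>\<^sub>M T) (\<lambda>\<omega>. (X \<omega>, Y \<omega>)) = distr M S X \<Otimes>\<^sub>M distr M T Y"
    using ind unfolding indep_var_distribution_eq by simp
  have Fm: "F \<in> borel_measurable (distr M S X \<Otimes>\<^sub>M distr M T Y)"
    using F by (simp cong: measurable_cong_sets sets_pair_measure_cong)
  have int: "integrable (distr M S X \<Otimes>\<^sub>M distr M T Y) F"
    by (rule PP.integrable_const_bound[where B=K]) (use Fb Fm in auto)
  have "expectation (\<lambda>\<omega>. F (X \<omega>, Y \<omega>)) = (LINT p|distr M (S \<Otimes>\<^sub>M T) (\<lambda>\<omega>. (X \<omega>, Y \<omega>)). F p)"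
    by (subst integral_distr) auto
  also have "\<dots> = (LINT a|distr M S X. LINT b|distr M T Y. F (a, b))"
    unfolding eq by (rule P.integral_fst'[OF int, symmetric])
  also have "\<dots> = (LINT a|distr M S X. expectation (\<lambda>\<omega>. F (a, Y \<omega>)))"
    by (intro Bochner_Integration.integral_cong refl, subst integral_distr) auto
  also have "\<dots> = expectation (\<lambda>\<omega>'. expectation (\<lambda>\<omega>. F (X \<omega>', Y \<omega>)))"
    by (subst integral_distr) auto
  finally show ?thesis .
qed

text \<open>Supplies the hypothesis \<open>step\<close> of the lemmas on transition operators at
  order 0, from the Lipschitz bound of the drift; the Markov property and the forward equation rely
  on it.\<close>

lemma (in drift) C_lip_0_step:
  assumes "t \<in> {0..T}" "0 \<le> \<delta>" "f \<in> C_lip 0 K"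
  shows "(\<lambda>x. f (x + \<delta> *\<^sub>R b t x)) \<in> C_lip 0 (K * (1 + \<kappa> * \<delta>))"
proof -
  have K: "0 \<le> K" using assms(3) by (rule C_lip_nonneg)
  have "\<bar>f (x + \<delta> *\<^sub>R b t x) - f (y + \<delta> *\<^sub>R b t y)\<bar> \<le> K * (1 + \<kappa> * \<delta>) * norm (x - y)" for x y
  proof -
    have "norm ((x + \<delta> *\<^sub>R b t x) - (y + \<delta> *\<^sub>R b t y)) = norm ((x - y) + \<delta> *\<^sub>R (b t x - b t y))"
      by (simp add: algebra_simps)
    also have "\<dots> \<le> norm (x - y) + \<delta> * (\<kappa> * norm (x - y))"
      using b_lipschitz[OF assms(1), of x y] assms(2)
      by (intro order_trans[OF norm_triangle_ineq] add_left_mono) (simp add: mult_left_mono)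
    finally have "K * norm ((x + \<delta> *\<^sub>R b t x) - (y + \<delta> *\<^sub>R b t y)) \<le> K * (norm (x - y) + \<delta> * (\<kappa> * norm (x - y)))"
      using K by (rule mult_left_mono)
    then show ?thesis
      using C_lip_lipschitz[OF assms(3), of "x + \<delta> *\<^sub>R b t x" "y + \<delta> *\<^sub>R b t y"] by (simp add: algebra_simps)
  qed
  moreover have "\<bar>f (x + \<delta> *\<^sub>R b t x)\<bar> \<le> K * (1 + \<kappa> * \<delta>)" for x
    using C_lip_bound[OF assms(3), of "x + \<delta> *\<^sub>R b t x"] K \<kappa> assms(2) mult_left_mono[of 1 "1 + \<kappa> * \<delta>" K] by simp
  ultimately show ?thesis by (simp add: C_lip.simps)
qed

section \<open>Moments of the solution and its transition operators\<close>

context sde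
begin

lemma X_initial:
  assumes "s \<in> {0..T}"
  shows "AE \<omega> in M. X s x s \<omega> = x"
  using X_solution[OF assms, of x]
proof eventually_elim
  case (elim \<omega>)
  have "AE r in lborel. r \<noteq> s" by (rule AE_lborel_singleton)
  then have "AE r in lborel. indicat_real {s..s} r *\<^sub>R b r (X s x r \<omega>) = 0"
    by eventually_elim (auto simp: indicator_def)
  then have "(LINT r:{s..s}|lborel. b r (X s x r \<omega>)) = 0"
    unfolding set_lebesgue_integral_def by (rule integral_eq_zero_AE)
  moreover have "X s x s \<omega> = x + (LINT r:{s..s}|lborel. b r (X s x r \<omega>)) + R *v (Z s \<omega> - Z s \<omega>)"
    using elim assms by auto
  ultimately show ?case by simp
qed

lemma step_props:
  assumes "0 \<le> r" "r \<le> t" "t \<le> T"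
  shows "0 \<le> (t - r) / real (Suc n)" "r + real (Suc n) * ((t - r) / real (Suc n)) = t"
    "r + real (Suc n) * ((t - r) / real (Suc n)) \<le> T" "real (Suc n) * ((t - r) / real (Suc n)) = t - r"
    "r + (t - r) = t"
  using assms by auto

text \<open>The mean bound \<open>D_moment\<close> for the scheme started at \<open>X s x r\<close>,
  passed to the limit by Fatou's lemma.\<close>

lemma X_moment_step:
  assumes s: "0 \<le> s" "s \<le> r" "r \<le> t" "t \<le> T" and y: "integrable M (X s x r)"
  shows "integrable M (\<lambda>\<omega>. X s x t \<omega> - X s x r \<omega> - R *v (Z t \<omega> - Z r \<omega>))"
    and "expectation (\<lambda>\<omega>. norm (X s x t \<omega> - X s x r \<omega> - R *v (Z t \<omega> - Z r \<omega>)))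
      \<le> (t - r) * (\<kappa> * (1 + expectation (\<lambda>\<omega>. norm (X s x r \<omega>)) + \<rho> * mom (t - r))) * exp (\<kappa> * (t - r))"
proof -
  let ?\<delta> = "\<lambda>n. (t - r) / real (Suc n)"
  let ?D = "\<lambda>n \<omega>. euler b r (?\<delta> n) (inc r (?\<delta> n) \<omega>) (Suc n) (X s x r \<omega>) - X s x r \<omega> - R *v (Z t \<omega> - Z r \<omega>)"
  have r: "0 \<le> r" "r \<le> t" "t \<le> T" "s \<in> {0..T}" "r \<in> {s..T}" "t \<in> {s..T}" using s by auto
  note st = step_props[OF r(1-3)]
  have D: "integrable M (?D n)" for n
    using D_integrable[OF r(1) st(1) st(3) y order_refl, of n] by (simp only: st(2))
  have E: "expectation (\<lambda>\<omega>. norm (?D n \<omega>)) \<le> (t - r) * (\<kappa> * (1 + expectation (\<lambda>\<omega>. norm (X s x r \<omega>)) + \<rho> * mom (t - r))) * exp (\<kappa> * (t - r))" for n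
    using D_moment[OF r(1) st(1) st(3) y order_refl, of n] by (simp only: st(2) st(4) st(5))
  have m: "(\<lambda>\<omega>. X s x t \<omega> - X s x r \<omega> - R *v (Z t \<omega> - Z r \<omega>)) \<in> borel_measurable M"
    using X_measurable[OF r(4,6), of x] X_measurable[OF r(4,5), of x] Z_shift(1)[OF r(1,2)] by measurable
  have lim: "AE \<omega> in M. (\<lambda>n. ?D n \<omega>) \<longlonglongrightarrow> X s x t \<omega> - X s x r \<omega> - R *v (Z t \<omega> - Z r \<omega>)"
    using euler_path[OF s, of x]
  proof eventually_elim
    case (elim \<omega>)
    then have "(\<lambda>n. euler b r (?\<delta> n) (inc r (?\<delta> n) \<omega>) (Suc n) (X s x r \<omega>)) \<longlonglongrightarrow> X s x t \<omega>"
      by (elim allE[of _ "\<lambda>_. X s x r \<omega>"]) simp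
    then show ?case by (intro tendsto_diff tendsto_const)
  qed
  show "integrable M (\<lambda>\<omega>. X s x t \<omega> - X s x r \<omega> - R *v (Z t \<omega> - Z r \<omega>))"
    by (rule expectation_norm_limit(1)[OF D m lim E])
  show "expectation (\<lambda>\<omega>. norm (X s x t \<omega> - X s x r \<omega> - R *v (Z t \<omega> - Z r \<omega>)))
      \<le> (t - r) * (\<kappa> * (1 + expectation (\<lambda>\<omega>. norm (X s x r \<omega>)) + \<rho> * mom (t - r))) * exp (\<kappa> * (t - r))"
    by (rule expectation_norm_limit(2)[OF D m lim E])
qed

text \<open>\<open>M1\<close> bounds the growth of the first moment in terms of the initial state,
  \<open>M2\<close> the mean rate at which drift accumulates; see \<open>X_integrable\<close> and
  \<open>X_increment\<close>.\<close>

definition M1 :: real where "M1 = 1 + T * (\<kappa> * (1 + \<rho> * mom T)) * exp (\<kappa> * T) + \<rho> * mom T"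
definition M2 :: real where "M2 = \<kappa> * (1 + M1 + \<rho> * mom T) * exp (\<kappa> * T)"

lemma \<rho>mom_nonneg: "0 \<le> \<rho> * mom h"
  using \<rho>_nonneg mom_nonneg by simp

lemma M1_ge: "1 \<le> M1" and M2_nonneg: "0 \<le> M2"
proof -
  show "1 \<le> M1" unfolding M1_def using T \<kappa> \<rho>mom_nonneg[of T] by simp
  then show "0 \<le> M2" unfolding M2_def using \<kappa> \<rho>mom_nonneg[of T] by simp
qed

lemma X_initial_integrable:
  assumes "s \<in> {0..T}"
  shows "integrable M (X s x s)" "expectation (\<lambda>\<omega>. norm (X s x s \<omega>)) = norm x"
proof -
  have m: "X s x s \<in> borel_measurable M" using X_measurable assms by simp
  have "integrable M (\<lambda>\<omega>. x)" by simp
  then show "integrable M (X s x s)"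
    by (rule integrable_cong_AE_imp) (use m X_initial[OF assms, of x] in auto)
  have "expectation (\<lambda>\<omega>. norm (X s x s \<omega>)) = expectation (\<lambda>\<omega>. norm x)"
    by (rule integral_cong_AE) (use m X_initial[OF assms, of x] in auto)
  then show "expectation (\<lambda>\<omega>. norm (X s x s \<omega>)) = norm x" by (simp add: prob_space)
qed

lemma bound_mono:
  assumes "0 \<le> h" "h \<le> T" "0 \<le> p" "p \<le> p'"
  shows "h * (\<kappa> * (1 + p + \<rho> * mom h)) * exp (\<kappa> * h) \<le> h * (\<kappa> * (1 + p' + \<rho> * mom T)) * exp (\<kappa> * T)"
proof -
  have "\<rho> * mom h \<le> \<rho> * mom T" using assms \<rho>_nonneg by (intro mult_left_mono mom_mono) auto
  then have 1: "h * (\<kappa> * (1 + p + \<rho> * mom h)) \<le> h * (\<kappa> * (1 + p' + \<rho> * mom T))"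
    using assms \<kappa> by (intro mult_left_mono) auto
  have 2: "exp (\<kappa> * h) \<le> exp (\<kappa> * T)" using assms \<kappa> by (simp add: mult_left_mono)
  have 3: "0 \<le> h * (\<kappa> * (1 + p' + \<rho> * mom T))"
    using assms \<kappa> \<rho>mom_nonneg[of T] by (intro mult_nonneg_nonneg) auto
  show ?thesis by (rule mult_mono[OF 1 2 3]) simp
qed

lemma X_integrable:
  assumes s: "0 \<le> s" "s \<le> t" "t \<le> T"
  shows "integrable M (X s x t)" and "expectation (\<lambda>\<omega>. norm (X s x t \<omega>)) \<le> M1 * (1 + norm x)"
proof -
  have s': "s \<in> {0..T}" "s \<le> s" using s by auto
  note X0 = X_initial_integrable[OF s'(1), of x]
  let ?D = "\<lambda>\<omega>. X s x t \<omega> - X s x s \<omega> - R *v (Z t \<omega> - Z s \<omega>)"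
  let ?N = "\<lambda>\<omega>. R *v (Z t \<omega> - Z s \<omega>)"
  note D = X_moment_step[OF s(1) s'(2) s(2,3) X0(1)]
  note N = Z_shift(2,3)[OF s(1,2)]
  have "integrable M (\<lambda>\<omega>. ?D \<omega> + X s x s \<omega> + ?N \<omega>)"
    by (intro Bochner_Integration.integrable_add D(1) X0(1) N(1))
  then show int: "integrable M (X s x t)" by simp
  have "expectation (\<lambda>\<omega>. norm (X s x t \<omega>)) \<le> expectation (\<lambda>\<omega>. norm (?D \<omega>) + norm (X s x s \<omega>) + norm (?N \<omega>))"
  proof (rule integral_mono)
    show "norm (X s x t \<omega>) \<le> norm (?D \<omega>) + norm (X s x s \<omega>) + norm (?N \<omega>)" for \<omega>
      using norm_triangle_ineq[of "?D \<omega> + X s x s \<omega>" "?N \<omega>"] norm_triangle_ineq[of "?D \<omega>" "X s x s \<omega>"] by simp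
  qed (intro integrable_norm int Bochner_Integration.integrable_add D(1) X0(1) N(1))+
  also have "\<dots> = expectation (\<lambda>\<omega>. norm (?D \<omega>)) + norm x + expectation (\<lambda>\<omega>. norm (?N \<omega>))"
    using D(1) X0 N(1) by (subst Bochner_Integration.integral_add, simp, simp)+ (simp only: X0(2))
  also have "\<dots> \<le> T * (\<kappa> * (1 + norm x + \<rho> * mom T)) * exp (\<kappa> * T) + norm x + \<rho> * mom T"
  proof (intro add_mono order_refl)
    have "(t - s) * (\<kappa> * (1 + norm x + \<rho> * mom T)) * exp (\<kappa> * T) \<le> T * (\<kappa> * (1 + norm x + \<rho> * mom T)) * exp (\<kappa> * T)"
      using s \<kappa> \<rho>mom_nonneg[of T] by (intro mult_right_mono) auto
    then show "expectation (\<lambda>\<omega>. norm (?D \<omega>)) \<le> T * (\<kappa> * (1 + norm x + \<rho> * mom T)) * exp (\<kappa> * T)"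
      using D(2) bound_mono[of "t - s" "norm x" "norm x"] s unfolding X0(2) by simp
    show "expectation (\<lambda>\<omega>. norm (?N \<omega>)) \<le> \<rho> * mom T"
      using N(2) mult_left_mono[OF mom_mono[of "t - s" T] \<rho>_nonneg] s by simp
  qed
  also have "\<dots> \<le> M1 * (1 + norm x)"
  proof -
    have "0 \<le> T * (\<kappa> * (\<rho> * mom T * norm x)) * exp (\<kappa> * T)" "0 \<le> \<rho> * mom T * norm x"
      using T \<kappa> \<rho>mom_nonneg[of T] by auto
    then show ?thesis unfolding M1_def by (simp add: algebra_simps)
  qed
  finally show "expectation (\<lambda>\<omega>. norm (X s x t \<omega>)) \<le> M1 * (1 + norm x)" .
qed

lemma X_increment:
  assumes s: "0 \<le> s" "s \<le> r" "r \<le> t" "t \<le> T"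
  shows "expectation (\<lambda>\<omega>. norm (X s x t \<omega> - X s x r \<omega>)) \<le> (t - r) * (M2 * (1 + norm x)) + \<rho> * mom (t - r)"
proof -
  have s': "s \<le> t" "r \<le> T" "0 \<le> r" using s by auto
  note Xr = X_integrable[OF s(1,2) s'(2), of x] and Xt = X_integrable[OF s(1) s'(1) s(4), of x]
  let ?N = "\<lambda>\<omega>. R *v (Z t \<omega> - Z r \<omega>)"
  let ?D = "\<lambda>\<omega>. X s x t \<omega> - X s x r \<omega> - ?N \<omega>"
  note D = X_moment_step[OF s Xr(1)]
  note N = Z_shift(2,3)[OF s'(3) s(3)]
  have "expectation (\<lambda>\<omega>. norm (X s x t \<omega> - X s x r \<omega>)) \<le> expectation (\<lambda>\<omega>. norm (?D \<omega>) + norm (?N \<omega>))"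
  proof (rule integral_mono)
    show "norm (X s x t \<omega> - X s x r \<omega>) \<le> norm (?D \<omega>) + norm (?N \<omega>)" for \<omega>
      using norm_triangle_ineq[of "?D \<omega>" "?N \<omega>"] by simp
  qed (intro integrable_norm Bochner_Integration.integrable_diff Bochner_Integration.integrable_add Xr(1) Xt(1) N(1) D(1))+
  also have "\<dots> = expectation (\<lambda>\<omega>. norm (?D \<omega>)) + expectation (\<lambda>\<omega>. norm (?N \<omega>))"
    by (intro Bochner_Integration.integral_add integrable_norm D(1) N(1))
  also have "\<dots> \<le> (t - r) * (M2 * (1 + norm x)) + \<rho> * mom (t - r)"
  proof (rule add_mono[OF _ N(2)])
    have "expectation (\<lambda>\<omega>. norm (?D \<omega>)) \<le> (t - r) * (\<kappa> * (1 + M1 * (1 + norm x) + \<rho> * mom T)) * exp (\<kappa> * T)"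
    proof (rule order_trans[OF D(2) bound_mono])
      show "0 \<le> expectation (\<lambda>\<omega>. norm (X s x r \<omega>))" by (intro integral_nonneg_AE) auto
    qed (use s Xr(2) in auto)
    also have "\<dots> \<le> (t - r) * (\<kappa> * ((1 + M1 + \<rho> * mom T) * (1 + norm x))) * exp (\<kappa> * T)"
    proof -
      have "1 + M1 * (1 + norm x) + \<rho> * mom T \<le> (1 + M1 + \<rho> * mom T) * (1 + norm x)"
        using mult_nonneg_nonneg[of "1 + \<rho> * mom T" "norm x"] \<rho>mom_nonneg[of T] by (simp add: algebra_simps)
      then show ?thesis using s \<kappa> by (intro mult_right_mono mult_left_mono) auto
    qed
    finally show "expectation (\<lambda>\<omega>. norm (?D \<omega>)) \<le> (t - r) * (M2 * (1 + norm x))"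
      unfolding M2_def by (simp add: mult_ac)
  qed
  finally show ?thesis .
qed

text \<open>The noise is kept exactly and only the drift is frozen at the start, so that the error
  in the mean is \<open>d - a\<close> times quantities that vanish as the interval shrinks.\<close>

lemma X_first_order:
  assumes a: "0 \<le> a" "a \<le> d" "d \<le> T"
    and osc: "\<And>\<tau>. \<tau> \<in> {a..d} \<Longrightarrow> norm (b \<tau> x - b a x) \<le> osc"
  shows "integrable M (\<lambda>\<omega>. X a x d \<omega> - x - R *v (Z d \<omega> - Z a \<omega>) - (d - a) *\<^sub>R b a x)"
    and "expectation (\<lambda>\<omega>. norm (X a x d \<omega> - x - R *v (Z d \<omega> - Z a \<omega>) - (d - a) *\<^sub>R b a x))
      \<le> (d - a) * (\<kappa> * ((d - a) * (M2 * (1 + norm x)) + \<rho> * mom (d - a)) + osc)"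
proof -
  let ?\<delta> = "\<lambda>n. (d - a) / real (Suc n)"
  let ?F = "\<lambda>n \<omega>. euler b a (?\<delta> n) (inc a (?\<delta> n) \<omega>) (Suc n) x - x - R *v (Z d \<omega> - Z a \<omega>) - (d - a) *\<^sub>R b a x"
  let ?B = "(d - a) * (M2 * (1 + norm x))"
  have a': "a \<in> {0..T}" "d \<in> {a..T}" using a by auto
  note st = step_props[OF a]
  have y: "integrable M (\<lambda>\<omega>. x)" by simp
  have F: "integrable M (?F n)" for n
    using D_integrable[OF a(1) st(1) st(3) y order_refl, of n]
    by (simp only: st(2)) (rule Bochner_Integration.integrable_diff, simp_all)
  have B: "expectation (\<lambda>\<omega>. norm (euler b a (?\<delta> n) (inc a (?\<delta> n) \<omega>) k x - x - R *v (Z (a + real k * ?\<delta> n) \<omega> - Z a \<omega>))) \<le> ?B"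
    if k: "k \<le> Suc n" for n k
  proof -
    have kn: "real k * ?\<delta> n \<le> d - a" "0 \<le> real k * ?\<delta> n"
      using mult_right_mono[of "real k" "real (Suc n)" "?\<delta> n"] k st(1)[of n] st(4)[of n]
        mult_nonneg_nonneg[OF of_nat_0_le_iff[of k] st(1)[of n]] by auto
    have "expectation (\<lambda>\<omega>. norm (euler b a (?\<delta> n) (inc a (?\<delta> n) \<omega>) k x - x - R *v (Z (a + real k * ?\<delta> n) \<omega> - Z a \<omega>)))
      \<le> real k * ?\<delta> n * (\<kappa> * (1 + norm x + \<rho> * mom (d - a))) * exp (\<kappa> * (real k * ?\<delta> n))"
      using D_moment[OF a(1) st(1) st(3) y k] by (simp only: st(2) st(4) st(5) lebesgue_integral_const) (simp add: prob_space)
    also have "\<dots> \<le> (d - a) * (\<kappa> * (1 + norm x + \<rho> * mom (d - a))) * exp (\<kappa> * (d - a))"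
      using kn \<kappa> a \<rho>mom_nonneg[of "d - a"] mult_left_mono[OF kn(1) \<kappa>] by (intro mult_mono mult_nonneg_nonneg) (auto simp: mult_left_mono)
    also have "\<dots> \<le> (d - a) * (\<kappa> * (1 + norm x + \<rho> * mom T)) * exp (\<kappa> * T)"
      using a by (intro bound_mono) auto
    also have "\<dots> \<le> (d - a) * (\<kappa> * ((1 + M1 + \<rho> * mom T) * (1 + norm x))) * exp (\<kappa> * T)"
    proof -
      have "1 + norm x + \<rho> * mom T \<le> (1 + M1 + \<rho> * mom T) * (1 + norm x)"
        using \<rho>mom_nonneg[of T] M1_ge mult_nonneg_nonneg[of "M1 + \<rho> * mom T" "norm x"] by (simp add: algebra_simps)
      then show ?thesis using a \<kappa> by (intro mult_right_mono mult_left_mono) auto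
    qed
    finally show ?thesis unfolding M2_def by (simp add: mult_ac)
  qed
  have E: "expectation (\<lambda>\<omega>. norm (?F n \<omega>)) \<le> (d - a) * (\<kappa> * (?B + \<rho> * mom (d - a)) + osc)" for n
    using D_first_order[OF a(1) st(1) st(3) y order_refl refl, of n osc ?B] osc B by (simp only: st(2) st(4) st(5))
  have m: "(\<lambda>\<omega>. X a x d \<omega> - x - R *v (Z d \<omega> - Z a \<omega>) - (d - a) *\<^sub>R b a x) \<in> borel_measurable M"
    using X_measurable[OF a', of x] Z_shift(1)[OF a(1,2)] by measurable
  have lim: "AE \<omega> in M. (\<lambda>n. ?F n \<omega>) \<longlonglongrightarrow> X a x d \<omega> - x - R *v (Z d \<omega> - Z a \<omega>) - (d - a) *\<^sub>R b a x"
    using euler_path[OF a(1) order_refl a(2,3), of x] X_initial[OF a'(1), of x]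
  proof eventually_elim
    case (elim \<omega>)
    then have "(\<lambda>n. euler b a (?\<delta> n) (inc a (?\<delta> n) \<omega>) (Suc n) x) \<longlonglongrightarrow> X a x d \<omega>"
      by (elim allE[of _ "\<lambda>_. x"]) simp
    then show ?case by (intro tendsto_diff tendsto_const)
  qed
  show "integrable M (\<lambda>\<omega>. X a x d \<omega> - x - R *v (Z d \<omega> - Z a \<omega>) - (d - a) *\<^sub>R b a x)"
    by (rule expectation_norm_limit(1)[OF F m lim E])
  show "expectation (\<lambda>\<omega>. norm (X a x d \<omega> - x - R *v (Z d \<omega> - Z a \<omega>) - (d - a) *\<^sub>R b a x))
      \<le> (d - a) * (\<kappa> * (?B + \<rho> * mom (d - a)) + osc)"
    by (rule expectation_norm_limit(2)[OF F m lim E])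
qed

lemma euler_measurable:
  assumes d: "\<And>j. j < k \<Longrightarrow> (\<lambda>\<omega>. d \<omega> j) \<in> borel_measurable S" and y: "y \<in> borel_measurable S"
    and t: "\<And>j. j \<le> k \<Longrightarrow> r + real j * \<delta> \<in> {0..T}"
  shows "(\<lambda>\<omega>. euler b r \<delta> (d \<omega>) k (y \<omega>)) \<in> borel_measurable S"
  using d t
proof (induction k)
  case 0
  then show ?case using y by simp
next
  case (Suc k)
  have v: "(\<lambda>\<omega>. euler b r \<delta> (d \<omega>) k (y \<omega>) + d \<omega> k) \<in> borel_measurable S"
    using Suc by (intro borel_measurable_add) auto
  have "(\<lambda>\<omega>. b (r + real (Suc k) * \<delta>) (euler b r \<delta> (d \<omega>) k (y \<omega>) + d \<omega> k)) \<in> borel_measurable S"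
    by (rule measurable_compose[OF v b_measurable]) (rule Suc.prems(2), simp)
  then show ?case
    unfolding euler.simps Let_def by (intro borel_measurable_add v borel_measurable_scaleR borel_measurable_const)
qed

lemma grid_times:
  assumes "0 \<le> r" "r \<le> t" "t \<le> T" "j \<le> Suc n"
  shows "r + real j * ((t - r) / real (Suc n)) \<in> {0..T}"
    and "r + real j * ((t - r) / real (Suc n)) \<in> {r..t}"
proof -
  note st = step_props(1-4)[OF assms(1-3), of n]
  have "real j * ((t - r) / real (Suc n)) \<le> real (Suc n) * ((t - r) / real (Suc n))"
    using assms(4) st(1) by (intro mult_right_mono) auto
  moreover have "0 \<le> real j * ((t - r) / real (Suc n))"
    by (rule mult_nonneg_nonneg[OF of_nat_0_le_iff st(1)])
  ultimately show "r + real j * ((t - r) / real (Suc n)) \<in> {0..T}"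
    "r + real j * ((t - r) / real (Suc n)) \<in> {r..t}"
    using assms st(4) by (auto simp del: of_nat_Suc)
qed

lemma inc_measurable:
  assumes "0 \<le> r" "0 \<le> \<delta>"
  shows "(\<lambda>\<omega>. inc r \<delta> \<omega> j) \<in> borel_measurable M"
  unfolding inc_def by (rule Z_shift(1)) (use assms in \<open>auto intro: mult_right_mono\<close>)

lemma euler_inc_measurable:
  assumes "0 \<le> r" "r \<le> t" "t \<le> T" and y: "y \<in> borel_measurable M"
  shows "(\<lambda>\<omega>. euler b r ((t - r) / real (Suc n)) (inc r ((t - r) / real (Suc n)) \<omega>) (Suc n) (y \<omega>)) \<in> borel_measurable M"
  using assms step_props(1)[OF assms(1-3)] by (intro euler_measurable inc_measurable y grid_times(1)) auto

text \<open>The discrete counterpart of \<open>transition\<close>; taking \<open>Suc n\<close> steps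
  avoids a division by 0.\<close>

definition euler_mean :: "real \<Rightarrow> real \<Rightarrow> (real^'n \<Rightarrow> real) \<Rightarrow> nat \<Rightarrow> real^'n \<Rightarrow> real" where
  "euler_mean r t f n y = expectation (\<lambda>\<omega>. f (euler b r ((t - r) / real (Suc n)) (inc r ((t - r) / real (Suc n)) \<omega>) (Suc n) y))"

lemma euler_mean_limit:
  assumes r: "0 \<le> r" "r \<le> t" "t \<le> T" and f: "f \<in> C_lip k K"
  shows "(\<lambda>n. euler_mean r t f n y) \<longlonglongrightarrow> transition M X r t f y"
  unfolding euler_mean_def transition_def
proof (rule integral_dominated_convergence[where w="\<lambda>_. K"])
  have r': "r \<in> {0..T}" "t \<in> {r..T}" using r by auto
  show "(\<lambda>\<omega>. f (X r y t \<omega>)) \<in> borel_measurable M"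
    by (rule measurable_compose[OF X_measurable[OF r'] C_lip_measurable[OF f]])
  show "(\<lambda>\<omega>. f (euler b r ((t - r) / real (Suc n)) (inc r ((t - r) / real (Suc n)) \<omega>) (Suc n) y)) \<in> borel_measurable M" for n
    by (rule measurable_compose[OF euler_inc_measurable[OF r] C_lip_measurable[OF f]]) simp
  show "AE \<omega> in M. (\<lambda>n. f (euler b r ((t - r) / real (Suc n)) (inc r ((t - r) / real (Suc n)) \<omega>) (Suc n) y)) \<longlonglongrightarrow> f (X r y t \<omega>)"
    using euler_path[OF r(1) order_refl r(2,3), of y] X_initial[OF r'(1), of y]
  proof eventually_elim
    case (elim \<omega>)
    then have "(\<lambda>n. euler b r ((t - r) / real (Suc n)) (inc r ((t - r) / real (Suc n)) \<omega>) (Suc n) y) \<longlonglongrightarrow> X r y t \<omega>"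
      by (elim allE[of _ "\<lambda>_. y"]) simp
    then show ?case by (rule continuous_on_tendsto_compose[OF C_lip_continuous[OF f]]) auto
  qed
qed (use C_lip_bound[OF f] in auto)

lemma euler_mean_C_lip:
  assumes step: "\<And>t \<delta> f K. t \<in> {0..T} \<Longrightarrow> 0 \<le> \<delta> \<Longrightarrow> \<delta> \<le> T \<Longrightarrow> f \<in> C_lip k K \<Longrightarrow>
      (\<lambda>x. f (x + \<delta> *\<^sub>R b t x)) \<in> C_lip k (K * (1 + C * \<delta>))"
    and C: "0 \<le> C" and r: "0 \<le> r" "r \<le> t" "t \<le> T" and f: "f \<in> C_lip k K"
  shows "euler_mean r t f n \<in> C_lip k (K * exp (C * T))"
proof -
  note st = step_props(1-4)[OF r, of n]
  have \<delta>: "(t - r) / real (Suc n) \<le> T"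
    using r by (auto simp: divide_le_eq algebra_simps intro: order_trans add_increasing)
  have "(\<lambda>y. f (euler b r ((t - r) / real (Suc n)) (inc r ((t - r) / real (Suc n)) \<omega>) (Suc n) y)) \<in> C_lip k (K * exp (C * (real (Suc n) * ((t - r) / real (Suc n)))))" for \<omega>
  proof (rule C_lip_euler[where T=T, OF _ r(1) st(3,1) C f])
    show "(\<lambda>x. f (x + ((t - r) / real (Suc n)) *\<^sub>R b t' x)) \<in> C_lip k (K * (1 + C * ((t - r) / real (Suc n))))"
      if "t' \<in> {0..T}" "f \<in> C_lip k K" for t' f K
      by (rule step[OF that(1) st(1) \<delta> that(2)])
  qed
  moreover have "K * exp (C * (real (Suc n) * ((t - r) / real (Suc n)))) \<le> K * exp (C * T)"
    unfolding st(4) using C_lip_nonneg[OF f] C r by (intro mult_left_mono) (auto intro: mult_left_mono)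
  ultimately have *: "(\<lambda>y. f (euler b r ((t - r) / real (Suc n)) (inc r ((t - r) / real (Suc n)) \<omega>) (Suc n) y)) \<in> C_lip k (K * exp (C * T))" for \<omega>
    by (rule C_lip_mono)
  show ?thesis
    unfolding euler_mean_def
    by (rule C_lip_expectation[OF *])
       (rule measurable_compose[OF euler_inc_measurable[OF r] C_lip_measurable[OF f]], simp)
qed

text \<open>\<open>step\<close> is left open since it is available in two ways: at order 0 from the
  Lipschitz bound, at order 2 from \<open>C_lip_compose_drift\<close>. The exponential bounds the
  product of the factors \<open>1 + C * \<delta>\<close> for every mesh.\<close>

lemma transition_C_lip:
  assumes step: "\<And>t \<delta> f K. t \<in> {0..T} \<Longrightarrow> 0 \<le> \<delta> \<Longrightarrow> \<delta> \<le> T \<Longrightarrow> f \<in> C_lip k K \<Longrightarrow>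
      (\<lambda>x. f (x + \<delta> *\<^sub>R b t x)) \<in> C_lip k (K * (1 + C * \<delta>))"
    and C: "0 \<le> C" and r: "0 \<le> r" "r \<le> t" "t \<le> T" and f: "f \<in> C_lip k K"
  shows "transition M X r t f \<in> C_lip k (K * exp (C * T))"
  by (rule C_lip_limit[OF euler_mean_C_lip[OF step C r f] euler_mean_limit[OF r f]])

text \<open>The two schemes consume disjoint blocks of noise increments, which are independent;
  averaging over the second block with the first one frozen produces
  \<open>euler_mean\<close>.\<close>

lemma euler_mean_Markov:
  assumes s: "0 \<le> s" "s \<le> r" "r \<le> t" "t \<le> T" and f: "f \<in> C_lip 0 K"
  shows "expectation (\<lambda>\<omega>. f (euler b r ((t - r) / real (Suc n)) (inc r ((t - r) / real (Suc n)) \<omega>) (Suc n)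
       (euler b s ((r - s) / real (Suc n)) (inc s ((r - s) / real (Suc n)) \<omega>) (Suc n) x)))
    = expectation (\<lambda>\<omega>. euler_mean r t f n (euler b s ((r - s) / real (Suc n)) (inc s ((r - s) / real (Suc n)) \<omega>) (Suc n) x))"
proof -
  define m where "m = Suc n"
  define \<delta>1 where "\<delta>1 = (r - s) / real m"
  define \<delta>2 where "\<delta>2 = (t - r) / real m"
  have sr: "0 \<le> s" "s \<le> r" "r \<le> T" and rt: "0 \<le> r" "r \<le> t" "t \<le> T" using s by auto
  note st1 = step_props(1-4)[OF sr, of n, folded m_def, folded \<delta>1_def]
  note st2 = step_props(1-4)[OF rt, of n, folded m_def, folded \<delta>2_def]
  \<comment> \<open>Both grids, of different mesh in general, are joined at \<open>r\<close> into
    one monotone sequence, so that a single appeal to independent increments covers the two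
    schemes.\<close>
  define \<tau> where "\<tau> j = (if j \<le> m then s + real j * \<delta>1 else r + real (j - m) * \<delta>2)" for j
  have \<tau>2: "\<tau> (m + i) = r + real i * \<delta>2" for i
    using st1(2) by (cases i) (auto simp: \<tau>_def)
  have \<tau>1: "\<tau> j = s + real j * \<delta>1" if "j \<le> m" for j using that by (simp add: \<tau>_def)
  have "mono \<tau>"
  proof (rule incseq_SucI)
    fix j show "\<tau> j \<le> \<tau> (Suc j)"
    proof (cases "Suc j \<le> m")
      case True
      then show ?thesis using st1(1) by (simp add: \<tau>1 algebra_simps)
    next
      case False
      then obtain i where "j = m + i" using le_Suc_ex[of m j] by auto
      then show ?thesis using \<tau>2[of i] \<tau>2[of "Suc i"] st2(1) by (simp add: algebra_simps)
    qed
  qed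
  moreover have "0 \<le> \<tau> 0" using s by (simp add: \<tau>1)
  ultimately have ind: "indep_vars (\<lambda>_. borel) (\<lambda>j \<omega>. Z (\<tau> (Suc j)) \<omega> - Z (\<tau> j) \<omega>) {..<m + m}"
    by (rule Z_indep_increments)
  let ?V = "\<lambda>j \<omega>. Z (\<tau> (Suc j)) \<omega> - Z (\<tau> j) \<omega>"
  let ?S = "Pi\<^sub>M {..<m} (\<lambda>_. borel :: (real^'n) measure)" and ?T = "Pi\<^sub>M {m..<m + m} (\<lambda>_. borel :: (real^'n) measure)"
  have pair: "indep_var ?S (\<lambda>\<omega>. \<lambda>j\<in>{..<m}. ?V j \<omega>) ?T (\<lambda>\<omega>. \<lambda>j\<in>{m..<m + m}. ?V j \<omega>)"
    by (rule indep_var_restrict[OF ind]) auto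
  define e1 where "e1 u = euler b s \<delta>1 (\<lambda>j. R *v u j) m x" for u :: "nat \<Rightarrow> real^'n"
  define e2 where "e2 v y = euler b r \<delta>2 (\<lambda>i. R *v v (m + i)) m y" for v :: "nat \<Rightarrow> real^'n" and y
  have e1: "e1 (\<lambda>j\<in>{..<m}. ?V j \<omega>) = euler b s \<delta>1 (inc s \<delta>1 \<omega>) m x" for \<omega>
    unfolding e1_def by (rule euler_cong) (auto simp: inc_def \<tau>1 simp del: of_nat_Suc)
  have e2: "e2 (\<lambda>j\<in>{m..<m + m}. ?V j \<omega>) y = euler b r \<delta>2 (inc r \<delta>2 \<omega>) m y" for \<omega> y
  proof -
    have "Z (\<tau> (Suc (m + i))) \<omega> = Z (r + real (Suc i) * \<delta>2) \<omega>" for i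
      using \<tau>2[of "Suc i"] by simp
    then show ?thesis
      unfolding e2_def by (intro euler_cong) (auto simp: inc_def \<tau>2 simp del: of_nat_Suc)
  qed
  have g1: "s + real j * \<delta>1 \<in> {0..T}" and g2: "r + real j * \<delta>2 \<in> {0..T}" if "j \<le> m" for j
    using grid_times(1)[OF sr, of j n] grid_times(1)[OF rt, of j n] that unfolding m_def \<delta>1_def \<delta>2_def by blast+
  have m1: "e1 \<in> borel_measurable ?S"
    unfolding e1_def
    by (rule euler_measurable[OF _ _ g1])
       (auto intro!: measurable_compose[OF _ R_measurable] measurable_component_singleton)
  have F: "(\<lambda>p. f (e2 (snd p) (e1 (fst p)))) \<in> borel_measurable (?S \<Otimes>\<^sub>M ?T)"
  proof (rule measurable_compose[OF _ C_lip_measurable[OF f]])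
    have c: "(\<lambda>p. R *v (snd p (m + i))) \<in> borel_measurable (?S \<Otimes>\<^sub>M ?T)" if "i < m" for i
      using that by (intro measurable_compose[OF _ R_measurable] measurable_compose[OF measurable_snd measurable_component_singleton]) auto
    show "(\<lambda>p. e2 (snd p) (e1 (fst p))) \<in> borel_measurable (?S \<Otimes>\<^sub>M ?T)"
      unfolding e2_def
      by (rule euler_measurable[OF c measurable_compose[OF measurable_fst m1]])
         (assumption | erule g2)+
  qed
  have "expectation (\<lambda>\<omega>. f (e2 (\<lambda>j\<in>{m..<m + m}. ?V j \<omega>) (e1 (\<lambda>j\<in>{..<m}. ?V j \<omega>))))
    = expectation (\<lambda>\<omega>'. expectation (\<lambda>\<omega>. f (e2 (\<lambda>j\<in>{m..<m + m}. ?V j \<omega>) (e1 (\<lambda>j\<in>{..<m}. ?V j \<omega>')))))"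
    using expectation_indep_pair[OF pair F C_lip_bound[OF f]] by (simp only: fst_conv snd_conv)
  note this[unfolded e1 e2, unfolded \<delta>1_def \<delta>2_def, unfolded m_def]
  then show ?thesis unfolding euler_mean_def .
qed

text \<open>Both sides of \<open>euler_mean_Markov\<close> converge. On the left the second scheme
  starts from the end of the first, as \<open>euler_path\<close> permits; on the right the discrete
  means share one Lipschitz constant, so that they may be evaluated along converging points.\<close>

lemma Markov:
  assumes s: "0 \<le> s" "s \<le> r" "r \<le> t" "t \<le> T" and f: "f \<in> C_lip 0 K"
  shows "transition M X s t f x = transition M X s r (transition M X r t f) x"
proof -
  have sr: "0 \<le> s" "s \<le> r" "r \<le> T" and rt: "0 \<le> r" "r \<le> t" "t \<le> T" using s by auto
  have s': "s \<in> {0..T}" "r \<in> {s..T}" "t \<in> {s..T}" using s by auto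
  let ?Y = "\<lambda>n \<omega>. euler b s ((r - s) / real (Suc n)) (inc s ((r - s) / real (Suc n)) \<omega>) (Suc n) x"
  let ?E = "\<lambda>n \<omega>. euler b r ((t - r) / real (Suc n)) (inc r ((t - r) / real (Suc n)) \<omega>) (Suc n) (?Y n \<omega>)"
  let ?K = "K * exp (\<kappa> * T)" and ?u = "transition M X r t f"
  have g: "euler_mean r t f n \<in> C_lip 0 ?K" for n
    by (rule euler_mean_C_lip[OF C_lip_0_step \<kappa> rt f])
  have u: "?u \<in> C_lip 0 ?K" by (rule transition_C_lip[OF C_lip_0_step \<kappa> rt f])
  have Ym: "?Y n \<in> borel_measurable M" for n by (rule euler_inc_measurable[OF sr]) simp
  have Y: "AE \<omega> in M. (\<lambda>n. ?Y n \<omega>) \<longlonglongrightarrow> X s x r \<omega>"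
    using euler_path[OF s(1) order_refl sr(2,3), of x] X_initial[OF s'(1), of x]
  proof eventually_elim
    case (elim \<omega>)
    then show ?case by (elim allE[of _ "\<lambda>_. x"]) simp
  qed
  have 1: "(\<lambda>n. expectation (\<lambda>\<omega>. f (?E n \<omega>))) \<longlonglongrightarrow> expectation (\<lambda>\<omega>. f (X s x t \<omega>))"
  proof (rule integral_dominated_convergence[where w="\<lambda>_. K"])
    show "(\<lambda>\<omega>. f (X s x t \<omega>)) \<in> borel_measurable M"
      by (rule measurable_compose[OF X_measurable[OF s'(1,3)] C_lip_measurable[OF f]])
    show "(\<lambda>\<omega>. f (?E n \<omega>)) \<in> borel_measurable M" for n
      by (rule measurable_compose[OF euler_inc_measurable[OF rt Ym] C_lip_measurable[OF f]])
    show "AE \<omega> in M. (\<lambda>n. f (?E n \<omega>)) \<longlonglongrightarrow> f (X s x t \<omega>)"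
      using euler_path[OF s, of x] Y
    proof eventually_elim
      case (elim \<omega>)
      then have "(\<lambda>n. ?E n \<omega>) \<longlonglongrightarrow> X s x t \<omega>" by (elim allE[of _ "\<lambda>n. ?Y n \<omega>"]) simp
      then show ?case by (rule continuous_on_tendsto_compose[OF C_lip_continuous[OF f]]) auto
    qed
  qed (use C_lip_bound[OF f] in auto)
  have 2: "(\<lambda>n. expectation (\<lambda>\<omega>. euler_mean r t f n (?Y n \<omega>))) \<longlonglongrightarrow> expectation (\<lambda>\<omega>. ?u (X s x r \<omega>))"
  proof (rule integral_dominated_convergence[where w="\<lambda>_. ?K"])
    show "(\<lambda>\<omega>. ?u (X s x r \<omega>)) \<in> borel_measurable M"
      by (rule measurable_compose[OF X_measurable[OF s'(1,2)] C_lip_measurable[OF u]])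
    show "(\<lambda>\<omega>. euler_mean r t f n (?Y n \<omega>)) \<in> borel_measurable M" for n
      by (rule measurable_compose[OF Ym C_lip_measurable[OF g]])
    show "AE \<omega> in M. (\<lambda>n. euler_mean r t f n (?Y n \<omega>)) \<longlonglongrightarrow> ?u (X s x r \<omega>)"
      using Y
    proof eventually_elim
      case (elim \<omega>)
      have "(\<lambda>n. euler_mean r t f n (?Y n \<omega>) - euler_mean r t f n (X s x r \<omega>)) \<longlonglongrightarrow> 0"
      proof (rule Lim_null_comparison)
        show "\<forall>\<^sub>F n in sequentially. norm (euler_mean r t f n (?Y n \<omega>) - euler_mean r t f n (X s x r \<omega>)) \<le> ?K * norm (?Y n \<omega> - X s x r \<omega>)"
          using C_lip_lipschitz[OF g] by (intro always_eventually allI) simp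
        have "(\<lambda>n. ?K * norm (?Y n \<omega> - X s x r \<omega>)) \<longlonglongrightarrow> ?K * norm (X s x r \<omega> - X s x r \<omega>)"
          by (intro tendsto_intros elim)
        then show "(\<lambda>n. ?K * norm (?Y n \<omega> - X s x r \<omega>)) \<longlonglongrightarrow> 0" by simp
      qed
      from tendsto_add[OF this euler_mean_limit[OF rt f, of "X s x r \<omega>"]] show ?case by simp
    qed
    show "AE \<omega> in M. norm (euler_mean r t f n (?Y n \<omega>)) \<le> ?K" for n
      using C_lip_bound[OF g] by (intro AE_I2) simp
  qed simp
  have "(\<lambda>n. expectation (\<lambda>\<omega>. f (?E n \<omega>))) \<longlonglongrightarrow> expectation (\<lambda>\<omega>. ?u (X s x r \<omega>))"
    unfolding euler_mean_Markov[OF s f] by (rule 2)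
  from LIMSEQ_unique[OF 1 this] show ?thesis unfolding transition_def .
qed

end

section \<open>The Kolmogorov equations\<close>

text \<open>Dominated convergence is not directly available, since the natural majorant of
  \<open>g n (X n \<omega>)\<close> moves with \<open>n\<close>. Linear growth and convergence of
  \<open>X n\<close> in the mean make up for it.\<close>

lemma (in prob_space) expectation_tendsto_L1:
  fixes X :: "nat \<Rightarrow> 'a \<Rightarrow> 'b::{banach,second_countable_topology}" and g :: "nat \<Rightarrow> 'b \<Rightarrow> real"
  assumes X: "\<And>n. integrable M (X n)" and Y: "integrable M Y"
    and lim: "(\<lambda>n. expectation (\<lambda>\<omega>. norm (X n \<omega> - Y \<omega>))) \<longlonglongrightarrow> 0"
    and g [measurable]: "\<And>n. g n \<in> borel_measurable borel" and G [measurable]: "G \<in> borel_measurable borel"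
    and C: "0 \<le> C" "\<And>n x. \<bar>g n x\<bar> \<le> C * (1 + norm x)" "\<And>x. \<bar>G x\<bar> \<le> C * (1 + norm x)"
    and conv: "\<And>x y r. strict_mono r \<Longrightarrow> x \<longlonglongrightarrow> y \<Longrightarrow> (\<lambda>n. g (r n) (x n)) \<longlonglongrightarrow> G y"
  shows "(\<lambda>n. expectation (\<lambda>\<omega>. g n (X n \<omega>))) \<longlonglongrightarrow> expectation (\<lambda>\<omega>. G (Y \<omega>))"
proof -
  have [measurable]: "X n \<in> borel_measurable M" "Y \<in> borel_measurable M" for n using X Y by auto
  define w where "w \<omega> = C * (1 + norm (Y \<omega>))" for \<omega>
  have w: "integrable M w" unfolding w_def using Y by auto
  have [measurable]: "w \<in> borel_measurable M" using w by auto
  \<comment> \<open>Truncation at the integrable \<open>w\<close>: what is cut off is at most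
    \<open>C * norm (X n \<omega> - Y \<omega>)\<close> and vanishes in the mean, and the limit
    \<open>G (Y \<omega>)\<close> is unaffected because it already lies between
    \<open>- w \<omega>\<close> and \<open>w \<omega>\<close>.\<close>
  define h where "h n \<omega> = max (- w \<omega>) (min (w \<omega>) (g n (X n \<omega>)))" for n \<omega>
  have w0: "0 \<le> w \<omega>" for \<omega> unfolding w_def using C(1) by simp
  have hw: "\<bar>h n \<omega>\<bar> \<le> w \<omega>" for n \<omega> using w0[of \<omega>] unfolding h_def by (auto simp: max_def min_def)
  have [measurable]: "h n \<in> borel_measurable M" for n unfolding h_def by measurable
  have h: "integrable M (h n)" for n
    by (rule Bochner_Integration.integrable_bound[OF w]) (use hw w0 in \<open>auto intro: order_trans\<close>)
  have diff: "\<bar>g n (X n \<omega>) - h n \<omega>\<bar> \<le> C * norm (X n \<omega> - Y \<omega>)" for n \<omega>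
  proof -
    have "\<bar>g n (X n \<omega>)\<bar> \<le> C * (1 + (norm (Y \<omega>) + norm (X n \<omega> - Y \<omega>)))"
      using norm_triangle_sub[of "X n \<omega>" "Y \<omega>"] C(1)
      by (intro order_trans[OF C(2)] mult_left_mono add_left_mono) auto
    also have "\<dots> = w \<omega> + C * norm (X n \<omega> - Y \<omega>)" by (simp add: w_def algebra_simps)
    finally show ?thesis
      using w0[of \<omega>] mult_nonneg_nonneg[OF C(1) norm_ge_zero[of "X n \<omega> - Y \<omega>"]]
      unfolding h_def by (auto simp: max_def min_def)
  qed
  have g_int: "integrable M (\<lambda>\<omega>. g n (X n \<omega>))" for n
  proof (rule Bochner_Integration.integrable_bound)
    show "integrable M (\<lambda>\<omega>. C * (1 + norm (X n \<omega>)))" using X by auto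
    show "AE \<omega> in M. norm (g n (X n \<omega>)) \<le> norm (C * (1 + norm (X n \<omega>)))"
      by (intro AE_I2, simp only: real_norm_def) (rule order_trans[OF C(2) abs_ge_self])
  qed measurable
  have d0: "(\<lambda>n. expectation (\<lambda>\<omega>. g n (X n \<omega>)) - expectation (h n)) \<longlonglongrightarrow> 0"
  proof (rule Lim_null_comparison)
    show "\<forall>\<^sub>F n in sequentially. norm (expectation (\<lambda>\<omega>. g n (X n \<omega>)) - expectation (h n)) \<le> C * expectation (\<lambda>\<omega>. norm (X n \<omega> - Y \<omega>))"
    proof (intro always_eventually allI)
      fix n
      have "norm (expectation (\<lambda>\<omega>. g n (X n \<omega>)) - expectation (h n)) = \<bar>expectation (\<lambda>\<omega>. g n (X n \<omega>) - h n \<omega>)\<bar>"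
        using g_int[of n] h[of n] by simp
      also have "\<dots> \<le> expectation (\<lambda>\<omega>. \<bar>g n (X n \<omega>) - h n \<omega>\<bar>)" by (rule integral_abs_bound)
      also have "\<dots> \<le> expectation (\<lambda>\<omega>. C * norm (X n \<omega> - Y \<omega>))"
        using g_int[of n] h[of n] X[of n] Y by (intro integral_mono diff) auto
      finally show "norm (expectation (\<lambda>\<omega>. g n (X n \<omega>)) - expectation (h n)) \<le> C * expectation (\<lambda>\<omega>. norm (X n \<omega> - Y \<omega>))"
        by simp
    qed
    show "(\<lambda>n. C * expectation (\<lambda>\<omega>. norm (X n \<omega> - Y \<omega>))) \<longlonglongrightarrow> 0"
      using tendsto_mult_left[OF lim, of C] by simp
  qed
  have "(\<lambda>n. expectation (h n)) \<longlonglongrightarrow> expectation (\<lambda>\<omega>. G (Y \<omega>))"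
  proof (rule ccontr)
    \<comment> \<open>Convergence in the mean gives almost sure convergence only along subsequences,
      so a subsequence that stays away from the limit is contradicted. This is why
      \<open>conv\<close> allows a reindexing of \<open>g\<close>.\<close>
    assume "\<not> ?thesis"
    then obtain e where e: "0 < e" "\<And>N. \<exists>n\<ge>N. e \<le> dist (expectation (h n)) (expectation (\<lambda>\<omega>. G (Y \<omega>)))"
      unfolding lim_sequentially by (meson not_le)
    then have inf: "infinite {n. e \<le> dist (expectation (h n)) (expectation (\<lambda>\<omega>. G (Y \<omega>)))}"
      unfolding infinite_nat_iff_unbounded_le by blast
    then obtain r :: "nat \<Rightarrow> nat" where r: "strict_mono r" "\<And>n. e \<le> dist (expectation (h (r n))) (expectation (\<lambda>\<omega>. G (Y \<omega>)))"
      using infinite_enumerate[OF inf] by blast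
    have "(\<lambda>n. expectation (\<lambda>\<omega>. norm (X (r n) \<omega> - Y \<omega>))) \<longlonglongrightarrow> 0"
      using LIMSEQ_subseq_LIMSEQ[OF lim r(1)] by (simp add: o_def)
    then obtain q where q: "strict_mono q" "AE \<omega> in M. (\<lambda>n. X (r (q n)) \<omega> - Y \<omega>) \<longlonglongrightarrow> 0"
      using tendsto_L1_AE_subseq[of M "\<lambda>n \<omega>. X (r n) \<omega> - Y \<omega>"] X Y by auto
    have "(\<lambda>n. expectation (h (r (q n)))) \<longlonglongrightarrow> expectation (\<lambda>\<omega>. G (Y \<omega>))"
    proof (rule integral_dominated_convergence[where w=w])
      show "AE \<omega> in M. (\<lambda>n. h (r (q n)) \<omega>) \<longlonglongrightarrow> G (Y \<omega>)"
        using q(2)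
      proof eventually_elim
        case (elim \<omega>)
        have "strict_mono (\<lambda>n. r (q n))" using r(1) q(1) by (auto simp: strict_mono_def)
        moreover have "(\<lambda>n. X (r (q n)) \<omega>) \<longlonglongrightarrow> Y \<omega>" using elim by (simp add: LIM_zero_iff)
        ultimately have "(\<lambda>n. g (r (q n)) (X (r (q n)) \<omega>)) \<longlonglongrightarrow> G (Y \<omega>)" by (rule conv)
        then have "(\<lambda>n. h (r (q n)) \<omega>) \<longlonglongrightarrow> max (- w \<omega>) (min (w \<omega>) (G (Y \<omega>)))"
          unfolding h_def by (intro tendsto_intros)
        also have "max (- w \<omega>) (min (w \<omega>) (G (Y \<omega>))) = G (Y \<omega>)"
          using C(3)[of "Y \<omega>"] unfolding w_def by (auto simp: max_def min_def abs_le_iff)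
        finally show ?case .
      qed
      show "AE \<omega> in M. norm (h (r (q n)) \<omega>) \<le> w \<omega>" for n using hw by auto
    qed (use w in measurable)
    then have "\<forall>\<^sub>F n in sequentially. dist (expectation (h (r (q n)))) (expectation (\<lambda>\<omega>. G (Y \<omega>))) < e"
      using e(1) by (rule tendstoD)
    then obtain n where "dist (expectation (h (r (q n)))) (expectation (\<lambda>\<omega>. G (Y \<omega>))) < e"
      using eventually_happens'[OF sequentially_bot] by blast
    then show False using r(2)[of "q n"] by linarith
  qed
  from tendsto_add[OF d0 this] show ?thesis by simp
qed

lemma difference_quotient_swap: "(u - v) / (w - z) = (v - u) / (z - w)" for u v w z :: real
  by (metis minus_diff_eq minus_divide_divide)

text \<open>Difference quotients over intervals that merely shrink to \<open>t\<close>, without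
  having \<open>t\<close> as an end point, control the derivative at nearby points as well;
  continuity of \<open>G\<close> therefore comes with differentiability.\<close>

lemma strict_derivative:
  fixes F G :: "real \<Rightarrow> real"
  assumes strict: "\<And>t a d. t \<in> {p..q} \<Longrightarrow> (\<And>n. a n \<in> {p..q}) \<Longrightarrow> (\<And>n. d n \<in> {p..q}) \<Longrightarrow> (\<And>n. a n < d n) \<Longrightarrow>
      a \<longlonglongrightarrow> t \<Longrightarrow> d \<longlonglongrightarrow> t \<Longrightarrow> (\<lambda>n. (F (d n) - F (a n)) / (d n - a n)) \<longlonglongrightarrow> G t"
  shows "t \<in> {p..q} \<Longrightarrow> (F has_real_derivative G t) (at t within {p..q})"
    and "continuous_on {p..q} G"
proof -
  show der: "(F has_real_derivative G t) (at t within {p..q})" if t: "t \<in> {p..q}" for t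
    unfolding has_field_derivative_iff tendsto_at_iff_sequentially o_def
  proof (intro allI impI)
    fix y assume y: "\<forall>n. y n \<in> {p..q} - {t}" "y \<longlonglongrightarrow> t"
    have "(\<lambda>n. (F (max (y n) t) - F (min (y n) t)) / (max (y n) t - min (y n) t)) \<longlonglongrightarrow> G t"
    proof (rule strict[OF t])
      have "(\<lambda>n. max (y n) t) \<longlonglongrightarrow> max t t" "(\<lambda>n. min (y n) t) \<longlonglongrightarrow> min t t"
        by (intro tendsto_intros y)+
      then show "(\<lambda>n. max (y n) t) \<longlonglongrightarrow> t" "(\<lambda>n. min (y n) t) \<longlonglongrightarrow> t" by simp_all
    qed (use y(1) t in \<open>auto simp: max_def min_def order_less_le\<close>)
    moreover have "(F (max (y n) t) - F (min (y n) t)) / (max (y n) t - min (y n) t) = (F (y n) - F t) / (y n - t)" for n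
      by (cases "y n \<le> t") (auto simp: max_def min_def intro: difference_quotient_swap)
    ultimately show "(\<lambda>n. (F (y n) - F t) / (y n - t)) \<longlonglongrightarrow> G t" by simp
  qed
  show "continuous_on {p..q} G"
  proof (cases "p < q")
    case True
    show ?thesis
      unfolding continuous_on_sequentially o_def
    proof (intro allI ballI impI, elim conjE)
      fix y t assume t: "t \<in> {p..q}" and y: "\<forall>n. y n \<in> {p..q}" "y \<longlonglongrightarrow> t"
      \<comment> \<open>A partner of \<open>y n\<close> so close that the difference quotient is
        within \<open>1 / real (Suc n)\<close> of \<open>G (y n)\<close>. As both points tend to
        \<open>t\<close>, these quotients also tend to \<open>G t\<close>.\<close>
      have "\<exists>z. z \<in> {p..q} - {y n} \<and> \<bar>z - y n\<bar> < 1 / real (Suc n) \<and> \<bar>(F z - F (y n)) / (z - y n) - G (y n)\<bar> < 1 / real (Suc n)" for n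
      proof -
        let ?A = "at (y n) within {p..q}"
        have yn: "y n \<in> {p..q}" using y by blast
        have pos: "0 < 1 / real (Suc n)" by simp
        have "((\<lambda>z. (F z - F (y n)) / (z - y n)) \<longlongrightarrow> G (y n)) ?A"
          using der[OF yn] by (simp add: has_field_derivative_iff)
        from tendstoD[OF this pos] have 1: "\<forall>\<^sub>F z in ?A. dist ((F z - F (y n)) / (z - y n)) (G (y n)) < 1 / real (Suc n)" .
        have 2: "\<forall>\<^sub>F z in ?A. dist z (y n) < 1 / real (Suc n)"
          using tendsto_ident_at pos by (rule tendstoD)
        have 3: "\<forall>\<^sub>F z in ?A. z \<in> {p..q} - {y n}"
          by (auto simp: eventually_at_filter)
        have "?A \<noteq> bot" using yn True by (simp add: trivial_limit_within islimpt_Icc)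
        from eventually_happens'[OF this eventually_conj[OF 3 eventually_conj[OF 2 1]]] show ?thesis
          by (auto simp: dist_real_def)
      qed
      then obtain z where z: "\<And>n. z n \<in> {p..q} - {y n}" "\<And>n. \<bar>z n - y n\<bar> < 1 / real (Suc n)"
        "\<And>n. \<bar>(F (z n) - F (y n)) / (z n - y n) - G (y n)\<bar> < 1 / real (Suc n)" by metis
      have l: "(\<lambda>n. 1 / real (Suc n)) \<longlonglongrightarrow> 0"
        using LIMSEQ_inverse_real_of_nat by (simp add: inverse_eq_divide)
      have "(\<lambda>n. z n - y n) \<longlonglongrightarrow> 0"
        by (rule Lim_null_comparison[OF _ l]) (intro always_eventually allI, simp only: real_norm_def, rule less_imp_le[OF z(2)])
      from tendsto_add[OF this y(2)] have zl: "z \<longlonglongrightarrow> t" by simp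
      have "(\<lambda>n. (F (max (z n) (y n)) - F (min (z n) (y n))) / (max (z n) (y n) - min (z n) (y n))) \<longlonglongrightarrow> G t"
      proof (rule strict[OF t])
        have "(\<lambda>n. max (z n) (y n)) \<longlonglongrightarrow> max t t" "(\<lambda>n. min (z n) (y n)) \<longlonglongrightarrow> min t t"
          by (intro tendsto_intros y zl)+
        then show "(\<lambda>n. max (z n) (y n)) \<longlonglongrightarrow> t" "(\<lambda>n. min (z n) (y n)) \<longlonglongrightarrow> t" by simp_all
        show "max (z n) (y n) \<in> {p..q}" "min (z n) (y n) \<in> {p..q}" "min (z n) (y n) < max (z n) (y n)" for n
          using y(1) z(1)[of n] by (auto simp: max_def min_def not_le order_less_le)
      qed
      moreover have "(F (max (z n) (y n)) - F (min (z n) (y n))) / (max (z n) (y n) - min (z n) (y n)) = (F (z n) - F (y n)) / (z n - y n)" for n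
        by (cases "z n \<le> y n") (auto simp: max_def min_def intro: difference_quotient_swap)
      ultimately have q: "(\<lambda>n. (F (z n) - F (y n)) / (z n - y n)) \<longlonglongrightarrow> G t" by simp
      have "(\<lambda>n. (F (z n) - F (y n)) / (z n - y n) - G (y n)) \<longlonglongrightarrow> 0"
        by (rule Lim_null_comparison[OF _ l]) (intro always_eventually allI, simp only: real_norm_def, rule less_imp_le[OF z(3)])
      from tendsto_diff[OF q this] show "(\<lambda>n. G (y n)) \<longlonglongrightarrow> G t" by simp
    qed
  next
    case False
    then have "{p..q} = {} \<or> {p..q} = {p}" by auto
    then show ?thesis by auto
  qed
qed

section \<open>Expansion of the transition operators over short times\<close>

context sde
begin

text \<open>\<open>generator\<close> in terms of the total drift: the two agree for
  \<open>b t x = A *v x + B t x\<close>.\<close>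

definition gen :: "real \<Rightarrow> (real^'n \<Rightarrow> real) \<Rightarrow> real^'n \<Rightarrow> real" where
  "gen t f x = b t x \<bullet> grad f x + igen f x"

lemma gen_continuous:
  assumes "t \<in> {0..T}" "f \<in> C_lip 1 K"
  shows "continuous_on UNIV (gen t f)"
  unfolding gen_def[abs_def]
proof (intro continuous_on_add continuous_on_inner igen_continuous[OF assms(2)])
  have f: "f \<in> C_lip (Suc 0) K" using assms(2) by simp
  show "continuous_on UNIV (b t)"
    unfolding continuous_on_sequentially o_def using assms(1) by (auto intro: b_tendsto)
  have "(real CARD('n) * K)-lipschitz_on UNIV (grad f)"
    using norm_grad_diff_le[OF f] C_lip_nonneg[OF f] by (auto simp: lipschitz_on_def dist_norm)
  then show "continuous_on UNIV (grad f)" by (rule lipschitz_on_continuous_on)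
qed

definition gen_const :: "real \<Rightarrow> real" where
  "gen_const K = \<kappa> * (real CARD('n) * K) + jump_const K * trunc_mass"

lemma gen_bound:
  assumes "t \<in> {0..T}" "f \<in> C_lip 1 K"
  shows "\<bar>gen t f x\<bar> \<le> gen_const K * (1 + norm x)" and "0 \<le> gen_const K"
proof -
  have f: "f \<in> C_lip (Suc 0) K" using assms(2) by simp
  have i: "\<bar>igen f x\<bar> \<le> jump_const K * trunc_mass" by (rule igen_bound[OF assms(2)])
  then have i0: "0 \<le> jump_const K * trunc_mass" by (rule order_trans[OF abs_ge_zero])
  have "\<bar>b t x \<bullet> grad f x\<bar> \<le> norm (b t x) * norm (grad f x)" by (rule Cauchy_Schwarz_ineq2)
  also have "\<dots> \<le> (\<kappa> * (1 + norm x)) * (real CARD('n) * K)"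
    using \<kappa> by (intro mult_mono b_growth[OF assms(1)] norm_grad_le[OF f]) auto
  finally have "\<bar>gen t f x\<bar> \<le> \<kappa> * (real CARD('n) * K) * (1 + norm x) + jump_const K * trunc_mass"
    using i unfolding gen_def by (simp add: mult_ac)
  also have "\<dots> \<le> gen_const K * (1 + norm x)"
    using mult_nonneg_nonneg[OF i0 norm_ge_zero[of x]] by (simp add: gen_const_def algebra_simps)
  finally show "\<bar>gen t f x\<bar> \<le> gen_const K * (1 + norm x)" .
  show "0 \<le> gen_const K" unfolding gen_const_def using i0 \<kappa> C_lip_nonneg[OF f] by simp
qed

lemma mom_tendsto:
  assumes "\<And>n. 0 \<le> h n" "h \<longlonglongrightarrow> 0"
  shows "(\<lambda>n. mom (h n)) \<longlonglongrightarrow> 0"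
proof (rule LIMSEQ_I)
  fix e :: real assume "0 < e"
  then obtain d where d: "0 < d" "\<And>h. 0 \<le> h \<Longrightarrow> h \<le> d \<Longrightarrow> mom h < e"
    using mom_small by metis
  have "\<forall>\<^sub>F n in sequentially. h n < d" using assms(2) d(1) by (rule order_tendstoD)
  then have "\<forall>\<^sub>F n in sequentially. norm (mom (h n) - 0) < e"
  proof eventually_elim
    case (elim n)
    then show ?case using d(2)[OF assms(1)] mom_nonneg[of "h n"] by simp
  qed
  then show "\<exists>N. \<forall>n\<ge>N. norm (mom (h n) - 0) < e" by (simp add: eventually_sequentially)
qed

text \<open>The maximum is attained at some time, which lets the oscillation be treated as a
  difference of two values of \<open>b\<close> along a sequence of times.\<close>

lemma oscillation:
  assumes "0 \<le> a" "a \<le> d" "d \<le> T"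
  obtains \<tau> where "\<tau> \<in> {a..d}" "\<And>\<tau>'. \<tau>' \<in> {a..d} \<Longrightarrow> norm (b \<tau>' x - b a x) \<le> norm (b \<tau> x - b a x)"
proof -
  have "continuous_on {a..d} (\<lambda>\<tau>. b \<tau> x)"
    unfolding continuous_on_sequentially o_def
  proof (intro allI ballI impI, elim conjE)
    fix v u assume v: "\<forall>n. v n \<in> {a..d}" "v \<longlonglongrightarrow> u" "u \<in> {a..d}"
    have "v n \<in> {0..T}" for n using v(1)[rule_format, of n] assms by auto
    then show "(\<lambda>n. b (v n) x) \<longlonglongrightarrow> b u x" using v(2,3) assms by (intro b_tendsto) auto
  qed
  then have "continuous_on {a..d} (\<lambda>\<tau>. norm (b \<tau> x - b a x))" by (intro continuous_intros)
  from continuous_attains_sup[OF _ _ this] assms show ?thesis using that by auto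
qed

text \<open>The solution is compared with a deterministic drift step followed by the exact noise
  increment. The latter has the form to which \<open>noise_estimate\<close> applies, at the shifted
  point.\<close>

lemma transition_first_order:
  assumes a: "0 \<le> a" "a \<le> d" "d \<le> T" and f: "f \<in> C_lip 0 K"
    and osc: "\<And>\<tau>. \<tau> \<in> {a..d} \<Longrightarrow> norm (b \<tau> x - b a x) \<le> osc"
  shows "\<bar>transition M X a d f x - expectation (\<lambda>\<omega>. f ((x + (d - a) *\<^sub>R b a x) + R *v (Z (a + (d - a)) \<omega> - Z a \<omega>)))\<bar>
    \<le> (d - a) * (K * (\<kappa> * ((d - a) * (M2 * (1 + norm x)) + \<rho> * mom (d - a)) + osc))"
proof -
  let ?N = "\<lambda>\<omega>. R *v (Z d \<omega> - Z a \<omega>)"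
  let ?x = "x + (d - a) *\<^sub>R b a x"
  let ?E = "\<lambda>\<omega>. X a x d \<omega> - x - ?N \<omega> - (d - a) *\<^sub>R b a x"
  have a': "a \<in> {0..T}" "d \<in> {a..T}" using a by auto
  note E = X_first_order[OF a osc]
  have m: "(\<lambda>\<omega>. f (X a x d \<omega>)) \<in> borel_measurable M" "(\<lambda>\<omega>. f (?x + ?N \<omega>)) \<in> borel_measurable M"
    using Z_shift(1)[OF a(1,2)] X_measurable[OF a', of x]
    by (auto intro!: measurable_compose[OF _ C_lip_measurable[OF f]])
  have i: "integrable M (\<lambda>\<omega>. f (X a x d \<omega>))" "integrable M (\<lambda>\<omega>. f (?x + ?N \<omega>))"
    using C_lip_bound[OF f] by (intro integrable_const_bound[where B=K] m; simp)+
  have "\<bar>transition M X a d f x - expectation (\<lambda>\<omega>. f (?x + ?N \<omega>))\<bar> = \<bar>expectation (\<lambda>\<omega>. f (X a x d \<omega>) - f (?x + ?N \<omega>))\<bar>"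
    unfolding transition_def using i by simp
  also have "\<dots> \<le> expectation (\<lambda>\<omega>. \<bar>f (X a x d \<omega>) - f (?x + ?N \<omega>)\<bar>)" by (rule integral_abs_bound)
  also have "\<dots> \<le> expectation (\<lambda>\<omega>. K * norm (?E \<omega>))"
  proof (rule integral_mono)
    show "\<bar>f (X a x d \<omega>) - f (?x + ?N \<omega>)\<bar> \<le> K * norm (?E \<omega>)" for \<omega>
      using C_lip_lipschitz[OF f, of "X a x d \<omega>" "?x + ?N \<omega>"] by (simp add: algebra_simps)
  qed (intro integrable_abs Bochner_Integration.integrable_diff i integrable_mult_right integrable_norm E(1))+
  also have "\<dots> = K * expectation (\<lambda>\<omega>. norm (?E \<omega>))" by simp
  also have "\<dots> \<le> K * ((d - a) * (\<kappa> * ((d - a) * (M2 * (1 + norm x)) + \<rho> * mom (d - a)) + osc))"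
    by (rule mult_left_mono[OF E(2) C_lip_nonneg[OF f]])
  finally show ?thesis by (simp add: mult_ac)
qed

text \<open>A bound on difference quotients for all points and times, with linear growth in the
  state. It provides the growth hypothesis of \<open>expectation_tendsto_L1\<close> in the forward
  equation and continuity in the initial time in the backward one.\<close>

lemma transition_increment:
  assumes K: "0 \<le> K"
  obtains C where "0 \<le> C" "\<And>f a d x. f \<in> C_lip 1 K \<Longrightarrow> 0 \<le> a \<Longrightarrow> a \<le> d \<Longrightarrow> d \<le> T \<Longrightarrow>
    \<bar>transition M X a d f x - f x\<bar> \<le> (d - a) * (C * (1 + norm x))"
proof -
  obtain C1 where C1: "0 \<le> C1" "\<And>f x t h. f \<in> C_lip 1 K \<Longrightarrow> 0 \<le> t \<Longrightarrow> 0 \<le> h \<Longrightarrow>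
    \<bar>expectation (\<lambda>\<omega>. f (x + R *v (Z (t + h) \<omega> - Z t \<omega>))) - f x - h * igen f x\<bar> \<le> h * (1 + C1 * mom h)"
    using noise_estimate[OF zero_less_one K] by blast
  define J where "J = \<bar>jump_const K * trunc_mass\<bar>"
  \<comment> \<open>\<open>P\<close> collects the error of \<open>transition_first_order\<close>,
    with the oscillation estimated by \<open>2 * \<kappa> * (1 + norm x)\<close>. The other summands
    of \<open>C\<close> stem from the noise remainder with \<open>e = 1\<close>, from
    \<open>igen f\<close>, and from the shift along the drift.\<close>
  define P where "P = K * (\<kappa> * (T * M2 + \<rho> * mom T) + 2 * \<kappa>)"
  define C where "C = P + (1 + C1 * mom T) + J + K * \<kappa>"
  have P: "0 \<le> P" unfolding P_def using K \<kappa> T M2_nonneg \<rho>mom_nonneg[of T] by simp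
  have C: "0 \<le> C" unfolding C_def J_def using P C1(1) mom_nonneg[of T] K \<kappa> by simp
  have "\<bar>transition M X a d f x - f x\<bar> \<le> (d - a) * (C * (1 + norm x))"
    if f: "f \<in> C_lip 1 K" and a: "0 \<le> a" "a \<le> d" "d \<le> T" for f a d x
  proof -
    let ?h = "d - a" and ?y = "1 + norm x"
    let ?x = "x + ?h *\<^sub>R b a x"
    let ?m = "expectation (\<lambda>\<omega>. f (?x + R *v (Z (a + ?h) \<omega> - Z a \<omega>)))"
    have h: "0 \<le> ?h" "?h \<le> T" using a by auto
    have y: "1 \<le> ?y" by simp
    have osc: "norm (b \<tau> x - b a x) \<le> 2 * \<kappa> * ?y" if "\<tau> \<in> {a..d}" for \<tau>
      using norm_triangle_ineq4[of "b \<tau> x" "b a x"] b_growth[of \<tau> x] b_growth[of a x] that a by auto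
    have "\<bar>transition M X a d f x - ?m\<bar> \<le> ?h * (K * (\<kappa> * (?h * (M2 * ?y) + \<rho> * mom ?h) + 2 * \<kappa> * ?y))"
      by (rule transition_first_order[OF a C_lip_0D[OF f] osc])
    also have "\<dots> \<le> ?h * (K * (\<kappa> * (T * (M2 * ?y) + \<rho> * mom T * ?y) + 2 * \<kappa> * ?y))"
    proof (intro mult_left_mono add_mono order_refl h K \<kappa> mult_right_mono)
      show "\<rho> * mom ?h \<le> \<rho> * mom T * ?y"
        using mult_left_mono[OF mom_mono[OF h] \<rho>_nonneg] mult_left_mono[OF y \<rho>mom_nonneg[of T]] by simp
    qed (use M2_nonneg \<kappa> in simp_all)
    also have "\<dots> = ?h * (P * ?y)" by (simp add: P_def algebra_simps)
    finally have 1: "\<bar>transition M X a d f x - ?m\<bar> \<le> ?h * (P * ?y)" .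
    have "\<bar>?m - f ?x - ?h * igen f ?x\<bar> \<le> ?h * (1 + C1 * mom ?h)"
      by (rule C1(2)[OF f a(1) h(1)])
    also have "\<dots> \<le> ?h * ((1 + C1 * mom T) * ?y)"
    proof (rule mult_left_mono[OF _ h(1)])
      have "C1 * mom ?h \<le> C1 * mom T" by (rule mult_left_mono[OF mom_mono[OF h] C1(1)])
      moreover have "(1 + C1 * mom T) * 1 \<le> (1 + C1 * mom T) * ?y"
        using C1(1) mom_nonneg[of T] by (intro mult_left_mono[OF y]) simp
      ultimately show "1 + C1 * mom ?h \<le> (1 + C1 * mom T) * ?y" by simp
    qed
    finally have 2: "\<bar>?m - f ?x - ?h * igen f ?x\<bar> \<le> ?h * ((1 + C1 * mom T) * ?y)" .
    have "\<bar>igen f ?x\<bar> \<le> J * ?y"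
    proof -
      have "\<bar>igen f ?x\<bar> \<le> J" unfolding J_def by (rule order_trans[OF igen_bound[OF f] abs_ge_self])
      also have "J * 1 \<le> J * ?y" by (rule mult_left_mono[OF y]) (simp add: J_def)
      then have "J \<le> J * ?y" by simp
      finally show ?thesis .
    qed
    then have 3: "\<bar>?h * igen f ?x\<bar> \<le> ?h * (J * ?y)"
      using h(1) by (simp only: abs_mult abs_of_nonneg mult_left_mono)
    have "\<bar>f ?x - f x\<bar> \<le> K * norm (?h *\<^sub>R b a x)"
      using C_lip_lipschitz[OF f, of ?x x] by simp
    also have "\<dots> = ?h * (K * norm (b a x))" using h(1) by simp
    also have "\<dots> \<le> ?h * (K * (\<kappa> * ?y))"
      using a by (intro mult_left_mono b_growth h K) auto
    finally have 4: "\<bar>f ?x - f x\<bar> \<le> ?h * (K * (\<kappa> * ?y))" .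
    have "?h * (C * ?y) = ?h * (P * ?y) + ?h * ((1 + C1 * mom T) * ?y) + ?h * (J * ?y) + ?h * (K * (\<kappa> * ?y))"
      by (simp add: C_def algebra_simps)
    then show ?thesis using 1 2 3 4 by linarith
  qed
  with C show ?thesis using that by blast
qed

text \<open>Functions and points both move with \<open>n\<close>, as the backward and the forward
  equation require. The quotient is a main term plus three errors: \<open>T1\<close> from replacing
  the solution by a drift step and noise, \<open>T2\<close> from expanding the noise,
  \<open>T3\<close> from expanding \<open>f n\<close> along the drift.\<close>

lemma generator_limit:
  assumes a: "\<And>n. 0 \<le> a n" "\<And>n. a n < d n" "\<And>n. d n \<le> T" and t: "t \<in> {0..T}" "a \<longlonglongrightarrow> t" "d \<longlonglongrightarrow> t"
    and x: "x \<longlonglongrightarrow> y" and f: "\<And>n. f n \<in> C_lip 1 K" and F: "\<And>x. (\<lambda>n. f n x) \<longlonglongrightarrow> F x"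
  shows "(\<lambda>n. (transition M X (a n) (d n) (f n) (x n) - f n (x n)) / (d n - a n)) \<longlonglongrightarrow> gen t F y"
proof -
  define h where "h n = d n - a n" for n
  have h: "0 < h n" for n using a(2) by (simp add: h_def)
  have h0: "h \<longlonglongrightarrow> 0" unfolding h_def using tendsto_diff[OF t(3,2)] by simp
  have K: "0 \<le> K" using f C_lip_nonneg by blast
  have f': "f n \<in> C_lip (Suc 0) K" for n using f by simp
  have F': "F \<in> C_lip (Suc 0) K" by (rule C_lip_limit[OF f' F])
  have aT: "a n \<in> {0..T}" for n using a[of n] by simp
  define \<beta> where "\<beta> n = b (a n) (x n)" for n
  have \<beta>: "\<beta> \<longlonglongrightarrow> b t y" unfolding \<beta>_def by (rule b_tendsto[OF t(1) aT t(2) x])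
  have momh: "(\<lambda>n. mom (h n)) \<longlonglongrightarrow> 0" by (rule mom_tendsto[OF less_imp_le[OF h] h0])
  define x' where "x' n = x n + h n *\<^sub>R \<beta> n" for n
  have "(\<lambda>n. x n + h n *\<^sub>R \<beta> n) \<longlonglongrightarrow> y + 0 *\<^sub>R b t y" by (intro tendsto_intros x h0 \<beta>)
  then have x': "x' \<longlonglongrightarrow> y" unfolding x'_def by simp
  define m where "m n = expectation (\<lambda>\<omega>. f n (x' n + R *v (Z (a n + h n) \<omega> - Z (a n) \<omega>)))" for n
  \<comment> \<open>Times of maximal oscillation of the drift. They are squeezed to
    \<open>t\<close>, so that the oscillation tends to 0 by joint continuity of
    \<open>b\<close>.\<close>
  have "\<exists>\<tau>. \<tau> \<in> {a n..d n} \<and> (\<forall>\<tau>'\<in>{a n..d n}. norm (b \<tau>' (x n) - b (a n) (x n)) \<le> norm (b \<tau> (x n) - b (a n) (x n)))" for n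
    using oscillation[OF a(1) less_imp_le[OF a(2)] a(3), of n "x n"] by metis
  then obtain \<tau> where \<tau>: "\<And>n. \<tau> n \<in> {a n..d n}"
    "\<And>n \<tau>'. \<tau>' \<in> {a n..d n} \<Longrightarrow> norm (b \<tau>' (x n) - b (a n) (x n)) \<le> norm (b (\<tau> n) (x n) - b (a n) (x n))"
    by metis
  have \<tau>l: "\<tau> \<longlonglongrightarrow> t"
    by (rule tendsto_sandwich[OF _ _ t(2,3)]) (use \<tau>(1) in auto)
  have \<tau>T: "\<tau> n \<in> {0..T}" for n using \<tau>(1)[of n] a(1)[of n] a(3)[of n] by auto
  let ?osc = "\<lambda>n. norm (b (\<tau> n) (x n) - b (a n) (x n))"
  have "?osc \<longlonglongrightarrow> norm (b t y - b t y)"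
    by (intro tendsto_intros b_tendsto[OF t(1) \<tau>T \<tau>l x] b_tendsto[OF t(1) aT t(2) x])
  then have osc: "?osc \<longlonglongrightarrow> 0" by simp
  have T1: "(\<lambda>n. (transition M X (a n) (d n) (f n) (x n) - m n) / h n) \<longlonglongrightarrow> 0"
  proof (rule Lim_null_comparison)
    let ?B = "\<lambda>n. K * (\<kappa> * (h n * (M2 * (1 + norm (x n))) + \<rho> * mom (h n)) + ?osc n)"
    show "\<forall>\<^sub>F n in sequentially. norm ((transition M X (a n) (d n) (f n) (x n) - m n) / h n) \<le> ?B n"
    proof (intro always_eventually allI)
      fix n
      have "\<bar>transition M X (a n) (d n) (f n) (x n) - m n\<bar> \<le> h n * ?B n"
        unfolding m_def x'_def \<beta>_def h_def
        by (rule transition_first_order[OF a(1) less_imp_le[OF a(2)] a(3) C_lip_0D[OF f] \<tau>(2)])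
      then show "norm ((transition M X (a n) (d n) (f n) (x n) - m n) / h n) \<le> ?B n"
        using h[of n] by (simp add: abs_divide divide_le_eq mult.commute)
    qed
    have "?B \<longlonglongrightarrow> K * (\<kappa> * (0 * (M2 * (1 + norm y)) + \<rho> * 0) + 0)"
      by (intro tendsto_intros h0 x momh osc)
    then show "?B \<longlonglongrightarrow> 0" by simp
  qed
  have T2: "(\<lambda>n. (m n - f n (x' n) - h n * igen (f n) (x' n)) / h n) \<longlonglongrightarrow> 0"
  proof (rule LIMSEQ_I)
    fix e :: real assume "0 < e"
    then have e: "0 < e / 2" by simp
    obtain C where C: "0 \<le> C" "\<And>f x t h. f \<in> C_lip 1 K \<Longrightarrow> 0 \<le> t \<Longrightarrow> 0 \<le> h \<Longrightarrow>
      \<bar>expectation (\<lambda>\<omega>. f (x + R *v (Z (t + h) \<omega> - Z t \<omega>))) - f x - h * igen f x\<bar> \<le> h * (e / 2 + C * mom h)"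
      using noise_estimate[OF e K] by blast
    have "(\<lambda>n. C * mom (h n)) \<longlonglongrightarrow> C * 0" by (intro tendsto_intros momh)
    then have "\<forall>\<^sub>F n in sequentially. C * mom (h n) < e / 2"
      using e by (intro order_tendstoD) auto
    then have "\<forall>\<^sub>F n in sequentially. norm ((m n - f n (x' n) - h n * igen (f n) (x' n)) / h n - 0) < e"
    proof eventually_elim
      case (elim n)
      have "\<bar>m n - f n (x' n) - h n * igen (f n) (x' n)\<bar> \<le> h n * (e / 2 + C * mom (h n))"
        unfolding m_def by (rule C(2)[OF f a(1) less_imp_le[OF h]])
      also have "\<dots> < h n * e" using elim h[of n] by simp
      finally show ?case using h[of n] by (simp add: abs_divide divide_less_eq mult.commute)
    qed
    then show "\<exists>N. \<forall>n\<ge>N. norm ((m n - f n (x' n) - h n * igen (f n) (x' n)) / h n - 0) < e"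
      by (simp add: eventually_sequentially)
  qed
  have gr: "(\<lambda>n. grad (f n) (x n)) \<longlonglongrightarrow> grad F y"
  proof -
    have "(\<lambda>n. grad (f n) (x n) - grad (f n) y) \<longlonglongrightarrow> 0"
    proof (rule Lim_null_comparison)
      show "\<forall>\<^sub>F n in sequentially. norm (grad (f n) (x n) - grad (f n) y) \<le> real CARD('n) * K * norm (x n - y)"
        by (intro always_eventually allI norm_grad_diff_le[OF f'])
      have "(\<lambda>n. real CARD('n) * K * norm (x n - y)) \<longlonglongrightarrow> real CARD('n) * K * norm (y - y)"
        by (intro tendsto_intros x)
      then show "(\<lambda>n. real CARD('n) * K * norm (x n - y)) \<longlonglongrightarrow> 0" by simp
    qed
    from tendsto_add[OF this grad_limit[OF f' F, of y]] show ?thesis by simp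
  qed
  have T3: "(\<lambda>n. (f n (x' n) - f n (x n) - h n * (\<beta> n \<bullet> grad (f n) (x n))) / h n) \<longlonglongrightarrow> 0"
  proof (rule Lim_null_comparison)
    let ?B = "\<lambda>n. real CARD('n) * K * (h n * (norm (\<beta> n))\<^sup>2)"
    show "\<forall>\<^sub>F n in sequentially. norm ((f n (x' n) - f n (x n) - h n * (\<beta> n \<bullet> grad (f n) (x n))) / h n) \<le> ?B n"
    proof (intro always_eventually allI)
      fix n
      have "\<bar>f n (x' n) - f n (x n) - h n * (\<beta> n \<bullet> grad (f n) (x n))\<bar> \<le> real CARD('n) * K * (norm (h n *\<^sub>R \<beta> n))\<^sup>2"
        using C_lip_taylor[OF f', of n "x' n" "x n"] by (simp add: x'_def inner_commute)
      also have "\<dots> = h n * ?B n" using h[of n] by (simp add: power2_eq_square)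
      finally show "norm ((f n (x' n) - f n (x n) - h n * (\<beta> n \<bullet> grad (f n) (x n))) / h n) \<le> ?B n"
        using h[of n] by (simp add: abs_divide divide_le_eq mult.commute)
    qed
    have "?B \<longlonglongrightarrow> real CARD('n) * K * (0 * (norm (b t y))\<^sup>2)"
      by (intro tendsto_intros h0 \<beta>)
    then show "?B \<longlonglongrightarrow> 0" by simp
  qed
  have lim: "(\<lambda>n. \<beta> n \<bullet> grad (f n) (x n) + igen (f n) (x' n)) \<longlonglongrightarrow> gen t F y"
    unfolding gen_def by (intro tendsto_intros \<beta> gr igen_tendsto[OF f F x'])
  have eq: "(transition M X (a n) (d n) (f n) (x n) - f n (x n)) / (d n - a n)
    = (transition M X (a n) (d n) (f n) (x n) - m n) / h n + (m n - f n (x' n) - h n * igen (f n) (x' n)) / h n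
      + (f n (x' n) - f n (x n) - h n * (\<beta> n \<bullet> grad (f n) (x n))) / h n
      + (\<beta> n \<bullet> grad (f n) (x n) + igen (f n) (x' n))" for n
    using h[of n] by (simp add: h_def[symmetric] field_simps)
  have "(\<lambda>n. (transition M X (a n) (d n) (f n) (x n) - f n (x n)) / (d n - a n)) \<longlonglongrightarrow> 0 + 0 + 0 + gen t F y"
    unfolding eq by (intro tendsto_add T1 T2 T3 lim)
  then show ?thesis by simp
qed

lemma transition_C_lip_0:
  "0 \<le> r \<Longrightarrow> r \<le> t \<Longrightarrow> t \<le> T \<Longrightarrow> f \<in> C_lip 0 K \<Longrightarrow> transition M X r t f \<in> C_lip 0 (K * exp (\<kappa> * T))"
  by (rule transition_C_lip[OF C_lip_0_step \<kappa>])

lemma X_tendsto_L1: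
  assumes s: "0 \<le> s" and a: "\<And>n. a n \<in> {s..T}" "t \<in> {s..T}" "a \<longlonglongrightarrow> t"
  shows "(\<lambda>n. expectation (\<lambda>\<omega>. norm (X s x (a n) \<omega> - X s x t \<omega>))) \<longlonglongrightarrow> 0"
proof (rule Lim_null_comparison)
  let ?B = "\<lambda>n. \<bar>a n - t\<bar> * (M2 * (1 + norm x)) + \<rho> * mom \<bar>a n - t\<bar>"
  show "\<forall>\<^sub>F n in sequentially. norm (expectation (\<lambda>\<omega>. norm (X s x (a n) \<omega> - X s x t \<omega>))) \<le> ?B n"
  proof (intro always_eventually allI)
    fix n
    have p: "0 \<le> expectation (\<lambda>\<omega>. norm (X s x (a n) \<omega> - X s x t \<omega>))" by (intro integral_nonneg_AE) auto
    show "norm (expectation (\<lambda>\<omega>. norm (X s x (a n) \<omega> - X s x t \<omega>))) \<le> ?B n"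
    proof (cases "a n \<le> t")
      case True
      then show ?thesis
        using X_increment[of s "a n" t x] s a(1)[of n] a(2) p by (simp add: norm_minus_commute)
    next
      case False
      then show ?thesis
        using X_increment[of s t "a n" x] s a(1)[of n] a(2) p by simp
    qed
  qed
  have d: "(\<lambda>n. \<bar>a n - t\<bar>) \<longlonglongrightarrow> 0" using a(3) by (simp add: LIM_zero_iff tendsto_rabs_zero_iff)
  have "?B \<longlonglongrightarrow> 0 * (M2 * (1 + norm x)) + \<rho> * 0"
    by (intro tendsto_intros d mom_tendsto) auto
  then show "?B \<longlonglongrightarrow> 0" by simp
qed

lemma gen_X_integrable:
  assumes s: "0 \<le> s" "s \<le> t" "t \<le> T" and f: "f \<in> C_lip 1 K"
  shows "integrable M (\<lambda>\<omega>. gen t f (X s x t \<omega>))"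
proof (rule Bochner_Integration.integrable_bound)
  have t: "t \<in> {0..T}" using s by simp
  note Xi = X_integrable(1)[OF s, of x]
  show "integrable M (\<lambda>\<omega>. gen_const K * (1 + norm (X s x t \<omega>)))" using Xi by auto
  show "(\<lambda>\<omega>. gen t f (X s x t \<omega>)) \<in> borel_measurable M"
    by (rule measurable_compose[OF borel_measurable_integrable[OF Xi] borel_measurable_continuous_onI[OF gen_continuous[OF t f]]])
  show "AE \<omega> in M. norm (gen t f (X s x t \<omega>)) \<le> norm (gen_const K * (1 + norm (X s x t \<omega>)))"
    by (intro AE_I2, simp only: real_norm_def) (rule order_trans[OF gen_bound(1)[OF t f] abs_ge_self])
qed

text \<open>By the Markov property at \<open>a n\<close> the difference quotient is the mean of
  \<open>g n\<close> at \<open>X s x (a n)\<close>. The \<open>g n\<close> have linear growth and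
  converge to \<open>gen t f\<close> along converging points, and the solution converges in the
  mean, which is the setting of \<open>expectation_tendsto_L1\<close>.\<close>

theorem forward_equation:
  assumes s: "s \<in> {0..T}" and f: "f \<in> C_lip 1 K"
  shows "t \<in> {s..T} \<Longrightarrow> ((\<lambda>t. transition M X s t f x) has_real_derivative transition M X s t (gen t f) x) (at t within {s..T})"
    and "continuous_on {s..T} (\<lambda>t. transition M X s t (gen t f) x)"
proof -
  obtain C where C: "0 \<le> C" "\<And>f a d x. f \<in> C_lip 1 K \<Longrightarrow> 0 \<le> a \<Longrightarrow> a \<le> d \<Longrightarrow> d \<le> T \<Longrightarrow>
    \<bar>transition M X a d f x - f x\<bar> \<le> (d - a) * (C * (1 + norm x))"
    using transition_increment[OF C_lip_nonneg[OF f]] by blast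
  have "(\<lambda>n. (transition M X s (d n) f x - transition M X s (a n) f x) / (d n - a n)) \<longlonglongrightarrow> transition M X s t (gen t f) x"
    if t: "t \<in> {s..T}" and a: "\<And>n. a n \<in> {s..T}" and d: "\<And>n. d n \<in> {s..T}" and ad: "\<And>n. a n < d n"
      and lim: "a \<longlonglongrightarrow> t" "d \<longlonglongrightarrow> t" for t a d
  proof -
    have t0: "t \<in> {0..T}" "s \<le> t" "t \<le> T" using t s by auto
    have a0: "0 \<le> a n" "s \<le> a n" "a n \<le> T" "a n \<le> d n" "d n \<le> T" for n
      using a[of n] d[of n] ad[of n] s by auto
    have s0: "0 \<le> s" using s by simp
    define g where "g n y = (transition M X (a n) (d n) f y - f y) / (d n - a n)" for n y
    \<comment> \<open>A growth constant common to the quotients \<open>g n\<close> and their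
      limit.\<close>
    let ?C = "max C (gen_const K)"
    note u = transition_C_lip_0[OF a0(1,4,5) C_lip_0D[OF f]]
    have eq: "(transition M X s (d n) f x - transition M X s (a n) f x) / (d n - a n) = expectation (\<lambda>\<omega>. g n (X s x (a n) \<omega>))" for n
    proof -
      have m: "(\<lambda>\<omega>. h (X s x (a n) \<omega>)) \<in> borel_measurable M" if "h \<in> C_lip 0 K'" for h K'
        by (rule measurable_compose[OF X_measurable C_lip_measurable[OF that]]) (use s a in auto)
      have i: "integrable M (\<lambda>\<omega>. h (X s x (a n) \<omega>))" if "h \<in> C_lip 0 K'" for h K'
        using C_lip_bound[OF that] by (intro integrable_const_bound[where B=K'] m[OF that]) simp
      have "transition M X s (d n) f x = transition M X s (a n) (transition M X (a n) (d n) f) x"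
        by (rule Markov[OF s0 a0(2,4,5) C_lip_0D[OF f]])
      then show ?thesis
        using i[OF u] i[OF C_lip_0D[OF f]] unfolding g_def transition_def[of M X s] by simp
    qed
    have "(\<lambda>n. expectation (\<lambda>\<omega>. g n (X s x (a n) \<omega>))) \<longlonglongrightarrow> expectation (\<lambda>\<omega>. gen t f (X s x t \<omega>))"
    proof (rule expectation_tendsto_L1[where C="?C" and X="\<lambda>n. X s x (a n)" and Y="X s x t" and g=g and G="gen t f"])
      show "integrable M (X s x (a n))" for n by (rule X_integrable(1)[OF s0 a0(2,3)])
      show "integrable M (X s x t)" by (rule X_integrable(1)[OF s0 t0(2,3)])
      show "(\<lambda>n. expectation (\<lambda>\<omega>. norm (X s x (a n) \<omega> - X s x t \<omega>))) \<longlonglongrightarrow> 0"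
        by (rule X_tendsto_L1[OF s0 a t lim(1)])
      show "g n \<in> borel_measurable borel" for n
        unfolding g_def using C_lip_measurable[OF u, of n] C_lip_measurable[OF f] by measurable
      show "gen t f \<in> borel_measurable borel"
        by (rule borel_measurable_continuous_onI[OF gen_continuous[OF t0(1) f]])
      show "0 \<le> ?C" using C(1) by simp
      show "\<bar>g n y\<bar> \<le> ?C * (1 + norm y)" for n y
      proof -
        have "\<bar>g n y\<bar> \<le> C * (1 + norm y)"
          using C(2)[OF f a0(1,4,5), of n y] ad[of n] unfolding g_def by (simp add: abs_divide divide_le_eq mult.commute)
        also have "\<dots> \<le> ?C * (1 + norm y)" by (rule mult_right_mono) auto
        finally show ?thesis .
      qed
      show "\<bar>gen t f y\<bar> \<le> ?C * (1 + norm y)" for y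
      proof -
        have "gen_const K * (1 + norm y) \<le> ?C * (1 + norm y)" by (rule mult_right_mono) auto
        with gen_bound(1)[OF t0(1) f] show ?thesis by (rule order_trans)
      qed
      show "(\<lambda>n. g (r n) (z n)) \<longlonglongrightarrow> gen t f y" if r: "strict_mono r" and z: "z \<longlonglongrightarrow> y" for z y r
        unfolding g_def
      proof (rule generator_limit[OF a0(1) ad a0(5) t0(1) _ _ z f tendsto_const])
        show "(\<lambda>n. a (r n)) \<longlonglongrightarrow> t" "(\<lambda>n. d (r n)) \<longlonglongrightarrow> t"
          using LIMSEQ_subseq_LIMSEQ[OF lim(1) r] LIMSEQ_subseq_LIMSEQ[OF lim(2) r] by (simp_all add: o_def)
      qed
    qed
    then show ?thesis unfolding eq by (simp only: transition_def)
  qed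
  note * = strict_derivative[where F="\<lambda>t. transition M X s t f x" and G="\<lambda>t. transition M X s t (gen t f) x", OF this]
  show "t \<in> {s..T} \<Longrightarrow> ((\<lambda>t. transition M X s t f x) has_real_derivative transition M X s t (gen t f) x) (at t within {s..T})"
    by (rule *(1))
  show "continuous_on {s..T} (\<lambda>t. transition M X s t (gen t f) x)"
    by (rule *(2))
qed

text \<open>Here the point is fixed and the functions \<open>transition M X (d n) t f\<close> move;
  the bound \<open>u\<close>, uniform in the initial time, is what \<open>generator_limit\<close>
  asks of a moving sequence of functions.\<close>

theorem backward_equation:
  assumes t: "t \<in> {0..T}" and u: "\<And>s. s \<in> {0..t} \<Longrightarrow> transition M X s t f \<in> C_lip 1 K" and f: "f \<in> C_lip 0 K0"
  shows "s \<in> {0..t} \<Longrightarrow> ((\<lambda>s. transition M X s t f x) has_real_derivative - gen s (transition M X s t f) x) (at s within {0..t})"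
    and "continuous_on {0..t} (\<lambda>s. - gen s (transition M X s t f) x)"
proof -
  have K: "0 \<le> K" using u[of t] t C_lip_nonneg by auto
  obtain C where C: "0 \<le> C" "\<And>f a d x. f \<in> C_lip 1 K \<Longrightarrow> 0 \<le> a \<Longrightarrow> a \<le> d \<Longrightarrow> d \<le> T \<Longrightarrow>
    \<bar>transition M X a d f x - f x\<bar> \<le> (d - a) * (C * (1 + norm x))"
    using transition_increment[OF K] by blast
  have Markov': "transition M X a t f y = transition M X a d (transition M X d t f) y" if "0 \<le> a" "a \<le> d" "d \<le> t" for a d y
    using Markov[OF that _ f] t by simp
  \<comment> \<open>Lipschitz continuity in the initial time, which provides the pointwise
    convergence of the moving functions.\<close>
  have cont: "\<bar>transition M X a t f y - transition M X d t f y\<bar> \<le> (d - a) * (C * (1 + norm y))"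
    if "0 \<le> a" "a \<le> d" "d \<le> t" for a d y
    unfolding Markov'[OF that] using C(2)[OF u, of d a d y] that t by simp
  have "(\<lambda>n. (transition M X (d n) t f x - transition M X (a n) t f x) / (d n - a n)) \<longlonglongrightarrow> - gen s (transition M X s t f) x"
    if s: "s \<in> {0..t}" and a: "\<And>n. a n \<in> {0..t}" and d: "\<And>n. d n \<in> {0..t}" and ad: "\<And>n. a n < d n"
      and lim: "a \<longlonglongrightarrow> s" "d \<longlonglongrightarrow> s" for s a d
  proof -
    have s0: "s \<in> {0..T}" using s t by auto
    have a0: "0 \<le> a n" "a n \<le> d n" "d n \<le> t" "d n \<le> T" for n
      using a[of n] d[of n] ad[of n] t by auto
    have ud: "(\<lambda>n. transition M X (d n) t f y) \<longlonglongrightarrow> transition M X s t f y" for y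
    proof -
      have "(\<lambda>n. transition M X (d n) t f y - transition M X s t f y) \<longlonglongrightarrow> 0"
      proof (rule Lim_null_comparison)
        show "\<forall>\<^sub>F n in sequentially. norm (transition M X (d n) t f y - transition M X s t f y) \<le> \<bar>d n - s\<bar> * (C * (1 + norm y))"
        proof (intro always_eventually allI)
          fix n
          show "norm (transition M X (d n) t f y - transition M X s t f y) \<le> \<bar>d n - s\<bar> * (C * (1 + norm y))"
            using cont[of "d n" s y] cont[of s "d n" y] d[of n] s
            by (cases "d n \<le> s") (auto simp: abs_minus_commute)
        qed
        have "(\<lambda>n. \<bar>d n - s\<bar> * (C * (1 + norm y))) \<longlonglongrightarrow> \<bar>s - s\<bar> * (C * (1 + norm y))"
          by (intro tendsto_intros lim)
        then show "(\<lambda>n. \<bar>d n - s\<bar> * (C * (1 + norm y))) \<longlonglongrightarrow> 0" by simp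
      qed
      then show ?thesis by (simp add: LIM_zero_iff)
    qed
    have "(\<lambda>n. (transition M X (a n) (d n) (transition M X (d n) t f) x - transition M X (d n) t f x) / (d n - a n)) \<longlonglongrightarrow> gen s (transition M X s t f) x"
      by (rule generator_limit[OF a0(1) ad a0(4) s0 lim tendsto_const u[OF d] ud])
    then have "(\<lambda>n. - ((transition M X (a n) t f x - transition M X (d n) t f x) / (d n - a n))) \<longlonglongrightarrow> - gen s (transition M X s t f) x"
      unfolding Markov'[OF a0(1-3)] by (rule tendsto_minus)
    then show ?thesis by (simp add: minus_divide_left)
  qed
  note * = strict_derivative[where F="\<lambda>s. transition M X s t f x" and G="\<lambda>s. - gen s (transition M X s t f) x", OF this]
  show "s \<in> {0..t} \<Longrightarrow> ((\<lambda>s. transition M X s t f x) has_real_derivative - gen s (transition M X s t f) x) (at s within {0..t})"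
    by (rule *(1))
  show "continuous_on {0..t} (\<lambda>s. - gen s (transition M X s t f) x)"
    by (rule *(2))
qed

end

section \<open>From the given coefficients to the abstract setting\<close>

lemma continuous_on_C_b0: "B \<in> C_b0 T k \<Longrightarrow> continuous_on ({0..T} \<times> UNIV) (\<lambda>(t, x). B t x)"
  by (cases k) auto

lemma drift_linear_plus_C_b0:
  fixes A :: "real^'n^'n"
  assumes T: "0 < T" and B: "B \<in> C_b0 T (Suc k)"
  shows "\<exists>\<kappa>. drift T (\<lambda>t x. A *v x + B t x) \<kappa>"
proof -
  obtain K where K: "\<And>t j. t \<in> {0..T} \<Longrightarrow> (\<lambda>x. B t x $ j) \<in> C_lip k K"
    using C_b0_imp_C_lip[OF B] by blast
  have K0: "0 \<le> K" using C_lip_nonneg[OF K[of 0]] T by simp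
  define a where "a = onorm ((*v) A)"
  have a: "norm (A *v x) \<le> a * norm x" for x unfolding a_def by (rule onorm) simp
  have a0: "0 \<le> a" unfolding a_def by (rule onorm_pos_le) simp
  define \<kappa> where "\<kappa> = a + real CARD('n) * K"
  have "drift T (\<lambda>t x. A *v x + B t x) \<kappa>"
  proof
    show "0 \<le> \<kappa>" unfolding \<kappa>_def using a0 K0 by simp
    have "continuous_on UNIV ((*v) A)" by (rule linear_continuous_on) simp
    then have A: "continuous_on ({0..T} \<times> UNIV) (\<lambda>p. A *v (snd p))"
      by (rule continuous_on_compose2[OF _ continuous_on_snd[OF continuous_on_id]]) simp
    show "continuous_on ({0..T} \<times> UNIV) (\<lambda>(t, x). A *v x + B t x)"
      using continuous_on_add[OF A continuous_on_C_b0[OF B]] by (simp only: case_prod_beta')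
    fix t :: real assume t: "t \<in> {0..T}"
    show "norm ((A *v x + B t x) - (A *v y + B t y)) \<le> \<kappa> * norm (x - y)" for x y
    proof -
      have "norm (B t x - B t y) \<le> real CARD('n) * (K * norm (x - y))"
        by (rule norm_le_components) (use C_lip_lipschitz[OF K[OF t]] in simp)
      moreover have "(A *v x + B t x) - (A *v y + B t y) = A *v (x - y) + (B t x - B t y)"
        by (simp add: matrix_vector_mult_diff_distrib)
      ultimately show ?thesis
        using norm_triangle_ineq[of "A *v (x - y)" "B t x - B t y"] a[of "x - y"] by (simp add: \<kappa>_def algebra_simps)
    qed
    show "norm (A *v x + B t x) \<le> \<kappa> * (1 + norm x)" for x
    proof -
      have "norm (B t x) \<le> real CARD('n) * K"
        by (rule norm_le_components) (rule C_lip_bound[OF K[OF t]])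
      moreover have "0 \<le> real CARD('n) * K * norm x" using K0 by simp
      ultimately show ?thesis
        using norm_triangle_ineq[of "A *v x" "B t x"] a[of x] a0 by (simp add: \<kappa>_def algebra_simps)
    qed
  qed (use T in simp)
  then show ?thesis ..
qed

lemma sde_solution_imp_sde:
  fixes W :: "real \<Rightarrow> 'a \<Rightarrow> real^'n"
  assumes "stable_noise M W L \<alpha> c \<nu>" and "drift T (\<lambda>t x. A *v x + B t x) \<kappa>"
    and X: "\<And>s x. s \<in> {0..T} \<Longrightarrow> sde_solution M T A B R (subordinate W L) s x (X s x)"
  shows "sde M W L \<alpha> c \<nu> R T (\<lambda>t x. A *v x + B t x) \<kappa> X"
proof -
  interpret stable_noise M W L \<alpha> c \<nu> by fact
  interpret drift T "\<lambda>t x. A *v x + B t x" \<kappa> by fact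
  show ?thesis
    by unfold_locales (use X in \<open>auto simp: sde_solution_def\<close>)
qed

theorem theorem7:
  fixes M :: "'a measure"
    and W :: "real \<Rightarrow> 'a \<Rightarrow> (real, 'n::{finite,linorder}) vec"
    and L :: "real \<Rightarrow> 'a \<Rightarrow> real"
    and \<alpha> \<gamma> c T :: real
    and \<nu> :: "(real, 'n) vec measure"
    and l \<sigma> :: "'n \<Rightarrow> real"
    and A R :: "((real, 'n) vec, 'n) vec"
    and B\<^sub>0 :: "real \<Rightarrow> (real, 'n) vec \<Rightarrow> (real, 'n) vec"
    and X :: "real \<Rightarrow> (real, 'n) vec \<Rightarrow> real \<Rightarrow> 'a \<Rightarrow> (real, 'n) vec"
  assumes T: "0 < T"
    and M: "prob_space M" "complete_measure M"
    and alpha: "1 / 2 < \<alpha>" "\<alpha> < 1"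
    and W: "standard_brownian_motion M W"
    and L: "subordinator M L" "strictly_stable M \<alpha> L"
    and gamma: "0 < \<gamma>"
    and char_L: "\<And>u. char (distr M borel (L 1)) u =
          exp (- of_real (\<gamma> powr \<alpha> * \<bar>u\<bar> powr \<alpha>) * (1 - \<i> * of_real (tan (pi * \<alpha> / 2) * sgn u)))"
    and indep: "indep_processes M W L"
    and c: "0 < c"
    and nu: "\<nu> = density lborel (\<lambda>z. ennreal (c * norm z powr (- (real CARD('n) + 2 * \<alpha>))))"
    and nu_levy: "levy_measure M (subordinate W L) \<nu>"
    and l: "\<And>i. 0 < l i" "mono l"
    and A: "A = - diag_mat l"
    and sigma: "\<And>i. 0 < (\<sigma> i)\<^sup>2"
    and R: "R = diag_mat (\<lambda>i. sqrt ((\<sigma> i)\<^sup>2))"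
    and X: "\<And>s x. s \<in> {0..T} \<Longrightarrow> sde_solution M T A B\<^sub>0 R (subordinate W L) s x (X s x)"
  shows "(B\<^sub>0 \<in> C_b0 T 1 \<longrightarrow> (\<forall>s\<in>{0..T}. \<forall>x. \<forall>\<phi>\<in>C_b 2.
      (\<forall>t\<in>{s..T}.
         integrable M (\<lambda>\<omega>. generator A B\<^sub>0 R \<nu> t \<phi> (X s x t \<omega>)) \<and>
         ((\<lambda>t. transition M X s t \<phi> x) has_real_derivative
            transition M X s t (generator A B\<^sub>0 R \<nu> t \<phi>) x) (at t within {s..T})) \<and>
      continuous_on {s..T} (\<lambda>t. transition M X s t (generator A B\<^sub>0 R \<nu> t \<phi>) x))) \<and>
    (B\<^sub>0 \<in> C_b0 T 3 \<longrightarrow> (\<forall>t\<in>{0..T}. \<forall>x. \<forall>\<phi>\<in>C_b 3.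
      (\<forall>s\<in>{0..t}.
         transition M X s t \<phi> \<in> C_b 2 \<and>
         ((\<lambda>s. transition M X s t \<phi> x) has_real_derivative
            - generator A B\<^sub>0 R \<nu> s (transition M X s t \<phi>) x) (at s within {0..t})) \<and>
      continuous_on {0..t} (\<lambda>s. - generator A B\<^sub>0 R \<nu> s (transition M X s t \<phi>) x)))"
proof -
  interpret prob_space M by (rule M(1))
  interpret N: stable_noise M W L \<alpha> c \<nu>
    by (intro stable_noise.intro stable_noise_axioms.intro subordination.intro subordination_axioms.intro
        M W L indep alpha c nu nu_levy)
  let ?b = "\<lambda>t x. A *v x + B\<^sub>0 t x"
  have gen: "sde.gen \<nu> R ?b = generator A B\<^sub>0 R \<nu>" if "sde M W L \<alpha> c \<nu> R T ?b \<kappa> X" for \<kappa>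
  proof -
    interpret S: sde M W L \<alpha> c \<nu> R T ?b \<kappa> X by fact
    show ?thesis by (intro ext) (simp add: S.gen_def S.igen_def S.jump_def generator_def)
  qed
  show ?thesis
  proof (intro conjI impI)
    assume B: "B\<^sub>0 \<in> C_b0 T 1"
    then obtain \<kappa> where "drift T ?b \<kappa>"
      using drift_linear_plus_C_b0[OF T, of B\<^sub>0 0 A] by auto
    then interpret S: sde M W L \<alpha> c \<nu> R T ?b \<kappa> X
      by (rule sde_solution_imp_sde[OF N.stable_noise_axioms _ X])
    note gen = gen[OF S.sde_axioms]
    show "\<forall>s\<in>{0..T}. \<forall>x. \<forall>\<phi>\<in>C_b 2.
      (\<forall>t\<in>{s..T}.
         integrable M (\<lambda>\<omega>. generator A B\<^sub>0 R \<nu> t \<phi> (X s x t \<omega>)) \<and>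
         ((\<lambda>t. transition M X s t \<phi> x) has_real_derivative
            transition M X s t (generator A B\<^sub>0 R \<nu> t \<phi>) x) (at t within {s..T})) \<and>
      continuous_on {s..T} (\<lambda>t. transition M X s t (generator A B\<^sub>0 R \<nu> t \<phi>) x)"
    proof (intro ballI allI)
      fix s x and \<phi> :: "(real, 'n) vec \<Rightarrow> real" assume s: "s \<in> {0..T}" and \<phi>: "\<phi> \<in> C_b 2"
      \<comment> \<open>Two bounded derivatives leave a Lipschitz gradient, enough for the quadratic
        Taylor bound under the Levy measure.\<close>
      obtain K where K: "\<phi> \<in> C_lip 1 K"
        using C_b_imp_C_lip[of \<phi> 1] \<phi> by (auto simp: numeral_2_eq_2)
      have "integrable M (\<lambda>\<omega>. generator A B\<^sub>0 R \<nu> t \<phi> (X s x t \<omega>))" if "t \<in> {s..T}" for t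
        using S.gen_X_integrable[OF _ _ _ K, of s t x] s that unfolding gen by simp
      then show "(\<forall>t\<in>{s..T}.
         integrable M (\<lambda>\<omega>. generator A B\<^sub>0 R \<nu> t \<phi> (X s x t \<omega>)) \<and>
         ((\<lambda>t. transition M X s t \<phi> x) has_real_derivative
            transition M X s t (generator A B\<^sub>0 R \<nu> t \<phi>) x) (at t within {s..T})) \<and>
        continuous_on {s..T} (\<lambda>t. transition M X s t (generator A B\<^sub>0 R \<nu> t \<phi>) x)"
        using S.forward_equation(1)[OF s K, of _ x, unfolded gen] S.forward_equation(2)[OF s K, of x, unfolded gen] by blast
    qed
  next
    assume B: "B\<^sub>0 \<in> C_b0 T 3"
    then have B': "B\<^sub>0 \<in> C_b0 T (Suc 2)" by simp
    then obtain \<kappa> where "drift T ?b \<kappa>"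
      using drift_linear_plus_C_b0[OF T, of B\<^sub>0 2 A] by blast
    then interpret S: sde M W L \<alpha> c \<nu> R T ?b \<kappa> X
      by (rule sde_solution_imp_sde[OF N.stable_noise_axioms _ X])
    note gen = gen[OF S.sde_axioms]
    obtain KB where KB: "\<And>t j. t \<in> {0..T} \<Longrightarrow> (\<lambda>x. B\<^sub>0 t x $ j) \<in> C_lip 2 KB"
      using C_b0_imp_C_lip[OF B'] by blast
    \<comment> \<open>No step of an Euler scheme exceeds \<open>T\<close>, which therefore serves as
      the bound \<open>D\<close> on the step size; one \<open>C\<close> serves all times because
      \<open>KB\<close> does.\<close>
    obtain C where C: "0 \<le> C" "\<And>\<delta> p f K. 0 \<le> \<delta> \<Longrightarrow> \<delta> \<le> T \<Longrightarrow> (\<And>j. (\<lambda>x. p x $ j) \<in> C_lip 2 KB) \<Longrightarrow>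
      f \<in> C_lip 2 K \<Longrightarrow> (\<lambda>x. f (x + \<delta> *\<^sub>R (A *v x + p x))) \<in> C_lip 2 (K * (1 + C * \<delta>))"
      using C_lip_compose_drift[OF less_imp_le[OF T], of 2 KB A] by blast
    show "\<forall>t\<in>{0..T}. \<forall>x. \<forall>\<phi>\<in>C_b 3.
      (\<forall>s\<in>{0..t}.
         transition M X s t \<phi> \<in> C_b 2 \<and>
         ((\<lambda>s. transition M X s t \<phi> x) has_real_derivative
            - generator A B\<^sub>0 R \<nu> s (transition M X s t \<phi>) x) (at s within {0..t})) \<and>
      continuous_on {0..t} (\<lambda>s. - generator A B\<^sub>0 R \<nu> s (transition M X s t \<phi>) x)"
    proof (intro ballI allI)
      fix t x and \<phi> :: "(real, 'n) vec \<Rightarrow> real" assume t: "t \<in> {0..T}" and \<phi>: "\<phi> \<in> C_b 3"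
      obtain K where K: "\<phi> \<in> C_lip 2 K"
        using C_b_imp_C_lip[of \<phi> 2] \<phi> by (auto simp: numeral_3_eq_3 numeral_2_eq_2)
      \<comment> \<open>Order 2 is what yields membership in \<open>C_b 2\<close>; the equation
        itself uses the consequence of order 1.\<close>
      have u: "transition M X s t \<phi> \<in> C_lip 2 (K * exp (C * T))" if "s \<in> {0..t}" for s
        by (rule S.transition_C_lip[OF C(2)[OF _ _ KB] C(1) _ _ _ K]) (use that t in auto)
      have u1: "transition M X s t \<phi> \<in> C_lip 1 (K * exp (C * T))" if "s \<in> {0..t}" for s
        using C_lip_Suc_D[of _ 1] u[OF that] by (simp add: numeral_2_eq_2)
      show "(\<forall>s\<in>{0..t}.
         transition M X s t \<phi> \<in> C_b 2 \<and>
         ((\<lambda>s. transition M X s t \<phi> x) has_real_derivative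
            - generator A B\<^sub>0 R \<nu> s (transition M X s t \<phi>) x) (at s within {0..t})) \<and>
        continuous_on {0..t} (\<lambda>s. - generator A B\<^sub>0 R \<nu> s (transition M X s t \<phi>) x)"
        using S.backward_equation(1)[OF t u1 C_lip_0D[OF K], of _ x, unfolded gen]
          S.backward_equation(2)[OF t u1 C_lip_0D[OF K], of x, unfolded gen] C_lip_imp_C_b[OF u] by blast
    qed
  qed
qed

end
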